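(* Let $A_{\Theta_1}\xrightarrow{\varphi_1}A_{\Theta_2}\xrightarrow{\varphi_2}\cdots$ be a unital toric inductive system, where each $\Theta_n\in M_{m_n}(\mathbb R)$ is nondegenerate skew-symmetric and $\varphi_n=\varphi_{M_n,z_n}$ is a monomial toric homomorphism with $M_n\in M_{m_{n+1}\times m_n}(\mathbb Z)$, $z_n\in\mathbb T^{m_n}$. Let $(F_n,S_n,J_n)_{n\ge1}$ be a compatible Fourier-multiplier structure, put $A_n:=A_{\Theta_n}$, $H_n:=L^2(A_{\Theta_n},\tau_{\Theta_n})\otimes S_n$, $D_n:=D_{F_n}$, and assume $\varphi_n(A_{\Theta_n}^\infty(D_n))\subseteq A_{\Theta_{n+1}}^\infty(D_{n+1})$ for every $n$. Assume in addition that $S_n=S$ and $J_n=\mathrm{Id}_S$ for every $n$. Then the formula $F_\infty([x,n]):=F_n(x)$ defines a selfadjoint matrix-valued function $F_\infty\colon G_\infty:=\varinjlim(\mathbb Z^{m_n},M_n)\to\mathrm{End}(S)_{\mathrm{sa}}$, where $[x,n]\in G_\infty$ is the class of $x\in\mathbb Z^{m_n}$. If moreover (a) for every $R>0$ the vector space $\bigoplus_{g\in G_\infty,\ \mathrm{Spec}(F_\infty(g))\cap[-R,R]\ne\varnothing}S$ is finite-dimensional, and (b) for every $h\in G_\infty$, $\sup_{g\in G_\infty}\|F_\infty(g+h)-F_\infty(g)\|<\infty$, then the inductive realization $(A_{\mathrm{pro}},H_{\mathrm{pro}},D_{\mathrm{pro}})$ of the system $\{(A_n,H_n,D_n),(\varphi_n,I_n)\}$,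 where $I_n(\Lambda_n(a)\otimes\xi)=\Lambda_{n+1}(\varphi_n(a))\otimes J_n\xi$, is a spectral triple on the $C^*$-algebra $A_{\mathrm{pro}}=\varinjlim(A_n,\varphi_n)$.
   Context: $A_\Theta$ ($\Theta\in M_m(\mathbb R)$ skew-symmetric, $m\ge2$) is the universal unital $C^*$-algebra generated by unitaries $U_1,\dots,U_m$ with $U_kU_j=e^{2\pi i\Theta_{j,k}}U_jU_k$; $U^x:=U_1^{x_1}\cdots U_m^{x_m}$. $\Theta$ is nondegenerate if the only $x\in\mathbb Z^m$ with $\exp(2\pi i\langle x,\Theta y\rangle)=1$ for all $y\in\mathbb Z^m$ is $x=0$; then $A_\Theta$ is simple with unique tracial state $\tau_\Theta$. A monomial toric homomorphism $\varphi_{M,z}\colon A_\Theta\to A_\Psi$ ($M\in M_{n\times m}(\mathbb Z)$, $z\in\mathbb T^m$, $\Theta-M^t\Psi M\in M_m(\mathbb Z)$) is the unital $*$-homomorphism $U_j\mapsto z_jV_1^{M_{1j}}\cdots V_n^{M_{nj}}$. $L^2(A_\Theta,\tau_\Theta)\cong\ell^2(\mathbb Z^m)$ is the GNS space, $\delta_x$ the vector of $U^x$; $\Lambda_n$ is the GNS map of $A_n$; $\pi_n$ is left multiplication of $A_n$ on $H_n$. For $F\colon\mathbb Z^m\to\mathrm{End}(S)_{\mathrm{sa}}$ with $S$ a finite-dimensional Hilbert space, $D_F$ is the selfadjoint operator with $D_F(\delta_x\otimes\xi)=\delta_x\otimes F(x)\xi$ and its maximal (diagonal) domain. A compatible Fourier-multiplier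 structure $(F_n,S_n,J_n)$: finite-dimensional Hilbert spaces $S_n$, isometries $J_n\colon S_n\to S_{n+1}$, functions $F_n\colon\mathbb Z^{m_n}\to\mathrm{End}(S_n)_{\mathrm{sa}}$ such that for each $n$: for every $R>0$, $\bigoplus_{x:\ \mathrm{Spec}(F_n(x))\cap[-R,R]\ne\varnothing}S_n$ is finite-dimensional; for every $a\in\mathbb Z^{m_n}$, $\sup_x\|F_n(x+a)-F_n(x)\|<\infty$; and $F_{n+1}(M_nx)J_n=J_nF_n(x)$ for all $x\in\mathbb Z^{m_n}$. A spectral triple $(A,H,D)$ on a unital $C^*$-algebra $A$: a faithful unital representation $\pi\colon A\to\mathcal B(H)$ and a selfadjoint $D$ with compact resolvent such that $A^\infty(D):=\{a\in A:[D,\pi(a)]\text{ is densely defined and extends to a bounded operator}\}$ is dense in $A$. Under these hypotheses each $I_n$ is an isometry $H_n\to H_{n+1}$ with $I_n\pi_n(a)=\pi_{n+1}(\varphi_n(a))I_n$, $I_n\mathrm{Dom}(D_n)\subseteq\mathrm{Dom}(D_{n+1})$ and $D_{n+1}I_n=I_nD_n$ on $\mathrm{Dom}(D_n)$. The inductive realization is $A_{\mathrm{pro}}:=\varinjlim(A_n,\varphi_n)$, $H_{\mathrm{pro}}:=\varinjlim(H_n,I_n)$ (Hilbert-space inductive limit with canonical isometries $I_{n,\infty}\colon H_n\to H_{\mathrm{pro}}$), with the representation of $A_{\mathrm{pro}}$ on $H_{\mathrm{pro}}$ induced by the $\pi_n$, and $D_{\mathrm{pro}}$ the closure of the operator $I_{n,\infty}\xi\mapsto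 I_{n,\infty}D_n\xi$ ($\xi\in\mathrm{Dom}(D_n)$) defined on $\bigcup_nI_{n,\infty}(\mathrm{Dom}(D_n))$. *)

theory Defs
  imports "Jordan_Normal_Form.VS_Connect" "HOL-Analysis.Abstract_Metric_Spaces"
begin

section \<open>Hilbert spaces and operators\<close>

text \<open>
  Hilbert spaces and C*-algebras are carrier-based complex vector spaces, so that a sequence of
  different ones can be quantified over. As for modules, the record fields \<open>mult\<close> and
  \<open>one\<close> of a Hilbert space are irrelevant. Inner products are conjugate-linear in the
  first argument.
\<close>

abbreviation linear_maps ::
  "(complex, 'v, 'c) module_scheme \<Rightarrow> (complex, 'w, 'd) module_scheme \<Rightarrow> ('v \<Rightarrow> 'w) set" where
  "linear_maps V W \<equiv> LinearCombinations.module_hom class_ring V W"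

record 'h hilbert = "(complex, 'h) module" +
  inner :: "'h \<Rightarrow> 'h \<Rightarrow> complex"

definition hnorm :: "('h, 'c) hilbert_scheme \<Rightarrow> 'h \<Rightarrow> real" where
  "hnorm H v = sqrt (Re (inner H v v))"

text \<open>The locale \<open>Metric_space\<close> requires symmetry and nonnegativity off the carrier as well.\<close>
definition hdist :: "('h, 'c) hilbert_scheme \<Rightarrow> 'h \<Rightarrow> 'h \<Rightarrow> real" where
  "hdist H v w =
    (if v \<in> carrier H \<and> w \<in> carrier H then hnorm H (v \<ominus>\<^bsub>H\<^esub> w) else 0)"

definition htop :: "('h, 'c) hilbert_scheme \<Rightarrow> 'h topology" where
  "htop H = Metric_space.mtopology (carrier H) (hdist H)"

locale hilbert_space =
  fixes H :: "('h, 'c) hilbert_scheme" (structure)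
  assumes vectorspace: "vectorspace class_ring H"
    and inner_commute: "v \<in> carrier H \<Longrightarrow> w \<in> carrier H \<Longrightarrow> inner H v w = cnj (inner H w v)"
    and inner_add: "u \<in> carrier H \<Longrightarrow> v \<in> carrier H \<Longrightarrow> w \<in> carrier H \<Longrightarrow>
      inner H u (v \<oplus> w) = inner H u v + inner H u w"
    and inner_smult: "v \<in> carrier H \<Longrightarrow> w \<in> carrier H \<Longrightarrow>
      inner H v (c \<odot>\<^bsub>H\<^esub> w) = c * inner H v w"
    and inner_nonneg: "v \<in> carrier H \<Longrightarrow> 0 \<le> Re (inner H v v)"
    and inner_definite: "v \<in> carrier H \<Longrightarrow> inner H v v = 0 \<Longrightarrow> v = \<zero>"
    and complete: "Metric_space.mcomplete (carrier H) (hdist H)"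

definition isometries :: "('h, 'c) hilbert_scheme \<Rightarrow> ('k, 'd) hilbert_scheme \<Rightarrow> ('h \<Rightarrow> 'k) set" where
  "isometries H K =
    {T \<in> linear_maps H K. \<forall>v\<in>carrier H. hnorm K (T v) = hnorm H v}"

definition bounded_ops :: "('h, 'c) hilbert_scheme \<Rightarrow> ('k, 'd) hilbert_scheme \<Rightarrow> ('h \<Rightarrow> 'k) set" where
  "bounded_ops H K =
    {T \<in> linear_maps H K. \<exists>C. \<forall>v\<in>carrier H. hnorm K (T v) \<le> C * hnorm H v}"

definition compact_ops :: "('h, 'c) hilbert_scheme \<Rightarrow> ('k, 'd) hilbert_scheme \<Rightarrow> ('h \<Rightarrow> 'k) set" where
  "compact_ops H K =
    {T \<in> bounded_ops H K.
      compactin (htop K) (htop K closure_of (T ` {v \<in> carrier H. hnorm H v \<le> 1}))}"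

definition opnorm :: "('h, 'c) hilbert_scheme \<Rightarrow> ('h \<Rightarrow> 'h) \<Rightarrow> real" where
  "opnorm H T = (SUP v\<in>{v \<in> carrier H. hnorm H v \<le> 1}. hnorm H (T v))"

text \<open>
  For a bounded operator on a Hilbert space, bijectivity of \<open>T - z\<close> already gives a bounded
  inverse. Only used for endomorphisms of finite-dimensional spaces.
\<close>
definition spectrum :: "('h, 'c) hilbert_scheme \<Rightarrow> ('h \<Rightarrow> 'h) \<Rightarrow> complex set" where
  "spectrum H T =
    {z. \<not> bij_betw (\<lambda>v. T v \<ominus>\<^bsub>H\<^esub> z \<odot>\<^bsub>H\<^esub> v) (carrier H) (carrier H)}"

text \<open>
  The selfadjoint part of End(S) for finite-dimensional S. Its elements are extensional functions,
  so that HOL equality of functions is equality of operators.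
\<close>
definition End_sa :: "('s, 'c) hilbert_scheme \<Rightarrow> ('s \<Rightarrow> 's) set" where
  "End_sa S =
    {T \<in> linear_maps S S \<inter> extensional (carrier S).
      \<forall>v\<in>carrier S. \<forall>w\<in>carrier S. inner S (T v) w = inner S v (T w)}"

text \<open>The external algebraic direct sum of copies of S indexed by X.\<close>
definition direct_power :: "'i set \<Rightarrow> ('s, 'c) hilbert_scheme \<Rightarrow> (complex, 'i \<Rightarrow> 's) module" where
  "direct_power X S =
    \<lparr>carrier = {f \<in> X \<rightarrow>\<^sub>E carrier S. finite {x \<in> X. f x \<noteq> \<zero>\<^bsub>S\<^esub>}},
     mult = undefined, one = undefined,
     zero = (\<lambda>x\<in>X. \<zero>\<^bsub>S\<^esub>), add = (\<lambda>f g. \<lambda>x\<in>X. f x \<oplus>\<^bsub>S\<^esub> g x),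
     smult = (\<lambda>c f. \<lambda>x\<in>X. c \<odot>\<^bsub>S\<^esub> f x)\<rparr>"

definition hilbert_tensor ::
  "'l hilbert \<Rightarrow> 's hilbert \<Rightarrow> 'h hilbert \<Rightarrow> ('l \<Rightarrow> 's \<Rightarrow> 'h) \<Rightarrow> bool" where
  "hilbert_tensor L S H tens \<longleftrightarrow>
    hilbert_space L \<and> hilbert_space S \<and> hilbert_space H \<and>
    (\<forall>s\<in>carrier S. (\<lambda>l. tens l s) \<in> linear_maps L H) \<and>
    (\<forall>l\<in>carrier L. tens l \<in> linear_maps S H) \<and>
    (\<forall>l\<in>carrier L. \<forall>l'\<in>carrier L. \<forall>s\<in>carrier S. \<forall>s'\<in>carrier S.
      inner H (tens l s) (tens l' s') = inner L l l' * inner S s s') \<and>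
    htop H closure_of
      LinearCombinations.module.span class_ring H {tens l s | l s. l \<in> carrier L \<and> s \<in> carrier S}
      = carrier H"

text \<open>Hilbert-space inductive limit: the completion of the algebraic limit, up to isomorphism.\<close>
definition hilbert_inductive_limit ::
  "(nat \<Rightarrow> 'h hilbert) \<Rightarrow> (nat \<Rightarrow> 'h \<Rightarrow> 'h) \<Rightarrow> 'k hilbert \<Rightarrow> (nat \<Rightarrow> 'h \<Rightarrow> 'k) \<Rightarrow> bool" where
  "hilbert_inductive_limit H I K J \<longleftrightarrow>
    hilbert_space K \<and> (\<forall>n. J n \<in> isometries (H n) K) \<and>
    (\<forall>n. \<forall>v\<in>carrier (H n). J (Suc n) (I n v) = J n v) \<and>
    htop K closure_of (\<Union>n. J n ` carrier (H n)) = carrier K"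

section \<open>Unbounded operators\<close>

text \<open>Unbounded operators on H are represented by their graphs.\<close>

definition adjoint_graph :: "('h, 'c) hilbert_scheme \<Rightarrow> ('h \<times> 'h) set \<Rightarrow> ('h \<times> 'h) set" where
  "adjoint_graph H D =
    {(v, w) \<in> carrier H \<times> carrier H. \<forall>(x, y)\<in>D. inner H y v = inner H x w}"

text \<open>Linearity of D is automatic here, since adjoint graphs are linear subspaces.\<close>
definition selfadjoint_op :: "('h, 'c) hilbert_scheme \<Rightarrow> ('h \<times> 'h) set \<Rightarrow> bool" where
  "selfadjoint_op H D \<longleftrightarrow>
    single_valued D \<and> htop H closure_of Domain D = carrier H \<and> adjoint_graph H D = D"

definition graph_closure :: "('h, 'c) hilbert_scheme \<Rightarrow> ('h \<times> 'h) set \<Rightarrow> ('h \<times> 'h) set" where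
  "graph_closure H D = prod_topology (htop H) (htop H) closure_of D"

text \<open>\<open>is_resolvent H D z R\<close>: the operator \<open>R\<close> is the bounded everywhere defined inverse of \<open>D - z\<close>.\<close>
definition is_resolvent ::
  "('h, 'c) hilbert_scheme \<Rightarrow> ('h \<times> 'h) set \<Rightarrow> complex \<Rightarrow> ('h \<Rightarrow> 'h) \<Rightarrow> bool" where
  "is_resolvent H D z R \<longleftrightarrow>
    R \<in> bounded_ops H H \<and>
    (\<forall>v\<in>carrier H. \<exists>w. (R v, w) \<in> D \<and> w \<ominus>\<^bsub>H\<^esub> z \<odot>\<^bsub>H\<^esub> R v = v) \<and>
    (\<forall>(v, w)\<in>D. R (w \<ominus>\<^bsub>H\<^esub> z \<odot>\<^bsub>H\<^esub> v) = v)"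

definition compact_resolvent :: "('h, 'c) hilbert_scheme \<Rightarrow> ('h \<times> 'h) set \<Rightarrow> bool" where
  "compact_resolvent H D \<longleftrightarrow>
    (\<exists>z R. is_resolvent H D z R) \<and>
    (\<forall>z R. is_resolvent H D z R \<longrightarrow> R \<in> compact_ops H H)"

text \<open>The graph of \<open>[D, T]\<close>, with domain \<open>{v \<in> Dom D. T v \<in> Dom D}\<close>.\<close>
definition commutator_graph ::
  "('h, 'c) hilbert_scheme \<Rightarrow> ('h \<times> 'h) set \<Rightarrow> ('h \<Rightarrow> 'h) \<Rightarrow> ('h \<times> 'h) set" where
  "commutator_graph H D T = {(v, y \<ominus>\<^bsub>H\<^esub> T w) | v w y. (v, w) \<in> D \<and> (T v, y) \<in> D}"

section \<open>C*-algebras\<close>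

record 'a cstar = "(complex, 'a) module" +
  star :: "'a \<Rightarrow> 'a"
  cnorm :: "'a \<Rightarrow> real"

definition cdist :: "('a, 'c) cstar_scheme \<Rightarrow> 'a \<Rightarrow> 'a \<Rightarrow> real" where
  "cdist A a b =
    (if a \<in> carrier A \<and> b \<in> carrier A then cnorm A (a \<ominus>\<^bsub>A\<^esub> b) else 0)"

definition ctop :: "('a, 'c) cstar_scheme \<Rightarrow> 'a topology" where
  "ctop A = Metric_space.mtopology (carrier A) (cdist A)"

locale unital_cstar_algebra =
  fixes A :: "('a, 'c) cstar_scheme" (structure)
  assumes ring: "ring A"
    and vectorspace: "vectorspace class_ring A"
    and smult_mult_left: "a \<in> carrier A \<Longrightarrow> b \<in> carrier A \<Longrightarrow>
      (c \<odot>\<^bsub>A\<^esub> a) \<otimes> b = c \<odot>\<^bsub>A\<^esub> (a \<otimes> b)"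
    and smult_mult_right: "a \<in> carrier A \<Longrightarrow> b \<in> carrier A \<Longrightarrow>
      a \<otimes> (c \<odot>\<^bsub>A\<^esub> b) = c \<odot>\<^bsub>A\<^esub> (a \<otimes> b)"
    and one_not_zero: "\<one> \<noteq> \<zero>"
    and star_closed: "a \<in> carrier A \<Longrightarrow> star A a \<in> carrier A"
    and star_star: "a \<in> carrier A \<Longrightarrow> star A (star A a) = a"
    and star_add: "a \<in> carrier A \<Longrightarrow> b \<in> carrier A \<Longrightarrow>
      star A (a \<oplus> b) = star A a \<oplus> star A b"
    and star_smult: "a \<in> carrier A \<Longrightarrow> star A (c \<odot>\<^bsub>A\<^esub> a) = cnj c \<odot>\<^bsub>A\<^esub> star A a"
    and star_mult: "a \<in> carrier A \<Longrightarrow> b \<in> carrier A \<Longrightarrow>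
      star A (a \<otimes> b) = star A b \<otimes> star A a"
    and norm_nonneg: "a \<in> carrier A \<Longrightarrow> 0 \<le> cnorm A a"
    and norm_definite: "a \<in> carrier A \<Longrightarrow> cnorm A a = 0 \<longleftrightarrow> a = \<zero>"
    and norm_triangle: "a \<in> carrier A \<Longrightarrow> b \<in> carrier A \<Longrightarrow>
      cnorm A (a \<oplus> b) \<le> cnorm A a + cnorm A b"
    and norm_smult: "a \<in> carrier A \<Longrightarrow> cnorm A (c \<odot>\<^bsub>A\<^esub> a) = cmod c * cnorm A a"
    and norm_mult: "a \<in> carrier A \<Longrightarrow> b \<in> carrier A \<Longrightarrow>
      cnorm A (a \<otimes> b) \<le> cnorm A a * cnorm A b"
    and cstar_identity: "a \<in> carrier A \<Longrightarrow> cnorm A (star A a \<otimes> a) = (cnorm A a)\<^sup>2"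
    and complete: "Metric_space.mcomplete (carrier A) (cdist A)"

definition unital_star_hom :: "'a cstar \<Rightarrow> 'b cstar \<Rightarrow> ('a \<Rightarrow> 'b) set" where
  "unital_star_hom A B =
    {f \<in> Ring.ring_hom A B \<inter> linear_maps A B.
      \<forall>a\<in>carrier A. f (star A a) = star B (f a)}"

definition unitaries :: "'a cstar \<Rightarrow> 'a set" where
  "unitaries A =
    {u \<in> carrier A. star A u \<otimes>\<^bsub>A\<^esub> u = \<one>\<^bsub>A\<^esub> \<and> u \<otimes>\<^bsub>A\<^esub> star A u = \<one>\<^bsub>A\<^esub>}"

definition tracial_state :: "'a cstar \<Rightarrow> ('a \<Rightarrow> complex) \<Rightarrow> bool" where
  "tracial_state A \<tau> \<longleftrightarrow>
    (\<forall>a\<in>carrier A. \<forall>b\<in>carrier A. \<tau> (a \<oplus>\<^bsub>A\<^esub> b) = \<tau> a + \<tau> b) \<and>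
    (\<forall>c. \<forall>a\<in>carrier A. \<tau> (c \<odot>\<^bsub>A\<^esub> a) = c * \<tau> a) \<and>
    (\<forall>a\<in>carrier A. \<tau> (star A a \<otimes>\<^bsub>A\<^esub> a) \<in> \<real> \<and> 0 \<le> Re (\<tau> (star A a \<otimes>\<^bsub>A\<^esub> a))) \<and>
    (\<forall>a\<in>carrier A. cmod (\<tau> a) \<le> cnorm A a) \<and>
    \<tau> \<one>\<^bsub>A\<^esub> = 1 \<and>
    (\<forall>a\<in>carrier A. \<forall>b\<in>carrier A. \<tau> (a \<otimes>\<^bsub>A\<^esub> b) = \<tau> (b \<otimes>\<^bsub>A\<^esub> a))"

text \<open>The GNS space L of \<open>\<tau>\<close> with its GNS map \<open>\<Lambda>\<close>; this determines the pair up to unitary equivalence.\<close>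
definition gns_space :: "'a cstar \<Rightarrow> ('a \<Rightarrow> complex) \<Rightarrow> 'l hilbert \<Rightarrow> ('a \<Rightarrow> 'l) \<Rightarrow> bool" where
  "gns_space A \<tau> L \<Lambda> \<longleftrightarrow>
    hilbert_space L \<and> \<Lambda> \<in> linear_maps A L \<and>
    (\<forall>a\<in>carrier A. \<forall>b\<in>carrier A. inner L (\<Lambda> a) (\<Lambda> b) = \<tau> (star A a \<otimes>\<^bsub>A\<^esub> b)) \<and>
    htop L closure_of (\<Lambda> ` carrier A) = carrier L"

definition unital_representation :: "'a cstar \<Rightarrow> 'h hilbert \<Rightarrow> ('a \<Rightarrow> 'h \<Rightarrow> 'h) \<Rightarrow> bool" where
  "unital_representation A H \<pi> \<longleftrightarrow>
    (\<forall>a\<in>carrier A. \<pi> a \<in> bounded_ops H H) \<and>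
    (\<forall>v\<in>carrier H.
      \<pi> \<one>\<^bsub>A\<^esub> v = v \<and>
      (\<forall>a\<in>carrier A. \<forall>b\<in>carrier A.
        \<pi> (a \<oplus>\<^bsub>A\<^esub> b) v = \<pi> a v \<oplus>\<^bsub>H\<^esub> \<pi> b v \<and> \<pi> (a \<otimes>\<^bsub>A\<^esub> b) v = \<pi> a (\<pi> b v)) \<and>
      (\<forall>c. \<forall>a\<in>carrier A. \<pi> (c \<odot>\<^bsub>A\<^esub> a) v = c \<odot>\<^bsub>H\<^esub> \<pi> a v) \<and>
      (\<forall>a\<in>carrier A. \<forall>w\<in>carrier H. inner H (\<pi> (star A a) v) w = inner H v (\<pi> a w)))"

definition faithful :: "'a cstar \<Rightarrow> 'h hilbert \<Rightarrow> ('a \<Rightarrow> 'h \<Rightarrow> 'h) \<Rightarrow> bool" where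
  "faithful A H \<pi> \<longleftrightarrow>
    (\<forall>a\<in>carrier A. (\<forall>v\<in>carrier H. \<pi> a v = \<zero>\<^bsub>H\<^esub>) \<longrightarrow> a = \<zero>\<^bsub>A\<^esub>)"

text \<open>The subalgebra of a for which \<open>[D, \<pi>(a)]\<close> is densely defined and extends to a bounded operator.\<close>
definition smooth_part ::
  "'a cstar \<Rightarrow> 'h hilbert \<Rightarrow> ('a \<Rightarrow> 'h \<Rightarrow> 'h) \<Rightarrow> ('h \<times> 'h) set \<Rightarrow> 'a set" where
  "smooth_part A H \<pi> D =
    {a \<in> carrier A.
      htop H closure_of Domain (commutator_graph H D (\<pi> a)) = carrier H \<and>
      (\<exists>B\<in>bounded_ops H H. \<forall>(v, w)\<in>commutator_graph H D (\<pi> a). B v = w)}"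

definition spectral_triple ::
  "'a cstar \<Rightarrow> 'h hilbert \<Rightarrow> ('a \<Rightarrow> 'h \<Rightarrow> 'h) \<Rightarrow> ('h \<times> 'h) set \<Rightarrow> bool" where
  "spectral_triple A H \<pi> D \<longleftrightarrow>
    unital_cstar_algebra A \<and> hilbert_space H \<and>
    unital_representation A H \<pi> \<and> faithful A H \<pi> \<and>
    selfadjoint_op H D \<and> compact_resolvent H D \<and>
    ctop A closure_of smooth_part A H \<pi> D = carrier A"

text \<open>\<open>chain f n k\<close> is the connecting map from stage n to stage n + k.\<close>
fun chain :: "(nat \<Rightarrow> 'x \<Rightarrow> 'x) \<Rightarrow> nat \<Rightarrow> nat \<Rightarrow> 'x \<Rightarrow> 'x" where
  "chain f n 0 x = x"
| "chain f n (Suc k) x = f (n + k) (chain f n k x)"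

text \<open>
  C*-algebraic inductive limit: up to isomorphism, the (separated) completion of the algebraic limit
  in the norm that maps the class of \<open>a \<in> A\<^sub>n\<close> to the limit of the norms of its images.
\<close>
definition cstar_inductive_limit ::
  "(nat \<Rightarrow> 'a cstar) \<Rightarrow> (nat \<Rightarrow> 'a \<Rightarrow> 'a) \<Rightarrow> 'b cstar \<Rightarrow> (nat \<Rightarrow> 'a \<Rightarrow> 'b) \<Rightarrow> bool" where
  "cstar_inductive_limit A \<phi> B \<mu> \<longleftrightarrow>
    unital_cstar_algebra B \<and> (\<forall>n. \<mu> n \<in> unital_star_hom (A n) B) \<and>
    (\<forall>n. \<forall>a\<in>carrier (A n). \<mu> (Suc n) (\<phi> n a) = \<mu> n a) \<and>
    (\<forall>n. \<forall>a\<in>carrier (A n).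
      (\<lambda>k. cnorm (A (n + k)) (chain \<phi> n k a)) \<longlonglongrightarrow> cnorm B (\<mu> n a)) \<and>
    ctop B closure_of (\<Union>n. \<mu> n ` carrier (A n)) = carrier B"

section \<open>Noncommutative tori\<close>

definition skew_symmetric :: "nat \<Rightarrow> real mat \<Rightarrow> bool" where
  "skew_symmetric m \<Theta> \<longleftrightarrow> \<Theta> \<in> carrier_mat m m \<and> transpose_mat \<Theta> = - \<Theta>"

definition nondegenerate :: "nat \<Rightarrow> real mat \<Rightarrow> bool" where
  "nondegenerate m \<Theta> \<longleftrightarrow>
    (\<forall>x\<in>carrier_vec m :: int Matrix.vec set.
      (\<forall>y\<in>carrier_vec m :: int Matrix.vec set.
        exp (2 * complex_of_real pi * \<i> *
          complex_of_real (scalar_prod (map_vec real_of_int x) (\<Theta> *\<^sub>v map_vec real_of_int y))) = 1)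
      \<longrightarrow> x = 0\<^sub>v m)"

definition torus_relations :: "nat \<Rightarrow> real mat \<Rightarrow> 'a cstar \<Rightarrow> (nat \<Rightarrow> 'a) \<Rightarrow> bool" where
  "torus_relations m \<Theta> A U \<longleftrightarrow>
    (\<forall>j<m. U j \<in> unitaries A) \<and>
    (\<forall>j<m. \<forall>k<m. U k \<otimes>\<^bsub>A\<^esub> U j =
      exp (2 * complex_of_real pi * \<i> * complex_of_real (\<Theta> $$ (j, k))) \<odot>\<^bsub>A\<^esub> (U j \<otimes>\<^bsub>A\<^esub> U k))"

definition generated_by :: "'a cstar \<Rightarrow> 'a set \<Rightarrow> bool" where
  "generated_by A X \<longleftrightarrow>
    (\<forall>B. X \<subseteq> B \<and> \<one>\<^bsub>A\<^esub> \<in> B \<and> VectorSpace.subspace class_ring B A \<and>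
      (\<forall>a\<in>B. star A a \<in> B) \<and> (\<forall>a\<in>B. \<forall>b\<in>B. a \<otimes>\<^bsub>A\<^esub> b \<in> B) \<and> closedin (ctop A) B
      \<longrightarrow> B = carrier A)"

text \<open>
  A with \<open>U\<close> is the universal unital C*-algebra of the torus relations. The universal property
  quantifies over C*-algebras B on the type of A only, which loses nothing: \<open>A\<close> is nonzero, so this
  type has at least continuum many elements, whereas a C*-subalgebra generated by finitely many
  elements has at most that many and hence has a copy on this type. Uniqueness of the homomorphism
  f follows from the generation condition.
\<close>
definition nc_torus :: "nat \<Rightarrow> real mat \<Rightarrow> 'a cstar \<Rightarrow> (nat \<Rightarrow> 'a) \<Rightarrow> bool" where
  "nc_torus m \<Theta> A U \<longleftrightarrow>
    unital_cstar_algebra A \<and> torus_relations m \<Theta> A U \<and> generated_by A (U ` {..<m}) \<and>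
    (\<forall>(B :: 'a cstar) V. unital_cstar_algebra B \<and> torus_relations m \<Theta> B V \<longrightarrow>
      (\<exists>f\<in>unital_star_hom A B. \<forall>j<m. f (U j) = V j))"

definition monomial :: "'a cstar \<Rightarrow> nat \<Rightarrow> (nat \<Rightarrow> 'a) \<Rightarrow> int Matrix.vec \<Rightarrow> 'a" where
  "monomial A m U x = foldr (\<lambda>j a. (U j [^]\<^bsub>A\<^esub> (x $ j)) \<otimes>\<^bsub>A\<^esub> a) [0..<m] \<one>\<^bsub>A\<^esub>"

definition monomial_toric_hom ::
  "nat \<Rightarrow> real mat \<Rightarrow> 'a cstar \<Rightarrow> (nat \<Rightarrow> 'a) \<Rightarrow> nat \<Rightarrow> real mat \<Rightarrow> 'b cstar \<Rightarrow> (nat \<Rightarrow> 'b) \<Rightarrow>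
    int mat \<Rightarrow> complex Matrix.vec \<Rightarrow> ('a \<Rightarrow> 'b) \<Rightarrow> bool" where
  "monomial_toric_hom m \<Theta> A U n \<Psi> B V M z \<phi> \<longleftrightarrow>
    M \<in> carrier_mat n m \<and> z \<in> carrier_vec m \<and> (\<forall>j<m. cmod (z $ j) = 1) \<and>
    elements_mat
      (\<Theta> - transpose_mat (map_mat real_of_int M) * \<Psi> * map_mat real_of_int M) \<subseteq> \<int> \<and>
    \<phi> \<in> unital_star_hom A B \<and>
    (\<forall>j<m. \<phi> (U j) = (z $ j) \<odot>\<^bsub>B\<^esub> monomial B n V (col M j))"

section \<open>Fourier multipliers\<close>

definition low_spectrum_set ::
  "('i \<Rightarrow> 's \<Rightarrow> 's) \<Rightarrow> 's hilbert \<Rightarrow> 'i set \<Rightarrow> real \<Rightarrow> 'i set" where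
  "low_spectrum_set F S X R =
    {x \<in> X. spectrum S (F x) \<inter> complex_of_real ` {-R..R} \<noteq> {}}"

text \<open>
  The Fourier multiplier operator. Here \<open>e x \<xi>\<close> stands for \<open>\<delta>\<^sub>x \<otimes> \<xi>\<close>, and the two conditions on s
  say that s and \<open>F x s\<close> are the components at x of v and w. So v is in the domain iff the family of
  the \<open>F x s\<close> is again square summable, i.e. iff it has a representing vector w in H.
\<close>
definition multiplier_op ::
  "int Matrix.vec set \<Rightarrow> (int Matrix.vec \<Rightarrow> 's \<Rightarrow> 's) \<Rightarrow> 's hilbert \<Rightarrow> 'h hilbert \<Rightarrow> (int Matrix.vec \<Rightarrow> 's \<Rightarrow> 'h) \<Rightarrow>
    ('h \<times> 'h) set" where
  "multiplier_op X F S H e =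
    {(v, w) \<in> carrier H \<times> carrier H. \<forall>x\<in>X. \<exists>s\<in>carrier S.
      (\<forall>\<xi>\<in>carrier S. inner H (e x \<xi>) v = inner S \<xi> s) \<and>
      (\<forall>\<xi>\<in>carrier S. inner H (e x \<xi>) w = inner S \<xi> (F x s))}"

definition compatible_multipliers ::
  "(nat \<Rightarrow> nat) \<Rightarrow> (nat \<Rightarrow> int mat) \<Rightarrow> (nat \<Rightarrow> int Matrix.vec \<Rightarrow> 's \<Rightarrow> 's) \<Rightarrow> (nat \<Rightarrow> 's hilbert) \<Rightarrow>
    (nat \<Rightarrow> 's \<Rightarrow> 's) \<Rightarrow> bool" where
  "compatible_multipliers m M F S J \<longleftrightarrow>
    (\<forall>n.
      hilbert_space (S n) \<and> vectorspace.fin_dim class_ring (S n) \<and>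
      J n \<in> isometries (S n) (S (Suc n)) \<and>
      (\<forall>x\<in>carrier_vec (m n). F n x \<in> End_sa (S n)) \<and>
      (\<forall>R>0. vectorspace.fin_dim class_ring
        (direct_power (low_spectrum_set (F n) (S n) (carrier_vec (m n)) R) (S n))) \<and>
      (\<forall>a\<in>carrier_vec (m n). bdd_above
        ((\<lambda>x. opnorm (S n) (\<lambda>v. F n (x + a) v \<ominus>\<^bsub>S n\<^esub> F n x v)) ` carrier_vec (m n))) \<and>
      (\<forall>x\<in>carrier_vec (m n). \<forall>v\<in>carrier (S n). F (Suc n) (M n *\<^sub>v x) (J n v) = J n (F n x v)))"

section \<open>The inductive limit of the lattices\<close>

definition lattice_pairs :: "(nat \<Rightarrow> nat) \<Rightarrow> (nat \<times> int Matrix.vec) set" where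
  "lattice_pairs m = (SIGMA n:UNIV. carrier_vec (m n))"

definition lattice_rel ::
  "(nat \<Rightarrow> nat) \<Rightarrow> (nat \<Rightarrow> int mat) \<Rightarrow> ((nat \<times> int Matrix.vec) \<times> (nat \<times> int Matrix.vec)) set" where
  "lattice_rel m M =
    {((n, x), (k, y)). (n, x) \<in> lattice_pairs m \<and> (k, y) \<in> lattice_pairs m \<and>
      (\<exists>l. l \<ge> n \<and> l \<ge> k \<and>
        chain (\<lambda>i v. M i *\<^sub>v v) n (l - n) x = chain (\<lambda>i v. M i *\<^sub>v v) k (l - k) y)}"

definition lattice_class ::
  "(nat \<Rightarrow> nat) \<Rightarrow> (nat \<Rightarrow> int mat) \<Rightarrow> nat \<Rightarrow> int Matrix.vec \<Rightarrow> (nat \<times> int Matrix.vec) set" where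
  "lattice_class m M n x = lattice_rel m M `` {(n, x)}"

definition lattice_limit ::
  "(nat \<Rightarrow> nat) \<Rightarrow> (nat \<Rightarrow> int mat) \<Rightarrow> (nat \<times> int Matrix.vec) set set" where
  "lattice_limit m M = lattice_pairs m // lattice_rel m M"

text \<open>
  Addition of classes: representatives at a common stage are added there. All classes in the union
  coincide.
\<close>
definition lattice_add ::
  "(nat \<Rightarrow> nat) \<Rightarrow> (nat \<Rightarrow> int mat) \<Rightarrow> (nat \<times> int Matrix.vec) set \<Rightarrow> (nat \<times> int Matrix.vec) set \<Rightarrow>
    (nat \<times> int Matrix.vec) set" where
  "lattice_add m M g h = \<Union>{lattice_class m M n (x + y) | n x y. (n, x) \<in> g \<and> (n, y) \<in> h}"

definition is_limit_multiplier ::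
  "(nat \<Rightarrow> nat) \<Rightarrow> (nat \<Rightarrow> int mat) \<Rightarrow> (nat \<Rightarrow> int Matrix.vec \<Rightarrow> 's \<Rightarrow> 's) \<Rightarrow> 's hilbert \<Rightarrow>
    ((nat \<times> int Matrix.vec) set \<Rightarrow> 's \<Rightarrow> 's) \<Rightarrow> bool" where
  "is_limit_multiplier m M F S Finf \<longleftrightarrow>
    Finf \<in> lattice_limit m M \<rightarrow>\<^sub>E End_sa S \<and>
    (\<forall>n. \<forall>x\<in>carrier_vec (m n). Finf (lattice_class m M n x) = F n x)"

section \<open>The inductive realization\<close>

text \<open>The representation of the limit algebra induced by the \<open>\<pi>\<^sub>n\<close>.\<close>
definition induced_representation ::
  "(nat \<Rightarrow> 'a cstar) \<Rightarrow> (nat \<Rightarrow> 'h hilbert) \<Rightarrow> (nat \<Rightarrow> 'a \<Rightarrow> 'h \<Rightarrow> 'h) \<Rightarrow>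
    'b cstar \<Rightarrow> (nat \<Rightarrow> 'a \<Rightarrow> 'b) \<Rightarrow> 'k hilbert \<Rightarrow> (nat \<Rightarrow> 'h \<Rightarrow> 'k) \<Rightarrow> ('b \<Rightarrow> 'k \<Rightarrow> 'k) \<Rightarrow> bool" where
  "induced_representation A H \<pi> B \<mu> K J \<rho> \<longleftrightarrow>
    unital_representation B K \<rho> \<and>
    (\<forall>n. \<forall>a\<in>carrier (A n). \<forall>v\<in>carrier (H n). \<rho> (\<mu> n a) (J n v) = J n (\<pi> n a v))"

definition inductive_dirac ::
  "(nat \<Rightarrow> ('h \<times> 'h) set) \<Rightarrow> 'k hilbert \<Rightarrow> (nat \<Rightarrow> 'h \<Rightarrow> 'k) \<Rightarrow> ('k \<times> 'k) set" where
  "inductive_dirac D K J = graph_closure K (\<Union>n. {(J n v, J n w) | v w. (v, w) \<in> D n})"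

end

theory Submission
  imports Defs
begin

text \<open>
  Write \<open>\<delta>\<^sub>x \<otimes> \<xi>\<close> for the standard vectors at a stage. Toric maps send monomials to monomials up to a phase,
  so the image of \<open>\<delta>\<^sub>x \<otimes> \<xi>\<close> in the limit space depends, up to a phase independent of \<open>\<xi>\<close>, only on the
  class of x in the limit lattice. Nondegeneracy makes the trace vanish on nontrivial monomials, hence
  these images are orthogonal blocks, one copy of S for each class, and the limit Dirac operator is
  block diagonal with blocks \<open>F\<^sub>\<infinity>(g)\<close>: it is selfadjoint, (a) gives the compact resolvent, and by (b)
  the commutators with monomials, which permute the blocks up to phases, are bounded.
  Faithfulness of the limit representation needs isometric representations at the stages. These come
  neither from universality nor from simplicity but from polynomial growth of the lattice: on the
  monomials in a box of radius r the C*-norm is at most \<open>(2r+1)\<^sup>m\<close> times the \<open>L\<^sup>2\<close>-norm, and the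
  factor disappears on passing to high powers of \<open>a\<^sup>* a\<close>.
\<close>

section \<open>Normed spaces on carriers\<close>

text \<open>The norm on \<open>Apro\<close> is a limit of C*-norms at the stages, while the
  representation on \<open>Hpro\<close> only controls operator norms; faithfulness needs the two to
  agree at every stage. The two inequalities have different sources: representations are contractive
  by a Neumann series, and an operator bound controls the C*-norm by the growth argument. Together
  they also make the connecting maps contractive and allow the limit representation to be built by
  multiplying approximating sequences stage by stage. The limit Dirac operator is the closure of a
  union of graphs, not a maximal operator. The two coincide because finitely many classes of the
  limit lattice have representatives at one stage, so that each finite truncation of a vector in the
  maximal domain comes from a stage operator. Nontriviality of S enters twice: only then do
  operators on the tensor product detect the algebra, and only then does a finite-dimensional direct
  sum of copies of S have a finite index set. Commutators are handled together with invariance of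
  the domain, since the domain of the commutator with a sum could otherwise shrink.\<close>

definition ndist :: "(complex, 'v, 'c) module_scheme \<Rightarrow> ('v \<Rightarrow> real) \<Rightarrow> 'v \<Rightarrow> 'v \<Rightarrow> real" where
  "ndist V N v w = (if v \<in> carrier V \<and> w \<in> carrier V then N (v \<ominus>\<^bsub>V\<^esub> w) else 0)"

lemma hdist_eq_ndist: "hdist H = ndist H (hnorm H)"
  by (intro ext) (simp add: hdist_def ndist_def)

lemma cdist_eq_ndist: "cdist A = ndist A (cnorm A)"
  by (intro ext) (simp add: cdist_def ndist_def)

text \<open>Common ground of Hilbert norms and C*-norms, so that limits, density arguments and total
  boundedness are developed once for both.\<close>

locale cnormed =
  fixes V :: "(complex, 'v, 'c) module_scheme" (structure) and N :: "'v \<Rightarrow> real"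
  assumes vs: "vectorspace class_ring V"
    and nrm_nonneg: "v \<in> carrier V \<Longrightarrow> 0 \<le> N v"
    and nrm_definite: "v \<in> carrier V \<Longrightarrow> N v = 0 \<Longrightarrow> v = \<zero>"
    and nrm_triangle: "v \<in> carrier V \<Longrightarrow> w \<in> carrier V \<Longrightarrow> N (v \<oplus> w) \<le> N v + N w"
    and nrm_smult: "v \<in> carrier V \<Longrightarrow> N (c \<odot>\<^bsub>V\<^esub> v) = cmod c * N v"
begin

lemma mod: "Module.module class_ring V"
  using vs by (simp add: vectorspace_def)

sublocale abelian_group V
  using mod by (rule Module.module.axioms(2))

lemma sm_closed [simp, intro]: "v \<in> carrier V \<Longrightarrow> c \<odot>\<^bsub>V\<^esub> v \<in> carrier V"
  using Module.module.smult_closed[OF mod] by simp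

lemma sm_ladd: "v \<in> carrier V \<Longrightarrow> (c + d) \<odot>\<^bsub>V\<^esub> v = c \<odot>\<^bsub>V\<^esub> v \<oplus> d \<odot>\<^bsub>V\<^esub> v"
  using Module.module.smult_l_distr[OF mod] by simp

lemma sm_radd: "v \<in> carrier V \<Longrightarrow> w \<in> carrier V \<Longrightarrow> c \<odot>\<^bsub>V\<^esub> (v \<oplus> w) = c \<odot>\<^bsub>V\<^esub> v \<oplus> c \<odot>\<^bsub>V\<^esub> w"
  using Module.module.smult_r_distr[OF mod] by simp

lemma sm_sm [simp]: "v \<in> carrier V \<Longrightarrow> c \<odot>\<^bsub>V\<^esub> (d \<odot>\<^bsub>V\<^esub> v) = (c * d) \<odot>\<^bsub>V\<^esub> v"
  using Module.module.smult_assoc1[OF mod] by simp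

lemma sm_one [simp]: "v \<in> carrier V \<Longrightarrow> 1 \<odot>\<^bsub>V\<^esub> v = v"
  using Module.module.smult_one[OF mod] by simp

lemma sm_zero_left [simp]: assumes "v \<in> carrier V" shows "0 \<odot>\<^bsub>V\<^esub> v = \<zero>"
proof -
  have "0 \<odot>\<^bsub>V\<^esub> v \<oplus> 0 \<odot>\<^bsub>V\<^esub> v = 0 \<odot>\<^bsub>V\<^esub> v"
    using sm_ladd[of v 0 0] assms by simp
  then show ?thesis using assms by simp
qed

lemma sm_zero_right [simp]: "c \<odot>\<^bsub>V\<^esub> \<zero> = \<zero>"
  using sm_sm[of \<zero> c 0] by simp

lemma uminus_sm: assumes "v \<in> carrier V" shows "\<ominus> v = (-1) \<odot>\<^bsub>V\<^esub> v"
proof (rule minus_equality)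
  have "(-1) \<odot>\<^bsub>V\<^esub> v \<oplus> 1 \<odot>\<^bsub>V\<^esub> v = \<zero>"
    using assms by (subst sm_ladd[symmetric]) auto
  then show "(-1) \<odot>\<^bsub>V\<^esub> v \<oplus> v = \<zero>" using assms by simp
qed (use assms in auto)

lemma minus_sm: "v \<in> carrier V \<Longrightarrow> w \<in> carrier V \<Longrightarrow> v \<ominus> w = v \<oplus> (-1) \<odot>\<^bsub>V\<^esub> w"
  by (simp add: a_minus_def uminus_sm)

lemma sm_minus: "v \<in> carrier V \<Longrightarrow> w \<in> carrier V \<Longrightarrow> c \<odot>\<^bsub>V\<^esub> (v \<ominus> w) = c \<odot>\<^bsub>V\<^esub> v \<ominus> c \<odot>\<^bsub>V\<^esub> w"
  by (simp add: minus_sm sm_radd)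

lemma sm_lminus: "v \<in> carrier V \<Longrightarrow> (c - d) \<odot>\<^bsub>V\<^esub> v = c \<odot>\<^bsub>V\<^esub> v \<ominus> d \<odot>\<^bsub>V\<^esub> v"
  using sm_ladd[of v c "-d"] by (simp add: minus_sm)

lemma add_diff_diff: "a \<in> carrier V \<Longrightarrow> b \<in> carrier V \<Longrightarrow> c \<in> carrier V \<Longrightarrow> d \<in> carrier V \<Longrightarrow>
   (a \<oplus> b) \<ominus> (c \<oplus> d) = (a \<ominus> c) \<oplus> (b \<ominus> d)"
  by (simp add: minus_sm sm_radd a_ac)

lemma diff_diff_diff: "a \<in> carrier V \<Longrightarrow> b \<in> carrier V \<Longrightarrow> c \<in> carrier V \<Longrightarrow> d \<in> carrier V \<Longrightarrow>
   (a \<ominus> b) \<ominus> (c \<ominus> d) = (a \<ominus> c) \<ominus> (b \<ominus> d)"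
  by (simp add: minus_sm sm_radd a_ac)

lemma add_diff: assumes "a \<in> carrier V" "b \<in> carrier V" shows "b \<oplus> (a \<ominus> b) = a"
proof -
  have "b \<oplus> (a \<ominus> b) = a \<oplus> (b \<oplus> \<ominus> b)" using assms by (simp add: a_minus_def a_lcomm)
  then show ?thesis using assms by (simp add: r_neg)
qed

lemma add_diff2: assumes "a \<in> carrier V" "b \<in> carrier V" shows "(a \<oplus> b) \<ominus> a = b"
proof -
  have "(a \<oplus> b) \<ominus> a = b \<oplus> (a \<oplus> \<ominus> a)" using assms by (simp add: a_minus_def a_ac)
  then show ?thesis using assms by (simp add: r_neg)
qed

lemma diff_trans: assumes "a \<in> carrier V" "b \<in> carrier V" "c \<in> carrier V"
  shows "a \<ominus> c = (a \<ominus> b) \<oplus> (b \<ominus> c)"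
proof -
  have "(a \<ominus> b) \<oplus> (b \<ominus> c) = (b \<oplus> (a \<ominus> b)) \<ominus> c" using assms by (simp add: a_minus_def a_ac)
  then show ?thesis using assms by (simp add: add_diff)
qed

lemma minus_self [simp]: "a \<in> carrier V \<Longrightarrow> a \<ominus> a = \<zero>"
  by (simp add: a_minus_def r_neg)

lemma minus_eq_zero: "a \<in> carrier V \<Longrightarrow> b \<in> carrier V \<Longrightarrow> a \<ominus> b = \<zero> \<Longrightarrow> a = b"
  using add_diff[of a b] by simp

lemma nrm_minus_eq_zero: assumes "a \<in> carrier V" "b \<in> carrier V" "N (a \<ominus> b) = 0" shows "a = b"
  by (rule minus_eq_zero[OF assms(1,2) nrm_definite[OF _ assms(3)]]) (use assms in simp)

lemma nrm_zero [simp]: "N \<zero> = 0"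
  using nrm_smult[of \<zero> 0] by simp

lemma nrm_uminus: "v \<in> carrier V \<Longrightarrow> N (\<ominus> v) = N v"
  by (simp add: uminus_sm nrm_smult)

lemma nrm_minus: "v \<in> carrier V \<Longrightarrow> w \<in> carrier V \<Longrightarrow> N (v \<ominus> w) \<le> N v + N w"
  using nrm_triangle[of v "\<ominus> w"] by (simp add: a_minus_def nrm_uminus)

lemma nrm_minus_commute: "v \<in> carrier V \<Longrightarrow> w \<in> carrier V \<Longrightarrow> N (v \<ominus> w) = N (w \<ominus> v)"
proof -
  assume a: "v \<in> carrier V" "w \<in> carrier V"
  have "w \<ominus> v = \<ominus> (v \<ominus> w)"
    using a by (simp add: a_minus_def minus_add a_comm)
  then show ?thesis using a by (simp add: nrm_uminus)
qed

lemma nrm_diff_triangle: "a \<in> carrier V \<Longrightarrow> b \<in> carrier V \<Longrightarrow> c \<in> carrier V \<Longrightarrow>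
   N (a \<ominus> c) \<le> N (a \<ominus> b) + N (b \<ominus> c)"
  using nrm_triangle[of "a \<ominus> b" "b \<ominus> c"] by (simp add: diff_trans[of a b c])

lemma nrm_le_diff: "a \<in> carrier V \<Longrightarrow> b \<in> carrier V \<Longrightarrow> N a \<le> N b + N (a \<ominus> b)"
  using nrm_triangle[of b "a \<ominus> b"] by (simp add: add_diff)

lemma abs_nrm_diff: "a \<in> carrier V \<Longrightarrow> b \<in> carrier V \<Longrightarrow> \<bar>N a - N b\<bar> \<le> N (a \<ominus> b)"
  using nrm_le_diff[of a b] nrm_le_diff[of b a] nrm_minus_commute[of a b] by linarith

sublocale met: Metric_space "carrier V" "ndist V N"
proof
  fix x y
  show "0 \<le> ndist V N x y" by (simp add: ndist_def nrm_nonneg)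
  show "ndist V N x y = ndist V N y x"
    using nrm_minus_commute[of x y] unfolding ndist_def by presburger
  assume xy: "x \<in> carrier V" "y \<in> carrier V"
  show "(ndist V N x y = 0) = (x = y)"
  proof
    assume "ndist V N x y = 0"
    then have "N (x \<ominus> y) = 0" using xy by (simp add: ndist_def)
    then show "x = y" by (rule nrm_minus_eq_zero[OF xy])
  next
    assume "x = y"
    then show "ndist V N x y = 0" using xy by (simp add: ndist_def)
  qed
  fix z assume "z \<in> carrier V"
  then show "ndist V N x z \<le> ndist V N x y + ndist V N y z"
    using xy nrm_diff_triangle[of x y z] unfolding ndist_def by presburger
qed

lemma closure_iff:
  "v \<in> met.mtopology closure_of X \<longleftrightarrow>
     v \<in> carrier V \<and> (\<forall>e>0. \<exists>x\<in>X. x \<in> carrier V \<and> N (v \<ominus> x) < e)"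
proof -
  have "v \<in> met.mtopology closure_of X \<longleftrightarrow> v \<in> carrier V \<and> (\<forall>e>0. \<exists>x\<in>X. x \<in> met.mball v e)"
    unfolding met.metric_closure_of by simp
  also have "\<dots> \<longleftrightarrow> v \<in> carrier V \<and> (\<forall>e>0. \<exists>x\<in>X. x \<in> carrier V \<and> N (v \<ominus> x) < e)"
    by (intro conj_cong refl all_cong bex_cong) (auto simp: ndist_def)
  finally show ?thesis .
qed

lemma dense_iff:
  "met.mtopology closure_of X = carrier V \<longleftrightarrow>
     (\<forall>v\<in>carrier V. \<forall>e>0. \<exists>x\<in>X. x \<in> carrier V \<and> N (v \<ominus> x) < e)"
proof -
  have "met.mtopology closure_of X \<subseteq> carrier V"
    using closure_of_subset_topspace[of met.mtopology X] by simp
  then have "met.mtopology closure_of X = carrier V \<longleftrightarrow> (\<forall>v\<in>carrier V. v \<in> met.mtopology closure_of X)"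
    by blast
  then show ?thesis unfolding closure_iff by simp
qed

text \<open>Membership of the limit and of all terms is built in, which spares later limit arguments
  separate carrier hypotheses.\<close>

definition conv :: "(nat \<Rightarrow> 'v) \<Rightarrow> 'v \<Rightarrow> bool" where
  "conv x l \<longleftrightarrow> l \<in> carrier V \<and> (\<forall>n. x n \<in> carrier V) \<and> (\<lambda>n. N (x n \<ominus> l)) \<longlonglongrightarrow> 0"

lemma conv_const: "l \<in> carrier V \<Longrightarrow> conv (\<lambda>_. l) l"
  by (simp add: conv_def)

lemma conv_unique: assumes "conv x l" "conv x l'" shows "l = l'"
proof -
  have c: "l \<in> carrier V" "l' \<in> carrier V" "\<And>n. x n \<in> carrier V" using assms by (auto simp: conv_def)
  have "(\<lambda>n. N (x n \<ominus> l) + N (x n \<ominus> l')) \<longlonglongrightarrow> 0 + 0"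
    using assms by (intro tendsto_add) (auto simp: conv_def)
  moreover have "N (l \<ominus> l') \<le> N (x n \<ominus> l) + N (x n \<ominus> l')" for n
    using nrm_diff_triangle[of l "x n" l'] c nrm_minus_commute[of l "x n"] by auto
  ultimately have "N (l \<ominus> l') \<le> 0"
    by (intro tendsto_lowerbound[where F=sequentially and f="\<lambda>n. N (x n \<ominus> l) + N (x n \<ominus> l')"]) auto
  then have "N (l \<ominus> l') = 0" using nrm_nonneg[of "l \<ominus> l'"] c by auto
  then show ?thesis by (rule nrm_minus_eq_zero[OF c(1,2)])
qed

lemma conv_squeeze:
  assumes "\<And>n. x n \<in> carrier V" "l \<in> carrier V" "\<And>n. N (x n \<ominus> l) \<le> f n" "f \<longlonglongrightarrow> 0"
  shows "conv x l"
  unfolding conv_def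
proof (intro conjI allI)
  show "(\<lambda>n. N (x n \<ominus> l)) \<longlonglongrightarrow> 0"
    using assms by (intro tendsto_sandwich[OF _ _ tendsto_const[of 0] assms(4)]) (auto simp: nrm_nonneg)
qed (use assms in auto)

lemma conv_add: assumes "conv x l" "conv y k" shows "conv (\<lambda>n. x n \<oplus> y n) (l \<oplus> k)"
proof (rule conv_squeeze)
  have c: "l \<in> carrier V" "k \<in> carrier V" "\<And>n. x n \<in> carrier V" "\<And>n. y n \<in> carrier V"
    using assms by (auto simp: conv_def)
  then show "x n \<oplus> y n \<in> carrier V" "l \<oplus> k \<in> carrier V" for n by auto
  show "N ((x n \<oplus> y n) \<ominus> (l \<oplus> k)) \<le> N (x n \<ominus> l) + N (y n \<ominus> k)" for n
    using c by (simp add: add_diff_diff nrm_triangle)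
  have "(\<lambda>n. N (x n \<ominus> l) + N (y n \<ominus> k)) \<longlonglongrightarrow> 0 + 0"
    using assms by (intro tendsto_add) (auto simp: conv_def)
  then show "(\<lambda>n. N (x n \<ominus> l) + N (y n \<ominus> k)) \<longlonglongrightarrow> 0" by simp
qed

lemma conv_smult: assumes "conv x l" shows "conv (\<lambda>n. c \<odot>\<^bsub>V\<^esub> x n) (c \<odot>\<^bsub>V\<^esub> l)"
proof (rule conv_squeeze)
  have c: "l \<in> carrier V" "\<And>n. x n \<in> carrier V"
    using assms by (auto simp: conv_def)
  then show "c \<odot>\<^bsub>V\<^esub> x n \<in> carrier V" "c \<odot>\<^bsub>V\<^esub> l \<in> carrier V" for n by auto
  show "N (c \<odot>\<^bsub>V\<^esub> x n \<ominus> c \<odot>\<^bsub>V\<^esub> l) \<le> cmod c * N (x n \<ominus> l)" for n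
    using c by (simp add: sm_minus[symmetric] nrm_smult)
  have "(\<lambda>n. cmod c * N (x n \<ominus> l)) \<longlonglongrightarrow> cmod c * 0"
    using assms by (intro tendsto_mult) (auto simp: conv_def)
  then show "(\<lambda>n. cmod c * N (x n \<ominus> l)) \<longlonglongrightarrow> 0" by simp
qed

lemma conv_minus: assumes "conv x l" "conv y k" shows "conv (\<lambda>n. x n \<ominus> y n) (l \<ominus> k)"
proof -
  have c: "l \<in> carrier V" "k \<in> carrier V" "\<And>n. x n \<in> carrier V" "\<And>n. y n \<in> carrier V"
    using assms by (auto simp: conv_def)
  show ?thesis using conv_add[OF assms(1) conv_smult[OF assms(2), of "-1"]] c by (simp add: minus_sm)
qed

lemma conv_nrm: assumes "conv x l" shows "(\<lambda>n. N (x n)) \<longlonglongrightarrow> N l"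
proof -
  have c: "l \<in> carrier V" "\<And>n. x n \<in> carrier V" "(\<lambda>n. N (x n \<ominus> l)) \<longlonglongrightarrow> 0"
    using assms by (auto simp: conv_def)
  have "(\<lambda>n. N (x n) - N l) \<longlonglongrightarrow> 0"
    by (rule Lim_null_comparison[OF _ c(3)])
      (use c abs_nrm_diff in \<open>auto intro!: always_eventually\<close>)
  then show ?thesis by (simp add: LIM_zero_iff)
qed

lemma conv_limit_le: assumes "conv x l" "\<And>n. N (x n) \<le> f n" "f \<longlonglongrightarrow> c" shows "N l \<le> c"
  using LIMSEQ_le[OF conv_nrm[OF assms(1)] assms(3)] assms(2) by auto

lemma complete_conv:
  assumes "met.mcomplete" "\<And>n. x n \<in> carrier V"
    and "\<And>e. e > 0 \<Longrightarrow> \<exists>K. \<forall>m\<ge>K. \<forall>n\<ge>K. N (x m \<ominus> x n) < e"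
  obtains l where "conv x l"
proof -
  have "met.MCauchy x"
    unfolding met.MCauchy_def using assms(2,3) by (auto simp: ndist_def)
  then obtain l where l: "limitin met.mtopology x l sequentially"
    using assms(1) met.mcomplete_def by blast
  then have "conv x l"
    unfolding met.limitin_metric_dist_null conv_def using assms(2) by (auto simp: ndist_def)
  then show thesis using that by blast
qed

text \<open>The vehicle of all density arguments: an identity that is continuous in v is written as
  the vanishing of a bounded seminorm at v, and then it only has to be checked on a set with dense
  span. Nonnegativity is a consequence.\<close>

definition bseminorm :: "('v \<Rightarrow> real) \<Rightarrow> bool" where
  "bseminorm p \<longleftrightarrow> (\<forall>x\<in>carrier V. \<forall>y\<in>carrier V. p (x \<oplus> y) \<le> p x + p y) \<and>
     (\<forall>x\<in>carrier V. \<forall>c. p (c \<odot>\<^bsub>V\<^esub> x) = cmod c * p x) \<and> (\<exists>C. \<forall>x\<in>carrier V. p x \<le> C * N x)"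

lemma bseminormD:
  assumes "bseminorm p"
  shows "x \<in> carrier V \<Longrightarrow> y \<in> carrier V \<Longrightarrow> p (x \<oplus> y) \<le> p x + p y"
    "x \<in> carrier V \<Longrightarrow> p (c \<odot>\<^bsub>V\<^esub> x) = cmod c * p x"
    "\<exists>C. \<forall>x\<in>carrier V. p x \<le> C * N x"
  using assms by (simp_all add: bseminorm_def)

text \<open>Homogeneity gives \<open>p 0 = 0\<close> and \<open>p (-x) = p x\<close>, so
  subadditivity yields \<open>0 \<le> 2 * p x\<close>.\<close>

lemma bseminorm_nonneg: assumes "bseminorm p" "x \<in> carrier V" shows "0 \<le> p x"
proof -
  have "p (x \<oplus> (-1) \<odot>\<^bsub>V\<^esub> x) \<le> p x + p ((-1) \<odot>\<^bsub>V\<^esub> x)"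
    using assms by (intro bseminormD(1)[OF assms(1)]) simp_all
  moreover have "p ((-1) \<odot>\<^bsub>V\<^esub> x) = p x" "p (0 \<odot>\<^bsub>V\<^esub> x) = 0"
    using assms(2) by (simp_all add: bseminormD(2)[OF assms(1)] del: sm_zero_left)
  moreover have "x \<oplus> (-1) \<odot>\<^bsub>V\<^esub> x = 0 \<odot>\<^bsub>V\<^esub> x"
    using assms sm_ladd[of x 1 "-1"] by simp
  ultimately show ?thesis by simp
qed

lemma submoduleI:
  assumes "W \<subseteq> carrier V" "\<zero> \<in> W" "\<And>x y. x \<in> W \<Longrightarrow> y \<in> W \<Longrightarrow> x \<oplus> y \<in> W"
    "\<And>c x. x \<in> W \<Longrightarrow> c \<odot>\<^bsub>V\<^esub> x \<in> W"
  shows "LinearCombinations.submodule class_ring W V"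
  by (rule LinearCombinations.submodule.intro) (simp_all add: mod assms)

lemma bseminorm_kernel: assumes "bseminorm p"
  shows "LinearCombinations.submodule class_ring {v \<in> carrier V. p v = 0} V"
proof (rule submoduleI)
  have "p (0 \<odot>\<^bsub>V\<^esub> \<zero>) = cmod 0 * p \<zero>" by (rule bseminormD(2)[OF assms zero_closed])
  then show "\<zero> \<in> {v \<in> carrier V. p v = 0}" by simp
  fix x y assume "x \<in> {v \<in> carrier V. p v = 0}" "y \<in> {v \<in> carrier V. p v = 0}"
  moreover from this have "p (x \<oplus> y) \<le> p x + p y" by (intro bseminormD(1)[OF assms]) simp_all
  ultimately show "x \<oplus> y \<in> {v \<in> carrier V. p v = 0}"
    using bseminorm_nonneg[OF assms, of "x \<oplus> y"] by auto
next
  fix c x assume "x \<in> {v \<in> carrier V. p v = 0}"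
  then show "c \<odot>\<^bsub>V\<^esub> x \<in> {v \<in> carrier V. p v = 0}" by (simp add: bseminormD(2)[OF assms])
qed auto

lemma bseminorm_zero_closure:
  assumes p: "bseminorm p" and "\<And>x. x \<in> X \<Longrightarrow> x \<in> carrier V \<Longrightarrow> p x = 0" and v: "v \<in> met.mtopology closure_of X"
  shows "p v = 0"
proof -
  obtain C where C: "\<And>x. x \<in> carrier V \<Longrightarrow> p x \<le> C * N x" using bseminormD(3)[OF p] by auto
  have vc: "v \<in> carrier V" using v by (simp add: closure_iff)
  have "p v \<le> 0"
  proof (rule field_le_epsilon)
    fix e :: real assume "e > 0"
    \<comment> \<open>The constant C may be zero or negative; \<open>\<bar>C\<bar> + 1\<close> is a
      positive bound that can be divided by.\<close>
    then have "e / (\<bar>C\<bar> + 1) > 0" by (simp add: add_nonneg_pos)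
    then obtain x where x: "x \<in> X" "x \<in> carrier V" "N (v \<ominus> x) < e / (\<bar>C\<bar> + 1)"
      using v unfolding closure_iff by meson
    have "p v = p (x \<oplus> (v \<ominus> x))" using x vc by (simp add: add_diff)
    also have "\<dots> \<le> p x + p (v \<ominus> x)" using bseminormD(1)[OF p] x vc by auto
    also have "\<dots> \<le> C * N (v \<ominus> x)" using C[of "v \<ominus> x"] assms(2) x vc by auto
    also have "\<dots> \<le> (\<bar>C\<bar> + 1) * N (v \<ominus> x)"
      using nrm_nonneg[of "v \<ominus> x"] x vc by (intro mult_right_mono) auto
    also have "\<dots> \<le> e" using x(3) by (simp add: field_simps)
    finally show "p v \<le> 0 + e" by simp
  qed
  then show ?thesis using bseminorm_nonneg[OF p vc] by simp
qed

lemma bseminorm_zero_span: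
  assumes "bseminorm p" "X \<subseteq> carrier V" "\<And>x. x \<in> X \<Longrightarrow> p x = 0"
    and "x \<in> LinearCombinations.module.span class_ring V X"
  shows "x \<in> carrier V \<and> p x = 0"
proof -
  have "X \<subseteq> {v \<in> carrier V. p v = 0}" using assms by auto
  then have "LinearCombinations.module.span class_ring V X \<subseteq> {v \<in> carrier V. p v = 0}"
    by (rule module.span_is_subset[OF mod _ bseminorm_kernel[OF assms(1)]])
  then show ?thesis using assms(4) by auto
qed

lemma bseminorm_zero:
  assumes "bseminorm p" "X \<subseteq> carrier V" "\<And>x. x \<in> X \<Longrightarrow> p x = 0"
    and "met.mtopology closure_of (LinearCombinations.module.span class_ring V X) = carrier V" "v \<in> carrier V"
  shows "p v = 0"
  by (rule bseminorm_zero_closure[OF assms(1), where X="LinearCombinations.module.span class_ring V X"])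
     (use bseminorm_zero_span[OF assms(1,2,3)] assms(4,5) in auto)

end

section \<open>Linear maps between normed spaces\<close>

lemma linear_mapsD:
  assumes "T \<in> linear_maps V W"
  shows "v \<in> carrier V \<Longrightarrow> T v \<in> carrier W"
    "v \<in> carrier V \<Longrightarrow> w \<in> carrier V \<Longrightarrow> T (v \<oplus>\<^bsub>V\<^esub> w) = T v \<oplus>\<^bsub>W\<^esub> T w"
    "v \<in> carrier V \<Longrightarrow> T (c \<odot>\<^bsub>V\<^esub> v) = c \<odot>\<^bsub>W\<^esub> T v"
  using assms unfolding LinearCombinations.module_hom_def by auto

lemma linear_mapsI:
  assumes "\<And>v. v \<in> carrier V \<Longrightarrow> T v \<in> carrier W"
    "\<And>v w. v \<in> carrier V \<Longrightarrow> w \<in> carrier V \<Longrightarrow> T (v \<oplus>\<^bsub>V\<^esub> w) = T v \<oplus>\<^bsub>W\<^esub> T w"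
    "\<And>c v. v \<in> carrier V \<Longrightarrow> T (c \<odot>\<^bsub>V\<^esub> v) = c \<odot>\<^bsub>W\<^esub> T v"
  shows "T \<in> linear_maps V W"
  using assms unfolding LinearCombinations.module_hom_def by auto

lemma linear_maps_zero: 
  assumes "cnormed V N" "cnormed W N'" "T \<in> linear_maps V W" shows "T \<zero>\<^bsub>V\<^esub> = \<zero>\<^bsub>W\<^esub>"
proof -
  interpret V: cnormed V N by fact
  interpret W: cnormed W N' by fact
  show ?thesis using linear_mapsD(3)[OF assms(3), of "\<zero>\<^bsub>V\<^esub>" 0] linear_mapsD(1)[OF assms(3)] by simp
qed

lemma linear_maps_minus: 
  assumes "cnormed V N" "cnormed W N'" "T \<in> linear_maps V W" "v \<in> carrier V" "w \<in> carrier V"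
  shows "T (v \<ominus>\<^bsub>V\<^esub> w) = T v \<ominus>\<^bsub>W\<^esub> T w"
proof -
  interpret V: cnormed V N by fact
  interpret W: cnormed W N' by fact
  show ?thesis using linear_mapsD[OF assms(3)] assms(4,5) by (simp add: V.minus_sm W.minus_sm)
qed

lemma bseminorm_linear:
  assumes "cnormed V N" "cnormed W N'" "T \<in> linear_maps V W" "\<And>v. v \<in> carrier V \<Longrightarrow> N' (T v) \<le> C * N v"
  shows "cnormed.bseminorm V N (\<lambda>v. N' (T v))"
proof -
  interpret V: cnormed V N by fact
  interpret W: cnormed W N' by fact
  show ?thesis unfolding V.bseminorm_def
  proof (intro conjI ballI allI)
    show "\<exists>C. \<forall>x\<in>carrier V. N' (T x) \<le> C * N x" using assms(4) by blast
  qed (use linear_mapsD[OF assms(3)] in \<open>simp_all add: W.nrm_triangle W.nrm_smult\<close>)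
qed

lemma linear_maps_diff:
  assumes "cnormed W N'" "T \<in> linear_maps V W" "T' \<in> linear_maps V W"
  shows "(\<lambda>v. T v \<ominus>\<^bsub>W\<^esub> T' v) \<in> linear_maps V W"
proof -
  interpret W: cnormed W N' by fact
  show ?thesis using linear_mapsD[OF assms(2)] linear_mapsD[OF assms(3)]
    by (intro linear_mapsI) (auto simp: W.add_diff_diff W.sm_minus)
qed

lemma conv_linear:
  assumes V: "cnormed V N" and W: "cnormed W N'" and T: "T \<in> linear_maps V W"
    and C: "\<And>v. v \<in> carrier V \<Longrightarrow> N' (T v) \<le> C * N v" and x: "cnormed.conv V N x l"
  shows "cnormed.conv W N' (\<lambda>n. T (x n)) (T l)"
proof -
  interpret V: cnormed V N by (rule V)
  interpret W: cnormed W N' by (rule W)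
  have l: "l \<in> carrier V" and xn: "\<And>n. x n \<in> carrier V" and lim: "(\<lambda>n. N (x n \<ominus>\<^bsub>V\<^esub> l)) \<longlonglongrightarrow> 0"
    using x unfolding V.conv_def by blast+
  show ?thesis
  proof (rule W.conv_squeeze)
    show "N' (T (x n) \<ominus>\<^bsub>W\<^esub> T l) \<le> C * N (x n \<ominus>\<^bsub>V\<^esub> l)" for n
      unfolding linear_maps_minus[OF V W T xn[of n] l, symmetric]
      by (rule C) (rule V.minus_closed[OF xn l])
    show "(\<lambda>n. C * N (x n \<ominus>\<^bsub>V\<^esub> l)) \<longlonglongrightarrow> 0"
      by (rule tendsto_mult_right_zero[OF lim])
    show "T (x n) \<in> carrier W" "T l \<in> carrier W" for n
      by (rule linear_mapsD(1)[OF T xn], rule linear_mapsD(1)[OF T l])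
  qed
qed

section \<open>Hilbert spaces\<close>

context hilbert_space
begin

lemma H_mod: "Module.module class_ring H"
  using vectorspace by (simp add: vectorspace_def)

interpretation H: abelian_group H
  by (rule Module.module.axioms(2)[OF H_mod])

lemma H_closed: "u \<in> carrier H \<Longrightarrow> v \<in> carrier H \<Longrightarrow> u \<oplus> v \<in> carrier H"
  "u \<in> carrier H \<Longrightarrow> c \<odot>\<^bsub>H\<^esub> u \<in> carrier H" "\<zero> \<in> carrier H"
  using Module.module.smult_closed[OF H_mod] by simp_all

lemma inner_add_left: "u \<in> carrier H \<Longrightarrow> v \<in> carrier H \<Longrightarrow> w \<in> carrier H \<Longrightarrow>
    inner H (u \<oplus> v) w = inner H u w + inner H v w"
  using inner_commute[of "u \<oplus> v" w] inner_commute[of u w] inner_commute[of v w] inner_add[of w u v] H_closed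
  by simp

lemma inner_smult_left: "v \<in> carrier H \<Longrightarrow> w \<in> carrier H \<Longrightarrow>
    inner H (c \<odot>\<^bsub>H\<^esub> v) w = cnj c * inner H v w"
  using inner_commute[of "c \<odot>\<^bsub>H\<^esub> v" w] inner_commute[of v w] inner_smult[of w v c] H_closed
  by simp

lemma inner_self_real: "v \<in> carrier H \<Longrightarrow> Im (inner H v v) = 0"
  using inner_commute[of v v] by (simp add: complex_eq_iff)

lemma hnorm_sq: "v \<in> carrier H \<Longrightarrow> (hnorm H v)\<^sup>2 = Re (inner H v v)"
  by (simp add: hnorm_def inner_nonneg)

lemma inner_self: "v \<in> carrier H \<Longrightarrow> inner H v v = complex_of_real ((hnorm H v)\<^sup>2)"
  by (simp add: hnorm_sq complex_eq_iff inner_self_real)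

lemma hnorm_nonneg: "v \<in> carrier H \<Longrightarrow> 0 \<le> hnorm H v"
  by (simp add: hnorm_def inner_nonneg)

lemma hnorm_add_sq:
  assumes "u \<in> carrier H" "v \<in> carrier H"
  shows "(hnorm H (u \<oplus> v))\<^sup>2 = (hnorm H u)\<^sup>2 + 2 * Re (inner H u v) + (hnorm H v)\<^sup>2"
proof -
  have "inner H (u \<oplus> v) (u \<oplus> v) = inner H u u + inner H u v + inner H v u + inner H v v"
    using assms H_closed by (simp add: inner_add inner_add_left)
  moreover have "Re (inner H v u) = Re (inner H u v)" using inner_commute[of v u] assms by simp
  ultimately show ?thesis using assms H_closed by (simp add: hnorm_sq)
qed

lemma hnorm_smult: assumes "v \<in> carrier H" shows "hnorm H (c \<odot>\<^bsub>H\<^esub> v) = cmod c * hnorm H v"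
proof -
  have "inner H (c \<odot>\<^bsub>H\<^esub> v) (c \<odot>\<^bsub>H\<^esub> v) = (c * cnj c) * inner H v v"
    using assms H_closed by (simp add: inner_smult inner_smult_left)
  also have "\<dots> = complex_of_real ((cmod c * hnorm H v)\<^sup>2)"
    using assms by (simp add: inner_self complex_mult_cnj cmod_power2 power_mult_distrib)
  finally have "(hnorm H (c \<odot>\<^bsub>H\<^esub> v))\<^sup>2 = (cmod c * hnorm H v)\<^sup>2"
    using assms H_closed by (simp add: hnorm_sq del: of_real_power of_real_mult)
  then show ?thesis
    using assms H_closed hnorm_nonneg by (simp add: power2_eq_iff_nonneg)
qed

lemma Cauchy_Schwarz:
  assumes "u \<in> carrier H" "v \<in> carrier H"
  shows "cmod (inner H u v) \<le> hnorm H u * hnorm H v"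
proof -
  define k where "k = inner H u v"
  \<comment> \<open>The squared norm of \<open>v - t * k * u\<close> with t real, so that the cross
    term is a real multiple of the squared modulus of k.\<close>
  have key: "0 \<le> t\<^sup>2 * (hnorm H u)\<^sup>2 * (cmod k)\<^sup>2 - 2 * t * (cmod k)\<^sup>2 + (hnorm H v)\<^sup>2" for t :: real
  proof -
    define c where "c = - (of_real t * k)"
    have "0 \<le> (hnorm H (c \<odot>\<^bsub>H\<^esub> u \<oplus> v))\<^sup>2" by simp
    also have "\<dots> = (cmod c * hnorm H u)\<^sup>2 + 2 * Re (cnj c * k) + (hnorm H v)\<^sup>2"
      using assms H_closed by (simp add: hnorm_add_sq hnorm_smult inner_smult_left k_def)
    also have "Re (cnj c * k) = - t * (cmod k)\<^sup>2"
    proof -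
      have "(cmod k)\<^sup>2 = Re k * Re k + Im k * Im k" unfolding cmod_power2 by (simp add: power2_eq_square)
      then show ?thesis by (simp add: c_def algebra_simps)
    qed
    also have "(cmod c * hnorm H u)\<^sup>2 = t\<^sup>2 * (hnorm H u)\<^sup>2 * (cmod k)\<^sup>2"
      by (simp add: c_def norm_mult power_mult_distrib)
    finally show ?thesis by simp
  qed
  have "(cmod k)\<^sup>2 \<le> (hnorm H u)\<^sup>2 * (hnorm H v)\<^sup>2"
  proof (cases "hnorm H u = 0")
    case True
    have "cmod k = 0"
    proof (rule ccontr)
      assume "cmod k \<noteq> 0"
      then have k: "(cmod k)\<^sup>2 > 0" by simp
      \<comment> \<open>When u has norm zero, \<open>key\<close> is affine in t with slope
        \<open>-2 * |k|^2\<close>; this value of t makes its right-hand side equal to -1.\<close>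
      have "2 * (((hnorm H v)\<^sup>2 + 1) / (2 * (cmod k)\<^sup>2)) * (cmod k)\<^sup>2 = (hnorm H v)\<^sup>2 + 1"
        using k by (simp add: field_simps)
      with key[of "((hnorm H v)\<^sup>2 + 1) / (2 * (cmod k)\<^sup>2)"] True show False by simp
    qed
    then show ?thesis by simp
  next
    case False
    define n where "n = (hnorm H u)\<^sup>2"
    have n: "n > 0" using False by (simp add: n_def)
    \<comment> \<open>The value \<open>t = 1/n\<close> minimizes the quadratic in
      \<open>key\<close>.\<close>
    have "0 \<le> (1/n)\<^sup>2 * n * (cmod k)\<^sup>2 - 2 * (1/n) * (cmod k)\<^sup>2 + (hnorm H v)\<^sup>2"
      using key[of "1/n"] by (simp add: n_def)
    then have "0 \<le> - (1/n) * (cmod k)\<^sup>2 + (hnorm H v)\<^sup>2"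
      using n by (simp add: power2_eq_square field_simps)
    then show ?thesis using n unfolding n_def[symmetric] by (simp add: field_simps)
  qed
  then have "(cmod k)\<^sup>2 \<le> (hnorm H u * hnorm H v)\<^sup>2" by (simp add: power_mult_distrib)
  then show ?thesis unfolding k_def
    by (rule power2_le_imp_le) (intro mult_nonneg_nonneg hnorm_nonneg assms)
qed

sublocale nrm: cnormed H "hnorm H"
proof (rule cnormed.intro)
  show "vectorspace class_ring H" by (rule vectorspace)
  fix v assume v: "v \<in> carrier H"
  show "0 \<le> hnorm H v" using v by (rule hnorm_nonneg)
  show "hnorm H v = 0 \<Longrightarrow> v = \<zero>" using v by (simp add: inner_definite inner_self)
  show "hnorm H (c \<odot>\<^bsub>H\<^esub> v) = cmod c * hnorm H v" for c using v by (rule hnorm_smult)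
  fix w assume w: "w \<in> carrier H"
  have "(hnorm H (v \<oplus> w))\<^sup>2 \<le> (hnorm H v + hnorm H w)\<^sup>2"
    using Cauchy_Schwarz[OF v w] complex_Re_le_cmod[of "inner H v w"]
    by (simp add: hnorm_add_sq[OF v w] power2_sum)
  then show "hnorm H (v \<oplus> w) \<le> hnorm H v + hnorm H w"
    by (rule power2_le_imp_le) (intro add_nonneg_nonneg hnorm_nonneg v w)
qed

lemma htop_eq: "htop H = nrm.met.mtopology"
  by (simp add: htop_def hdist_eq_ndist)

lemma mcompl: "nrm.met.mcomplete"
  using complete by (simp add: hdist_eq_ndist)

lemma inner_zero [simp]: assumes "v \<in> carrier H" shows "inner H v \<zero> = 0" "inner H \<zero> v = 0"
proof -
  have "inner H v (0 \<odot>\<^bsub>H\<^esub> v) = 0" "inner H (0 \<odot>\<^bsub>H\<^esub> v) v = 0"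
    using inner_smult[of v v 0] inner_smult_left[of v v 0] assms by simp_all
  then show "inner H v \<zero> = 0" "inner H \<zero> v = 0" using assms by simp_all
qed

lemma inner_minus: "u \<in> carrier H \<Longrightarrow> v \<in> carrier H \<Longrightarrow> w \<in> carrier H \<Longrightarrow>
      inner H u (v \<ominus> w) = inner H u v - inner H u w"
  by (simp add: nrm.minus_sm inner_add inner_smult H_closed)

lemma inner_minus_left: "u \<in> carrier H \<Longrightarrow> v \<in> carrier H \<Longrightarrow> w \<in> carrier H \<Longrightarrow>
      inner H (v \<ominus> w) u = inner H v u - inner H w u"
  by (simp add: nrm.minus_sm inner_add_left inner_smult_left H_closed)

lemma inner_eqI: assumes "u \<in> carrier H" "v \<in> carrier H" "\<And>w. w \<in> carrier H \<Longrightarrow> inner H w u = inner H w v"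
  shows "u = v"
proof -
  have "inner H (u \<ominus> v) (u \<ominus> v) = 0" using assms by (simp add: inner_minus)
  then show ?thesis using inner_definite[of "u \<ominus> v"] assms(1,2) by simp
qed

lemma inner_finsum: "finite X \<Longrightarrow> u \<in> carrier H \<Longrightarrow> (\<And>x. x \<in> X \<Longrightarrow> f x \<in> carrier H) \<Longrightarrow>
   inner H u (finsum H f X) = (\<Sum>x\<in>X. inner H u (f x))"
  by (induction X rule: finite_induct) (auto simp: inner_add Pi_def)

lemma inner_finsum_left: "finite X \<Longrightarrow> u \<in> carrier H \<Longrightarrow> (\<And>x. x \<in> X \<Longrightarrow> f x \<in> carrier H) \<Longrightarrow>
   inner H (finsum H f X) u = (\<Sum>x\<in>X. inner H (f x) u)"
  by (induction X rule: finite_induct) (auto simp: inner_add_left Pi_def)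

lemma hnorm_minus_sq:
  assumes "u \<in> carrier H" "v \<in> carrier H"
  shows "(hnorm H (u \<ominus> v))\<^sup>2 = (hnorm H u)\<^sup>2 - 2 * Re (inner H u v) + (hnorm H v)\<^sup>2"
  using hnorm_add_sq[of u "(-1) \<odot>\<^bsub>H\<^esub> v"] assms H_closed by (simp add: nrm.minus_sm inner_smult hnorm_smult)

lemma bseminorm_inner:
  assumes "u \<in> carrier H"
  shows "nrm.bseminorm (\<lambda>v. cmod (inner H u v))"
  unfolding nrm.bseminorm_def using assms Cauchy_Schwarz[OF assms]
  by (auto simp: inner_add inner_smult norm_mult norm_triangle_ineq H_closed)

lemma conv_inner: assumes "nrm.conv x l" "u \<in> carrier H" shows "(\<lambda>n. inner H u (x n)) \<longlonglongrightarrow> inner H u l"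
proof -
  have c: "l \<in> carrier H" "\<And>n. x n \<in> carrier H" "(\<lambda>n. hnorm H (x n \<ominus> l)) \<longlonglongrightarrow> 0"
    using assms by (auto simp: nrm.conv_def)
  have "(\<lambda>n. inner H u (x n) - inner H u l) \<longlonglongrightarrow> 0"
  proof (rule Lim_null_comparison)
    show "(\<lambda>n. hnorm H u * hnorm H (x n \<ominus> l)) \<longlonglongrightarrow> 0"
      using tendsto_mult[OF tendsto_const[of "hnorm H u"] c(3)] by simp
    show "\<forall>\<^sub>F n in sequentially. norm (inner H u (x n) - inner H u l) \<le> hnorm H u * hnorm H (x n \<ominus> l)"
      using Cauchy_Schwarz[OF assms(2), of "x n \<ominus> l" for n] c assms(2)
      by (intro always_eventually) (simp add: inner_minus)
  qed
  then show ?thesis by (simp add: LIM_zero_iff)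
qed

end

section \<open>C*-algebras and their representations\<close>

context unital_cstar_algebra
begin

sublocale rg: Ring.ring A by (rule ring)

sublocale nrm: cnormed A "cnorm A"
proof (rule cnormed.intro)
  show "vectorspace class_ring A" by (rule vectorspace)
qed (use norm_nonneg norm_definite norm_triangle norm_smult in simp_all)

lemma ctop_eq: "ctop A = nrm.met.mtopology"
  by (simp add: ctop_def cdist_eq_ndist)

lemma mcompl: "nrm.met.mcomplete"
  using complete by (simp add: cdist_eq_ndist)

lemma mult_minus_right: assumes "a \<in> carrier A" "b \<in> carrier A" "c \<in> carrier A"
  shows "a \<otimes> (b \<ominus> c) = (a \<otimes> b) \<ominus> (a \<otimes> c)"
  using assms by (simp add: a_minus_def rg.r_distr rg.r_minus)

lemma mult_minus_left: assumes "a \<in> carrier A" "b \<in> carrier A" "c \<in> carrier A"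
  shows "(b \<ominus> c) \<otimes> a = (b \<otimes> a) \<ominus> (c \<otimes> a)"
  using assms by (simp add: a_minus_def rg.l_distr rg.l_minus)

lemma conv_mult: assumes "nrm.conv x a" "nrm.conv y b" shows "nrm.conv (\<lambda>n. x n \<otimes> y n) (a \<otimes> b)"
proof (rule nrm.conv_squeeze)
  have c: "a \<in> carrier A" "b \<in> carrier A" "\<And>n. x n \<in> carrier A" "\<And>n. y n \<in> carrier A"
    and l: "(\<lambda>n. cnorm A (x n \<ominus> a)) \<longlonglongrightarrow> 0" "(\<lambda>n. cnorm A (y n \<ominus> b)) \<longlonglongrightarrow> 0"
    using assms by (simp_all add: nrm.conv_def)
  show "x n \<otimes> y n \<in> carrier A" "a \<otimes> b \<in> carrier A" for n using c by simp_all
  show "cnorm A (x n \<otimes> y n \<ominus> a \<otimes> b) \<le> cnorm A (x n \<ominus> a) * cnorm A (y n) + cnorm A a * cnorm A (y n \<ominus> b)" for n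
  proof -
    have "x n \<otimes> y n \<ominus> a \<otimes> b = (x n \<otimes> y n \<ominus> a \<otimes> y n) \<oplus> (a \<otimes> y n \<ominus> a \<otimes> b)"
      by (rule nrm.diff_trans) (use c in simp_all)
    also have "\<dots> = ((x n \<ominus> a) \<otimes> y n) \<oplus> (a \<otimes> (y n \<ominus> b))"
      using c by (simp add: mult_minus_left mult_minus_right)
    finally have eq: "x n \<otimes> y n \<ominus> a \<otimes> b = ((x n \<ominus> a) \<otimes> y n) \<oplus> (a \<otimes> (y n \<ominus> b))" .
    have "cnorm A (((x n \<ominus> a) \<otimes> y n) \<oplus> (a \<otimes> (y n \<ominus> b))) \<le> cnorm A ((x n \<ominus> a) \<otimes> y n) + cnorm A (a \<otimes> (y n \<ominus> b))"
      by (rule norm_triangle) (use c in simp_all)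
    also have "\<dots> \<le> cnorm A (x n \<ominus> a) * cnorm A (y n) + cnorm A a * cnorm A (y n \<ominus> b)"
      by (intro add_mono norm_mult) (use c in simp_all)
    finally show ?thesis unfolding eq .
  qed
  have "(\<lambda>n. cnorm A (x n \<ominus> a) * cnorm A (y n) + cnorm A a * cnorm A (y n \<ominus> b)) \<longlonglongrightarrow> 0 * cnorm A b + cnorm A a * 0"
    by (intro tendsto_intros l nrm.conv_nrm[OF assms(2)])
  then show "(\<lambda>n. cnorm A (x n \<ominus> a) * cnorm A (y n) + cnorm A a * cnorm A (y n \<ominus> b)) \<longlonglongrightarrow> 0" by simp
qed

lemma norm_star_le: assumes "a \<in> carrier A" shows "cnorm A a \<le> cnorm A (star A a)"
proof (cases "cnorm A a = 0")
  case False
  then have "cnorm A a > 0" using norm_nonneg[OF assms] by simp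
  moreover have "cnorm A a * cnorm A a \<le> cnorm A (star A a) * cnorm A a"
    using cstar_identity[OF assms] norm_mult[OF star_closed[OF assms] assms] by (simp add: power2_eq_square)
  ultimately show ?thesis by simp
qed (use norm_nonneg[OF star_closed[OF assms]] in simp)

lemma norm_star: assumes "a \<in> carrier A" shows "cnorm A (star A a) = cnorm A a"
  using norm_star_le[OF assms] norm_star_le[OF star_closed[OF assms]] star_star[OF assms] by simp

lemma star_minus: assumes "a \<in> carrier A" "b \<in> carrier A" shows "star A (a \<ominus> b) = star A a \<ominus> star A b"
  using assms by (simp add: nrm.minus_sm star_add star_smult star_closed)

lemma conv_star: assumes "nrm.conv x a" shows "nrm.conv (\<lambda>n. star A (x n)) (star A a)"
  using assms by (simp add: nrm.conv_def star_minus[symmetric] norm_star star_closed)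

lemma star_one: "star A \<one> = \<one>"
proof -
  have "star A (star A \<one>) = star A (star A \<one> \<otimes> \<one>)" using star_closed[of \<one>] by simp
  also have "\<dots> = star A \<one> \<otimes> star A (star A \<one>)" by (rule star_mult) (simp_all add: star_closed)
  finally show ?thesis using star_closed[of \<one>] by (simp add: star_star)
qed

lemma norm_one: "cnorm A \<one> = 1"
proof -
  have "cnorm A \<one> = (cnorm A \<one>)\<^sup>2" using cstar_identity[of \<one>] by (simp add: star_one)
  moreover have "cnorm A \<one> \<noteq> 0" using norm_definite[of \<one>] one_not_zero by simp
  ultimately show ?thesis by (simp add: power2_eq_square)
qed

text \<open>The C*-identity computes the norm of a square of a selfadjoint element, hence exponents
  that are powers of two. Selfadjointness of the power is part of the induction because the next
  squaring requires it.\<close>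

lemma norm_selfadjoint_power:
  assumes "h \<in> carrier A" "star A h = h"
  shows "cnorm A (h [^] (2 ^ k :: nat)) = cnorm A h ^ (2 ^ k) \<and> star A (h [^] (2 ^ k :: nat)) = h [^] (2 ^ k :: nat)"
proof (induction k)
  case (Suc k)
  let ?g = "h [^] (2 ^ k :: nat)"
  have g: "?g \<in> carrier A" using assms by simp
  have e: "h [^] (2 ^ Suc k :: nat) = ?g \<otimes> ?g" using assms by (simp add: rg.nat_pow_mult mult_2)
  have "cnorm A (?g \<otimes> ?g) = (cnorm A ?g)\<^sup>2" using cstar_identity[OF g] Suc by simp
  moreover have "star A (?g \<otimes> ?g) = ?g \<otimes> ?g" using star_mult[OF g g] Suc by simp
  ultimately show ?case unfolding e using Suc by (simp add: power_mult[symmetric] mult.commute)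
qed (use assms in simp)

text \<open>Neumann series. A left inverse is all that the contractivity of representations needs,
  and it is read off from the fixed-point equation \<open>c = 1 + c t\<close> satisfied by the
  limit.\<close>

lemma one_minus_left_invertible:
  assumes t: "t \<in> carrier A" and lt: "cnorm A t < 1"
  obtains c where "c \<in> carrier A" "c \<otimes> (\<one> \<ominus> t) = \<one>"
proof -
  \<comment> \<open>Partial sums of the geometric series in Horner form: starting from zero,
    \<open>s n\<close> is the sum of the powers of t below n, so consecutive terms differ by the
    n-th power.\<close>
  define s where "s = rec_nat \<zero> (\<lambda>_ s. \<one> \<oplus> s \<otimes> t)"
  have s0: "s 0 = \<zero>" and sS: "\<And>n. s (Suc n) = \<one> \<oplus> s n \<otimes> t" by (simp_all add: s_def)
  have sc: "s n \<in> carrier A" for n by (induction n) (simp_all add: s0 sS t)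
  have stp: "cnorm A (s (Suc n) \<ominus> s n) \<le> cnorm A t ^ n" for n
  proof (induction n)
    case 0
    have "(\<one> \<oplus> \<zero> \<otimes> t) \<ominus> \<zero> = \<one>" using t by (simp add: a_minus_def)
    then show ?case using norm_one by (simp add: sS s0)
  next
    case (Suc n)
    have "s (Suc (Suc n)) \<ominus> s (Suc n) = (\<one> \<oplus> s (Suc n) \<otimes> t) \<ominus> (\<one> \<oplus> s n \<otimes> t)"
      using sS by simp
    also have "\<dots> = (\<one> \<ominus> \<one>) \<oplus> (s (Suc n) \<otimes> t \<ominus> s n \<otimes> t)"
      by (rule nrm.add_diff_diff) (use sc t in simp_all)
    also have "\<dots> = (s (Suc n) \<ominus> s n) \<otimes> t" using sc t by (simp add: mult_minus_left)
    finally have e: "s (Suc (Suc n)) \<ominus> s (Suc n) = (s (Suc n) \<ominus> s n) \<otimes> t" .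
    have "cnorm A ((s (Suc n) \<ominus> s n) \<otimes> t) \<le> cnorm A (s (Suc n) \<ominus> s n) * cnorm A t"
      by (rule norm_mult) (use sc t in simp_all)
    also have "\<dots> \<le> cnorm A t ^ n * cnorm A t" by (rule mult_right_mono[OF Suc norm_nonneg[OF t]])
    finally show ?case unfolding e by (simp add: mult.commute)
  qed
  let ?q = "cnorm A t"
  have q0: "0 \<le> ?q" using norm_nonneg[OF t] .
  have tail: "cnorm A (s (n + k) \<ominus> s n) \<le> ?q ^ n / (1 - ?q)" for n k
  proof -
    have "cnorm A (s (n + k) \<ominus> s n) \<le> (\<Sum>i<k. ?q ^ (n + i))"
    proof (induction k)
      case (Suc k)
      have "cnorm A (s (n + Suc k) \<ominus> s n) \<le> cnorm A (s (n + Suc k) \<ominus> s (n + k)) + cnorm A (s (n + k) \<ominus> s n)"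
        by (rule nrm.nrm_diff_triangle) (rule sc)+
      also have "\<dots> \<le> ?q ^ (n + k) + (\<Sum>i<k. ?q ^ (n + i))"
        using stp[of "n + k"] Suc by simp
      finally show ?case by simp
    qed (simp add: sc)
    also have "\<dots> = ?q ^ n * (\<Sum>i<k. ?q ^ i)" by (simp add: sum_distrib_left power_add)
    also have "(\<Sum>i<k. ?q ^ i) = (1 - ?q ^ k) / (1 - ?q)" using lt by (simp add: sum_gp_strict)
    also have "?q ^ n * ((1 - ?q ^ k) / (1 - ?q)) \<le> ?q ^ n * (1 / (1 - ?q))"
      using lt q0 by (intro mult_left_mono divide_right_mono) simp_all
    finally show ?thesis by simp
  qed
  have lim0: "(\<lambda>n. ?q ^ n / (1 - ?q)) \<longlonglongrightarrow> 0"
    using tendsto_divide[OF LIMSEQ_power_zero[of ?q] tendsto_const[of "1 - ?q"]] lt q0 by simp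
  obtain c where c: "nrm.conv s c"
  proof (rule nrm.complete_conv[OF mcompl sc])
    fix e :: real assume "e > 0"
    then obtain K where K: "?q ^ K / (1 - ?q) < e / 2"
      using order_tendstoD(2)[OF lim0, of "e / 2"] unfolding eventually_sequentially by force
    show "\<exists>K. \<forall>m\<ge>K. \<forall>n\<ge>K. cnorm A (s m \<ominus> s n) < e"
    proof (intro exI[of _ K] allI impI)
      fix m n assume mn: "K \<le> m" "K \<le> n"
      have "cnorm A (s m \<ominus> s n) \<le> cnorm A (s m \<ominus> s K) + cnorm A (s K \<ominus> s n)"
        by (rule nrm.nrm_diff_triangle) (rule sc)+
      also have "cnorm A (s K \<ominus> s n) = cnorm A (s n \<ominus> s K)" by (rule nrm.nrm_minus_commute) (rule sc)+
      also have "cnorm A (s m \<ominus> s K) + cnorm A (s n \<ominus> s K) < e"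
      proof -
        have "cnorm A (s m \<ominus> s K) < e / 2" "cnorm A (s n \<ominus> s K) < e / 2"
          using tail[of K "m - K"] tail[of K "n - K"] K mn by (simp_all del: less_divide_eq_numeral1)
        then show ?thesis by simp
      qed
      finally show "cnorm A (s m \<ominus> s n) < e" .
    qed
  qed (rule that)
  have cc: "c \<in> carrier A" using c by (simp add: nrm.conv_def)
  have "nrm.conv (\<lambda>n. s (Suc n)) (\<one> \<oplus> c \<otimes> t)"
    unfolding sS by (intro nrm.conv_add nrm.conv_const conv_mult c) (simp_all add: t)
  moreover have "nrm.conv (\<lambda>n. s (Suc n)) c"
    using c LIMSEQ_Suc[of "\<lambda>n. cnorm A (s n \<ominus> c)" 0] unfolding nrm.conv_def by simp
  ultimately have e: "c = \<one> \<oplus> c \<otimes> t" by (rule nrm.conv_unique[symmetric])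
  have "c \<otimes> (\<one> \<ominus> t) = c \<ominus> c \<otimes> t" using cc t by (simp add: mult_minus_right)
  also have "\<dots> = (\<one> \<oplus> c \<otimes> t) \<ominus> c \<otimes> t" using e by simp
  also have "\<dots> = (c \<otimes> t \<oplus> \<one>) \<ominus> c \<otimes> t" using cc t by (simp add: rg.a_comm)
  also have "\<dots> = \<one>" using cc t by (simp add: nrm.add_diff2)
  finally show thesis using cc that by blast
qed

end

lemma norm_unitary:
  assumes "unital_cstar_algebra A" "u \<in> unitaries A" shows "cnorm A u = 1"
proof -
  interpret unital_cstar_algebra A by fact
  have "u \<in> carrier A" "star A u \<otimes>\<^bsub>A\<^esub> u = \<one>\<^bsub>A\<^esub>" using assms(2) by (simp_all add: unitaries_def)
  then have "(cnorm A u)\<^sup>2 = 1" "0 \<le> cnorm A u" using cstar_identity[of u] norm_one norm_nonneg by simp_all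
  then show ?thesis by (simp add: power2_eq_1_iff)
qed

section \<open>Bounded operators and contractivity of representations\<close>

lemma bounded_opsD:
  assumes "T \<in> bounded_ops H K"
  shows "T \<in> linear_maps H K" "\<exists>C. \<forall>v\<in>carrier H. hnorm K (T v) \<le> C * hnorm H v"
  using assms by (simp_all add: bounded_ops_def)

lemma bounded_opsI:
  assumes "T \<in> linear_maps H K" "\<And>v. v \<in> carrier H \<Longrightarrow> hnorm K (T v) \<le> C * hnorm H v"
  shows "T \<in> bounded_ops H K"
  using assms unfolding bounded_ops_def by blast

text \<open>The operator norm as the infimum of the admissible bounds. Its minimality is what the
  contractivity proof contradicts by exhibiting a smaller admissible bound.\<close>

lemma least_bound:
  assumes "hilbert_space H" "hilbert_space K" "T \<in> bounded_ops H K"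
  obtains r where "0 \<le> r" "\<And>v. v \<in> carrier H \<Longrightarrow> hnorm K (T v) \<le> r * hnorm H v"
    "\<And>s. 0 \<le> s \<Longrightarrow> (\<And>v. v \<in> carrier H \<Longrightarrow> hnorm K (T v) \<le> s * hnorm H v) \<Longrightarrow> r \<le> s"
proof -
  interpret H: hilbert_space H by fact
  interpret K: hilbert_space K by fact
  define B where "B = {s. 0 \<le> s \<and> (\<forall>v\<in>carrier H. hnorm K (T v) \<le> s * hnorm H v)}"
  obtain C where C: "\<forall>v\<in>carrier H. hnorm K (T v) \<le> C * hnorm H v" using bounded_opsD(2)[OF assms(3)] by blast
  have "\<forall>v\<in>carrier H. hnorm K (T v) \<le> \<bar>C\<bar> * hnorm H v"
    using C H.hnorm_nonneg by (meson abs_ge_self mult_right_mono order_trans)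
  then have CB: "\<bar>C\<bar> \<in> B" by (simp add: B_def)
  have bdd: "bdd_below B" unfolding B_def by (rule bdd_belowI[of _ 0]) simp
  show thesis
  proof (rule that[of "Inf B"])
    show "0 \<le> Inf B" 
    proof (rule cInf_greatest)
      show "B \<noteq> {}" using CB by blast
    qed (simp add: B_def)
    show "Inf B \<le> s" if "0 \<le> s" "\<And>v. v \<in> carrier H \<Longrightarrow> hnorm K (T v) \<le> s * hnorm H v" for s
      using that bdd by (intro cInf_lower) (auto simp: B_def)
    show "hnorm K (T v) \<le> Inf B * hnorm H v" if v: "v \<in> carrier H" for v
    proof (cases "hnorm H v = 0")
      case True
      then show ?thesis using C v by fastforce
    next
      case False
      then have p: "hnorm H v > 0" using H.hnorm_nonneg[OF v] by simp
      have "hnorm K (T v) / hnorm H v \<le> Inf B"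
      proof (rule cInf_greatest)
        show "B \<noteq> {}" using CB by blast
        show "hnorm K (T v) / hnorm H v \<le> x" if "x \<in> B" for x
          using that v p by (simp add: B_def divide_le_eq)
      qed
      then show ?thesis using p by (simp add: divide_le_eq)
    qed
  qed
qed

lemma unital_representationD:
  assumes "unital_representation A H \<pi>"
  shows "a \<in> carrier A \<Longrightarrow> \<pi> a \<in> bounded_ops H H"
    "v \<in> carrier H \<Longrightarrow> \<pi> \<one>\<^bsub>A\<^esub> v = v"
    "a \<in> carrier A \<Longrightarrow> b \<in> carrier A \<Longrightarrow> v \<in> carrier H \<Longrightarrow> \<pi> (a \<oplus>\<^bsub>A\<^esub> b) v = \<pi> a v \<oplus>\<^bsub>H\<^esub> \<pi> b v"
    "a \<in> carrier A \<Longrightarrow> b \<in> carrier A \<Longrightarrow> v \<in> carrier H \<Longrightarrow> \<pi> (a \<otimes>\<^bsub>A\<^esub> b) v = \<pi> a (\<pi> b v)"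
    "a \<in> carrier A \<Longrightarrow> v \<in> carrier H \<Longrightarrow> \<pi> (c \<odot>\<^bsub>A\<^esub> a) v = c \<odot>\<^bsub>H\<^esub> \<pi> a v"
    "a \<in> carrier A \<Longrightarrow> v \<in> carrier H \<Longrightarrow> w \<in> carrier H \<Longrightarrow> inner H (\<pi> (star A a) v) w = inner H v (\<pi> a w)"
    "a \<in> carrier A \<Longrightarrow> v \<in> carrier H \<Longrightarrow> \<pi> a v \<in> carrier H"
proof -
  note D = assms[unfolded unital_representation_def, THEN conjunct2, rule_format]
  show B: "a \<in> carrier A \<Longrightarrow> \<pi> a \<in> bounded_ops H H"
    using assms by (simp add: unital_representation_def)
  show "v \<in> carrier H \<Longrightarrow> \<pi> \<one>\<^bsub>A\<^esub> v = v"
    "a \<in> carrier A \<Longrightarrow> b \<in> carrier A \<Longrightarrow> v \<in> carrier H \<Longrightarrow> \<pi> (a \<oplus>\<^bsub>A\<^esub> b) v = \<pi> a v \<oplus>\<^bsub>H\<^esub> \<pi> b v"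
    "a \<in> carrier A \<Longrightarrow> b \<in> carrier A \<Longrightarrow> v \<in> carrier H \<Longrightarrow> \<pi> (a \<otimes>\<^bsub>A\<^esub> b) v = \<pi> a (\<pi> b v)"
    "a \<in> carrier A \<Longrightarrow> v \<in> carrier H \<Longrightarrow> \<pi> (c \<odot>\<^bsub>A\<^esub> a) v = c \<odot>\<^bsub>H\<^esub> \<pi> a v"
    "a \<in> carrier A \<Longrightarrow> v \<in> carrier H \<Longrightarrow> w \<in> carrier H \<Longrightarrow> inner H (\<pi> (star A a) v) w = inner H v (\<pi> a w)"
    using D by simp_all
  show "a \<in> carrier A \<Longrightarrow> v \<in> carrier H \<Longrightarrow> \<pi> a v \<in> carrier H"
    by (rule linear_mapsD(1)[OF bounded_opsD(1)[OF B]])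
qed

text \<open>If r = opnorm (\<pi> h) were larger than the norm of h, then \<open>1 - h\<^sup>2/r\<^sup>2\<close> would be invertible,
  which contradicts the existence of approximate eigenvectors of \<open>\<pi> h\<close> for \<open>r\<close> or \<open>-r\<close>.\<close>

lemma representation_contractive_selfadjoint:
  assumes "unital_cstar_algebra A" "hilbert_space H" and rep: "unital_representation A H \<pi>"
    and h: "h \<in> carrier A" "star A h = h" and v: "v \<in> carrier H"
  shows "hnorm H (\<pi> h v) \<le> cnorm A h * hnorm H v"
proof -
  interpret A: unital_cstar_algebra A by fact
  interpret H: hilbert_space H by fact
  note R = unital_representationD[OF rep]
  obtain r where r: "0 \<le> r" and rb: "\<And>v. v \<in> carrier H \<Longrightarrow> hnorm H (\<pi> h v) \<le> r * hnorm H v"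
    and least: "\<And>s. 0 \<le> s \<Longrightarrow> (\<And>v. v \<in> carrier H \<Longrightarrow> hnorm H (\<pi> h v) \<le> s * hnorm H v) \<Longrightarrow> r \<le> s"
    using least_bound[OF assms(2,2) R(1)[OF h(1)]] by metis
  have "r \<le> cnorm A h"
  proof (rule ccontr)
    assume "\<not> r \<le> cnorm A h"
    then have lt: "cnorm A h < r" by simp
    then have rp: "r > 0" using A.norm_nonneg[OF h(1)] by simp
    \<comment> \<open>By the C*-identity, \<open>t = h h / r^2\<close> has norm
      \<open>(cnorm A h / r)^2 < 1\<close>, so \<open>1 - t\<close> has a left inverse c.\<close>
    define k where "k = complex_of_real (1 / r\<^sup>2)"
    define t where "t = k \<odot>\<^bsub>A\<^esub> (h \<otimes>\<^bsub>A\<^esub> h)"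
    have tc: "t \<in> carrier A" using h by (simp add: t_def)
    have "cnorm A t = cmod k * cnorm A (h \<otimes>\<^bsub>A\<^esub> h)" using h by (simp add: t_def A.norm_smult)
    also have "\<dots> = (cnorm A h)\<^sup>2 / r\<^sup>2"
      using A.cstar_identity[OF h(1)] h(2) rp by (simp add: k_def norm_divide norm_power)
    also have "\<dots> < 1" using lt A.norm_nonneg[OF h(1)] rp by (simp add: power_strict_mono)
    finally have "cnorm A t < 1" .
    then obtain c where c: "c \<in> carrier A" "c \<otimes>\<^bsub>A\<^esub> (\<one>\<^bsub>A\<^esub> \<ominus>\<^bsub>A\<^esub> t) = \<one>\<^bsub>A\<^esub>"
      using A.one_minus_left_invertible[OF tc] by metis
    obtain K0 where K0: "\<And>v. v \<in> carrier H \<Longrightarrow> hnorm H (\<pi> c v) \<le> K0 * hnorm H v"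
      using bounded_opsD(2)[OF R(1)[OF c(1)]] by blast
    define K where "K = \<bar>K0\<bar> + 1"
    have K: "K \<ge> 1" "\<And>v. v \<in> carrier H \<Longrightarrow> hnorm H (\<pi> c v) \<le> K * hnorm H v"
    proof -
      show "hnorm H (\<pi> c v) \<le> K * hnorm H v" if "v \<in> carrier H" for v
        by (rule order_trans[OF K0[OF that] mult_right_mono[OF _ H.hnorm_nonneg[OF that]]]) (simp add: K_def)
    qed (simp add: K_def)
    \<comment> \<open>Applying \<open>\<pi> c\<close> gives
      \<open>|v| \<le> K * |v - h h v / r^2|\<close>. Expanding the square turns this into
      \<open>|h v|^2 \<le> r^2 * (1 - 1 / K^2) * |v|^2\<close>, which makes s an admissible bound
      below r. Taking \<open>K \<ge> 1\<close> keeps the root real.\<close>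
    define s where "s = r * sqrt (1 - 1 / K\<^sup>2)"
    have K2: "1 \<le> K\<^sup>2" using K(1) by simp
    have K3: "0 \<le> 1 - 1 / K\<^sup>2" "K\<^sup>2 > 0" "K > 0" using K(1) K2 by simp_all
    have s0: "0 \<le> s" unfolding s_def by (rule mult_nonneg_nonneg[OF r real_sqrt_ge_zero[OF K3(1)]])
    have bound: "hnorm H (\<pi> h v) \<le> s * hnorm H v" if v: "v \<in> carrier H" for v
    proof -
      let ?T = "\<pi> h v"
      have T: "?T \<in> carrier H" "\<pi> h ?T \<in> carrier H" using R(7)[OF h(1)] v by simp_all
      have pt: "\<pi> (\<one>\<^bsub>A\<^esub> \<ominus>\<^bsub>A\<^esub> t) v = v \<ominus>\<^bsub>H\<^esub> k \<odot>\<^bsub>H\<^esub> \<pi> h ?T"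
        using v h tc T by (simp add: A.nrm.minus_sm H.nrm.minus_sm R(2,3,4,5) t_def)
      have "v = \<pi> c (\<pi> (\<one>\<^bsub>A\<^esub> \<ominus>\<^bsub>A\<^esub> t) v)"
        using R(4)[OF c(1) _ v, of "\<one>\<^bsub>A\<^esub> \<ominus>\<^bsub>A\<^esub> t"] c R(2)[OF v] tc by simp
      then have "hnorm H v \<le> K * hnorm H (v \<ominus>\<^bsub>H\<^esub> k \<odot>\<^bsub>H\<^esub> \<pi> h ?T)"
        using K(2)[of "v \<ominus>\<^bsub>H\<^esub> k \<odot>\<^bsub>H\<^esub> \<pi> h ?T"] pt v T by simp
      then have "(hnorm H v)\<^sup>2 \<le> K\<^sup>2 * (hnorm H (v \<ominus>\<^bsub>H\<^esub> k \<odot>\<^bsub>H\<^esub> \<pi> h ?T))\<^sup>2"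
        using H.hnorm_nonneg[OF v] by (metis power_mono power_mult_distrib)
      also have "(hnorm H (v \<ominus>\<^bsub>H\<^esub> k \<odot>\<^bsub>H\<^esub> \<pi> h ?T))\<^sup>2
        = (hnorm H v)\<^sup>2 - 2 * Re (k * inner H v (\<pi> h ?T)) + (cmod k * hnorm H (\<pi> h ?T))\<^sup>2"
        using v T by (simp add: H.hnorm_minus_sq H.inner_smult H.hnorm_smult)
      also have "inner H v (\<pi> h ?T) = inner H ?T ?T" using R(6)[OF h(1) v T(1)] h(2) by simp
      also have "\<dots> = complex_of_real ((hnorm H ?T)\<^sup>2)" by (rule H.inner_self[OF T(1)])
      also have "Re (k * complex_of_real ((hnorm H ?T)\<^sup>2)) = (hnorm H ?T)\<^sup>2 / r\<^sup>2"
        unfolding k_def of_real_mult[symmetric] Re_complex_of_real by simp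
      also have "cmod k = 1 / r\<^sup>2" unfolding k_def norm_of_real by simp
      finally have 1: "(hnorm H v)\<^sup>2 \<le> K\<^sup>2 * ((hnorm H v)\<^sup>2 - 2 * ((hnorm H ?T)\<^sup>2 / r\<^sup>2)
          + (1 / r\<^sup>2 * hnorm H (\<pi> h ?T))\<^sup>2)" .
      \<comment> \<open>The bound r applied to the vector \<open>h v\<close> shows that the last
        square is at most \<open>|h v|^2 / r^2\<close>. It thus cancels one of the two copies of
        this quantity in the cross term and leaves the other one.\<close>
      have "1 / r\<^sup>2 * hnorm H (\<pi> h ?T) \<le> 1 / r\<^sup>2 * (r * hnorm H ?T)"
        using rb[OF T(1)] by (intro mult_left_mono) simp_all
      also have "\<dots> = hnorm H ?T / r" using rp by (simp add: power2_eq_square)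
      finally have "(1 / r\<^sup>2 * hnorm H (\<pi> h ?T))\<^sup>2 \<le> (hnorm H ?T / r)\<^sup>2"
        by (rule power_mono) (use H.hnorm_nonneg[OF T(2)] in simp)
      then have "(hnorm H v)\<^sup>2 - 2 * ((hnorm H ?T)\<^sup>2 / r\<^sup>2) + (1 / r\<^sup>2 * hnorm H (\<pi> h ?T))\<^sup>2
          \<le> (hnorm H v)\<^sup>2 - (hnorm H ?T)\<^sup>2 / r\<^sup>2" by (simp add: power_divide)
      then have "K\<^sup>2 * ((hnorm H v)\<^sup>2 - 2 * ((hnorm H ?T)\<^sup>2 / r\<^sup>2) + (1 / r\<^sup>2 * hnorm H (\<pi> h ?T))\<^sup>2)
          \<le> K\<^sup>2 * ((hnorm H v)\<^sup>2 - (hnorm H ?T)\<^sup>2 / r\<^sup>2)"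
        by (rule mult_left_mono) simp
      with 1 have "(hnorm H v)\<^sup>2 \<le> K\<^sup>2 * ((hnorm H v)\<^sup>2 - (hnorm H ?T)\<^sup>2 / r\<^sup>2)" by linarith
      then have "(hnorm H v)\<^sup>2 / K\<^sup>2 \<le> (hnorm H v)\<^sup>2 - (hnorm H ?T)\<^sup>2 / r\<^sup>2"
        using K3 by (simp add: pos_divide_le_eq mult.commute)
      then have "(hnorm H ?T)\<^sup>2 / r\<^sup>2 \<le> (1 - 1 / K\<^sup>2) * (hnorm H v)\<^sup>2"
        by (simp add: left_diff_distrib)
      then have "(hnorm H ?T)\<^sup>2 \<le> r\<^sup>2 * ((1 - 1 / K\<^sup>2) * (hnorm H v)\<^sup>2)"
        using rp by (simp add: pos_divide_le_eq mult.commute)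
      also have "\<dots> = (s * hnorm H v)\<^sup>2"
        by (simp only: s_def power_mult_distrib real_sqrt_pow2[OF K3(1)] mult.assoc)
      finally show ?thesis
        by (rule power2_le_imp_le) (intro mult_nonneg_nonneg s0 H.hnorm_nonneg v)
    qed
    have "r \<le> s" by (rule least[OF s0 bound])
    moreover have "sqrt (1 - 1 / K\<^sup>2) < sqrt 1" using K3 by (intro real_sqrt_less_mono) simp
    ultimately show False using rp by (simp add: s_def)
  qed
  then show ?thesis using rb[OF v] H.hnorm_nonneg[OF v] by (meson mult_right_mono order_trans)
qed

text \<open>The selfadjoint case for the product of the adjoint of a with a: the squared norm of
  \<open>\<pi> a v\<close> is the inner product of its image of v with v, and the C*-identity takes
  the square root.\<close>

lemma representation_contractive:
  assumes "unital_cstar_algebra A" "hilbert_space H" and rep: "unital_representation A H \<pi>"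
    and a: "a \<in> carrier A" and v: "v \<in> carrier H"
  shows "hnorm H (\<pi> a v) \<le> cnorm A a * hnorm H v"
proof -
  interpret A: unital_cstar_algebra A by fact
  interpret H: hilbert_space H by fact
  note R = unital_representationD[OF rep]
  let ?h = "star A a \<otimes>\<^bsub>A\<^esub> a"
  have sa: "star A a \<in> carrier A" using a by (rule A.star_closed)
  have h: "?h \<in> carrier A" "star A ?h = ?h"
    using a sa by (simp_all add: A.star_mult A.star_star)
  have av: "\<pi> a v \<in> carrier H" by (rule R(7)[OF a v])
  have "(hnorm H (\<pi> a v))\<^sup>2 = Re (inner H (\<pi> a v) (\<pi> a v))" by (rule H.hnorm_sq[OF av])
  also have "inner H (\<pi> a v) (\<pi> a v) = inner H (\<pi> (star A a) (\<pi> a v)) v"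
    using R(6)[OF a av v] by simp
  also have "\<pi> (star A a) (\<pi> a v) = \<pi> ?h v" using R(4)[OF sa a v] by simp
  also have "Re (inner H (\<pi> ?h v) v) \<le> cmod (inner H (\<pi> ?h v) v)" by (rule complex_Re_le_cmod)
  also have "\<dots> \<le> hnorm H (\<pi> ?h v) * hnorm H v" by (rule H.Cauchy_Schwarz[OF R(7)[OF h(1) v] v])
  also have "\<dots> \<le> (cnorm A ?h * hnorm H v) * hnorm H v"
    by (rule mult_right_mono[OF representation_contractive_selfadjoint[OF assms(1,2) rep h v] H.hnorm_nonneg[OF v]])
  also have "\<dots> = (cnorm A a * hnorm H v)\<^sup>2"
    using A.cstar_identity[OF a] by (simp add: power2_eq_square)
  finally show ?thesis
    by (rule power2_le_imp_le) (intro mult_nonneg_nonneg A.norm_nonneg H.hnorm_nonneg a v)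
qed

section \<open>Totally bounded sets\<close>

context cnormed
begin

text \<open>Total boundedness with centres anywhere in the space. This makes stability under subsets
  and under approximation immediate; centres inside the set are restored only when passing to
  compactness.\<close>

definition tb :: "'v set \<Rightarrow> bool" where
  "tb X \<longleftrightarrow> X \<subseteq> carrier V \<and> (\<forall>e>0. \<exists>Y. finite Y \<and> Y \<subseteq> carrier V \<and> (\<forall>x\<in>X. \<exists>y\<in>Y. N (x \<ominus> y) < e))"

lemma tbD: assumes "tb X" "e > 0"
  obtains Y where "finite Y" "Y \<subseteq> carrier V" "\<And>x. x \<in> X \<Longrightarrow> \<exists>y\<in>Y. N (x \<ominus> y) < e"
  using assms unfolding tb_def by metis

lemma tb_subset: "tb X \<Longrightarrow> Y \<subseteq> X \<Longrightarrow> tb Y"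
  unfolding tb_def by (meson subset_iff)

text \<open>The form in which compactness of the resolvent is obtained: a set that is uniformly
  close to totally bounded sets is totally bounded.\<close>

lemma tb_approx:
  assumes X: "X \<subseteq> carrier V" and "\<And>e. e > 0 \<Longrightarrow> \<exists>Y. tb Y \<and> (\<forall>x\<in>X. \<exists>y\<in>Y. N (x \<ominus> y) < e)"
  shows "tb X"
  unfolding tb_def
proof (intro conjI X allI impI)
  fix e :: real assume e: "e > 0"
  obtain Y where Y: "tb Y" "\<And>x. x \<in> X \<Longrightarrow> \<exists>y\<in>Y. N (x \<ominus> y) < e/2"
    using assms(2)[of "e/2"] e by auto
  obtain Z where Z: "finite Z" "Z \<subseteq> carrier V" "\<And>y. y \<in> Y \<Longrightarrow> \<exists>z\<in>Z. N (y \<ominus> z) < e/2"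
    using tbD[OF Y(1), of "e/2"] e by auto
  have "\<exists>z\<in>Z. N (x \<ominus> z) < e" if x: "x \<in> X" for x
  proof -
    obtain y z where yz: "y \<in> Y" "N (x \<ominus> y) < e/2" "z \<in> Z" "N (y \<ominus> z) < e/2" using Y(2)[OF x] Z(3) by blast
    have c: "x \<in> carrier V" "y \<in> carrier V" "z \<in> carrier V" using x X yz Y(1) Z(2) unfolding tb_def by blast+
    have "N (x \<ominus> z) < e" using nrm_diff_triangle[OF c] yz by simp
    then show ?thesis using yz by blast
  qed
  then show "\<exists>Y. finite Y \<and> Y \<subseteq> carrier V \<and> (\<forall>x\<in>X. \<exists>y\<in>Y. N (x \<ominus> y) < e)" using Z by blast
qed

lemma tb_scale: assumes "v \<in> carrier V" shows "tb {c \<odot>\<^bsub>V\<^esub> v | c. cmod c \<le> C}"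
  unfolding tb_def
proof (intro conjI allI impI)
  fix e :: real assume e: "e > 0"
  \<comment> \<open>Radius of a net of scalars in the compact disc; the added 1 covers the case
    \<open>N v = 0\<close>.\<close>
  define d where "d = e / (N v + 1)"
  have d: "d > 0" "d * N v < e"
    using e nrm_nonneg[OF assms] by (simp_all add: d_def add_nonneg_pos field_simps)
  have "compact (cball (0::complex) C)" by simp
  then obtain k where k: "finite k" "cball (0::complex) C \<subseteq> (\<Union>x\<in>k. ball x d)"
    using compact_eq_totally_bounded[of "cball (0::complex) C"] d(1) by metis
  show "\<exists>Y. finite Y \<and> Y \<subseteq> carrier V \<and> (\<forall>x\<in>{c \<odot>\<^bsub>V\<^esub> v | c. cmod c \<le> C}. \<exists>y\<in>Y. N (x \<ominus> y) < e)"
  proof (intro exI[of _ "(\<lambda>c. c \<odot>\<^bsub>V\<^esub> v) ` k"] conjI ballI)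
    fix x assume "x \<in> {c \<odot>\<^bsub>V\<^esub> v | c. cmod c \<le> C}"
    then obtain c where c: "x = c \<odot>\<^bsub>V\<^esub> v" "cmod c \<le> C" by blast
    then have "c \<in> cball 0 C" by simp
    then obtain c' where c': "c' \<in> k" "dist c' c < d" using k(2) by fastforce
    have "N (x \<ominus> c' \<odot>\<^bsub>V\<^esub> v) = cmod (c - c') * N v"
      using assms by (simp add: c(1) sm_lminus[symmetric] nrm_smult)
    also have "\<dots> \<le> d * N v" using c' nrm_nonneg[OF assms] by (intro mult_right_mono) (simp_all add: dist_norm norm_minus_commute)
    finally show "\<exists>y\<in>(\<lambda>c. c \<odot>\<^bsub>V\<^esub> v) ` k. N (x \<ominus> y) < e" using c'(1) d(2) by force
  qed (use k(1) assms in auto)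
qed (use assms in auto)

lemma tb_add: assumes "tb X" "tb Y" shows "tb {x \<oplus> y | x y. x \<in> X \<and> y \<in> Y}"
  unfolding tb_def
proof (intro conjI allI impI)
  have XY: "X \<subseteq> carrier V" "Y \<subseteq> carrier V" using assms by (simp_all add: tb_def)
  then show "{x \<oplus> y | x y. x \<in> X \<and> y \<in> Y} \<subseteq> carrier V" by auto
  fix e :: real assume e: "e > 0"
  obtain A where A: "finite A" "A \<subseteq> carrier V" "\<And>y. y \<in> X \<Longrightarrow> \<exists>z\<in>A. N (y \<ominus> z) < e/2"
    using tbD[OF assms(1), of "e/2"] e by auto
  obtain B where B: "finite B" "B \<subseteq> carrier V" "\<And>y. y \<in> Y \<Longrightarrow> \<exists>z\<in>B. N (y \<ominus> z) < e/2"
    using tbD[OF assms(2), of "e/2"] e by auto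
  show "\<exists>Z. finite Z \<and> Z \<subseteq> carrier V \<and> (\<forall>x\<in>{x \<oplus> y | x y. x \<in> X \<and> y \<in> Y}. \<exists>y\<in>Z. N (x \<ominus> y) < e)"
  proof (intro exI[of _ "(\<lambda>(a,b). a \<oplus> b) ` (A \<times> B)"] conjI ballI)
    fix z assume "z \<in> {x \<oplus> y | x y. x \<in> X \<and> y \<in> Y}"
    then obtain x y where z: "z = x \<oplus> y" "x \<in> X" "y \<in> Y" by blast
    obtain a b where ab: "a \<in> A" "N (x \<ominus> a) < e/2" "b \<in> B" "N (y \<ominus> b) < e/2" using A(3)[OF z(2)] B(3)[OF z(3)] by blast
    have c: "a \<in> carrier V" "b \<in> carrier V" "x \<in> carrier V" "y \<in> carrier V" using ab z XY A B by blast+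
    have "N (z \<ominus> (a \<oplus> b)) \<le> N (x \<ominus> a) + N (y \<ominus> b)"
      unfolding z(1) by (subst add_diff_diff) (use c nrm_triangle in simp_all)
    then have "N (z \<ominus> (a \<oplus> b)) < e" using ab by simp
    moreover have "a \<oplus> b \<in> (\<lambda>(a,b). a \<oplus> b) ` (A \<times> B)" using ab by auto
    ultimately show "\<exists>y\<in>(\<lambda>(a,b). a \<oplus> b) ` (A \<times> B). N (z \<ominus> y) < e" by blast
  qed (use A B in auto)
qed

lemma tb_finsum:
  assumes "finite J" "\<And>i. i \<in> J \<Longrightarrow> tb (X i)"
  shows "tb {finsum V f J | f. \<forall>i\<in>J. f i \<in> X i}"
  using assms
proof (induction J rule: finite_induct)
  case empty
  have "tb {\<zero>}" unfolding tb_def by (auto intro!: exI[of _ "{\<zero>}"])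
  then show ?case by (rule tb_subset) auto
next
  case (insert j J)
  have "tb {x \<oplus> y | x y. x \<in> X j \<and> y \<in> {finsum V f J | f. \<forall>i\<in>J. f i \<in> X i}}"
    using insert by (intro tb_add) simp_all
  then show ?case
  proof (rule tb_subset)
    show "{finsum V f (insert j J) | f. \<forall>i\<in>insert j J. f i \<in> X i} \<subseteq>
      {x \<oplus> y | x y. x \<in> X j \<and> y \<in> {finsum V f J | f. \<forall>i\<in>J. f i \<in> X i}}"
    proof safe
      fix f assume f: "\<forall>i\<in>insert j J. f i \<in> X i"
      have "f i \<in> carrier V" if "i \<in> insert j J" for i using f insert.prems that unfolding tb_def by blast
      then have "finsum V f (insert j J) = f j \<oplus> finsum V f J"
        using insert.hyps by (intro finsum_insert) auto
      then show "\<exists>x y. finsum V f (insert j J) = x \<oplus> y \<and> x \<in> X j \<and> y \<in> {finsum V f J | f. \<forall>i\<in>J. f i \<in> X i}"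
        using f by blast
    qed
  qed
qed

lemma tb_imp_mtotally_bounded: assumes "tb X" shows "met.mtotally_bounded X"
  unfolding met.mtotally_bounded_def
proof (intro allI impI)
  have X: "X \<subseteq> carrier V" using assms by (simp add: tb_def)
  fix e :: real assume e: "e > 0"
  obtain Y where Y: "finite Y" "Y \<subseteq> carrier V" "\<And>y. y \<in> X \<Longrightarrow> \<exists>z\<in>Y. N (y \<ominus> z) < e/2"
    using tbD[OF assms(1), of "e/2"] e by auto
  \<comment> \<open>Replaces a centre by a point of X near it, which doubles the radius; centres
    with no point of X nearby are discarded.\<close>
  define p where "p y = (SOME x. x \<in> X \<and> N (x \<ominus> y) < e/2)" for y
  show "\<exists>K. finite K \<and> K \<subseteq> X \<and> X \<subseteq> (\<Union>x\<in>K. met.mball x e)"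
  proof (intro exI[of _ "p ` {y \<in> Y. \<exists>x. x \<in> X \<and> N (x \<ominus> y) < e/2}"] conjI)
    show "p ` {y \<in> Y. \<exists>x. x \<in> X \<and> N (x \<ominus> y) < e/2} \<subseteq> X"
      unfolding p_def by (auto dest!: someI_ex)
    show "X \<subseteq> (\<Union>x\<in>p ` {y \<in> Y. \<exists>x. x \<in> X \<and> N (x \<ominus> y) < e/2}. met.mball x e)"
    proof
      fix x assume x: "x \<in> X"
      obtain y where y: "y \<in> Y" "N (x \<ominus> y) < e/2" using Y(3)[OF x] by blast
      have p: "p y \<in> X \<and> N (p y \<ominus> y) < e/2" unfolding p_def by (rule someI[of _ x]) (use x y in simp)
      have c: "x \<in> carrier V" "p y \<in> carrier V" "y \<in> carrier V" using x p y X Y(2) by blast+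
      have "N (p y \<ominus> x) \<le> N (p y \<ominus> y) + N (y \<ominus> x)" by (rule nrm_diff_triangle[OF c(2,3,1)])
      also have "N (y \<ominus> x) = N (x \<ominus> y)" by (rule nrm_minus_commute[OF c(3,1)])
      finally have "N (p y \<ominus> x) < e" using p y(2) by simp
      then have "x \<in> met.mball (p y) e" using c by (simp add: ndist_def)
      then show "x \<in> (\<Union>x\<in>p ` {y \<in> Y. \<exists>x. x \<in> X \<and> N (x \<ominus> y) < e/2}. met.mball x e)"
        using x y by blast
    qed
  qed (use Y in simp)
qed

lemma tb_compact_closure: assumes "met.mcomplete" "tb X" shows "compactin met.mtopology (met.mtopology closure_of X)"
  using tb_imp_mtotally_bounded[OF assms(2)] met.mtotally_bounded_eq_compact_closure_of[OF assms(1)] by blast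

lemma tb_subseq:
  assumes "met.mcomplete" "tb X" "\<And>n. x n \<in> X"
  obtains r l where "strict_mono (r :: nat \<Rightarrow> nat)" "conv (\<lambda>n. x (r n)) l"
proof -
  obtain r where r: "strict_mono (r :: nat \<Rightarrow> nat)" "met.MCauchy (x \<circ> r)"
    using tb_imp_mtotally_bounded[OF assms(2)] assms(3) unfolding met.mtotally_bounded_sequentially by blast
  then obtain l where l: "limitin met.mtopology (x \<circ> r) l sequentially"
    using assms(1) met.mcomplete_def by blast
  have xc: "x n \<in> carrier V" for n using assms(2,3) unfolding tb_def by blast
  have "conv (\<lambda>n. x (r n)) l"
    using l xc unfolding met.limitin_metric_dist_null conv_def by (auto simp: ndist_def o_def)
  with r show thesis using that by blast
qed

lemma nrm_finsum_le: "finite J \<Longrightarrow> (\<And>i. i \<in> J \<Longrightarrow> f i \<in> carrier V) \<Longrightarrow> N (finsum V f J) \<le> (\<Sum>i\<in>J. N (f i))"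
proof (induction J rule: finite_induct)
  case (insert j J)
  have "finsum V f (insert j J) = f j \<oplus> finsum V f J" using insert by (intro finsum_insert) auto
  moreover have "N (f j \<oplus> finsum V f J) \<le> N (f j) + N (finsum V f J)" using insert by (intro nrm_triangle finsum_closed) auto
  ultimately show ?case using insert by simp
qed simp

end

lemma linear_finsum:
  assumes "cnormed V N" "cnormed W N'" "T \<in> linear_maps V W"
  shows "finite J \<Longrightarrow> (\<And>i. i \<in> J \<Longrightarrow> f i \<in> carrier V) \<Longrightarrow> T (finsum V f J) = finsum W (\<lambda>i. T (f i)) J"
proof (induction J rule: finite_induct)
  case empty
  interpret V: cnormed V N by fact
  interpret W: cnormed W N' by fact
  show ?case using linear_maps_zero[OF assms] by simp
next
  case (insert j J)
  interpret V: cnormed V N by fact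
  interpret W: cnormed W N' by fact
  note T = linear_mapsD[OF assms(3)]
  have "finsum V f (insert j J) = f j \<oplus>\<^bsub>V\<^esub> finsum V f J" using insert by (intro V.finsum_insert) auto
  moreover have "finsum W (\<lambda>i. T (f i)) (insert j J) = T (f j) \<oplus>\<^bsub>W\<^esub> finsum W (\<lambda>i. T (f i)) J"
    using insert T(1) by (intro W.finsum_insert) auto
  moreover have "T (f j \<oplus>\<^bsub>V\<^esub> finsum V f J) = T (f j) \<oplus>\<^bsub>W\<^esub> T (finsum V f J)"
    using insert by (intro T(2) V.finsum_closed) auto
  ultimately show ?case using insert by simp
qed

lemma tb_image:
  assumes V: "cnormed V N" and W: "cnormed W N'" and T: "T \<in> linear_maps V W"
    and C: "\<And>v. v \<in> carrier V \<Longrightarrow> N' (T v) \<le> C * N v" and X: "cnormed.tb V N X"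
  shows "cnormed.tb W N' (T ` X)"
proof -
  interpret V: cnormed V N by fact
  interpret W: cnormed W N' by fact
  have Xc: "X \<subseteq> carrier V" using X by (simp add: V.tb_def)
  show ?thesis unfolding W.tb_def
  proof (intro conjI allI impI)
    show "T ` X \<subseteq> carrier W" using Xc linear_mapsD(1)[OF T] by blast
    fix e :: real assume e: "e > 0"
    then have "e / (\<bar>C\<bar> + 1) > 0" by (simp add: add_nonneg_pos)
    then obtain Y where Y: "finite Y" "Y \<subseteq> carrier V" "\<And>y. y \<in> X \<Longrightarrow> \<exists>z\<in>Y. N (y \<ominus>\<^bsub>V\<^esub> z) < e / (\<bar>C\<bar> + 1)"
      using V.tbD[OF X] by metis
    show "\<exists>Y. finite Y \<and> Y \<subseteq> carrier W \<and> (\<forall>x\<in>T ` X. \<exists>y\<in>Y. N' (x \<ominus>\<^bsub>W\<^esub> y) < e)"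
    proof (intro exI[of _ "T ` Y"] conjI ballI)
      fix z assume "z \<in> T ` X"
      then obtain x where x: "z = T x" "x \<in> X" by blast
      obtain y where y: "y \<in> Y" "N (x \<ominus>\<^bsub>V\<^esub> y) < e / (\<bar>C\<bar> + 1)" using Y(3)[OF x(2)] by blast
      have c: "x \<in> carrier V" "y \<in> carrier V" using x y Xc Y by blast+
      have "N' (T x \<ominus>\<^bsub>W\<^esub> T y) \<le> C * N (x \<ominus>\<^bsub>V\<^esub> y)"
        using C[OF V.minus_closed[OF c]] unfolding linear_maps_minus[OF V W T c] .
      also have "\<dots> \<le> (\<bar>C\<bar> + 1) * N (x \<ominus>\<^bsub>V\<^esub> y)"
        using V.nrm_nonneg[OF V.minus_closed[OF c]] by (intro mult_right_mono) simp_all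
      also have "\<dots> < e" using y(2) by (simp add: less_divide_eq add_nonneg_pos mult.commute)
      finally show "\<exists>y\<in>T ` Y. N' (z \<ominus>\<^bsub>W\<^esub> y) < e" using x(1) y(1) by blast
    qed (use Y linear_mapsD(1)[OF T] in auto)
  qed
qed

section \<open>Finite-dimensional Hilbert spaces\<close>

context hilbert_space
begin

definition orthonormal :: "'h set \<Rightarrow> bool" where
  "orthonormal B \<longleftrightarrow> B \<subseteq> carrier H \<and> (\<forall>a\<in>B. \<forall>b\<in>B. inner H a b = (if a = b then 1 else 0))"

definition expand :: "'h set \<Rightarrow> 'h \<Rightarrow> 'h" where
  "expand B v = finsum H (\<lambda>b. inner H b v \<odot>\<^bsub>H\<^esub> b) B"

text \<open>Spanning is encoded as reproduction of every vector by \<open>expand\<close>, the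
  orthogonal projection onto the span of B, since bases are used only through their expansion
  formula.\<close>

definition onb :: "'h set \<Rightarrow> bool" where
  "onb B \<longleftrightarrow> finite B \<and> orthonormal B \<and> (\<forall>v\<in>carrier H. expand B v = v)"

lemma expand_closed: "B \<subseteq> carrier H \<Longrightarrow> expand B v \<in> carrier H"
  unfolding expand_def by (rule nrm.finsum_closed) auto

lemma inner_expand: "finite B \<Longrightarrow> B \<subseteq> carrier H \<Longrightarrow> w \<in> carrier H \<Longrightarrow>
    inner H w (expand B v) = (\<Sum>b\<in>B. inner H b v * inner H w b)"
  unfolding expand_def by (subst inner_finsum) (auto simp: inner_smult subset_iff intro!: sum.cong)

lemma inner_expand_member: assumes "finite B" "orthonormal B" "b \<in> B"
  shows "inner H b (expand B v) = inner H b v"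
proof -
  have "inner H b (expand B v) = (\<Sum>c\<in>B. inner H c v * inner H b c)"
    using assms by (intro inner_expand) (auto simp: orthonormal_def)
  also have "\<dots> = (\<Sum>c\<in>B. if b = c then inner H c v else 0)"
    using assms by (intro sum.cong refl) (auto simp: orthonormal_def)
  finally show ?thesis using assms by simp
qed

text \<open>Replaces a vector equation by scalar equations that are linear in v, so that closure of
  the fixed points of \<open>expand\<close> under the module operations becomes arithmetic of
  sums.\<close>

lemma expand_iff:
  assumes "finite B" "B \<subseteq> carrier H" "v \<in> carrier H"
  shows "expand B v = v \<longleftrightarrow> (\<forall>w\<in>carrier H. inner H w v = (\<Sum>b\<in>B. inner H b v * inner H w b))"
proof
  assume *: "\<forall>w\<in>carrier H. inner H w v = (\<Sum>b\<in>B. inner H b v * inner H w b)"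
  show "expand B v = v"
    by (rule inner_eqI[OF expand_closed[OF assms(2)] assms(3)])
       (rule trans[OF inner_expand[OF assms(1,2)] bspec[OF *, symmetric]])
next
  assume *: "expand B v = v"
  show "\<forall>w\<in>carrier H. inner H w v = (\<Sum>b\<in>B. inner H b v * inner H w b)"
  proof
    fix w assume "w \<in> carrier H"
    from inner_expand[OF assms(1,2) this, of v, unfolded *]
    show "inner H w v = (\<Sum>b\<in>B. inner H b v * inner H w b)" .
  qed
qed

lemma expand_submodule:
  assumes B: "finite B" "B \<subseteq> carrier H"
  shows "LinearCombinations.submodule class_ring {v \<in> carrier H. expand B v = v} H"
proof (rule nrm.submoduleI)
  have Bc: "b \<in> carrier H" if "b \<in> B" for b using that B by blast
  have *: "{v \<in> carrier H. expand B v = v} = {v \<in> carrier H. \<forall>w\<in>carrier H. inner H w v = (\<Sum>b\<in>B. inner H b v * inner H w b)}"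
    using expand_iff[OF B] by blast
  show "\<zero> \<in> {v \<in> carrier H. expand B v = v}" unfolding * by (simp add: Bc)
  have D: "x \<in> carrier H" "\<And>w. w \<in> carrier H \<Longrightarrow> (\<Sum>b\<in>B. inner H b x * inner H w b) = inner H w x"
    if "x \<in> {v \<in> carrier H. expand B v = v}" for x
    using that inner_expand[OF B, of _ x] by simp_all
  fix x assume x: "x \<in> {v \<in> carrier H. expand B v = v}"
  show "c \<odot>\<^bsub>H\<^esub> x \<in> {v \<in> carrier H. expand B v = v}" for c
    unfolding * using D(1)[OF x] by (simp add: Bc inner_smult mult.assoc sum_distrib_left[symmetric] D(2)[OF x])
  fix y assume y: "y \<in> {v \<in> carrier H. expand B v = v}"
  show "x \<oplus> y \<in> {v \<in> carrier H. expand B v = v}"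
    unfolding * using D(1)[OF x] D(1)[OF y]
    by (simp add: Bc inner_add sum.distrib distrib_right D(2)[OF x] D(2)[OF y])
qed auto

text \<open>Gram-Schmidt carried out inside a submodule W. With W the whole space it gives
  orthonormal bases; with W the range of \<open>T - i\<close> it gives the projection onto that
  range in \<open>End_sa_resolvent\<close>.\<close>

lemma orthonormalize:
  assumes "finite A" and W: "LinearCombinations.submodule class_ring W H" and "A \<subseteq> W"
  shows "\<exists>B. finite B \<and> B \<subseteq> W \<and> orthonormal B \<and> (\<forall>a\<in>A. expand B a = a)"
  using assms(1,3)
proof (induction A rule: finite_induct)
  case empty
  show ?case by (intro exI[of _ "{}"]) (simp add: orthonormal_def)
next
  case (insert a A)
  then obtain B where B: "finite B" "B \<subseteq> W" "orthonormal B" "\<forall>a\<in>A. expand B a = a" by auto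
  have Wc: "W \<subseteq> carrier H" using LinearCombinations.submodule.subset[OF W] .
  have Wm: "x \<in> W \<Longrightarrow> y \<in> W \<Longrightarrow> x \<oplus> y \<in> W" "x \<in> W \<Longrightarrow> c \<odot>\<^bsub>H\<^esub> x \<in> W" "\<zero> \<in> W" for x y c
    using LinearCombinations.submodule.m_closed[OF W] LinearCombinations.submodule.smult_closed[OF W]
      LinearCombinations.submodule.zero_closed[OF W] by simp_all
  have Bc: "B \<subseteq> carrier H" using B(2) Wc by blast
  have aW: "a \<in> W" "a \<in> carrier H" using insert.prems Wc by blast+
  have eW: "expand B a \<in> W"
  proof -
    have "finite X \<Longrightarrow> X \<subseteq> B \<Longrightarrow> finsum H (\<lambda>b. inner H b a \<odot>\<^bsub>H\<^esub> b) X \<in> W" for X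
    proof (induction X rule: finite_induct)
      case (insert x X)
      then show ?case using Bc B(2) by (subst nrm.finsum_insert) (auto intro!: Wm)
    qed (simp add: Wm)
    then show ?thesis unfolding expand_def using B(1) by simp
  qed
  have ec: "expand B a \<in> carrier H" using eW Wc by blast
  define r where "r = a \<ominus> expand B a"
  have r: "r \<in> W" "r \<in> carrier H"
    using aW eW ec by (simp_all add: r_def nrm.minus_sm Wm)
  have br: "inner H b r = 0" if "b \<in> B" for b
    using that Bc aW ec inner_expand_member[OF B(1,3) that, of a] by (simp add: r_def inner_minus subset_iff)
  show ?case
  proof (cases "r = \<zero>")
    case True
    \<comment> \<open>A vector already in the span of B adds nothing, so linear independence of A is
      not assumed.\<close>
    then have "a = expand B a" using nrm.minus_eq_zero[OF aW(2) ec] unfolding r_def by blast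
    then show ?thesis using B by auto
  next
    case False
    define n where "n = hnorm H r"
    have n: "n > 0" using False nrm.nrm_definite[OF r(2)] hnorm_nonneg[OF r(2)] unfolding n_def by fastforce
    define u where "u = complex_of_real (1 / n) \<odot>\<^bsub>H\<^esub> r"
    have u: "u \<in> W" "u \<in> carrier H" using r by (simp_all add: u_def Wm)
    have bu: "inner H b u = 0" "inner H u b = 0" if "b \<in> B" for b
    proof -
      have "b \<in> carrier H" using that Bc by blast
      then show "inner H b u = 0" using br[OF that] r by (simp add: u_def inner_smult)
      then show "inner H u b = 0" using inner_commute[of u b] u \<open>b \<in> carrier H\<close> by simp
    qed
    have uu: "inner H u u = 1"
    proof -
      have "inner H r r = complex_of_real (n\<^sup>2)" by (simp only: inner_self[OF r(2)] n_def)
      then show ?thesis using n r by (simp add: u_def inner_smult inner_smult_left power2_eq_square)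
    qed
    have uB: "u \<notin> B" using bu(1)[of u] uu by auto
    have uX: "inner H u (expand B x) = 0" for x
      using inner_expand[OF B(1) Bc u(2), of x] bu by simp
    have ex: "expand (insert u B) x = inner H u x \<odot>\<^bsub>H\<^esub> u \<oplus> expand B x" for x
      unfolding expand_def using B(1) uB u Bc by (intro nrm.finsum_insert) auto
    have "expand (insert u B) a = a"
    proof -
      have "inner H u a = inner H u r"
        using u aW ec uX[of a] by (simp add: r_def inner_minus)
      also have "\<dots> = complex_of_real n"
        using r n by (simp add: u_def inner_smult_left inner_self n_def[symmetric] power2_eq_square)
      finally have "inner H u a \<odot>\<^bsub>H\<^esub> u = r" using r n by (simp add: u_def)
      then show ?thesis unfolding ex using nrm.add_diff[OF aW(2) ec] ec r(2) by (simp add: r_def nrm.a_comm)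
    qed
    moreover have "expand (insert u B) x = x" if "x \<in> A" for x
    proof -
      have xB: "expand B x = x" and xc: "x \<in> carrier H" using that B(4) insert.prems Wc by blast+
      then have "inner H u x = 0" using uX[of x] by simp
      then show ?thesis unfolding ex using xB xc u by simp
    qed
    moreover have "orthonormal (insert u B)"
      using B(3) u(2) bu uu uB unfolding orthonormal_def by auto
    ultimately show ?thesis using B u by (intro exI[of _ "insert u B"]) auto
  qed
qed

lemma onb_exists:
  assumes "vectorspace.fin_dim class_ring H" obtains B where "onb B"
proof -
  obtain A where A: "finite A" "A \<subseteq> carrier H" "LinearCombinations.module.span class_ring H A = carrier H"
    using assms unfolding vectorspace.fin_dim_def[OF vectorspace] by blast
  have "LinearCombinations.submodule class_ring (carrier H) H"
    by (rule nrm.submoduleI) auto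
  from orthonormalize[OF A(1) this A(2)]
  obtain B where B: "finite B" "B \<subseteq> carrier H" "orthonormal B" "\<forall>a\<in>A. expand B a = a" by blast
  have "A \<subseteq> {v \<in> carrier H. expand B v = v}" using A B by blast
  from module.span_is_subset[OF H_mod this expand_submodule[OF B(1,2)]]
  have "\<forall>v\<in>carrier H. expand B v = v" using A(3) by blast
  then show thesis using that B unfolding onb_def by blast
qed

lemma onbD: assumes "onb B"
  shows "finite B" "orthonormal B" "B \<subseteq> carrier H" "b \<in> B \<Longrightarrow> b \<in> carrier H" "v \<in> carrier H \<Longrightarrow> expand B v = v"
    "v \<in> carrier H \<Longrightarrow> w \<in> carrier H \<Longrightarrow> inner H w v = (\<Sum>b\<in>B. inner H b v * inner H w b)"
  using assms inner_expand[of B w v] unfolding onb_def orthonormal_def by auto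

lemma onb_norm1: "onb B \<Longrightarrow> b \<in> B \<Longrightarrow> hnorm H b = 1"
  unfolding onb_def orthonormal_def hnorm_def by simp

text \<open>Cauchy-Schwarz bounds each of the finitely many coordinates by C, so the ball lies in a
  finite sum of discs.\<close>

lemma tb_ball: assumes "onb B" shows "nrm.tb {v \<in> carrier H. hnorm H v \<le> C}"
proof (rule nrm.tb_subset)
  note B = onbD[OF assms]
  show "nrm.tb {finsum H f B | f. \<forall>b\<in>B. f b \<in> {c \<odot>\<^bsub>H\<^esub> b | c. cmod c \<le> C}}"
    by (intro nrm.tb_finsum nrm.tb_scale B(1) B(4))
  show "{v \<in> carrier H. hnorm H v \<le> C} \<subseteq> {finsum H f B | f. \<forall>b\<in>B. f b \<in> {c \<odot>\<^bsub>H\<^esub> b | c. cmod c \<le> C}}"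
  proof safe
    fix v assume v: "v \<in> carrier H" "hnorm H v \<le> C"
    have "cmod (inner H b v) \<le> C" if "b \<in> B" for b
      using Cauchy_Schwarz[OF B(4)[OF that] v(1)] onb_norm1[OF assms that] v(2) by simp
    then show "\<exists>f. v = finsum H f B \<and> (\<forall>b\<in>B. f b \<in> {c \<odot>\<^bsub>H\<^esub> b | c. cmod c \<le> C})"
      using B(5)[OF v(1)] unfolding expand_def by (intro exI[of _ "\<lambda>b. inner H b v \<odot>\<^bsub>H\<^esub> b"]) auto
  qed
qed

end

lemma linear_bounded_fin_dim:
  assumes "hilbert_space S" "hilbert_space K" "hilbert_space.onb S B" "T \<in> linear_maps S K"
  shows "T \<in> bounded_ops S K"
proof -
  interpret S: hilbert_space S by fact
  interpret K: hilbert_space K by fact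
  note B = S.onbD[OF assms(3)]
  note T = linear_mapsD[OF assms(4)]
  show ?thesis
  proof (rule bounded_opsI[OF assms(4)])
    fix v assume v: "v \<in> carrier S"
    have "T v = T (finsum S (\<lambda>b. inner S b v \<odot>\<^bsub>S\<^esub> b) B)" using B(5)[OF v] unfolding S.expand_def by simp
    also have "\<dots> = finsum K (\<lambda>b. T (inner S b v \<odot>\<^bsub>S\<^esub> b)) B"
      by (rule linear_finsum[OF S.nrm.cnormed_axioms K.nrm.cnormed_axioms assms(4) B(1)]) (simp add: B(4))
    finally have "hnorm K (T v) \<le> (\<Sum>b\<in>B. hnorm K (T (inner S b v \<odot>\<^bsub>S\<^esub> b)))"
      using K.nrm.nrm_finsum_le[OF B(1), of "\<lambda>b. T (inner S b v \<odot>\<^bsub>S\<^esub> b)"] T(1) B(4) by simp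
    also have "\<dots> \<le> (\<Sum>b\<in>B. hnorm K (T b) * hnorm S v)"
    proof (rule sum_mono)
      fix b assume b: "b \<in> B"
      have "hnorm K (T (inner S b v \<odot>\<^bsub>S\<^esub> b)) = cmod (inner S b v) * hnorm K (T b)"
        using T B(4)[OF b] by (simp add: K.hnorm_smult)
      also have "\<dots> \<le> hnorm S v * hnorm K (T b)"
        using S.Cauchy_Schwarz[OF B(4)[OF b] v] S.onb_norm1[OF assms(3) b] K.hnorm_nonneg[OF T(1)[OF B(4)[OF b]]]
        by (intro mult_right_mono) simp_all
      finally show "hnorm K (T (inner S b v \<odot>\<^bsub>S\<^esub> b)) \<le> hnorm K (T b) * hnorm S v" by (simp add: mult.commute)
    qed
    finally show "hnorm K (T v) \<le> (\<Sum>b\<in>B. hnorm K (T b)) * hnorm S v" by (simp add: sum_distrib_right)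
  qed
qed

section \<open>Spectrum and resolvent of a selfadjoint endomorphism\<close>

lemma End_saD:
  assumes "T \<in> End_sa S"
  shows "T \<in> linear_maps S S" "v \<in> carrier S \<Longrightarrow> w \<in> carrier S \<Longrightarrow> inner S (T v) w = inner S v (T w)"
    "v \<in> carrier S \<Longrightarrow> T v \<in> carrier S" "T \<in> extensional (carrier S)"
  using assms linear_mapsD(1)[of T S S] by (simp_all add: End_sa_def)

context hilbert_space
begin

lemma eigenvalue_in_spectrum:
  assumes T: "T \<in> linear_maps H H" and v: "v \<in> carrier H" "v \<noteq> \<zero>" "T v = z \<odot>\<^bsub>H\<^esub> v"
  shows "z \<in> spectrum H T"
proof -
  have T0: "T \<zero> = \<zero>" by (rule linear_maps_zero[OF nrm.cnormed_axioms nrm.cnormed_axioms T])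
  have "T v \<ominus> z \<odot>\<^bsub>H\<^esub> v = T \<zero> \<ominus> z \<odot>\<^bsub>H\<^esub> \<zero>" using v by (simp add: T0)
  then have "\<not> inj_on (\<lambda>v. T v \<ominus> z \<odot>\<^bsub>H\<^esub> v) (carrier H)"
    using v inj_onD[of "\<lambda>v. T v \<ominus> z \<odot>\<^bsub>H\<^esub> v" "carrier H" v \<zero>] by blast
  then show ?thesis by (auto simp: spectrum_def bij_betw_def)
qed

text \<open>The minimum \<open>\<mu>\<close> of \<open>|T u|\<close> over the unit sphere is attained at some u, and then
  \<open>T\<^sup>2 u = \<mu>\<^sup>2 u\<close>, so that \<open>\<mu>\<close> or \<open>-\<mu>\<close> is an eigenvalue of T.\<close>

lemma lower_bound_off_spectrum:
  assumes B: "onb B" and T: "T \<in> End_sa H"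
    and sp: "spectrum H T \<inter> complex_of_real ` {-R..R} = {}" and s: "s \<in> carrier H"
  shows "R * hnorm H s \<le> hnorm H (T s)"
proof (rule ccontr)
  assume "\<not> ?thesis"
  then have lt: "hnorm H (T s) < R * hnorm H s" by simp
  note TS = End_saD[OF T]
  note Tl = linear_mapsD[OF TS(1)]
  have sn: "hnorm H s > 0"
    using lt hnorm_nonneg[OF TS(3)[OF s]] hnorm_nonneg[OF s] by (cases "hnorm H s = 0") simp_all
  define N1 where "N1 = {hnorm H (T u) | u. u \<in> carrier H \<and> hnorm H u = 1}"
  define \<mu> where "\<mu> = Inf N1"
  have nrmz: "hnorm H (T v) / hnorm H v \<in> N1" if v: "v \<in> carrier H" "hnorm H v > 0" for v
  proof -
    let ?u = "complex_of_real (1 / hnorm H v) \<odot>\<^bsub>H\<^esub> v"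
    have "?u \<in> carrier H" "hnorm H ?u = 1" "hnorm H (T ?u) = hnorm H (T v) / hnorm H v"
      using v Tl by (simp_all add: hnorm_smult norm_divide)
    then show ?thesis unfolding N1_def by (intro CollectI exI[of _ ?u]) simp
  qed
  have bdd: "bdd_below N1" unfolding N1_def by (rule bdd_belowI[of _ 0]) (use hnorm_nonneg TS(3) in auto)
  have ne: "N1 \<noteq> {}" using nrmz[OF s sn] by blast
  have \<mu>0: "0 \<le> \<mu>" unfolding \<mu>_def
    by (rule cInf_greatest[OF ne]) (use hnorm_nonneg TS(3) in \<open>auto simp: N1_def\<close>)
  have "\<mu> \<le> hnorm H (T s) / hnorm H s" unfolding \<mu>_def by (rule cInf_lower[OF nrmz[OF s sn] bdd])
  also have "\<dots> < R" using lt sn by (simp add: pos_divide_less_eq)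
  finally have \<mu>R: "\<mu> < R" .
  have lower: "\<mu> * hnorm H v \<le> hnorm H (T v)" if v: "v \<in> carrier H" for v
  proof (cases "hnorm H v = 0")
    case False
    then have "hnorm H v > 0" using hnorm_nonneg[OF v] by simp
    then show ?thesis using cInf_lower[OF nrmz[OF v] bdd] unfolding \<mu>_def by (simp add: pos_le_divide_eq)
  qed (use hnorm_nonneg TS(3) v in simp)
  have "\<exists>u. u \<in> carrier H \<and> hnorm H u = 1 \<and> hnorm H (T u) < \<mu> + 1 / Suc n" for n
  proof -
    have "Inf N1 < \<mu> + 1 / Suc n" by (simp add: \<mu>_def)
    from cInf_lessD[OF ne this] show ?thesis unfolding N1_def by blast
  qed
  \<comment> \<open>A minimizing sequence on the unit sphere; total boundedness of the ball gives a
    subsequence converging to a minimizer w.\<close>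
  then obtain u where u: "\<And>n. u n \<in> carrier H" "\<And>n. hnorm H (u n) = 1" "\<And>n. hnorm H (T (u n)) < \<mu> + 1 / Suc n" by metis
  obtain r w where r: "strict_mono (r :: nat \<Rightarrow> nat)" and cw: "nrm.conv (\<lambda>n. u (r n)) w"
  proof (rule nrm.tb_subseq[OF mcompl tb_ball[OF B, of 1], of u])
    show "u n \<in> {v \<in> carrier H. hnorm H v \<le> 1}" for n using u by simp
  qed
  have wc: "w \<in> carrier H" using cw by (simp add: nrm.conv_def)
  have w1: "hnorm H w = 1" using nrm.conv_nrm[OF cw] u(2) by (simp add: LIMSEQ_const_iff)
  obtain C where C: "\<And>v. v \<in> carrier H \<Longrightarrow> hnorm H (T v) \<le> C * hnorm H v"
    using bounded_opsD(2)[OF linear_bounded_fin_dim[OF hilbert_space_axioms hilbert_space_axioms B TS(1)]] by blast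
  have cT: "nrm.conv (\<lambda>n. T (u (r n))) (T w)"
    by (rule conv_linear[OF nrm.cnormed_axioms nrm.cnormed_axioms TS(1) C cw])
  have "hnorm H (T w) \<le> \<mu>"
  proof (rule nrm.conv_limit_le[OF cT])
    show "hnorm H (T (u (r n))) \<le> \<mu> + 1 / Suc n" for n
    proof -
      have "hnorm H (T (u (r n))) \<le> \<mu> + 1 / Suc (r n)" using u(3)[of "r n"] by simp
      also have "\<dots> \<le> \<mu> + 1 / Suc n" using seq_suble[OF r, of n] by (simp add: frac_le)
      finally show ?thesis .
    qed
    have "(\<lambda>n. \<mu> + 1 / Suc n) \<longlonglongrightarrow> \<mu> + 0"
      using LIMSEQ_inverse_real_of_nat by (intro tendsto_add tendsto_const) (simp add: inverse_eq_divide)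
    then show "(\<lambda>n. \<mu> + 1 / Suc n) \<longlonglongrightarrow> \<mu>" by simp
  qed
  then have Tw: "hnorm H (T w) = \<mu>" using lower[OF wc] w1 by simp
  have Twc: "T w \<in> carrier H" "T (T w) \<in> carrier H" using TS(3) wc by simp_all
  \<comment> \<open>Up to a factor this is the gradient at w of the nonnegative form
    \<open>|T v|^2 - \<mu>^2 * |v|^2\<close>. The form vanishes at w, so w minimizes it and y must
    be zero.\<close>
  define y where "y = T (T w) \<ominus> complex_of_real (\<mu>\<^sup>2) \<odot>\<^bsub>H\<^esub> w"
  have yc: "y \<in> carrier H" "T y \<in> carrier H" using Twc wc TS(3) by (simp_all add: y_def)
  define q where "q = (hnorm H (T y))\<^sup>2 - \<mu>\<^sup>2 * (hnorm H y)\<^sup>2"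
  have k: "inner H (T w) (T y) - complex_of_real (\<mu>\<^sup>2) * inner H w y = complex_of_real ((hnorm H y)\<^sup>2)"
  proof -
    have "inner H y y = inner H (T (T w)) y - complex_of_real (\<mu>\<^sup>2) * inner H w y"
      using yc wc Twc by (subst (1) y_def) (simp add: inner_minus_left inner_smult_left)
    then show ?thesis using TS(2)[OF Twc(1) yc(1)] inner_self[OF yc(1)] by simp
  qed
  \<comment> \<open>The form evaluated at \<open>w - t * y\<close>: its linear term in t is
    \<open>-2 * |y|^2\<close> and its quadratic coefficient is q. After division by t, letting t
    tend to zero forces \<open>y = 0\<close>.\<close>
  have quad: "2 * (hnorm H y)\<^sup>2 \<le> t * q" if t: "t > 0" for t
  proof -
    let ?c = "complex_of_real (-t)"
    let ?v = "w \<oplus> ?c \<odot>\<^bsub>H\<^esub> y"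
    have v: "?v \<in> carrier H" using wc yc by simp
    have "(\<mu> * hnorm H ?v)\<^sup>2 \<le> (hnorm H (T ?v))\<^sup>2"
      by (rule power_mono[OF lower[OF v] mult_nonneg_nonneg[OF \<mu>0 hnorm_nonneg[OF v]]])
    moreover have "T ?v = T w \<oplus> ?c \<odot>\<^bsub>H\<^esub> T y" using Tl wc yc by simp
    moreover have "(hnorm H ?v)\<^sup>2 = 1 - 2 * t * Re (inner H w y) + t\<^sup>2 * (hnorm H y)\<^sup>2"
      using wc yc t w1 by (simp add: hnorm_add_sq hnorm_smult inner_smult power_mult_distrib)
    moreover have "(hnorm H (T w \<oplus> ?c \<odot>\<^bsub>H\<^esub> T y))\<^sup>2 = \<mu>\<^sup>2 - 2 * t * Re (inner H (T w) (T y)) + t\<^sup>2 * (hnorm H (T y))\<^sup>2"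
      using Twc yc t Tw by (simp add: hnorm_add_sq hnorm_smult inner_smult power_mult_distrib)
    moreover have "Re (inner H (T w) (T y)) = (hnorm H y)\<^sup>2 + \<mu>\<^sup>2 * Re (inner H w y)"
      using arg_cong[OF k, of Re] by simp
    ultimately have "\<mu>\<^sup>2 * (1 - 2 * t * Re (inner H w y) + t\<^sup>2 * (hnorm H y)\<^sup>2)
        \<le> \<mu>\<^sup>2 - 2 * t * ((hnorm H y)\<^sup>2 + \<mu>\<^sup>2 * Re (inner H w y)) + t\<^sup>2 * (hnorm H (T y))\<^sup>2"
      by (simp only: power_mult_distrib)
    then have "0 \<le> t * (t * q - 2 * (hnorm H y)\<^sup>2)"
      by (simp add: q_def algebra_simps power2_eq_square)
    then show ?thesis using t by (simp add: zero_le_mult_iff)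
  qed
  have "(hnorm H y)\<^sup>2 \<le> 0"
  proof (rule field_le_epsilon)
    fix e :: real assume e: "e > 0"
    have "2 * (hnorm H y)\<^sup>2 \<le> (e / (\<bar>q\<bar> + 1)) * q" by (rule quad) (use e in \<open>simp add: add_nonneg_pos\<close>)
    also have "\<dots> \<le> (e / (\<bar>q\<bar> + 1)) * (\<bar>q\<bar> + 1)" using e by (intro mult_left_mono) (simp_all add: add_nonneg_pos)
    also have "\<dots> = e" by simp
    finally show "(hnorm H y)\<^sup>2 \<le> 0 + e" using zero_le_power2[of "hnorm H y"] by linarith
  qed
  then have "y = \<zero>" using nrm.nrm_definite[OF yc(1)] by simp
  then have TT: "T (T w) = complex_of_real (\<mu>\<^sup>2) \<odot>\<^bsub>H\<^esub> w"
    unfolding y_def using nrm.minus_eq_zero[OF Twc(2) nrm.sm_closed[OF wc]] by blast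
  \<comment> \<open>Since \<open>(T - \<mu>) (T + \<mu>) w = 0\<close>, the vector x is an
    eigenvector for \<open>\<mu>\<close> unless it vanishes, and then w itself is one for
    \<open>-\<mu>\<close>.\<close>
  define x where "x = T w \<oplus> complex_of_real \<mu> \<odot>\<^bsub>H\<^esub> w"
  have xc: "x \<in> carrier H" using Twc wc by (simp add: x_def)
  have w0: "w \<noteq> \<zero>" using w1 by auto
  show False
  proof (cases "x = \<zero>")
    case True
    have "T w = (x \<ominus> complex_of_real \<mu> \<odot>\<^bsub>H\<^esub> w)"
      using Twc wc unfolding x_def by (subst nrm.a_comm) (simp_all add: nrm.add_diff2)
    also have "\<dots> = complex_of_real (- \<mu>) \<odot>\<^bsub>H\<^esub> w" using True wc by (simp add: nrm.minus_sm)
    finally have "complex_of_real (- \<mu>) \<in> spectrum H T" by (rule eigenvalue_in_spectrum[OF TS(1) wc w0])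
    moreover have "- \<mu> \<in> {-R..R}" using \<mu>0 \<mu>R by simp
    ultimately show False using sp by blast
  next
    case False
    have "T x = complex_of_real \<mu> \<odot>\<^bsub>H\<^esub> x"
      unfolding x_def using Tl TT Twc wc by (simp add: nrm.sm_radd power2_eq_square nrm.a_comm)
    then have "complex_of_real \<mu> \<in> spectrum H T" by (rule eigenvalue_in_spectrum[OF TS(1) xc False])
    moreover have "\<mu> \<in> {-R..R}" using \<mu>0 \<mu>R by simp
    ultimately show False using sp by blast
  qed
qed

text \<open>The inner product of \<open>T v\<close> with v is real, so the cross term with
  \<open>i v\<close> has no real part. This one identity gives injectivity of \<open>T - i\<close>
  and the norm bound for its inverse.\<close>

lemma hnorm_minus_i_sq:
  assumes T: "\<And>v w. v \<in> carrier H \<Longrightarrow> w \<in> carrier H \<Longrightarrow> inner H (T v) w = inner H v (T w)"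
    and v: "v \<in> carrier H" "T v \<in> carrier H"
  shows "(hnorm H (T v \<ominus> \<i> \<odot>\<^bsub>H\<^esub> v))\<^sup>2 = (hnorm H (T v))\<^sup>2 + (hnorm H v)\<^sup>2"
proof -
  have "inner H (T v) v = cnj (inner H (T v) v)" using T[OF v(1,1)] inner_commute[OF v(2,1)] by simp
  then have "Im (inner H (T v) v) = 0" by (simp add: complex_eq_iff)
  then show ?thesis using v by (simp add: hnorm_minus_sq inner_smult hnorm_smult)
qed

text \<open>The map \<open>T - i\<close> is bounded below by 1. It is onto because a vector r
  orthogonal to its range satisfies \<open><r, T r> = i * <r, r>\<close>, where the left side is
  real, whence \<open>r = 0\<close>.\<close>

lemma End_sa_resolvent:
  assumes B: "onb B" and T: "T \<in> End_sa H"
  obtains R where "R \<in> linear_maps H H" "\<And>v. v \<in> carrier H \<Longrightarrow> hnorm H (R v) \<le> hnorm H v"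
    "\<And>v. v \<in> carrier H \<Longrightarrow> T (R v) \<ominus> \<i> \<odot>\<^bsub>H\<^esub> R v = v"
proof -
  note TS = End_saD[OF T]
  note Tl = linear_mapsD[OF TS(1)]
  note B' = onbD[OF B]
  define P where "P v = T v \<ominus> \<i> \<odot>\<^bsub>H\<^esub> v" for v
  have P: "P \<in> linear_maps H H" unfolding P_def
    by (rule linear_maps_diff[OF nrm.cnormed_axioms TS(1)]) (rule linear_mapsI; simp add: nrm.sm_radd mult.commute)
  note Pl = linear_mapsD[OF P]
  have Pn: "hnorm H v \<le> hnorm H (P v)" if v: "v \<in> carrier H" for v
  proof (rule power2_le_imp_le)
    show "(hnorm H v)\<^sup>2 \<le> (hnorm H (P v))\<^sup>2" unfolding P_def using hnorm_minus_i_sq[OF TS(2) v TS(3)[OF v]] by simp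
  qed (rule hnorm_nonneg[OF Pl(1)[OF v]])
  have inj: "v = w" if vw: "v \<in> carrier H" "w \<in> carrier H" "P v = P w" for v w
  proof -
    have "P (v \<ominus> w) = \<zero>" using linear_maps_minus[OF nrm.cnormed_axioms nrm.cnormed_axioms P vw(1,2)] vw Pl(1) by simp
    then have "hnorm H (v \<ominus> w) = 0" using Pn[of "v \<ominus> w"] hnorm_nonneg[of "v \<ominus> w"] vw by simp
    then show ?thesis by (rule nrm.nrm_minus_eq_zero[OF vw(1,2)])
  qed
  have W: "LinearCombinations.submodule class_ring (P ` carrier H) H"
  proof (rule nrm.submoduleI)
    show "P ` carrier H \<subseteq> carrier H" using Pl(1) by blast
    show "\<zero> \<in> P ` carrier H" using linear_maps_zero[OF nrm.cnormed_axioms nrm.cnormed_axioms P] by force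
    show "x \<oplus> y \<in> P ` carrier H" if xy: "x \<in> P ` carrier H" "y \<in> P ` carrier H" for x y
    proof -
      obtain a b where "x = P a" "y = P b" "a \<in> carrier H" "b \<in> carrier H" using xy by blast
      then show ?thesis using Pl(2)[of a b] by (intro image_eqI[of _ _ "a \<oplus> b"]) simp_all
    qed
    show "c \<odot>\<^bsub>H\<^esub> x \<in> P ` carrier H" if xy: "x \<in> P ` carrier H" for c x
    proof -
      obtain a where "x = P a" "a \<in> carrier H" using xy by blast
      then show ?thesis using Pl(3)[of a c] by (intro image_eqI[of _ _ "c \<odot>\<^bsub>H\<^esub> a"]) simp_all
    qed
  qed
  have "P ` B \<subseteq> P ` carrier H" using B'(3) by blast
  from orthonormalize[OF finite_imageI[OF B'(1)] W this]
  obtain E where E: "finite E" "E \<subseteq> P ` carrier H" "orthonormal E" "\<forall>a\<in>P ` B. expand E a = a" by blast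
  have Ec: "E \<subseteq> carrier H" using E(3) by (simp add: orthonormal_def)
  have surj: "\<exists>u\<in>carrier H. P u = s" if s: "s \<in> carrier H" for s
  proof -
    have ec: "expand E s \<in> carrier H" by (rule expand_closed[OF Ec])
    \<comment> \<open>The residue of s after projection onto the range of P. It is orthogonal to P
      of every basis vector, hence by expansion also to \<open>P r\<close>.\<close>
    define r where "r = s \<ominus> expand E s"
    have rc: "r \<in> carrier H" using s ec by (simp add: r_def)
    have er: "inner H r e = 0" if "e \<in> E" for e
    proof -
      have "e \<in> carrier H" using that Ec by blast
      then have "inner H e r = 0" using s ec inner_expand_member[OF E(1,3) that] by (simp add: r_def inner_minus)
      then show ?thesis using inner_commute[OF rc \<open>e \<in> carrier H\<close>] by simp
    qed
    have rb: "inner H r (P b) = 0" if "b \<in> B" for b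
    proof -
      have "inner H r (P b) = inner H r (expand E (P b))" using E(4) that by simp
      also have "\<dots> = (\<Sum>e\<in>E. inner H e (P b) * inner H r e)" by (rule inner_expand[OF E(1) Ec rc])
      finally show ?thesis using er by simp
    qed
    have "P r = P (finsum H (\<lambda>b. inner H b r \<odot>\<^bsub>H\<^esub> b) B)" using B'(5)[OF rc] unfolding expand_def by simp
    also have "\<dots> = finsum H (\<lambda>b. P (inner H b r \<odot>\<^bsub>H\<^esub> b)) B"
      by (rule linear_finsum[OF nrm.cnormed_axioms nrm.cnormed_axioms P B'(1)]) (simp add: B'(4))
    finally have "inner H r (P r) = (\<Sum>b\<in>B. inner H r (P (inner H b r \<odot>\<^bsub>H\<^esub> b)))"
      using inner_finsum[OF B'(1) rc, of "\<lambda>b. P (inner H b r \<odot>\<^bsub>H\<^esub> b)"] Pl(1) B'(4) by simp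
    also have "\<dots> = 0" using rb Pl rc B'(4) by (intro sum.neutral) (simp add: inner_smult)
    finally have "inner H r (T r) = \<i> * inner H r r"
      using TS(3)[OF rc] rc by (simp add: P_def inner_minus inner_smult)
    moreover have "Im (inner H r (T r)) = 0"
      using inner_commute[OF rc TS(3)[OF rc]] TS(2)[OF rc rc] by (simp add: complex_eq_iff)
    ultimately have "Re (inner H r r) = 0" by simp
    then have "hnorm H r = 0" by (simp add: hnorm_def)
    then have "s = expand E s" unfolding r_def by (rule nrm.nrm_minus_eq_zero[OF s ec])
    moreover have "expand E s \<in> P ` carrier H"
    proof -
      have "finite X \<Longrightarrow> X \<subseteq> E \<Longrightarrow> finsum H (\<lambda>b. inner H b s \<odot>\<^bsub>H\<^esub> b) X \<in> P ` carrier H" for X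
      proof (induction X rule: finite_induct)
        case empty then show ?case using LinearCombinations.submodule.zero_closed[OF W] by simp
      next
        case (insert x X)
        then have "finsum H (\<lambda>b. inner H b s \<odot>\<^bsub>H\<^esub> b) (insert x X) = inner H x s \<odot>\<^bsub>H\<^esub> x \<oplus> finsum H (\<lambda>b. inner H b s \<odot>\<^bsub>H\<^esub> b) X"
          using Ec by (intro nrm.finsum_insert) auto
        moreover have "inner H x s \<odot>\<^bsub>H\<^esub> x \<in> P ` carrier H"
          using insert.prems E(2) LinearCombinations.submodule.smult_closed[OF W] by auto
        ultimately show ?case using insert LinearCombinations.submodule.m_closed[OF W] by simp
      qed
      then show ?thesis unfolding expand_def using E(1) by simp
    qed
    ultimately show ?thesis by auto
  qed
  define R where "R s = (SOME u. u \<in> carrier H \<and> P u = s)" for s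
  have R: "R s \<in> carrier H" "P (R s) = s" if "s \<in> carrier H" for s
    using someI_ex[of "\<lambda>u. u \<in> carrier H \<and> P u = s"] surj[OF that] unfolding R_def by blast+
  show thesis
  proof (rule that[of R])
    show "R \<in> linear_maps H H"
    proof (rule linear_mapsI)
      show "R (v \<oplus> w) = R v \<oplus> R w" if "v \<in> carrier H" "w \<in> carrier H" for v w
        by (rule inj) (use that R Pl in simp_all)
      show "R (c \<odot>\<^bsub>H\<^esub> v) = c \<odot>\<^bsub>H\<^esub> R v" if "v \<in> carrier H" for c v
        by (rule inj) (use that R Pl in simp_all)
    qed (rule R(1))
    show "hnorm H (R v) \<le> hnorm H v" if "v \<in> carrier H" for v using Pn[OF R(1)[OF that]] R(2)[OF that] by simp
    show "T (R v) \<ominus> \<i> \<odot>\<^bsub>H\<^esub> R v = v" if "v \<in> carrier H" for v using R(2)[OF that] unfolding P_def .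
  qed
qed

end

section \<open>Block-diagonal operators\<close>

lemma (in hilbert_space) graph_closure_iff:
  "(v, w) \<in> graph_closure H D \<longleftrightarrow> v \<in> carrier H \<and> w \<in> carrier H \<and>
     (\<forall>\<epsilon>>0. \<exists>(x, y)\<in>D. x \<in> carrier H \<and> y \<in> carrier H \<and> hnorm H (v \<ominus> x) < \<epsilon> \<and> hnorm H (w \<ominus> y) < \<epsilon>)"
proof
  assume L: "(v, w) \<in> graph_closure H D"
  have vw: "v \<in> carrier H" "w \<in> carrier H"
    using L closure_of_subset_topspace[of "prod_topology (htop H) (htop H)" D]
    unfolding graph_closure_def htop_eq by auto
  moreover have "\<exists>(x, y)\<in>D. x \<in> carrier H \<and> y \<in> carrier H \<and> hnorm H (v \<ominus> x) < \<epsilon> \<and> hnorm H (w \<ominus> y) < \<epsilon>"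
    if e: "\<epsilon> > 0" for \<epsilon>
  proof -
    let ?U = "nrm.met.mball v \<epsilon> \<times> nrm.met.mball w \<epsilon>"
    have "openin (prod_topology (htop H) (htop H)) ?U" "(v, w) \<in> ?U"
      using vw e unfolding htop_eq openin_prod_Times_iff by auto
    with L[unfolded graph_closure_def in_closure_of, THEN conjunct2, rule_format, of ?U]
    obtain p where p: "p \<in> D" "p \<in> ?U" by auto
    obtain x y where xy: "p = (x, y)" by (cases p)
    show ?thesis using p vw unfolding xy by (intro bexI[of _ "(x, y)"]) (auto simp: ndist_def)
  qed
  ultimately show "v \<in> carrier H \<and> w \<in> carrier H \<and>
     (\<forall>\<epsilon>>0. \<exists>(x, y)\<in>D. x \<in> carrier H \<and> y \<in> carrier H \<and> hnorm H (v \<ominus> x) < \<epsilon> \<and> hnorm H (w \<ominus> y) < \<epsilon>)" by blast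
next
  assume R: "v \<in> carrier H \<and> w \<in> carrier H \<and>
     (\<forall>\<epsilon>>0. \<exists>(x, y)\<in>D. x \<in> carrier H \<and> y \<in> carrier H \<and> hnorm H (v \<ominus> x) < \<epsilon> \<and> hnorm H (w \<ominus> y) < \<epsilon>)"
  show "(v, w) \<in> graph_closure H D"
    unfolding graph_closure_def in_closure_of
  proof (intro conjI allI impI)
    show "(v, w) \<in> topspace (prod_topology (htop H) (htop H))" using R by (simp add: htop_eq)
    fix T assume T: "(v, w) \<in> T \<and> openin (prod_topology (htop H) (htop H)) T"
    then obtain U W where U: "openin (htop H) U" "openin (htop H) W" "v \<in> U" "w \<in> W" "U \<times> W \<subseteq> T"
      unfolding openin_prod_topology_alt by metis
    obtain r1 where r1: "r1 > 0" "nrm.met.mball v r1 \<subseteq> U" using U unfolding htop_eq nrm.met.openin_mtopology by metis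
    obtain r2 where r2: "r2 > 0" "nrm.met.mball w r2 \<subseteq> W" using U unfolding htop_eq nrm.met.openin_mtopology by metis
    obtain x y where xy: "(x, y) \<in> D" "x \<in> carrier H" "y \<in> carrier H" "hnorm H (v \<ominus> x) < min r1 r2" "hnorm H (w \<ominus> y) < min r1 r2"
      using R r1(1) r2(1) by (metis (no_types, lifting) case_prodE min_less_iff_conj)
    have "x \<in> nrm.met.mball v r1" "y \<in> nrm.met.mball w r2" using xy R by (simp_all add: ndist_def)
    then have "(x, y) \<in> T" using r1 r2 U(5) by blast
    then show "\<exists>y. y \<in> D \<and> y \<in> T" using xy(1) by blast
  qed
qed

section \<open>Orthogonal decomposition of K into copies of S\<close>

locale block_space = K: hilbert_space K + S: hilbert_space S
  for K :: "'k hilbert" and S :: "'s hilbert" +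
  fixes G :: "'g set" and e :: "'g \<Rightarrow> 's \<Rightarrow> 'k" and B :: "'s set"
  assumes onb: "S.onb B"
    and e_linear: "g \<in> G \<Longrightarrow> e g \<in> linear_maps S K"
    and e_inner: "g \<in> G \<Longrightarrow> h \<in> G \<Longrightarrow> s \<in> carrier S \<Longrightarrow> t \<in> carrier S \<Longrightarrow>
      inner K (e g s) (e h t) = (if g = h then inner S s t else 0)"
    and total: "v \<in> carrier K \<Longrightarrow> (\<And>g s. g \<in> G \<Longrightarrow> s \<in> carrier S \<Longrightarrow> inner K (e g s) v = 0) \<Longrightarrow> v = \<zero>\<^bsub>K\<^esub>"
begin

lemma e_closed [simp]: "g \<in> G \<Longrightarrow> s \<in> carrier S \<Longrightarrow> e g s \<in> carrier K"
  by (rule linear_mapsD(1)[OF e_linear])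

lemma e_norm: "g \<in> G \<Longrightarrow> s \<in> carrier S \<Longrightarrow> hnorm K (e g s) = hnorm S s"
  by (simp add: hnorm_def e_inner)

text \<open>The adjoint of \<open>e g\<close>, written out in the basis B of S so that its existence
  requires no representation theorem.\<close>

definition comp :: "'g \<Rightarrow> 'k \<Rightarrow> 's" where
  "comp g v = finsum S (\<lambda>b. inner K (e g b) v \<odot>\<^bsub>S\<^esub> b) B"

lemma comp_closed [simp]: "comp g v \<in> carrier S"
  unfolding comp_def by (rule S.nrm.finsum_closed) (use S.onbD(4)[OF onb] in auto)

lemma inner_comp:
  assumes g: "g \<in> G" and v: "v \<in> carrier K" and s: "s \<in> carrier S"
  shows "inner K (e g s) v = inner S s (comp g v)"
proof -
  note B = S.onbD[OF onb]
  have "e g s = e g (finsum S (\<lambda>b. inner S b s \<odot>\<^bsub>S\<^esub> b) B)" using B(5)[OF s] unfolding S.expand_def by simp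
  also have "\<dots> = finsum K (\<lambda>b. e g (inner S b s \<odot>\<^bsub>S\<^esub> b)) B"
    by (rule linear_finsum[OF S.nrm.cnormed_axioms K.nrm.cnormed_axioms e_linear[OF g] B(1)]) (simp add: B(4))
  finally have "inner K (e g s) v = (\<Sum>b\<in>B. inner K (e g (inner S b s \<odot>\<^bsub>S\<^esub> b)) v)"
    using K.inner_finsum_left[OF B(1) v, of "\<lambda>b. e g (inner S b s \<odot>\<^bsub>S\<^esub> b)"] g B(4) by simp
  also have "\<dots> = (\<Sum>b\<in>B. cnj (inner S b s) * inner K (e g b) v)"
    using g v B(4) by (intro sum.cong refl) (simp add: linear_mapsD(3)[OF e_linear[OF g]] K.inner_smult_left)
  also have "\<dots> = (\<Sum>b\<in>B. inner S s (inner K (e g b) v \<odot>\<^bsub>S\<^esub> b))"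
    using s B(4) S.inner_commute[OF s B(4), symmetric] by (intro sum.cong refl) (simp add: S.inner_smult)
  also have "\<dots> = inner S s (comp g v)"
    unfolding comp_def using S.inner_finsum[OF B(1) s, of "\<lambda>b. inner K (e g b) v \<odot>\<^bsub>S\<^esub> b"] B(4) by simp
  finally show ?thesis .
qed

lemma comp_unique:
  assumes "g \<in> G" "v \<in> carrier K" "t \<in> carrier S" "\<And>s. s \<in> carrier S \<Longrightarrow> inner K (e g s) v = inner S s t"
  shows "comp g v = t"
  by (rule S.inner_eqI) (use assms inner_comp[OF assms(1,2)] in simp_all)

lemma comp_linear: assumes g: "g \<in> G" shows "comp g \<in> linear_maps K S"
proof (rule linear_mapsI)
  show "comp g (v \<oplus>\<^bsub>K\<^esub> w) = comp g v \<oplus>\<^bsub>S\<^esub> comp g w" if "v \<in> carrier K" "w \<in> carrier K" for v w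
    by (rule comp_unique[OF g]) (use that g in \<open>simp_all add: K.inner_add S.inner_add inner_comp\<close>)
  show "comp g (c \<odot>\<^bsub>K\<^esub> v) = c \<odot>\<^bsub>S\<^esub> comp g v" if "v \<in> carrier K" for c v
    by (rule comp_unique[OF g]) (use that g in \<open>simp_all add: K.inner_smult S.inner_smult inner_comp\<close>)
qed simp

lemma comp_minus: "g \<in> G \<Longrightarrow> v \<in> carrier K \<Longrightarrow> w \<in> carrier K \<Longrightarrow> comp g (v \<ominus>\<^bsub>K\<^esub> w) = comp g v \<ominus>\<^bsub>S\<^esub> comp g w"
  by (rule linear_maps_minus[OF K.nrm.cnormed_axioms S.nrm.cnormed_axioms comp_linear])

lemma comp_e: "g \<in> G \<Longrightarrow> h \<in> G \<Longrightarrow> s \<in> carrier S \<Longrightarrow> comp g (e h s) = (if g = h then s else \<zero>\<^bsub>S\<^esub>)"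
  by (rule comp_unique) (simp_all add: e_inner)

text \<open>Totality in its working form: identities in K are checked one block at a time.\<close>

lemma comp_ext:
  assumes "u \<in> carrier K" "v \<in> carrier K" "\<And>g. g \<in> G \<Longrightarrow> comp g u = comp g v"
  shows "u = v"
proof -
  have "u \<ominus>\<^bsub>K\<^esub> v = \<zero>\<^bsub>K\<^esub>"
    by (rule total) (use assms in \<open>simp_all add: K.inner_minus inner_comp\<close>)
  then show ?thesis by (rule K.nrm.minus_eq_zero[OF assms(1,2)])
qed

definition blk :: "('g \<Rightarrow> 's) \<Rightarrow> 'g set \<Rightarrow> 'k" where
  "blk s X = finsum K (\<lambda>g. e g (s g)) X"

lemma blk_closed: assumes "X \<subseteq> G" "\<And>g. g \<in> X \<Longrightarrow> s g \<in> carrier S" shows "blk s X \<in> carrier K"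
  unfolding blk_def by (rule K.nrm.finsum_closed) (use assms in auto)

lemma inner_blk:
  assumes "finite X" "X \<subseteq> G" "\<And>g. g \<in> X \<Longrightarrow> s g \<in> carrier S" "v \<in> carrier K"
  shows "inner K (blk s X) v = (\<Sum>g\<in>X. inner S (s g) (comp g v))"
proof -
  have "inner K (blk s X) v = (\<Sum>g\<in>X. inner K (e g (s g)) v)"
    unfolding blk_def by (rule K.inner_finsum_left) (use assms in auto)
  then show ?thesis using assms by (simp add: inner_comp subset_iff)
qed

lemma comp_blk:
  assumes "finite X" "X \<subseteq> G" "\<And>g. g \<in> X \<Longrightarrow> s g \<in> carrier S" "g \<in> G"
  shows "comp g (blk s X) = (if g \<in> X then s g else \<zero>\<^bsub>S\<^esub>)"
proof (rule comp_unique[OF assms(4) blk_closed])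
  fix t assume t: "t \<in> carrier S"
  have "inner K (e g t) (blk s X) = (\<Sum>h\<in>X. inner K (e g t) (e h (s h)))"
    unfolding blk_def by (rule K.inner_finsum) (use assms t in auto)
  also have "\<dots> = (\<Sum>h\<in>X. if g = h then inner S t (s h) else 0)"
    using assms t by (intro sum.cong refl) (simp add: e_inner subset_iff)
  also have "\<dots> = inner S t (if g \<in> X then s g else \<zero>\<^bsub>S\<^esub>)" using assms(1) t by simp
  finally show "inner K (e g t) (blk s X) = inner S t (if g \<in> X then s g else \<zero>\<^bsub>S\<^esub>)" .
qed (use assms in auto)

lemma hnorm_blk:
  assumes "finite X" "X \<subseteq> G" "\<And>g. g \<in> X \<Longrightarrow> s g \<in> carrier S"
  shows "(hnorm K (blk s X))\<^sup>2 = (\<Sum>g\<in>X. (hnorm S (s g))\<^sup>2)"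
proof -
  have "inner K (blk s X) (blk s X) = (\<Sum>g\<in>X. inner S (s g) (comp g (blk s X)))"
    by (rule inner_blk[OF assms blk_closed[OF assms(2,3)]]) auto
  also have "\<dots> = (\<Sum>g\<in>X. inner S (s g) (s g))"
    using assms by (intro sum.cong refl) (simp add: comp_blk subset_iff)
  also have "\<dots> = complex_of_real (\<Sum>g\<in>X. (hnorm S (s g))\<^sup>2)"
    unfolding of_real_sum using assms(3) by (intro sum.cong refl S.inner_self)
  finally show ?thesis using K.hnorm_sq[OF blk_closed[OF assms(2,3)]] by simp
qed

definition proj :: "'g set \<Rightarrow> 'k \<Rightarrow> 'k" where
  "proj X v = blk (\<lambda>g. comp g v) X"

lemma proj_closed: "X \<subseteq> G \<Longrightarrow> proj X v \<in> carrier K"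
  unfolding proj_def by (rule blk_closed) simp_all

lemma proj_defect:
  assumes "finite X" "X \<subseteq> G" "v \<in> carrier K"
  shows "(hnorm K (v \<ominus>\<^bsub>K\<^esub> proj X v))\<^sup>2 = (hnorm K v)\<^sup>2 - (\<Sum>g\<in>X. (hnorm S (comp g v))\<^sup>2)"
proof -
  have pc: "proj X v \<in> carrier K" using assms(2) by (rule proj_closed)
  have "inner K (proj X v) v = (\<Sum>g\<in>X. inner S (comp g v) (comp g v))"
    unfolding proj_def by (rule inner_blk) (use assms in simp_all)
  also have "\<dots> = complex_of_real (\<Sum>g\<in>X. (hnorm S (comp g v))\<^sup>2)"
    unfolding of_real_sum by (intro sum.cong refl S.inner_self) simp
  finally have "inner K v (proj X v) = complex_of_real (\<Sum>g\<in>X. (hnorm S (comp g v))\<^sup>2)"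
    using K.inner_commute[OF assms(3) pc] by simp
  moreover have "(hnorm K (proj X v))\<^sup>2 = (\<Sum>g\<in>X. (hnorm S (comp g v))\<^sup>2)"
    unfolding proj_def by (rule hnorm_blk) (use assms in simp_all)
  ultimately show ?thesis using K.hnorm_minus_sq[OF assms(3) pc] by simp
qed

lemma Bessel: "finite X \<Longrightarrow> X \<subseteq> G \<Longrightarrow> v \<in> carrier K \<Longrightarrow> (\<Sum>g\<in>X. (hnorm S (comp g v))\<^sup>2) \<le> (hnorm K v)\<^sup>2"
  using proj_defect[of X v] zero_le_power2[of "hnorm K (v \<ominus>\<^bsub>K\<^esub> proj X v)"] by linarith

lemma comp_norm_le: assumes "g \<in> G" "v \<in> carrier K" shows "hnorm S (comp g v) \<le> hnorm K v"
  by (rule power2_le_imp_le) (use Bessel[of "{g}" v] assms K.hnorm_nonneg in simp_all)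

text \<open>G may be any index set, so the sum is approached through the supremum M of its finite
  partial sums: countably many finite sets come within \<open>1 / Suc n\<close> of M, and the block
  vectors over them form a Cauchy sequence.\<close>

lemma Riesz_Fischer:
  assumes s: "\<And>g. g \<in> G \<Longrightarrow> s g \<in> carrier S"
    and bd: "\<And>X. finite X \<Longrightarrow> X \<subseteq> G \<Longrightarrow> (\<Sum>g\<in>X. (hnorm S (s g))\<^sup>2) \<le> C"
  obtains u where "u \<in> carrier K" "\<And>g. g \<in> G \<Longrightarrow> comp g u = s g" "(hnorm K u)\<^sup>2 \<le> C"
    "\<And>\<epsilon>. \<epsilon> > 0 \<Longrightarrow> \<exists>X. finite X \<and> X \<subseteq> G \<and> hnorm K (u \<ominus>\<^bsub>K\<^esub> blk s X) < \<epsilon>"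
proof -
  define \<Sigma> where "\<Sigma> X = (\<Sum>g\<in>X. (hnorm S (s g))\<^sup>2)" for X
  define Z where "Z = \<Sigma> ` {X. finite X \<and> X \<subseteq> G}"
  define M where "M = Sup Z"
  have bdd: "bdd_above Z" unfolding Z_def \<Sigma>_def using bd by (intro bdd_aboveI[of _ C]) auto
  have ne: "Z \<noteq> {}" unfolding Z_def by blast
  have leM: "\<Sigma> X \<le> M" if "finite X" "X \<subseteq> G" for X
    unfolding M_def by (rule cSup_upper[OF _ bdd]) (use that in \<open>auto simp: Z_def\<close>)
  have "\<exists>X. finite X \<and> X \<subseteq> G \<and> M - 1 / Suc n < \<Sigma> X" for n
  proof -
    have "M - 1 / Suc n < Sup Z" by (simp add: M_def)
    from less_cSupD[OF ne this] show ?thesis unfolding Z_def by blast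
  qed
  then obtain X where X: "\<And>n. finite (X n)" "\<And>n. X n \<subseteq> G" "\<And>n. M - 1 / Suc n < \<Sigma> (X n)" by metis
  \<comment> \<open>Unions make the sets increasing. Then \<open>u n\<close> and \<open>u m\<close>
    differ by the blocks in \<open>Y n - Y m\<close>, whose squares sum to at most
    \<open>1 / Suc m\<close>.\<close>
  define Y where "Y n = (\<Union>i\<le>n. X i)" for n
  have Y: "finite (Y n)" "Y n \<subseteq> G" for n using X unfolding Y_def by auto
  have Ymono: "Y m \<subseteq> Y n" if "m \<le> n" for m n using that unfolding Y_def by (intro UN_mono) auto
  have \<Sigma>mono: "\<Sigma> A \<le> \<Sigma> A'" if "A \<subseteq> A'" "finite A'" for A A'
    unfolding \<Sigma>_def by (rule sum_mono2) (use that in auto)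
  have YM: "M - 1 / Suc n < \<Sigma> (Y n)" for n
  proof -
    have "\<Sigma> (X n) \<le> \<Sigma> (Y n)" by (rule \<Sigma>mono[OF _ Y(1)]) (auto simp: Y_def)
    then show ?thesis using X(3)[of n] by simp
  qed
  define u where "u n = blk s (Y n)" for n
  have uc: "u n \<in> carrier K" for n unfolding u_def by (rule blk_closed) (use Y s in blast)+
  have ucomp: "comp g (u n) = (if g \<in> Y n then s g else \<zero>\<^bsub>S\<^esub>)" if "g \<in> G" for g n
    unfolding u_def by (rule comp_blk) (use Y s that in blast)+
  have diff: "(hnorm K (u n \<ominus>\<^bsub>K\<^esub> u m))\<^sup>2 \<le> 1 / Suc m" if mn: "m \<le> n" for m n
  proof -
    have "u n \<ominus>\<^bsub>K\<^esub> u m = blk s (Y n - Y m)"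
    proof (rule comp_ext)
      show "blk s (Y n - Y m) \<in> carrier K" by (rule blk_closed) (use Y s in blast)+
      fix g assume g: "g \<in> G"
      have "comp g (blk s (Y n - Y m)) = (if g \<in> Y n - Y m then s g else \<zero>\<^bsub>S\<^esub>)"
        by (rule comp_blk[OF _ _ _ g]) (use Y s in blast)+
      moreover have "comp g (u n \<ominus>\<^bsub>K\<^esub> u m) = (if g \<in> Y n then s g else \<zero>\<^bsub>S\<^esub>) \<ominus>\<^bsub>S\<^esub> (if g \<in> Y m then s g else \<zero>\<^bsub>S\<^esub>)"
        using g uc by (simp add: comp_minus ucomp)
      moreover have "s g \<ominus>\<^bsub>S\<^esub> \<zero>\<^bsub>S\<^esub> = s g" using s[OF g] by (simp add: S.nrm.minus_sm)
      ultimately show "comp g (u n \<ominus>\<^bsub>K\<^esub> u m) = comp g (blk s (Y n - Y m))"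
        using Ymono[OF mn] s[OF g] by auto
    qed (use uc in simp)
    then have "(hnorm K (u n \<ominus>\<^bsub>K\<^esub> u m))\<^sup>2 = \<Sigma> (Y n - Y m)"
      unfolding \<Sigma>_def by (simp only:) (rule hnorm_blk; use Y s in blast)
    also have "\<dots> = \<Sigma> (Y n) - \<Sigma> (Y m)"
      unfolding \<Sigma>_def by (rule sum_diff[OF Y(1) Ymono[OF mn]])
    also have "\<dots> \<le> 1 / Suc m" using leM[OF Y] YM[of m] by (smt (verit))
    finally show ?thesis .
  qed
  have lim: "(\<lambda>n. sqrt (1 / Suc n)) \<longlonglongrightarrow> 0"
    using tendsto_real_sqrt[OF LIMSEQ_inverse_real_of_nat] by (simp add: inverse_eq_divide)
  have diff': "hnorm K (u n \<ominus>\<^bsub>K\<^esub> u m) \<le> sqrt (1 / Suc m)" if "m \<le> n" for m n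
    by (rule real_le_rsqrt[OF diff[OF that]])
  obtain l where l: "K.nrm.conv u l"
  proof (rule K.nrm.complete_conv[OF K.mcompl uc])
    fix \<epsilon> :: real assume "\<epsilon> > 0"
    then obtain N where N: "sqrt (1 / Suc N) < \<epsilon> / 2"
      using order_tendstoD(2)[OF lim, of "\<epsilon> / 2"] unfolding eventually_sequentially by force
    show "\<exists>N. \<forall>m\<ge>N. \<forall>n\<ge>N. hnorm K (u m \<ominus>\<^bsub>K\<^esub> u n) < \<epsilon>"
    proof (intro exI[of _ N] allI impI)
      fix m n assume mn: "N \<le> m" "N \<le> n"
      have "hnorm K (u m \<ominus>\<^bsub>K\<^esub> u n) \<le> hnorm K (u m \<ominus>\<^bsub>K\<^esub> u N) + hnorm K (u N \<ominus>\<^bsub>K\<^esub> u n)"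
        by (rule K.nrm.nrm_diff_triangle) (rule uc)+
      also have "hnorm K (u N \<ominus>\<^bsub>K\<^esub> u n) = hnorm K (u n \<ominus>\<^bsub>K\<^esub> u N)" by (rule K.nrm.nrm_minus_commute) (rule uc)+
      also have "hnorm K (u m \<ominus>\<^bsub>K\<^esub> u N) + hnorm K (u n \<ominus>\<^bsub>K\<^esub> u N) < \<epsilon>"
        using diff'[OF mn(1)] diff'[OF mn(2)] N by linarith
      finally show "hnorm K (u m \<ominus>\<^bsub>K\<^esub> u n) < \<epsilon>" .
    qed
  qed (rule that)
  have lc: "l \<in> carrier K" using l by (simp add: K.nrm.conv_def)
  show thesis
  proof (rule that[OF lc])
    show "comp g l = s g" if g: "g \<in> G" for g
    proof (rule S.nrm.conv_unique)
      show "S.nrm.conv (\<lambda>n. comp g (u n)) (comp g l)"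
        by (rule conv_linear[OF K.nrm.cnormed_axioms S.nrm.cnormed_axioms comp_linear[OF g], where C=1])
           (use comp_norm_le[OF g] l in simp_all)
      show "S.nrm.conv (\<lambda>n. comp g (u n)) (s g)"
      proof (rule S.nrm.conv_squeeze[OF _ s[OF g] _ lim])
        fix n
        show "hnorm S (comp g (u n) \<ominus>\<^bsub>S\<^esub> s g) \<le> sqrt (1 / Suc n)"
        proof (cases "g \<in> Y n")
          case True
          then show ?thesis using s[OF g] by (simp add: ucomp[OF g])
        next
          \<comment> \<open>A block missing from \<open>Y n\<close> cannot lift the partial sum
            above M, so its square is at most \<open>1 / Suc n\<close>. In particular an index that
            never enters any \<open>Y n\<close> has a zero entry.\<close>
          case False
          have "\<Sigma> (insert g (Y n)) = (hnorm S (s g))\<^sup>2 + \<Sigma> (Y n)"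
            unfolding \<Sigma>_def using False Y(1) by simp
          then have "(hnorm S (s g))\<^sup>2 \<le> 1 / Suc n"
            using leM[of "insert g (Y n)"] Y[of n] g YM[of n] by simp
          then have "hnorm S (s g) \<le> sqrt (1 / Suc n)" by (rule real_le_rsqrt)
          moreover have "hnorm S (\<zero>\<^bsub>S\<^esub> \<ominus>\<^bsub>S\<^esub> s g) = hnorm S (s g)"
            using s[OF g] by (simp add: S.nrm.minus_sm S.hnorm_smult)
          ultimately show ?thesis using False by (simp add: ucomp[OF g])
        qed
      qed simp
    qed
    have "hnorm K l \<le> sqrt C"
    proof (rule K.nrm.conv_limit_le[OF l _ tendsto_const])
      show "hnorm K (u n) \<le> sqrt C" for n
      proof (rule real_le_rsqrt)
        have "(hnorm K (u n))\<^sup>2 = \<Sigma> (Y n)" unfolding u_def \<Sigma>_def by (rule hnorm_blk) (use Y s in blast)+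
        then show "(hnorm K (u n))\<^sup>2 \<le> C" using bd[OF Y] unfolding \<Sigma>_def by simp
      qed
    qed
    moreover have "0 \<le> C" using bd[of "{}"] by simp
    ultimately show "(hnorm K l)\<^sup>2 \<le> C"
      using K.hnorm_nonneg[OF lc] by (metis power_mono real_sqrt_pow2)
    fix \<epsilon> :: real assume e: "\<epsilon> > 0"
    have "(\<lambda>n. hnorm K (u n \<ominus>\<^bsub>K\<^esub> l)) \<longlonglongrightarrow> 0" using l by (simp add: K.nrm.conv_def)
    from eventually_happens'[OF sequentially_bot order_tendstoD(2)[OF this e]]
    obtain n where "hnorm K (u n \<ominus>\<^bsub>K\<^esub> l) < \<epsilon>" by blast
    then have "hnorm K (l \<ominus>\<^bsub>K\<^esub> blk s (Y n)) < \<epsilon>"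
      using K.nrm.nrm_minus_commute[OF uc lc] unfolding u_def by simp
    then show "\<exists>X. finite X \<and> X \<subseteq> G \<and> hnorm K (l \<ominus>\<^bsub>K\<^esub> blk s X) < \<epsilon>" using Y by blast
  qed
qed

text \<open>The vector rebuilt from the components of v has the same components, hence is v. The
  estimate holds for all larger finite sets as well, which later allows two vectors to be truncated
  over the same set.\<close>

lemma Parseval_approx:
  assumes v: "v \<in> carrier K" and e: "\<epsilon> > 0"
  obtains X where "finite X" "X \<subseteq> G" "\<And>Y. finite Y \<Longrightarrow> Y \<subseteq> G \<Longrightarrow> X \<subseteq> Y \<Longrightarrow> hnorm K (v \<ominus>\<^bsub>K\<^esub> proj Y v) < \<epsilon>"
proof -
  obtain u where u: "u \<in> carrier K" "\<And>g. g \<in> G \<Longrightarrow> comp g u = comp g v"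
    "\<And>\<epsilon>. \<epsilon> > 0 \<Longrightarrow> \<exists>X. finite X \<and> X \<subseteq> G \<and> hnorm K (u \<ominus>\<^bsub>K\<^esub> blk (\<lambda>g. comp g v) X) < \<epsilon>"
    using Riesz_Fischer[of "\<lambda>g. comp g v", OF comp_closed Bessel[OF _ _ v]] by metis
  have "u = v" by (rule comp_ext[OF u(1) v u(2)])
  then obtain X where X: "finite X" "X \<subseteq> G" "hnorm K (v \<ominus>\<^bsub>K\<^esub> proj X v) < \<epsilon>"
    using u(3)[OF e] unfolding proj_def by blast
  show thesis
  proof (rule that[OF X(1,2)])
    fix Y assume Y: "finite Y" "Y \<subseteq> G" "X \<subseteq> Y"
    have "(\<Sum>g\<in>X. (hnorm S (comp g v))\<^sup>2) \<le> (\<Sum>g\<in>Y. (hnorm S (comp g v))\<^sup>2)"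
      by (rule sum_mono2) (use Y in auto)
    then have "(hnorm K (v \<ominus>\<^bsub>K\<^esub> proj Y v))\<^sup>2 \<le> (hnorm K (v \<ominus>\<^bsub>K\<^esub> proj X v))\<^sup>2"
      using proj_defect[OF X(1,2) v] proj_defect[OF Y(1,2) v] by simp
    then have "hnorm K (v \<ominus>\<^bsub>K\<^esub> proj Y v) \<le> hnorm K (v \<ominus>\<^bsub>K\<^esub> proj X v)"
      by (rule power2_le_imp_le) (intro K.hnorm_nonneg K.nrm.minus_closed v proj_closed X(2))
    then show "hnorm K (v \<ominus>\<^bsub>K\<^esub> proj Y v) < \<epsilon>" using X(3) by simp
  qed
qed

lemma norm_le_of_comp:
  assumes x: "x \<in> carrier K" and y: "y \<in> carrier K"
    and le: "\<And>g. g \<in> G \<Longrightarrow> hnorm S (comp g x) \<le> hnorm S (comp g y)"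
  shows "hnorm K x \<le> hnorm K y"
proof -
  have b: "(\<Sum>g\<in>X. (hnorm S (comp g x))\<^sup>2) \<le> (hnorm K y)\<^sup>2" if "finite X" "X \<subseteq> G" for X
  proof -
    have "(\<Sum>g\<in>X. (hnorm S (comp g x))\<^sup>2) \<le> (\<Sum>g\<in>X. (hnorm S (comp g y))\<^sup>2)"
      by (intro sum_mono power_mono le S.hnorm_nonneg) (use that in auto)
    also have "\<dots> \<le> (hnorm K y)\<^sup>2" by (rule Bessel[OF that y])
    finally show ?thesis .
  qed
  obtain u where u: "u \<in> carrier K" "\<And>g. g \<in> G \<Longrightarrow> comp g u = comp g x" "(hnorm K u)\<^sup>2 \<le> (hnorm K y)\<^sup>2"
    using Riesz_Fischer[of "\<lambda>g. comp g x", OF comp_closed b] by metis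
  have "u = x" by (rule comp_ext[OF u(1) x u(2)])
  then show ?thesis using u(3) K.hnorm_nonneg[OF y] power2_le_imp_le by blast
qed

text \<open>The source of all bounded operators built from blocks: the component in block g is
  transformed by \<open>T g\<close> and moved to block \<open>\<sigma> g\<close>. It yields the
  resolvent (with \<open>\<sigma>\<close> the identity), the translations and their commutators with
  the Dirac operator.\<close>

lemma block_shift_exists:
  assumes \<sigma>: "inj_on \<sigma> G" "\<sigma> ` G \<subseteq> G"
    and T: "\<And>g. g \<in> G \<Longrightarrow> T g \<in> linear_maps S S"
    and C: "\<And>g s. g \<in> G \<Longrightarrow> s \<in> carrier S \<Longrightarrow> hnorm S (T g s) \<le> C * hnorm S s"
  obtains R where "R \<in> bounded_ops K K"
    "\<And>g v. g \<in> G \<Longrightarrow> v \<in> carrier K \<Longrightarrow> comp (\<sigma> g) (R v) = T g (comp g v)"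
    "\<And>k v. k \<in> G \<Longrightarrow> k \<notin> \<sigma> ` G \<Longrightarrow> v \<in> carrier K \<Longrightarrow> comp k (R v) = \<zero>\<^bsub>S\<^esub>"
proof -
  define \<tau> where "\<tau> = inv_into G \<sigma>"
  have \<tau>: "\<tau> k \<in> G" "\<sigma> (\<tau> k) = k" if "k \<in> \<sigma> ` G" for k
    using that by (simp_all add: \<tau>_def inv_into_into f_inv_into_f)
  have \<tau>\<sigma>: "\<tau> (\<sigma> g) = g" if "g \<in> G" for g using \<sigma>(1) that by (simp add: \<tau>_def)
  define s where "s v k = (if k \<in> \<sigma> ` G then T (\<tau> k) (comp (\<tau> k) v) else \<zero>\<^bsub>S\<^esub>)" for v k
  note Tl = linear_mapsD[OF T]
  have sc: "s v k \<in> carrier S" for v k unfolding s_def using \<tau>(1) Tl(1) by simp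
  have bd: "(\<Sum>k\<in>X. (hnorm S (s v k))\<^sup>2) \<le> (\<bar>C\<bar> * hnorm K v)\<^sup>2"
    if X: "finite X" "X \<subseteq> G" and v: "v \<in> carrier K" for X v
  proof -
    have "(\<Sum>k\<in>X. (hnorm S (s v k))\<^sup>2) = (\<Sum>k\<in>X \<inter> \<sigma> ` G. (hnorm S (s v k))\<^sup>2)"
      by (rule sum.mono_neutral_right) (use X in \<open>auto simp: s_def\<close>)
    also have "\<dots> \<le> (\<Sum>k\<in>X \<inter> \<sigma> ` G. C\<^sup>2 * (hnorm S (comp (\<tau> k) v))\<^sup>2)"
    proof (rule sum_mono)
      fix k assume k: "k \<in> X \<inter> \<sigma> ` G"
      have "hnorm S (s v k) \<le> C * hnorm S (comp (\<tau> k) v)" using k C \<tau>(1) by (simp add: s_def)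
      from power_mono[OF this S.hnorm_nonneg[OF sc], of 2]
      show "(hnorm S (s v k))\<^sup>2 \<le> C\<^sup>2 * (hnorm S (comp (\<tau> k) v))\<^sup>2" by (simp add: power_mult_distrib)
    qed
    also have "\<dots> = C\<^sup>2 * (\<Sum>g\<in>\<tau> ` (X \<inter> \<sigma> ` G). (hnorm S (comp g v))\<^sup>2)"
    proof -
      \<comment> \<open>Distinct target blocks come from distinct source blocks, so the Bessel
        inequality for v bounds the sum.\<close>
      have "inj_on \<tau> (X \<inter> \<sigma> ` G)" by (rule inj_onI) (metis IntD2 \<tau>(2))
      then show ?thesis by (simp add: sum.reindex sum_distrib_left)
    qed
    also have "\<dots> \<le> C\<^sup>2 * (hnorm K v)\<^sup>2"
      by (intro mult_left_mono Bessel v) (use X \<tau>(1) in auto)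
    finally show ?thesis by (simp add: power_mult_distrib)
  qed
  have "\<exists>u. u \<in> carrier K \<and> (\<forall>g\<in>G. comp g u = s v g) \<and> (hnorm K u)\<^sup>2 \<le> (\<bar>C\<bar> * hnorm K v)\<^sup>2"
    if v: "v \<in> carrier K" for v
    using Riesz_Fischer[of "s v", OF sc bd[OF _ _ v]] by metis
  then obtain R where R: "\<And>v. v \<in> carrier K \<Longrightarrow> R v \<in> carrier K"
    "\<And>v g. v \<in> carrier K \<Longrightarrow> g \<in> G \<Longrightarrow> comp g (R v) = s v g"
    "\<And>v. v \<in> carrier K \<Longrightarrow> (hnorm K (R v))\<^sup>2 \<le> (\<bar>C\<bar> * hnorm K v)\<^sup>2" by metis
  show thesis
  proof (rule that[of R])
    show "R \<in> bounded_ops K K"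
    proof (rule bounded_opsI[OF linear_mapsI])
      show "R v \<in> carrier K" if "v \<in> carrier K" for v using R(1)[OF that] .
      show "R (v \<oplus>\<^bsub>K\<^esub> w) = R v \<oplus>\<^bsub>K\<^esub> R w" if "v \<in> carrier K" "w \<in> carrier K" for v w
      proof (rule comp_ext)
        fix g assume g: "g \<in> G"
        show "comp g (R (v \<oplus>\<^bsub>K\<^esub> w)) = comp g (R v \<oplus>\<^bsub>K\<^esub> R w)"
          using that g R(1) \<tau>(1) by (simp add: R(2) linear_mapsD(2)[OF comp_linear] s_def Tl(2))
      qed (use that R(1) in simp_all)
      show "R (c \<odot>\<^bsub>K\<^esub> v) = c \<odot>\<^bsub>K\<^esub> R v" if "v \<in> carrier K" for c v
      proof (rule comp_ext)
        fix g assume g: "g \<in> G"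
        show "comp g (R (c \<odot>\<^bsub>K\<^esub> v)) = comp g (c \<odot>\<^bsub>K\<^esub> R v)"
          using that g R(1) \<tau>(1) by (simp add: R(2) linear_mapsD(3)[OF comp_linear] s_def Tl(3))
      qed (use that R(1) in simp_all)
      show "hnorm K (R v) \<le> \<bar>C\<bar> * hnorm K v" if "v \<in> carrier K" for v
        by (rule power2_le_imp_le[OF R(3)[OF that]]) (use K.hnorm_nonneg[OF that] in simp)
    qed
    show "comp (\<sigma> g) (R v) = T g (comp g v)" if g: "g \<in> G" "v \<in> carrier K" for g v
      using R(2)[OF g(2), of "\<sigma> g"] g(1) \<sigma>(2) by (simp add: s_def \<tau>\<sigma> image_subset_iff)
    show "comp k (R v) = \<zero>\<^bsub>S\<^esub>" if "k \<in> G" "k \<notin> \<sigma> ` G" "v \<in> carrier K" for k v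
      using R(2)[OF that(3,1)] that(2) by (simp add: s_def)
  qed
qed

lemma bounded_eq_on_blocks:
  assumes T: "T \<in> bounded_ops K K" "T' \<in> bounded_ops K K"
    and eq: "\<And>g s. g \<in> G \<Longrightarrow> s \<in> carrier S \<Longrightarrow> T (e g s) = T' (e g s)" and v: "v \<in> carrier K"
  shows "T v = T' v"
proof -
  note L = bounded_opsD(1)[OF T(1)] bounded_opsD(1)[OF T(2)]
  obtain C where C: "\<And>v. v \<in> carrier K \<Longrightarrow> hnorm K (T v) \<le> C * hnorm K v"
    using bounded_opsD(2)[OF T(1)] by blast
  obtain C' where C': "\<And>v. v \<in> carrier K \<Longrightarrow> hnorm K (T' v) \<le> C' * hnorm K v"
    using bounded_opsD(2)[OF T(2)] by blast
  let ?P = "{proj X v | X v. finite X \<and> X \<subseteq> G \<and> v \<in> carrier K}"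
  have bs: "K.nrm.bseminorm (\<lambda>v. hnorm K (T v \<ominus>\<^bsub>K\<^esub> T' v))"
  proof (rule bseminorm_linear[OF K.nrm.cnormed_axioms K.nrm.cnormed_axioms linear_maps_diff[OF K.nrm.cnormed_axioms L]])
    show "hnorm K (T v \<ominus>\<^bsub>K\<^esub> T' v) \<le> (C + C') * hnorm K v" if "v \<in> carrier K" for v
      using C[OF that] C'[OF that] K.nrm.nrm_minus[OF linear_mapsD(1)[OF L(1) that] linear_mapsD(1)[OF L(2) that]]
      by (simp add: distrib_right)
  qed
  have "hnorm K (T v \<ominus>\<^bsub>K\<^esub> T' v) = 0"
  proof (rule K.nrm.bseminorm_zero_closure[OF bs])
    show "v \<in> K.nrm.met.mtopology closure_of ?P"
      unfolding K.nrm.closure_iff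
    proof (intro conjI v allI impI)
      fix \<epsilon> :: real assume e: "\<epsilon> > 0"
      obtain X where X: "finite X" "X \<subseteq> G" "\<And>Y. finite Y \<Longrightarrow> Y \<subseteq> G \<Longrightarrow> X \<subseteq> Y \<Longrightarrow> hnorm K (v \<ominus>\<^bsub>K\<^esub> proj Y v) < \<epsilon>"
        using Parseval_approx[OF v e] by metis
      show "\<exists>x\<in>?P. x \<in> carrier K \<and> hnorm K (v \<ominus>\<^bsub>K\<^esub> x) < \<epsilon>"
        by (rule bexI[of _ "proj X v"]) (use X(1,2) v X(3)[OF X(1,2) order_refl] proj_closed[OF X(2)] in auto)
    qed
    fix x assume "x \<in> ?P"
    then obtain X w where X: "x = proj X w" "finite X" "X \<subseteq> G" by blast
    have "T x = finsum K (\<lambda>g. T (e g (comp g w))) X"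
      unfolding X(1) proj_def blk_def
      by (rule linear_finsum[OF K.nrm.cnormed_axioms K.nrm.cnormed_axioms L(1) X(2)]) (use X(3) in auto)
    also have "\<dots> = finsum K (\<lambda>g. T' (e g (comp g w))) X"
      by (rule K.nrm.finsum_cong') (use X(3) eq linear_mapsD(1)[OF L(2)] in auto)
    also have "\<dots> = T' x"
      unfolding X(1) proj_def blk_def
      by (rule linear_finsum[OF K.nrm.cnormed_axioms K.nrm.cnormed_axioms L(2) X(2), symmetric]) (use X(3) in auto)
    finally show "hnorm K (T x \<ominus>\<^bsub>K\<^esub> T' x) = 0"
      using linear_mapsD(1)[OF L(2)] proj_closed[OF X(3)] unfolding X(1) by simp
  qed
  then show ?thesis by (rule K.nrm.nrm_minus_eq_zero[OF linear_mapsD(1)[OF L(1) v] linear_mapsD(1)[OF L(2) v]])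
qed

end

section \<open>Block-diagonal selfadjoint operators\<close>

locale block_multiplier = block_space K S G e B
  for K :: "'k hilbert" and S :: "'s hilbert" and G :: "'g set" and e :: "'g \<Rightarrow> 's \<Rightarrow> 'k" and B :: "'s set" +
  fixes F :: "'g \<Rightarrow> 's \<Rightarrow> 's"
  assumes F_sa: "g \<in> G \<Longrightarrow> F g \<in> End_sa S"
begin

lemma F_linear: "g \<in> G \<Longrightarrow> F g \<in> linear_maps S S"
  by (rule End_saD(1)[OF F_sa])

lemma F_closed [simp]: "g \<in> G \<Longrightarrow> s \<in> carrier S \<Longrightarrow> F g s \<in> carrier S"
  by (rule linear_mapsD(1)[OF F_linear])

text \<open>The maximal block-diagonal operator: v belongs to its domain exactly when the
  transformed components are those of some vector of K.\<close>

definition mop :: "('k \<times> 'k) set" where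
  "mop = {(v, w) \<in> carrier K \<times> carrier K. \<forall>g\<in>G. comp g w = F g (comp g v)}"

lemma mopD: "(v, w) \<in> mop \<Longrightarrow> v \<in> carrier K" "(v, w) \<in> mop \<Longrightarrow> w \<in> carrier K"
  "(v, w) \<in> mop \<Longrightarrow> g \<in> G \<Longrightarrow> comp g w = F g (comp g v)"
  by (simp_all add: mop_def)

lemma mopI: "v \<in> carrier K \<Longrightarrow> w \<in> carrier K \<Longrightarrow> (\<And>g. g \<in> G \<Longrightarrow> comp g w = F g (comp g v)) \<Longrightarrow> (v, w) \<in> mop"
  by (simp add: mop_def)

lemma F_zero: "g \<in> G \<Longrightarrow> F g \<zero>\<^bsub>S\<^esub> = \<zero>\<^bsub>S\<^esub>"
  by (rule linear_maps_zero[OF S.nrm.cnormed_axioms S.nrm.cnormed_axioms F_linear])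

lemma mop_domain_proj:
  assumes X: "finite X" "X \<subseteq> G"
  shows "(proj X v, blk (\<lambda>g. F g (comp g v)) X) \<in> mop"
proof (rule mopI[OF proj_closed[OF X(2)]])
  show "blk (\<lambda>g. F g (comp g v)) X \<in> carrier K" by (rule blk_closed[OF X(2)]) (use X in auto)
  fix g assume g: "g \<in> G"
  have "comp g (proj X v) = (if g \<in> X then comp g v else \<zero>\<^bsub>S\<^esub>)"
    unfolding proj_def by (rule comp_blk[OF X _ g]) simp
  moreover have "comp g (blk (\<lambda>g. F g (comp g v)) X) = (if g \<in> X then F g (comp g v) else \<zero>\<^bsub>S\<^esub>)"
    by (rule comp_blk[OF X _ g]) (use X in auto)
  ultimately show "comp g (blk (\<lambda>g. F g (comp g v)) X) = F g (comp g (proj X v))" using F_zero[OF g] by simp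
qed

lemma mop_domain_dense: "htop K closure_of Domain mop = carrier K"
  unfolding K.htop_eq K.nrm.dense_iff
proof (intro ballI allI impI)
  fix v and \<epsilon> :: real assume v: "v \<in> carrier K" and e: "\<epsilon> > 0"
  obtain X where X: "finite X" "X \<subseteq> G" "\<And>Y. finite Y \<Longrightarrow> Y \<subseteq> G \<Longrightarrow> X \<subseteq> Y \<Longrightarrow> hnorm K (v \<ominus>\<^bsub>K\<^esub> proj Y v) < \<epsilon>"
    using Parseval_approx[OF v e] by metis
  show "\<exists>x\<in>Domain mop. x \<in> carrier K \<and> hnorm K (v \<ominus>\<^bsub>K\<^esub> x) < \<epsilon>"
    by (rule bexI[of _ "proj X v"])
       (use X(3)[OF X(1,2) order_refl] mop_domain_proj[OF X(1,2), of v] proj_closed[OF X(2)] in auto)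
qed

lemma mop_single_valued: "single_valued mop"
proof (rule single_valuedI)
  fix v w w' assume a: "(v, w) \<in> mop" "(v, w') \<in> mop"
  show "w = w'" by (rule comp_ext[OF mopD(2)[OF a(1)] mopD(2)[OF a(2)]]) (use a in \<open>simp add: mopD(3)\<close>)
qed

text \<open>Over a finite set of blocks symmetry is that of each \<open>F g\<close>. Truncating x
  and y over one common finite set transfers it to whole vectors, with an error controlled by
  Cauchy-Schwarz.\<close>

lemma mop_symmetric:
  assumes "(x, y) \<in> mop" "(v, w) \<in> mop"
  shows "inner K y v = inner K x w"
proof -
  note c = mopD(1,2)[OF assms(1)] mopD(1,2)[OF assms(2)]
  have "cmod (inner K y v - inner K x w) \<le> 0"
  proof (rule field_le_epsilon)
    fix \<epsilon> :: real assume e: "\<epsilon> > 0"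
    \<comment> \<open>Chosen so that the two truncation errors, multiplied by the norms of v and w,
      add up to at most \<epsilon>; the 1 keeps the denominator positive.\<close>
    define d where "d = \<epsilon> / (hnorm K v + hnorm K w + 1)"
    have pos: "hnorm K v + hnorm K w + 1 > 0" using K.hnorm_nonneg[OF c(3)] K.hnorm_nonneg[OF c(4)] by simp
    have d: "d > 0" using e pos by (simp add: d_def)
    obtain X1 where X1: "finite X1" "X1 \<subseteq> G" "\<And>Y. finite Y \<Longrightarrow> Y \<subseteq> G \<Longrightarrow> X1 \<subseteq> Y \<Longrightarrow> hnorm K (x \<ominus>\<^bsub>K\<^esub> proj Y x) < d"
      using Parseval_approx[OF c(1) d] by metis
    obtain X2 where X2: "finite X2" "X2 \<subseteq> G" "\<And>Y. finite Y \<Longrightarrow> Y \<subseteq> G \<Longrightarrow> X2 \<subseteq> Y \<Longrightarrow> hnorm K (y \<ominus>\<^bsub>K\<^esub> proj Y y) < d"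
      using Parseval_approx[OF c(2) d] by metis
    define X where "X = X1 \<union> X2"
    have X: "finite X" "X \<subseteq> G" and dx: "hnorm K (x \<ominus>\<^bsub>K\<^esub> proj X x) < d" and dy: "hnorm K (y \<ominus>\<^bsub>K\<^esub> proj X y) < d"
      using X1 X2 unfolding X_def by auto
    have p: "proj X x \<in> carrier K" "proj X y \<in> carrier K" by (rule proj_closed[OF X(2)])+
    have "inner K (proj X y) v = (\<Sum>g\<in>X. inner S (comp g y) (comp g v))"
      unfolding proj_def by (rule inner_blk[OF X _ c(3)]) simp
    also have "\<dots> = (\<Sum>g\<in>X. inner S (comp g x) (comp g w))"
    proof (rule sum.cong[OF refl])
      fix g assume "g \<in> X"
      then have g: "g \<in> G" using X by blast
      show "inner S (comp g y) (comp g v) = inner S (comp g x) (comp g w)"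
        unfolding mopD(3)[OF assms(1) g] mopD(3)[OF assms(2) g] by (rule End_saD(2)[OF F_sa[OF g]]) simp_all
    qed
    also have "\<dots> = inner K (proj X x) w"
      unfolding proj_def by (rule inner_blk[OF X _ c(4), symmetric]) simp
    finally have "inner K y v - inner K x w = inner K (y \<ominus>\<^bsub>K\<^esub> proj X y) v - inner K (x \<ominus>\<^bsub>K\<^esub> proj X x) w"
      using c p by (simp add: K.inner_minus_left)
    also have "cmod \<dots> \<le> hnorm K (y \<ominus>\<^bsub>K\<^esub> proj X y) * hnorm K v + hnorm K (x \<ominus>\<^bsub>K\<^esub> proj X x) * hnorm K w"
      using K.Cauchy_Schwarz[OF K.nrm.minus_closed[OF c(2) p(2)] c(3)] K.Cauchy_Schwarz[OF K.nrm.minus_closed[OF c(1) p(1)] c(4)]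
      by (intro norm_triangle_le_diff) simp
    also have "\<dots> \<le> d * hnorm K v + d * hnorm K w"
      using dx dy c by (intro add_mono mult_right_mono K.hnorm_nonneg) simp_all
    also have "\<dots> \<le> d * (hnorm K v + hnorm K w + 1)" using d by (simp add: algebra_simps)
    also have "\<dots> = \<epsilon>" using pos by (simp add: d_def)
    finally show "cmod (inner K y v - inner K x w) \<le> 0 + \<epsilon>" by simp
  qed
  then show ?thesis by simp
qed

lemma mop_e: assumes g: "g \<in> G" and s: "s \<in> carrier S" shows "(e g s, e g (F g s)) \<in> mop"
  by (rule mopI) (use g s in \<open>simp_all add: comp_e F_zero\<close>)

text \<open>Testing a pair of the adjoint graph on the vectors \<open>e g s\<close>, which lie in
  the domain, already yields all the equations that define \<open>mop\<close>; maximality of the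
  domain does the rest.\<close>

lemma mop_selfadjoint: "selfadjoint_op K mop"
  unfolding selfadjoint_op_def
proof (intro conjI mop_single_valued mop_domain_dense equalityI subsetI)
  fix p assume "p \<in> adjoint_graph K mop"
  then obtain v w where p: "p = (v, w)" and c: "v \<in> carrier K" "w \<in> carrier K"
    and a: "\<And>x y. (x, y) \<in> mop \<Longrightarrow> inner K y v = inner K x w"
    unfolding adjoint_graph_def by blast
  have "(v, w) \<in> mop"
  proof (rule mopI[OF c])
    fix g assume g: "g \<in> G"
    show "comp g w = F g (comp g v)"
    proof (rule comp_unique[OF g c(2)])
      fix s assume s: "s \<in> carrier S"
      have "inner K (e g s) w = inner K (e g (F g s)) v" using a[OF mop_e[OF g s]] by simp
      also have "\<dots> = inner S (F g s) (comp g v)" using g s c by (simp add: inner_comp)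
      also have "\<dots> = inner S s (F g (comp g v))" by (rule End_saD(2)[OF F_sa[OF g] s]) simp
      finally show "inner K (e g s) w = inner S s (F g (comp g v))" .
    qed (use g in simp)
  qed
  then show "p \<in> mop" using p by simp
next
  fix p assume p: "p \<in> mop"
  obtain v w where vw: "p = (v, w)" by (cases p)
  show "p \<in> adjoint_graph K mop"
    unfolding adjoint_graph_def vw using p[unfolded vw] mop_symmetric[OF _ p[unfolded vw]] mopD(1,2)[OF p[unfolded vw]] by auto
qed

lemma F_bounded: assumes "g \<in> G" shows "F g \<in> bounded_ops S S"
  by (rule linear_bounded_fin_dim[OF S.hilbert_space_axioms S.hilbert_space_axioms onb F_linear[OF assms]])

text \<open>Each component map is continuous and each \<open>F g\<close> is bounded, so the defining
  equations survive limits of pairs.\<close>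

lemma mop_closed: "graph_closure K mop \<subseteq> mop"
proof
  fix p assume p: "p \<in> graph_closure K mop"
  obtain v w where vw: "p = (v, w)" by (cases p)
  have c: "v \<in> carrier K" "w \<in> carrier K"
    and ap: "\<And>\<epsilon>. \<epsilon> > 0 \<Longrightarrow> \<exists>(x, y)\<in>mop. x \<in> carrier K \<and> y \<in> carrier K \<and> hnorm K (v \<ominus>\<^bsub>K\<^esub> x) < \<epsilon> \<and> hnorm K (w \<ominus>\<^bsub>K\<^esub> y) < \<epsilon>"
    using p unfolding vw K.graph_closure_iff by blast+
  have "(v, w) \<in> mop"
  proof (rule mopI[OF c])
    fix g assume g: "g \<in> G"
    obtain C where C: "\<And>s. s \<in> carrier S \<Longrightarrow> hnorm S (F g s) \<le> C * hnorm S s"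
      using bounded_opsD(2)[OF F_bounded[OF g]] by blast
    have "hnorm S (comp g w \<ominus>\<^bsub>S\<^esub> F g (comp g v)) \<le> 0"
    proof (rule field_le_epsilon)
      fix \<epsilon> :: real assume e: "\<epsilon> > 0"
      define d where "d = \<epsilon> / (\<bar>C\<bar> + 1)"
      have d: "d > 0" "d * (\<bar>C\<bar> + 1) = \<epsilon>" using e by (simp_all add: d_def add_nonneg_pos)
      obtain x y where xy: "(x, y) \<in> mop" "x \<in> carrier K" "y \<in> carrier K" "hnorm K (v \<ominus>\<^bsub>K\<^esub> x) < d" "hnorm K (w \<ominus>\<^bsub>K\<^esub> y) < d"
        using ap[OF d(1)] by blast
      have "comp g w \<ominus>\<^bsub>S\<^esub> F g (comp g v) = (comp g w \<ominus>\<^bsub>S\<^esub> comp g y) \<oplus>\<^bsub>S\<^esub> (comp g y \<ominus>\<^bsub>S\<^esub> F g (comp g v))"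
        by (rule S.nrm.diff_trans) (use g in simp_all)
      also have "comp g w \<ominus>\<^bsub>S\<^esub> comp g y = comp g (w \<ominus>\<^bsub>K\<^esub> y)" using comp_minus[OF g c(2) xy(3)] by simp
      also have "comp g y \<ominus>\<^bsub>S\<^esub> F g (comp g v) = F g (comp g (x \<ominus>\<^bsub>K\<^esub> v))"
        using comp_minus[OF g xy(2) c(1)] mopD(3)[OF xy(1) g]
          linear_maps_minus[OF S.nrm.cnormed_axioms S.nrm.cnormed_axioms F_linear[OF g], of "comp g x" "comp g v"] by simp
      finally have "hnorm S (comp g w \<ominus>\<^bsub>S\<^esub> F g (comp g v)) \<le> hnorm S (comp g (w \<ominus>\<^bsub>K\<^esub> y)) + hnorm S (F g (comp g (x \<ominus>\<^bsub>K\<^esub> v)))"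
        using S.nrm.nrm_triangle[OF comp_closed[of g "w \<ominus>\<^bsub>K\<^esub> y"] F_closed[OF g comp_closed[of g "x \<ominus>\<^bsub>K\<^esub> v"]]] by simp
      also have "\<dots> \<le> d + \<bar>C\<bar> * d"
      proof (rule add_mono)
        show "hnorm S (comp g (w \<ominus>\<^bsub>K\<^esub> y)) \<le> d" using comp_norm_le[OF g, of "w \<ominus>\<^bsub>K\<^esub> y"] xy c by simp
        have "hnorm S (F g (comp g (x \<ominus>\<^bsub>K\<^esub> v))) \<le> C * hnorm S (comp g (x \<ominus>\<^bsub>K\<^esub> v))" by (rule C) simp
        also have "\<dots> \<le> \<bar>C\<bar> * hnorm S (comp g (x \<ominus>\<^bsub>K\<^esub> v))" by (intro mult_right_mono S.hnorm_nonneg) simp_all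
        also have "\<dots> \<le> \<bar>C\<bar> * d"
          using comp_norm_le[OF g, of "x \<ominus>\<^bsub>K\<^esub> v"] xy c K.nrm.nrm_minus_commute[OF c(1) xy(2)] by (intro mult_left_mono) simp_all
        finally show "hnorm S (F g (comp g (x \<ominus>\<^bsub>K\<^esub> v))) \<le> \<bar>C\<bar> * d" .
      qed
      also have "\<dots> = \<epsilon>" using d(2) by (simp add: algebra_simps)
      finally show "hnorm S (comp g w \<ominus>\<^bsub>S\<^esub> F g (comp g v)) \<le> 0 + \<epsilon>" by simp
    qed
    then have "hnorm S (comp g w \<ominus>\<^bsub>S\<^esub> F g (comp g v)) = 0"
      using S.hnorm_nonneg[of "comp g w \<ominus>\<^bsub>S\<^esub> F g (comp g v)"] g by simp
    then show "comp g w = F g (comp g v)" by (rule S.nrm.nrm_minus_eq_zero[OF comp_closed F_closed[OF g comp_closed]])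
  qed
  then show "p \<in> mop" using vw by simp
qed

text \<open>Truncating both entries of a pair over the same finite set approximates it in the graph
  norm. Hence any part of the graph that contains all finite truncations is a core.\<close>

lemma mop_core:
  assumes "\<And>v w X. (v, w) \<in> mop \<Longrightarrow> finite X \<Longrightarrow> X \<subseteq> G \<Longrightarrow> (proj X v, proj X w) \<in> D" and "D \<subseteq> mop"
  shows "graph_closure K D = mop"
proof
  have "graph_closure K D \<subseteq> graph_closure K mop"
    unfolding graph_closure_def by (rule closure_of_mono[OF assms(2)])
  then show "graph_closure K D \<subseteq> mop" using mop_closed by blast
  show "mop \<subseteq> graph_closure K D"
  proof
    fix p assume p: "p \<in> mop"
    obtain v w where vw: "p = (v, w)" by (cases p)
    note m = p[unfolded vw]
    note c = mopD(1,2)[OF m]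
    show "p \<in> graph_closure K D"
      unfolding vw K.graph_closure_iff
    proof (intro conjI c allI impI)
      fix d :: real assume d: "d > 0"
      obtain X1 where X1: "finite X1" "X1 \<subseteq> G" "\<And>Y. finite Y \<Longrightarrow> Y \<subseteq> G \<Longrightarrow> X1 \<subseteq> Y \<Longrightarrow> hnorm K (v \<ominus>\<^bsub>K\<^esub> proj Y v) < d"
        using Parseval_approx[OF c(1) d] by metis
      obtain X2 where X2: "finite X2" "X2 \<subseteq> G" "\<And>Y. finite Y \<Longrightarrow> Y \<subseteq> G \<Longrightarrow> X2 \<subseteq> Y \<Longrightarrow> hnorm K (w \<ominus>\<^bsub>K\<^esub> proj Y w) < d"
        using Parseval_approx[OF c(2) d] by metis
      define X where "X = X1 \<union> X2"
      have X: "finite X" "X \<subseteq> G" and dx: "hnorm K (v \<ominus>\<^bsub>K\<^esub> proj X v) < d" and dy: "hnorm K (w \<ominus>\<^bsub>K\<^esub> proj X w) < d"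
        using X1 X2 unfolding X_def by auto
      show "\<exists>(x, y)\<in>D. x \<in> carrier K \<and> y \<in> carrier K \<and> hnorm K (v \<ominus>\<^bsub>K\<^esub> x) < d \<and> hnorm K (w \<ominus>\<^bsub>K\<^esub> y) < d"
        by (rule bexI[OF _ assms(1)[OF m X]]) (simp add: dx dy proj_closed[OF X(2)])
    qed
  qed
qed

text \<open>The blockwise inverses of \<open>F g - i\<close> all have norm at most 1, and this
  uniformity in g is what lets them be glued to a bounded operator.\<close>

lemma mop_resolvent_exists: "\<exists>R. is_resolvent K mop \<i> R"
proof -
  have "\<exists>R. R \<in> linear_maps S S \<and> (\<forall>s\<in>carrier S. hnorm S (R s) \<le> 1 * hnorm S s) \<and>
      (\<forall>s\<in>carrier S. F g (R s) \<ominus>\<^bsub>S\<^esub> \<i> \<odot>\<^bsub>S\<^esub> R s = s)" if "g \<in> G" for g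
    using S.End_sa_resolvent[OF onb F_sa[OF that]] by (metis mult_1)
  then obtain Q where Q: "\<And>g. g \<in> G \<Longrightarrow> Q g \<in> linear_maps S S"
    "\<And>g s. g \<in> G \<Longrightarrow> s \<in> carrier S \<Longrightarrow> hnorm S (Q g s) \<le> 1 * hnorm S s"
    "\<And>g s. g \<in> G \<Longrightarrow> s \<in> carrier S \<Longrightarrow> F g (Q g s) \<ominus>\<^bsub>S\<^esub> \<i> \<odot>\<^bsub>S\<^esub> Q g s = s" by metis
  obtain R where R: "R \<in> bounded_ops K K" "\<And>g v. g \<in> G \<Longrightarrow> v \<in> carrier K \<Longrightarrow> comp g (R v) = Q g (comp g v)"
    using block_shift_exists[of "\<lambda>g. g" Q 1, OF _ _ Q(1) Q(2)] by auto
  note Rc = linear_mapsD(1)[OF bounded_opsD(1)[OF R(1)]]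
  have Qc: "Q g s \<in> carrier S" if "g \<in> G" "s \<in> carrier S" for g s using linear_mapsD(1)[OF Q(1)] that by blast
  have rg: "(R v, v \<oplus>\<^bsub>K\<^esub> \<i> \<odot>\<^bsub>K\<^esub> R v) \<in> mop" if v: "v \<in> carrier K" for v
  proof (rule mopI[OF Rc[OF v]])
    show "v \<oplus>\<^bsub>K\<^esub> \<i> \<odot>\<^bsub>K\<^esub> R v \<in> carrier K" using v Rc by simp
    fix g assume g: "g \<in> G"
    have "comp g (v \<oplus>\<^bsub>K\<^esub> \<i> \<odot>\<^bsub>K\<^esub> R v) = comp g v \<oplus>\<^bsub>S\<^esub> \<i> \<odot>\<^bsub>S\<^esub> Q g (comp g v)"
      using v Rc g by (simp add: linear_mapsD(2,3)[OF comp_linear[OF g]] R(2))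
    also have "\<dots> = (F g (Q g (comp g v)) \<ominus>\<^bsub>S\<^esub> \<i> \<odot>\<^bsub>S\<^esub> Q g (comp g v)) \<oplus>\<^bsub>S\<^esub> \<i> \<odot>\<^bsub>S\<^esub> Q g (comp g v)"
      using Q(3)[OF g comp_closed] by simp
    also have "\<dots> = F g (Q g (comp g v))"
      using S.nrm.add_diff[of "F g (Q g (comp g v))" "\<i> \<odot>\<^bsub>S\<^esub> Q g (comp g v)"] Qc[OF g] g
      by (simp add: S.nrm.a_comm)
    finally show "comp g (v \<oplus>\<^bsub>K\<^esub> \<i> \<odot>\<^bsub>K\<^esub> R v) = F g (comp g (R v))" using R(2)[OF g v] by simp
  qed
  have "is_resolvent K mop \<i> R"
    unfolding is_resolvent_def
  proof (intro conjI R(1) ballI)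
    fix v assume v: "v \<in> carrier K"
    have "(v \<oplus>\<^bsub>K\<^esub> \<i> \<odot>\<^bsub>K\<^esub> R v) \<ominus>\<^bsub>K\<^esub> \<i> \<odot>\<^bsub>K\<^esub> R v = v"
      using v Rc by (subst K.nrm.a_comm) (simp_all add: K.nrm.add_diff2)
    then show "\<exists>w. (R v, w) \<in> mop \<and> w \<ominus>\<^bsub>K\<^esub> \<i> \<odot>\<^bsub>K\<^esub> R v = v" using rg[OF v] by blast
  next
    fix p assume p: "p \<in> mop"
    obtain v w where vw: "p = (v, w)" by (cases p)
    note m = p[unfolded vw]
    note c = mopD(1,2)[OF m]
    define u where "u = w \<ominus>\<^bsub>K\<^esub> \<i> \<odot>\<^bsub>K\<^esub> v"
    have uc: "u \<in> carrier K" using c by (simp add: u_def)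
    have "R u = v"
    proof (rule comp_ext[OF Rc[OF uc] c(1)])
      fix g assume g: "g \<in> G"
      let ?s = "comp g v" and ?t = "Q g (comp g u)"
      have tc: "?t \<in> carrier S" using Qc[OF g] by simp
      have 1: "comp g u = F g ?s \<ominus>\<^bsub>S\<^esub> \<i> \<odot>\<^bsub>S\<^esub> ?s"
        unfolding u_def using c g comp_minus[OF g] linear_mapsD(3)[OF comp_linear[OF g]] mopD(3)[OF m g] by simp
      have 2: "F g ?t \<ominus>\<^bsub>S\<^esub> \<i> \<odot>\<^bsub>S\<^esub> ?t = comp g u" by (rule Q(3)[OF g comp_closed])
      \<comment> \<open>The difference of the two candidates is annihilated by
        \<open>F g - i\<close>, and \<open>hnorm_minus_i_sq\<close> then makes its norm
        zero.\<close>
      let ?d = "?t \<ominus>\<^bsub>S\<^esub> ?s"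
      have dc: "?d \<in> carrier S" using tc by simp
      have "F g ?d \<ominus>\<^bsub>S\<^esub> \<i> \<odot>\<^bsub>S\<^esub> ?d = (F g ?t \<ominus>\<^bsub>S\<^esub> \<i> \<odot>\<^bsub>S\<^esub> ?t) \<ominus>\<^bsub>S\<^esub> (F g ?s \<ominus>\<^bsub>S\<^esub> \<i> \<odot>\<^bsub>S\<^esub> ?s)"
        using tc g linear_maps_minus[OF S.nrm.cnormed_axioms S.nrm.cnormed_axioms F_linear[OF g] tc comp_closed]
        by (simp add: S.nrm.sm_minus S.nrm.diff_diff_diff)
      also have "\<dots> = \<zero>\<^bsub>S\<^esub>" by (simp only: 2 1[symmetric] S.nrm.minus_self comp_closed)
      finally have "(hnorm S (F g ?d))\<^sup>2 + (hnorm S ?d)\<^sup>2 = 0"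
        using S.hnorm_minus_i_sq[OF End_saD(2)[OF F_sa[OF g]] dc F_closed[OF g dc]] by simp
      then have "hnorm S ?d = 0" by (simp add: sum_power2_eq_zero_iff)
      then have "?t = ?s" by (rule S.nrm.nrm_minus_eq_zero[OF tc comp_closed])
      then show "comp g (R u) = comp g v" using R(2)[OF g uc] by simp
    qed
    then show "case p of (v, w) \<Rightarrow> R (w \<ominus>\<^bsub>K\<^esub> \<i> \<odot>\<^bsub>K\<^esub> v) = v" unfolding vw u_def by simp
  qed
  then show ?thesis by blast
qed

text \<open>Outside the low-spectrum set, \<open>F g\<close> expands norms by at least r, so the
  part of v lying there is bounded by \<open>|w| / r\<close>; this is compared block by
  block.\<close>

lemma mop_tail:
  assumes vw: "(v, w) \<in> mop" and r: "r > 0" and fin: "finite (low_spectrum_set F S G r)"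
  shows "r * hnorm K (v \<ominus>\<^bsub>K\<^esub> proj (low_spectrum_set F S G r) v) \<le> hnorm K w"
proof -
  let ?X = "low_spectrum_set F S G r"
  have X: "?X \<subseteq> G" by (auto simp: low_spectrum_set_def)
  note c = mopD(1,2)[OF vw]
  have pc: "proj ?X v \<in> carrier K" by (rule proj_closed[OF X])
  have "hnorm K (complex_of_real r \<odot>\<^bsub>K\<^esub> (v \<ominus>\<^bsub>K\<^esub> proj ?X v)) \<le> hnorm K w"
  proof (rule norm_le_of_comp)
    fix g assume g: "g \<in> G"
    have cp: "comp g (proj ?X v) = (if g \<in> ?X then comp g v else \<zero>\<^bsub>S\<^esub>)"
      unfolding proj_def by (rule comp_blk[OF fin X _ g]) simp
    have "comp g (complex_of_real r \<odot>\<^bsub>K\<^esub> (v \<ominus>\<^bsub>K\<^esub> proj ?X v)) = complex_of_real r \<odot>\<^bsub>S\<^esub> (comp g v \<ominus>\<^bsub>S\<^esub> comp g (proj ?X v))"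
      using c pc g by (simp add: comp_minus linear_mapsD(3)[OF comp_linear])
    then have eq: "hnorm S (comp g (complex_of_real r \<odot>\<^bsub>K\<^esub> (v \<ominus>\<^bsub>K\<^esub> proj ?X v))) = r * hnorm S (comp g v \<ominus>\<^bsub>S\<^esub> comp g (proj ?X v))"
      using r by (simp add: S.hnorm_smult)
    show "hnorm S (comp g (complex_of_real r \<odot>\<^bsub>K\<^esub> (v \<ominus>\<^bsub>K\<^esub> proj ?X v))) \<le> hnorm S (comp g w)"
    proof (cases "g \<in> ?X")
      case True
      then show ?thesis unfolding eq cp using S.hnorm_nonneg[of "comp g w"] by simp
    next
      case False
      then have "spectrum S (F g) \<inter> complex_of_real ` {-r..r} = {}" using g by (simp add: low_spectrum_set_def)
      from S.lower_bound_off_spectrum[OF onb F_sa[OF g] this, of "comp g v"]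
      have "r * hnorm S (comp g v) \<le> hnorm S (comp g w)" using mopD(3)[OF vw g] by simp
      moreover have "comp g v \<ominus>\<^bsub>S\<^esub> \<zero>\<^bsub>S\<^esub> = comp g v" by (simp add: S.nrm.minus_sm)
      ultimately show ?thesis unfolding eq cp using False by simp
    qed
  qed (use c pc in simp_all)
  then show ?thesis using r c pc by (simp add: K.hnorm_smult)
qed

text \<open>Every resolvent is treated directly. The image x of a unit-ball vector u has
  \<open>D x = u + z x\<close> of uniformly bounded norm, so by \<open>mop_tail\<close> it is
  uniformly close to vectors in finitely many blocks, with components in a fixed ball of S.\<close>

lemma mop_compact_resolvent:
  assumes fin: "\<And>r. r > 0 \<Longrightarrow> finite (low_spectrum_set F S G r)"
  shows "compact_resolvent K mop"
  unfolding compact_resolvent_def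
proof (intro conjI allI impI)
  show "\<exists>z R. is_resolvent K mop z R" using mop_resolvent_exists by blast
  fix z R assume R: "is_resolvent K mop z R"
  have Rb: "R \<in> bounded_ops K K" using R by (simp add: is_resolvent_def)
  obtain C0 where C0: "\<And>v. v \<in> carrier K \<Longrightarrow> hnorm K (R v) \<le> C0 * hnorm K v" using bounded_opsD(2)[OF Rb] by blast
  define C where "C = \<bar>C0\<bar>"
  have C: "C \<ge> 0" by (simp add: C_def)
  let ?Z = "R ` {v \<in> carrier K. hnorm K v \<le> 1}"
  have Z: "\<exists>w. (x, w) \<in> mop \<and> hnorm K w \<le> 1 + cmod z * C" "hnorm K x \<le> C" "x \<in> carrier K" if "x \<in> ?Z" for x
  proof -
    obtain u where u: "u \<in> carrier K" "hnorm K u \<le> 1" "x = R u" using \<open>x \<in> ?Z\<close> by blast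
    show xc: "x \<in> carrier K" using u linear_mapsD(1)[OF bounded_opsD(1)[OF Rb]] by blast
    have "hnorm K x \<le> C0 * hnorm K u" using C0 u by blast
    also have "\<dots> \<le> C * 1" unfolding C_def using u K.hnorm_nonneg[OF u(1)] by (intro mult_mono) simp_all
    finally show nx: "hnorm K x \<le> C" by simp
    obtain w where w: "(x, w) \<in> mop" "w \<ominus>\<^bsub>K\<^esub> z \<odot>\<^bsub>K\<^esub> x = u" using R u unfolding is_resolvent_def by blast
    have wc: "w \<in> carrier K" using w mopD(2) by blast
    have "w = z \<odot>\<^bsub>K\<^esub> x \<oplus>\<^bsub>K\<^esub> u" using w(2) K.nrm.add_diff[OF wc K.nrm.sm_closed[OF xc, of z]] by simp
    then have "hnorm K w \<le> hnorm K (z \<odot>\<^bsub>K\<^esub> x) + hnorm K u" using K.nrm.nrm_triangle xc u by simp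
    also have "\<dots> \<le> cmod z * C + 1" using u nx xc by (intro add_mono) (simp_all add: K.hnorm_smult mult_left_mono)
    finally show "\<exists>w. (x, w) \<in> mop \<and> hnorm K w \<le> 1 + cmod z * C" using w(1) by (intro exI[of _ w]) simp
  qed
  have "K.nrm.tb ?Z"
  proof (rule K.nrm.tb_approx)
    show "?Z \<subseteq> carrier K" using Z(3) by blast
    fix \<epsilon> :: real assume e: "\<epsilon> > 0"
    define q where "q = 1 + cmod z * C"
    have q: "q > 0" using C by (simp add: q_def add_pos_nonneg)
    \<comment> \<open>With this spectral cutoff the tail bound \<open>q / r\<close> equals
      \<open>\<epsilon> / 2\<close>.\<close>
    define r where "r = 2 * q / \<epsilon>"
    have r: "r > 0" using q e by (simp add: r_def)
    let ?X = "low_spectrum_set F S G r"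
    have X: "finite ?X" "?X \<subseteq> G" using fin[OF r] by (auto simp: low_spectrum_set_def)
    let ?Y = "{finsum K f ?X | f. \<forall>g\<in>?X. f g \<in> e g ` {s \<in> carrier S. hnorm S s \<le> C}}"
    have "K.nrm.tb ?Y"
    proof (rule K.nrm.tb_finsum[OF X(1)])
      fix g assume "g \<in> ?X"
      then have g: "g \<in> G" using X by blast
      show "K.nrm.tb (e g ` {s \<in> carrier S. hnorm S s \<le> C})"
        by (rule tb_image[OF S.nrm.cnormed_axioms K.nrm.cnormed_axioms e_linear[OF g] _ S.tb_ball[OF onb], where C=1])
           (simp add: e_norm g)
    qed
    moreover have "\<exists>y\<in>?Y. hnorm K (x \<ominus>\<^bsub>K\<^esub> y) < \<epsilon>" if x: "x \<in> ?Z" for x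
    proof (rule bexI[of _ "proj ?X x"])
      obtain w where w: "(x, w) \<in> mop" "hnorm K w \<le> q" using Z(1)[OF x] unfolding q_def by blast
      have "r * hnorm K (x \<ominus>\<^bsub>K\<^esub> proj ?X x) \<le> q" using mop_tail[OF w(1) r X(1)] w(2) by simp
      then have "hnorm K (x \<ominus>\<^bsub>K\<^esub> proj ?X x) \<le> \<epsilon> / 2" using q e by (simp add: r_def field_simps)
      then show "hnorm K (x \<ominus>\<^bsub>K\<^esub> proj ?X x) < \<epsilon>" using e by simp
      have "hnorm S (comp g x) \<le> C" if "g \<in> ?X" for g
        using comp_norm_le[of g x] that X(2) Z(2,3)[OF x] by fastforce
      then show "proj ?X x \<in> ?Y" unfolding proj_def blk_def by (intro CollectI exI[of _ "\<lambda>g. e g (comp g x)"]) auto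
    qed
    ultimately show "\<exists>Y. K.nrm.tb Y \<and> (\<forall>x\<in>?Z. \<exists>y\<in>Y. hnorm K (x \<ominus>\<^bsub>K\<^esub> y) < \<epsilon>)" by blast
  qed
  then show "R \<in> compact_ops K K"
    unfolding compact_ops_def using Rb K.nrm.tb_compact_closure[OF K.mcompl] by (simp add: K.htop_eq)
qed

text \<open>The commutator has blocks \<open>c g * (F (\<sigma> g) - F g)\<close>, uniformly bounded
  by C. Membership of \<open>(T v, Q v + T w)\<close> in the graph states both that T preserves the
  domain and that Q extends the commutator.\<close>

lemma shift_commutator:
  assumes T: "T \<in> bounded_ops K K" and \<sigma>: "inj_on \<sigma> G" "\<sigma> ` G \<subseteq> G"
    and Te: "\<And>g s. g \<in> G \<Longrightarrow> s \<in> carrier S \<Longrightarrow> T (e g s) = c g \<odot>\<^bsub>K\<^esub> e (\<sigma> g) s"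
    and c: "\<And>g. g \<in> G \<Longrightarrow> cmod (c g) = 1"
    and C: "\<And>g s. g \<in> G \<Longrightarrow> s \<in> carrier S \<Longrightarrow> hnorm S (F (\<sigma> g) s \<ominus>\<^bsub>S\<^esub> F g s) \<le> C * hnorm S s"
  shows "\<exists>Q\<in>bounded_ops K K. \<forall>(v, w)\<in>mop. (T v, Q v \<oplus>\<^bsub>K\<^esub> T w) \<in> mop"
proof -
  have \<sigma>G: "\<sigma> g \<in> G" if "g \<in> G" for g using \<sigma>(2) that by blast
  have b1: "hnorm S (c g \<odot>\<^bsub>S\<^esub> s) \<le> 1 * hnorm S s" if "g \<in> G" "s \<in> carrier S" for g s
    using that by (simp add: S.hnorm_smult c)
  have lin1: "(\<lambda>s. c g \<odot>\<^bsub>S\<^esub> s) \<in> linear_maps S S" if "g \<in> G" for g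
    by (rule linear_mapsI) (simp_all add: S.nrm.sm_radd mult.commute)
  \<comment> \<open>T is known only on vectors of single blocks. T' agrees with it there, hence
    everywhere by continuity, and has known components on every vector.\<close>
  obtain T' where T': "T' \<in> bounded_ops K K"
    "\<And>g v. g \<in> G \<Longrightarrow> v \<in> carrier K \<Longrightarrow> comp (\<sigma> g) (T' v) = c g \<odot>\<^bsub>S\<^esub> comp g v"
    "\<And>k v. k \<in> G \<Longrightarrow> k \<notin> \<sigma> ` G \<Longrightarrow> v \<in> carrier K \<Longrightarrow> comp k (T' v) = \<zero>\<^bsub>S\<^esub>"
    by (rule block_shift_exists[OF \<sigma>, of "\<lambda>g s. c g \<odot>\<^bsub>S\<^esub> s" 1]) (use lin1 b1 in blast)+
  note T'c = linear_mapsD(1)[OF bounded_opsD(1)[OF T'(1)]]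
  have TT': "T v = T' v" if "v \<in> carrier K" for v
  proof (rule bounded_eq_on_blocks[OF T T'(1) _ that])
    fix g s assume g: "g \<in> G" and s: "s \<in> carrier S"
    have "c g \<odot>\<^bsub>K\<^esub> e (\<sigma> g) s = T' (e g s)"
    proof (rule comp_ext)
      fix k assume k: "k \<in> G"
      have l: "comp k (c g \<odot>\<^bsub>K\<^esub> e (\<sigma> g) s) = c g \<odot>\<^bsub>S\<^esub> (if k = \<sigma> g then s else \<zero>\<^bsub>S\<^esub>)"
        using k g s \<sigma>G by (simp add: linear_mapsD(3)[OF comp_linear] comp_e)
      show "comp k (c g \<odot>\<^bsub>K\<^esub> e (\<sigma> g) s) = comp k (T' (e g s))"
      proof (cases "k \<in> \<sigma> ` G")
        case True
        then obtain h where h: "h \<in> G" "k = \<sigma> h" by blast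
        have "(\<sigma> h = \<sigma> g) = (h = g)" using \<sigma>(1) h g by (simp add: inj_on_eq_iff)
        then show ?thesis unfolding l using h g s T'(2)[OF h(1), of "e g s"] by (auto simp: comp_e)
      next
        case False
        then have "k \<noteq> \<sigma> g" using g by blast
        then show ?thesis unfolding l using T'(3)[OF k False, of "e g s"] g s by simp
      qed
    qed (use g s \<sigma>G T'c in simp_all)
    then show "T (e g s) = T' (e g s)" using Te[OF g s] by simp
  qed
  have lin2: "(\<lambda>s. c g \<odot>\<^bsub>S\<^esub> (F (\<sigma> g) s \<ominus>\<^bsub>S\<^esub> F g s)) \<in> linear_maps S S" if g: "g \<in> G" for g
  proof -
    note D = linear_mapsD[OF linear_maps_diff[OF S.nrm.cnormed_axioms F_linear[OF \<sigma>G[OF g]] F_linear[OF g]]]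
    show ?thesis by (rule linear_mapsI) (use g \<sigma>G in \<open>simp_all add: D S.nrm.sm_radd mult.commute\<close>)
  qed
  have b2: "hnorm S (c g \<odot>\<^bsub>S\<^esub> (F (\<sigma> g) s \<ominus>\<^bsub>S\<^esub> F g s)) \<le> C * hnorm S s" if "g \<in> G" "s \<in> carrier S" for g s
    using C[OF that] that \<sigma>G by (simp add: S.hnorm_smult c)
  obtain Q where Q: "Q \<in> bounded_ops K K"
    "\<And>g v. g \<in> G \<Longrightarrow> v \<in> carrier K \<Longrightarrow> comp (\<sigma> g) (Q v) = c g \<odot>\<^bsub>S\<^esub> (F (\<sigma> g) (comp g v) \<ominus>\<^bsub>S\<^esub> F g (comp g v))"
    "\<And>k v. k \<in> G \<Longrightarrow> k \<notin> \<sigma> ` G \<Longrightarrow> v \<in> carrier K \<Longrightarrow> comp k (Q v) = \<zero>\<^bsub>S\<^esub>"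
    by (rule block_shift_exists[OF \<sigma>, of "\<lambda>g s. c g \<odot>\<^bsub>S\<^esub> (F (\<sigma> g) s \<ominus>\<^bsub>S\<^esub> F g s)" C]) (use lin2 b2 in blast)+
  note Qc = linear_mapsD(1)[OF bounded_opsD(1)[OF Q(1)]]
  show ?thesis
  proof (rule bexI[OF _ Q(1)], safe)
    fix v w assume m: "(v, w) \<in> mop"
    note cc = mopD(1,2)[OF m]
    show "(T v, Q v \<oplus>\<^bsub>K\<^esub> T w) \<in> mop"
      unfolding TT'[OF cc(1)] TT'[OF cc(2)]
    proof (rule mopI)
      fix k assume k: "k \<in> G"
      have l: "comp k (Q v \<oplus>\<^bsub>K\<^esub> T' w) = comp k (Q v) \<oplus>\<^bsub>S\<^esub> comp k (T' w)"
        using k cc Qc T'c by (simp add: linear_mapsD(2)[OF comp_linear])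
      show "comp k (Q v \<oplus>\<^bsub>K\<^esub> T' w) = F k (comp k (T' v))"
      proof (cases "k \<in> \<sigma> ` G")
        case True
        then obtain g where g: "g \<in> G" "k = \<sigma> g" by blast
        let ?s = "comp g v"
        have "comp k (Q v \<oplus>\<^bsub>K\<^esub> T' w) = c g \<odot>\<^bsub>S\<^esub> (F k ?s \<ominus>\<^bsub>S\<^esub> F g ?s) \<oplus>\<^bsub>S\<^esub> c g \<odot>\<^bsub>S\<^esub> F g ?s"
          unfolding l using g cc Q(2) T'(2) mopD(3)[OF m] by simp
        also have "\<dots> = c g \<odot>\<^bsub>S\<^esub> (F g ?s \<oplus>\<^bsub>S\<^esub> (F k ?s \<ominus>\<^bsub>S\<^esub> F g ?s))"
          using g k by (simp add: S.nrm.sm_radd S.nrm.a_comm)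
        also have "\<dots> = c g \<odot>\<^bsub>S\<^esub> F k ?s" using g k by (simp add: S.nrm.add_diff)
        also have "\<dots> = F k (comp k (T' v))"
          using g k cc T'(2) linear_mapsD(3)[OF F_linear[OF k]] by simp
        finally show ?thesis .
      next
        case False
        then show ?thesis unfolding l using k cc Q(3) T'(3) F_zero by simp
      qed
    qed (use cc Qc T'c in simp_all)
  qed
qed

end

section \<open>Unitaries, phases and monomials\<close>

text \<open>Products and images of monomials produce phases whose values never matter for the block
  structure, only that they have modulus one.\<close>

definition ph :: "'a cstar \<Rightarrow> 'a \<Rightarrow> 'a \<Rightarrow> bool" where
  "ph A u v \<longleftrightarrow> (\<exists>c. cmod c = 1 \<and> u = c \<odot>\<^bsub>A\<^esub> v)"

definition e2pi :: "real \<Rightarrow> complex" where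
  "e2pi t = exp (2 * complex_of_real pi * \<i> * complex_of_real t)"

lemma e2pi_add: "e2pi (s + t) = e2pi s * e2pi t"
  by (simp add: e2pi_def distrib_left exp_add)

lemma e2pi_0 [simp]: "e2pi 0 = 1"
  by (simp add: e2pi_def)

lemma e2pi_minus: "e2pi t * e2pi (- t) = 1"
  by (simp flip: e2pi_add)

text \<open>Here the phase is recorded, through its real exponent, so that exponents add under
  products. The vanishing of the trace depends on the phase being different from 1.\<close>

definition commutes_up_to :: "'a cstar \<Rightarrow> 'a \<Rightarrow> 'a \<Rightarrow> real \<Rightarrow> bool" where
  "commutes_up_to A u v t \<longleftrightarrow> v \<otimes>\<^bsub>A\<^esub> u = e2pi t \<odot>\<^bsub>A\<^esub> (u \<otimes>\<^bsub>A\<^esub> v)"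

locale ucstar = unital_cstar_algebra A for A :: "'a cstar" (structure)
begin

lemma unitaryD: assumes "u \<in> unitaries A"
  shows "u \<in> carrier A" "star A u \<in> carrier A" "star A u \<otimes> u = \<one>" "u \<otimes> star A u = \<one>"
  using assms star_closed by (auto simp: unitaries_def)

lemma star_unitary: "u \<in> unitaries A \<Longrightarrow> star A u \<in> unitaries A"
  by (auto simp: unitaries_def star_closed star_star)

lemma one_unitary: "\<one> \<in> unitaries A"
  by (auto simp: unitaries_def star_one)

lemma mult_unitary: assumes "u \<in> unitaries A" "v \<in> unitaries A" shows "u \<otimes> v \<in> unitaries A"
proof -
  note u = unitaryD[OF assms(1)] and v = unitaryD[OF assms(2)]
  have "star A v \<otimes> star A u \<otimes> (u \<otimes> v) = star A v \<otimes> (star A u \<otimes> u) \<otimes> v" using u(1,2) v(1,2) by (simp add: rg.m_assoc)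
  moreover have "u \<otimes> v \<otimes> (star A v \<otimes> star A u) = u \<otimes> (v \<otimes> star A v) \<otimes> star A u" using u(1,2) v(1,2) by (simp add: rg.m_assoc)
  ultimately show ?thesis using u v by (simp add: unitaries_def star_mult)
qed

lemma cancel_left: assumes "u \<in> unitaries A" "a \<in> carrier A" shows "star A u \<otimes> (u \<otimes> a) = a" "u \<otimes> (star A u \<otimes> a) = a"
  using unitaryD[OF assms(1)] assms(2) by (simp_all flip: rg.m_assoc)

lemma cancel_right: assumes "u \<in> unitaries A" "a \<in> carrier A" shows "a \<otimes> u \<otimes> star A u = a" "a \<otimes> star A u \<otimes> u = a"
  using unitaryD[OF assms(1)] assms(2) by (simp_all add: rg.m_assoc)

lemma inv_unitary: assumes "u \<in> unitaries A" shows "inv u = star A u"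
  unfolding m_inv_def
proof (rule the_equality)
  fix y assume y: "y \<in> carrier A \<and> u \<otimes> y = \<one> \<and> y \<otimes> u = \<one>"
  have "y = star A u \<otimes> (u \<otimes> y)" using y cancel_left(1)[OF assms, of y] by simp
  also have "\<dots> = star A u" using y unitaryD(2)[OF assms] by simp
  finally show "y = star A u" .
qed (use unitaryD[OF assms] in simp)

lemma nat_pow_unitary: "u \<in> unitaries A \<Longrightarrow> u [^] (n::nat) \<in> unitaries A"
  by (induction n) (simp_all add: one_unitary mult_unitary)

lemma int_pow_unitary: assumes "u \<in> unitaries A" shows "u [^] (k::int) \<in> unitaries A"
proof -
  have "inv (u [^] n) \<in> unitaries A" for n :: nat
    using nat_pow_unitary[OF assms] by (simp add: inv_unitary star_unitary)
  then show ?thesis using nat_pow_unitary[OF assms] by (simp add: int_pow_def nat_pow_def Let_def)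
qed

text \<open>Integer powers are defined by a case split on the sign. This recursion and its
  predecessor form replace the split by induction in both directions.\<close>

lemma int_pow_succ: assumes u: "u \<in> unitaries A" shows "u [^] (k + 1 :: int) = u [^] k \<otimes> u"
proof (cases "k \<ge> 0")
  case True
  have p: "u [^] i = u [^] nat i" if "i \<ge> 0" for i :: int using that by (simp add: int_pow_def nat_pow_def)
  have 1: "u [^] (k + 1) = u [^] nat (k + 1)" by (rule p) (use True in simp)
  have 2: "u [^] k = u [^] nat k" by (rule p[OF True])
  have 3: "nat (k + 1) = Suc (nat k)" using True by simp
  show ?thesis unfolding 1 2 3 by (rule nat_pow_Suc)
next
  case False
  \<comment> \<open>So that \<open>k = -(n + 1)\<close> and \<open>k + 1 = -n\<close>: one factor of
    the inverse power is cancelled by u.\<close>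
  define n where "n = nat (- k - 1)"
  have k: "k = - int (Suc n)" using False by (simp add: n_def)
  have neg: "u [^] (- int j) = star A (u [^] j)" for j
  proof (cases "j = 0")
    case False
    then have "u [^] (- int j) = inv (u [^] j)" by (simp add: int_pow_def nat_pow_def)
    then show ?thesis using nat_pow_unitary[OF u] by (simp add: inv_unitary)
  qed (simp add: star_one)
  have c: "u \<in> carrier A" "u [^] n \<in> carrier A" using unitaryD[OF u] unitaryD[OF nat_pow_unitary[OF u]] by blast+
  have "u [^] k \<otimes> u = star A (u [^] Suc n) \<otimes> u" using neg[of "Suc n"] k by simp
  also have "u [^] Suc n = u \<otimes> u [^] n" using c by (simp only: rg.nat_pow_Suc2)
  also have "star A (u \<otimes> u [^] n) \<otimes> u = star A (u [^] n)"
    using c cancel_right(2)[OF u star_closed[OF c(2)]] by (simp add: star_mult)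
  also have "\<dots> = u [^] (k + 1)" using neg[of n] k by simp
  finally show ?thesis by simp
qed

lemma int_pow_pred: assumes u: "u \<in> unitaries A" shows "u [^] (k - 1 :: int) = u [^] k \<otimes> star A u"
  using int_pow_succ[OF u, of "k - 1"] cancel_right(1)[OF u unitaryD(1)[OF int_pow_unitary[OF u]]] by simp

lemma int_pow_add: assumes u: "u \<in> unitaries A" shows "u [^] (j::int) \<otimes> u [^] (k::int) = u [^] (j + k)"
proof (induction k rule: int_induct[where k=0])
  case base
  show ?case using unitaryD(1)[OF int_pow_unitary[OF u]] by simp
next
  case (step1 i)
  note c = unitaryD(1)[OF int_pow_unitary[OF u]] unitaryD(1)[OF u]
  have "u [^] j \<otimes> u [^] (i + 1) = u [^] j \<otimes> u [^] i \<otimes> u" using c by (simp add: int_pow_succ[OF u] rg.m_assoc)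
  also have "\<dots> = u [^] (j + i + 1)" using step1 by (simp add: int_pow_succ[OF u])
  finally show ?case by (simp add: add.assoc)
next
  case (step2 i)
  note c = unitaryD(1)[OF int_pow_unitary[OF u]] unitaryD(1,2)[OF u]
  have "u [^] j \<otimes> u [^] (i - 1) = u [^] j \<otimes> u [^] i \<otimes> star A u" using c by (simp add: int_pow_pred[OF u] rg.m_assoc)
  also have "\<dots> = u [^] (j + i - 1)" using step2 by (simp add: int_pow_pred[OF u])
  finally show ?case by (simp add: add_diff_eq)
qed

lemma ph_refl [simp]: "u \<in> carrier A \<Longrightarrow> ph A u u"
  unfolding ph_def by (intro exI[of _ 1]) simp

lemma ph_sym: assumes "ph A u v" "v \<in> carrier A" shows "ph A v u"
proof -
  obtain c where c: "cmod c = 1" "u = c \<odot>\<^bsub>A\<^esub> v" using assms(1) unfolding ph_def by blast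
  have "c \<noteq> 0" using c(1) by auto
  then show ?thesis unfolding ph_def using c assms(2) by (intro exI[of _ "inverse c"]) (simp add: norm_inverse)
qed

lemma ph_trans: assumes "ph A u v" "ph A v w" "w \<in> carrier A" shows "ph A u w"
proof -
  obtain c d where "cmod c = 1" "u = c \<odot>\<^bsub>A\<^esub> v" "cmod d = 1" "v = d \<odot>\<^bsub>A\<^esub> w" using assms(1,2) unfolding ph_def by blast
  then show ?thesis unfolding ph_def using assms(3) by (intro exI[of _ "c * d"]) (simp add: Real_Vector_Spaces.norm_mult)
qed

lemma ph_mult: assumes "ph A u v" "ph A u' v'" "v \<in> carrier A" "v' \<in> carrier A" shows "ph A (u \<otimes> u') (v \<otimes> v')"
proof -
  obtain c d where "cmod c = 1" "u = c \<odot>\<^bsub>A\<^esub> v" "cmod d = 1" "u' = d \<odot>\<^bsub>A\<^esub> v'" using assms(1,2) unfolding ph_def by blast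
  then show ?thesis unfolding ph_def using assms(3,4)
    by (intro exI[of _ "c * d"]) (simp add: Real_Vector_Spaces.norm_mult smult_mult_left smult_mult_right mult.commute)
qed

lemma ph_star: assumes "ph A u v" "v \<in> carrier A" shows "ph A (star A u) (star A v)"
proof -
  obtain c where "cmod c = 1" "u = c \<odot>\<^bsub>A\<^esub> v" using assms(1) unfolding ph_def by blast
  then show ?thesis unfolding ph_def using assms(2) by (intro exI[of _ "cnj c"]) (simp add: star_smult)
qed

lemma ph_int_pow: assumes "ph A u v" "u \<in> unitaries A" "v \<in> unitaries A" shows "ph A (u [^] (k::int)) (v [^] k)"
proof (induction k rule: int_induct[where k=0])
  case (step1 i)
  then show ?case using assms unitaryD[OF assms(3)] unitaryD(1)[OF int_pow_unitary[OF assms(3)]] by (simp add: int_pow_succ ph_mult)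
next
  case (step2 i)
  then show ?case using assms unitaryD[OF assms(3)] unitaryD(1)[OF int_pow_unitary[OF assms(3)]] by (simp add: int_pow_pred ph_mult ph_star)
qed simp

lemma commutes_one: "u \<in> carrier A \<Longrightarrow> commutes_up_to A u \<one> 0"
  by (simp add: commutes_up_to_def)

lemma commutes_sym: assumes "commutes_up_to A u v t" "u \<in> carrier A" "v \<in> carrier A" shows "commutes_up_to A v u (- t)"
  using assms e2pi_minus[of t] by (simp add: commutes_up_to_def mult.commute)

lemma commutes_mult:
  assumes "commutes_up_to A u v s" "commutes_up_to A u w t" "u \<in> carrier A" "v \<in> carrier A" "w \<in> carrier A"
  shows "commutes_up_to A u (v \<otimes> w) (s + t)"
proof -
  note c = assms(3,4,5)
  have 1: "v \<otimes> u = e2pi s \<odot>\<^bsub>A\<^esub> (u \<otimes> v)" and 2: "w \<otimes> u = e2pi t \<odot>\<^bsub>A\<^esub> (u \<otimes> w)"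
    using assms(1,2) by (simp_all add: commutes_up_to_def)
  have "v \<otimes> w \<otimes> u = v \<otimes> (w \<otimes> u)" using c by (simp add: rg.m_assoc)
  also have "\<dots> = e2pi t \<odot>\<^bsub>A\<^esub> (v \<otimes> (u \<otimes> w))" unfolding 2 using c by (simp add: smult_mult_right)
  also have "v \<otimes> (u \<otimes> w) = (v \<otimes> u) \<otimes> w" using c by (simp add: rg.m_assoc)
  also have "\<dots> = e2pi s \<odot>\<^bsub>A\<^esub> (u \<otimes> (v \<otimes> w))" unfolding 1 using c by (simp add: smult_mult_left rg.m_assoc)
  also have "e2pi t \<odot>\<^bsub>A\<^esub> \<dots> = e2pi (s + t) \<odot>\<^bsub>A\<^esub> (u \<otimes> (v \<otimes> w))" using c by (simp add: e2pi_add mult.commute)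
  finally show ?thesis by (simp add: commutes_up_to_def)
qed

lemma commutes_star:
  assumes "commutes_up_to A u v t" "u \<in> carrier A" "v \<in> unitaries A"
  shows "commutes_up_to A u (star A v) (- t)"
proof -
  note v = unitaryD[OF assms(3)]
  have "u \<otimes> v = e2pi (- t) \<odot>\<^bsub>A\<^esub> (v \<otimes> u)"
    using commutes_sym[OF assms(1,2) v(1)] by (simp add: commutes_up_to_def)
  then have "star A v \<otimes> (u \<otimes> v) \<otimes> star A v = e2pi (- t) \<odot>\<^bsub>A\<^esub> (star A v \<otimes> (v \<otimes> u) \<otimes> star A v)"
    using v assms(2) by (simp add: smult_mult_right smult_mult_left)
  moreover have "star A v \<otimes> (u \<otimes> v) \<otimes> star A v = star A v \<otimes> (u \<otimes> v \<otimes> star A v)" using v assms(2) by (simp add: rg.m_assoc)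
  ultimately show ?thesis using cancel_right(1)[OF assms(3,2)] cancel_left(1)[OF assms(3,2)]
    by (simp add: commutes_up_to_def)
qed

lemma commutes_int_pow:
  assumes "commutes_up_to A u v t" "u \<in> carrier A" "v \<in> unitaries A"
  shows "commutes_up_to A u (v [^] (k::int)) (real_of_int k * t)"
proof (induction k rule: int_induct[where k=0])
  case base
  show ?case using commutes_one[OF assms(2)] by simp
next
  case (step1 i)
  have "commutes_up_to A u (v [^] i \<otimes> v) (real_of_int i * t + t)"
    by (rule commutes_mult[OF step1(2) assms(1,2)]) (use unitaryD[OF assms(3)] unitaryD(1)[OF int_pow_unitary[OF assms(3)]] in simp_all)
  then show ?case by (simp add: int_pow_succ[OF assms(3)] distrib_right)
next
  case (step2 i)
  have "commutes_up_to A u (v [^] i \<otimes> star A v) (real_of_int i * t + - t)"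
    by (rule commutes_mult[OF step2(2) commutes_star[OF assms] assms(2)]) (use unitaryD[OF assms(3)] unitaryD(1)[OF int_pow_unitary[OF assms(3)]] in simp_all)
  then show ?case by (simp add: int_pow_pred[OF assms(3)] left_diff_distrib)
qed

lemma commutes_imp_ph: assumes "commutes_up_to A u v t" shows "ph A (v \<otimes> u) (u \<otimes> v)"
  using assms unfolding commutes_up_to_def ph_def e2pi_def by (intro exI[of _ "e2pi t"]) (simp add: e2pi_def norm_exp)

end

section \<open>Monomials in unitaries with the torus relations\<close>

locale torus_unitaries = ucstar A for A :: "'a cstar" (structure) +
  fixes m :: nat and \<Theta> :: "real mat" and U :: "nat \<Rightarrow> 'a"
  assumes rel: "torus_relations m \<Theta> A U"
begin

lemma U_unitary: "j < m \<Longrightarrow> U j \<in> unitaries A"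
  using rel by (simp add: torus_relations_def)

lemma U_commutes: "j < m \<Longrightarrow> k < m \<Longrightarrow> commutes_up_to A (U j) (U k) (\<Theta> $$ (j, k))"
  using rel unfolding torus_relations_def commutes_up_to_def e2pi_def by blast

text \<open>Monomials over an arbitrary list of indices, which allows induction on the list;
  \<open>W\<close> is the case of the full list.\<close>

definition mon :: "nat list \<Rightarrow> (nat \<Rightarrow> int) \<Rightarrow> 'a" where
  "mon js f = foldr (\<lambda>j a. (U j [^] f j) \<otimes> a) js \<one>"

lemma mon_simps [simp]: "mon [] f = \<one>" "mon (j # js) f = (U j [^] f j) \<otimes> mon js f"
  by (simp_all add: mon_def)

abbreviation W :: "int Matrix.vec \<Rightarrow> 'a" where "W x \<equiv> monomial A m U x"

lemma W_mon: "W x = mon [0..<m] (\<lambda>j. x $ j)"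
  by (simp add: monomial_def mon_def)

lemma set_upt_le: "set [0..<m] \<subseteq> {..<m}"
  by auto

lemma mon_unitary: "set js \<subseteq> {..<m} \<Longrightarrow> mon js f \<in> unitaries A"
  by (induction js) (simp_all add: one_unitary mult_unitary int_pow_unitary U_unitary)

lemma W_unitary: "W x \<in> unitaries A"
  unfolding W_mon by (rule mon_unitary) auto

lemma W_closed [simp]: "W x \<in> carrier A"
  by (rule unitaryD(1)[OF W_unitary])

lemma commutes_mon:
  assumes "u \<in> carrier A" "\<And>j. j < m \<Longrightarrow> commutes_up_to A u (U j) (t j)"
  shows "set js \<subseteq> {..<m} \<Longrightarrow> commutes_up_to A u (mon js f) (\<Sum>j\<leftarrow>js. real_of_int (f j) * t j)"
proof (induction js)
  case (Cons j js)
  then have j: "j < m" and js: "set js \<subseteq> {..<m}" by simp_all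
  have "commutes_up_to A u (U j [^] f j \<otimes> mon js f) (real_of_int (f j) * t j + (\<Sum>j\<leftarrow>js. real_of_int (f j) * t j))"
    by (rule commutes_mult[OF commutes_int_pow[OF assms(2)[OF j] assms(1) U_unitary[OF j]] Cons.IH[OF js] assms(1)])
       (use unitaryD(1)[OF int_pow_unitary[OF U_unitary[OF j]]] unitaryD(1)[OF mon_unitary[OF js]] in simp_all)
  then show ?case by simp
qed (simp add: commutes_one assms(1))

text \<open>Obtained by running along the factors of \<open>W y\<close> against one generator and
  then along those of \<open>W x\<close>. Each pass is followed by an exchange of the two sides, and
  the two signs cancel.\<close>

lemma commutes_W: "commutes_up_to A (W x) (W y) (\<Sum>j<m. \<Sum>k<m. real_of_int (x $ j) * real_of_int (y $ k) * \<Theta> $$ (j, k))"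
proof -
  have 1: "commutes_up_to A (W y) (U j) (- (\<Sum>k<m. real_of_int (y $ k) * \<Theta> $$ (j, k)))" if j: "j < m" for j
  proof -
    have "commutes_up_to A (U j) (W y) (\<Sum>k\<leftarrow>[0..<m]. real_of_int (y $ k) * \<Theta> $$ (j, k))"
      unfolding W_mon by (rule commutes_mon) (use U_commutes[OF j] unitaryD(1)[OF U_unitary[OF j]] in auto)
    from commutes_sym[OF this unitaryD(1)[OF U_unitary[OF j]] W_closed]
    show ?thesis by (simp add: interv_sum_list_conv_sum_set_nat atLeast0LessThan)
  qed
  have "commutes_up_to A (W y) (W x) (\<Sum>j\<leftarrow>[0..<m]. real_of_int (x $ j) * (- (\<Sum>k<m. real_of_int (y $ k) * \<Theta> $$ (j, k))))"
    unfolding W_mon[of x] by (rule commutes_mon[OF W_closed 1]) auto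
  from commutes_sym[OF this W_closed W_closed]
  have "commutes_up_to A (W x) (W y) (- (\<Sum>j<m. real_of_int (x $ j) * (- (\<Sum>k<m. real_of_int (y $ k) * \<Theta> $$ (j, k)))))"
    unfolding interv_sum_list_conv_sum_set_nat set_upt atLeast0LessThan .
  then show ?thesis by (simp only: Rings.mult_minus_right sum_negf minus_minus sum_distrib_left mult.assoc)
qed

lemma ph_mon_mult:
  "set js \<subseteq> {..<m} \<Longrightarrow> ph A (mon js f \<otimes> mon js g) (mon js (\<lambda>j. f j + g j))"
proof (induction js)
  case (Cons j js)
  then have j: "j < m" and js: "set js \<subseteq> {..<m}" by simp_all
  let ?a = "U j [^] f j" and ?b = "U j [^] g j" and ?x = "mon js f" and ?y = "mon js g"
  have c: "?a \<in> carrier A" "?b \<in> carrier A" "?x \<in> carrier A" "?y \<in> carrier A" "mon js (\<lambda>j. f j + g j) \<in> carrier A"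
    using unitaryD(1)[OF int_pow_unitary[OF U_unitary[OF j]]] unitaryD(1)[OF mon_unitary[OF js]] by simp_all
  have "commutes_up_to A ?b ?x (\<Sum>i\<leftarrow>js. real_of_int (f i) * (- (real_of_int (g j) * \<Theta> $$ (i, j))))"
  proof (rule commutes_mon[OF c(2) _ js])
    fix i assume i: "i < m"
    show "commutes_up_to A ?b (U i) (- (real_of_int (g j) * \<Theta> $$ (i, j)))"
      by (rule commutes_sym[OF commutes_int_pow[OF U_commutes[OF i j] unitaryD(1)[OF U_unitary[OF i]] U_unitary[OF j]]])
         (use c unitaryD(1)[OF U_unitary[OF i]] in simp_all)
  qed
  \<comment> \<open>The only reordering needed: the power of \<open>U j\<close> from the second
    monomial moves left past the tail of the first one.\<close>
  then have 1: "ph A (?x \<otimes> ?b) (?b \<otimes> ?x)" by (rule commutes_imp_ph)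
  have 2: "ph A (?a \<otimes> (?x \<otimes> ?b) \<otimes> ?y) (?a \<otimes> (?b \<otimes> ?x) \<otimes> ?y)"
    by (rule ph_mult[OF ph_mult[OF ph_refl 1] ph_refl]) (use c in simp_all)
  have e1: "?a \<otimes> (?x \<otimes> ?b) \<otimes> ?y = (?a \<otimes> ?x) \<otimes> (?b \<otimes> ?y)" and e2: "?a \<otimes> (?b \<otimes> ?x) \<otimes> ?y = (?a \<otimes> ?b) \<otimes> (?x \<otimes> ?y)"
    using c by (simp_all add: rg.m_assoc)
  have 3: "ph A ((?a \<otimes> ?b) \<otimes> (?x \<otimes> ?y)) ((?a \<otimes> ?b) \<otimes> mon js (\<lambda>j. f j + g j))"
    by (rule ph_mult[OF ph_refl Cons.IH[OF js]]) (use c in simp_all)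
  have "ph A ((?a \<otimes> ?x) \<otimes> (?b \<otimes> ?y)) ((?a \<otimes> ?b) \<otimes> mon js (\<lambda>j. f j + g j))"
    by (rule ph_trans[OF 2[unfolded e1 e2] 3]) (use c in simp)
  then show ?case by (simp add: int_pow_add[OF U_unitary[OF j]])
qed simp

lemma W_mult: assumes "x \<in> carrier_vec m" "y \<in> carrier_vec m" shows "ph A (W x \<otimes> W y) (W (x + y))"
proof -
  have "mon [0..<m] (\<lambda>j. (x + y) $ j) = mon [0..<m] (\<lambda>j. x $ j + y $ j)"
    unfolding mon_def by (rule foldr_cong) (use assms in auto)
  then show ?thesis using ph_mon_mult[OF set_upt_le, of "\<lambda>j. x $ j" "\<lambda>j. y $ j"] unfolding W_mon by simp
qed

lemma W_zero [simp]: "W (0\<^sub>v m) = \<one>"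
proof -
  have "mon js (\<lambda>j. 0) = \<one>" for js by (induction js) simp_all
  moreover have "mon [0..<m] (\<lambda>j. 0\<^sub>v m $ j) = mon [0..<m] (\<lambda>j. 0)"
    unfolding mon_def by (rule foldr_cong) auto
  ultimately show ?thesis unfolding W_mon by simp
qed

lemma W_star: assumes "x \<in> carrier_vec m" shows "ph A (star A (W x)) (W (- x))"
proof -
  have "ph A (W x \<otimes> W (- x)) (W (x + - x))" using assms by (intro W_mult) simp_all
  moreover have "x + - x = 0\<^sub>v m" using assms by auto
  ultimately have 1: "ph A \<one> (W x \<otimes> W (- x))" using ph_sym by simp
  have "ph A (star A (W x) \<otimes> \<one>) (star A (W x) \<otimes> (W x \<otimes> W (- x)))"
    by (rule ph_mult[OF ph_refl 1]) (use unitaryD(2)[OF W_unitary] in simp_all)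
  then show ?thesis using cancel_left(1)[OF W_unitary] unitaryD(2)[OF W_unitary] by simp
qed

lemma W_star_mult:
  assumes "x \<in> carrier_vec m" "y \<in> carrier_vec m" shows "ph A (star A (W x) \<otimes> W y) (W (y - x))"
proof -
  have 1: "ph A (star A (W x) \<otimes> W y) (W (- x) \<otimes> W y)" by (rule ph_mult[OF W_star[OF assms(1)] ph_refl]) simp_all
  have 2: "ph A (W (- x) \<otimes> W y) (W (- x + y))" using assms by (intro W_mult) simp_all
  have 3: "- x + y = y - x" using assms by auto
  show ?thesis by (rule ph_trans[OF 1 2[unfolded 3] W_closed])
qed

lemma W_int_pow: assumes "x \<in> carrier_vec m" shows "ph A (W x [^] (k::int)) (W (k \<cdot>\<^sub>v x))"
proof (induction k rule: int_induct[where k=0])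
  case base
  have "0 \<cdot>\<^sub>v x = 0\<^sub>v m" using assms by auto
  then show ?case by simp
next
  case (step1 i)
  have 1: "ph A (W x [^] i \<otimes> W x) (W (i \<cdot>\<^sub>v x) \<otimes> W x)" by (rule ph_mult[OF step1(2) ph_refl]) simp_all
  have 2: "ph A (W (i \<cdot>\<^sub>v x) \<otimes> W x) (W (i \<cdot>\<^sub>v x + x))" using assms by (intro W_mult) simp_all
  have 3: "i \<cdot>\<^sub>v x + x = (i + 1) \<cdot>\<^sub>v x" using assms by (auto simp: distrib_right)
  show ?case unfolding int_pow_succ[OF W_unitary] by (rule ph_trans[OF 1 2[unfolded 3] W_closed])
next
  case (step2 i)
  have 1: "ph A (W x [^] i \<otimes> star A (W x)) (W (i \<cdot>\<^sub>v x) \<otimes> W (- x))" by (rule ph_mult[OF step2(2) W_star[OF assms]]) simp_all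
  have 2: "ph A (W (i \<cdot>\<^sub>v x) \<otimes> W (- x)) (W (i \<cdot>\<^sub>v x + - x))" using assms by (intro W_mult) simp_all
  have 3: "i \<cdot>\<^sub>v x + - x = (i - 1) \<cdot>\<^sub>v x" using assms by (auto simp: left_diff_distrib)
  show ?case unfolding int_pow_pred[OF W_unitary] by (rule ph_trans[OF 1 2[unfolded 3] W_closed])
qed

text \<open>Nondegeneracy supplies y for which conjugation by \<open>W y\<close> multiplies
  \<open>W x\<close> by a phase other than 1. The trace is invariant under conjugation, hence
  vanishes on \<open>W x\<close>.\<close>

lemma trace_W_zero:
  assumes tr: "tracial_state A \<tau>" and nd: "nondegenerate m \<Theta>" and \<Theta>: "\<Theta> \<in> carrier_mat m m"
    and x: "x \<in> carrier_vec m" "x \<noteq> 0\<^sub>v m"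
  shows "\<tau> (W x) = 0"
proof -
  obtain y where y: "y \<in> carrier_vec m" "exp (2 * complex_of_real pi * \<i> *
          complex_of_real (scalar_prod (map_vec real_of_int x) (\<Theta> *\<^sub>v map_vec real_of_int y))) \<noteq> 1"
    using nd x unfolding nondegenerate_def by blast
  define t where "t = (\<Sum>j<m. \<Sum>k<m. real_of_int (x $ j) * real_of_int (y $ k) * \<Theta> $$ (j, k))"
  have "scalar_prod (map_vec real_of_int x) (\<Theta> *\<^sub>v map_vec real_of_int y) = t"
    using x y(1) \<Theta> unfolding t_def scalar_prod_def
    by (auto simp: scalar_prod_def atLeast0LessThan sum_distrib_left intro!: sum.cong)
  then have ne: "e2pi t \<noteq> 1" using y(2) by (simp add: e2pi_def)
  have com: "W y \<otimes> W x = e2pi t \<odot>\<^bsub>A\<^esub> (W x \<otimes> W y)" using commutes_W[of x y] unfolding commutes_up_to_def t_def .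
  note sy = unitaryD(2)[OF W_unitary[of y]]
  have T: "\<tau> (a \<otimes> b) = \<tau> (b \<otimes> a)" "\<tau> (c \<odot>\<^bsub>A\<^esub> a) = c * \<tau> a" if "a \<in> carrier A" "b \<in> carrier A" for a b c
    using tr that unfolding tracial_state_def by blast+
  have "\<tau> (W x) = \<tau> (star A (W y) \<otimes> (W y \<otimes> W x))" by (simp add: cancel_left(1)[OF W_unitary])
  also have "\<dots> = e2pi t * \<tau> (star A (W y) \<otimes> (W x \<otimes> W y))"
    unfolding com using sy by (simp add: smult_mult_right T(2)[of _ \<one>])
  also have "\<tau> (star A (W y) \<otimes> (W x \<otimes> W y)) = \<tau> ((W x \<otimes> W y) \<otimes> star A (W y))" by (rule T(1)) (use sy in simp_all)
  also have "\<dots> = \<tau> (W x)" by (simp add: cancel_right(1)[OF W_unitary])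
  finally show ?thesis using ne by simp
qed

end

section \<open>Star homomorphisms on monomials\<close>

lemma unital_star_homD:
  assumes "f \<in> unital_star_hom A B"
  shows "f \<in> linear_maps A B" "a \<in> carrier A \<Longrightarrow> f a \<in> carrier B" "a \<in> carrier A \<Longrightarrow> f (star A a) = star B (f a)"
    "f \<one>\<^bsub>A\<^esub> = \<one>\<^bsub>B\<^esub>" "a \<in> carrier A \<Longrightarrow> b \<in> carrier A \<Longrightarrow> f (a \<otimes>\<^bsub>A\<^esub> b) = f a \<otimes>\<^bsub>B\<^esub> f b"
    "a \<in> carrier A \<Longrightarrow> b \<in> carrier A \<Longrightarrow> f (a \<oplus>\<^bsub>A\<^esub> b) = f a \<oplus>\<^bsub>B\<^esub> f b"
    "a \<in> carrier A \<Longrightarrow> f (c \<odot>\<^bsub>A\<^esub> a) = c \<odot>\<^bsub>B\<^esub> f a"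
proof -
  have f: "f \<in> Ring.ring_hom A B" "f \<in> linear_maps A B" "\<And>a. a \<in> carrier A \<Longrightarrow> f (star A a) = star B (f a)"
    using assms by (simp_all add: unital_star_hom_def)
  show "f \<in> linear_maps A B" "a \<in> carrier A \<Longrightarrow> f (star A a) = star B (f a)" using f by simp_all
  show "a \<in> carrier A \<Longrightarrow> f a \<in> carrier B"
    "f \<one>\<^bsub>A\<^esub> = \<one>\<^bsub>B\<^esub>" "a \<in> carrier A \<Longrightarrow> b \<in> carrier A \<Longrightarrow> f (a \<otimes>\<^bsub>A\<^esub> b) = f a \<otimes>\<^bsub>B\<^esub> f b"
    using ring_hom_closed[OF f(1)] ring_hom_mult[OF f(1)] ring_hom_one[OF f(1)] by simp_all
  show "a \<in> carrier A \<Longrightarrow> b \<in> carrier A \<Longrightarrow> f (a \<oplus>\<^bsub>A\<^esub> b) = f a \<oplus>\<^bsub>B\<^esub> f b"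
    "a \<in> carrier A \<Longrightarrow> f (c \<odot>\<^bsub>A\<^esub> a) = c \<odot>\<^bsub>B\<^esub> f a"
    using linear_mapsD[OF f(2)] by simp_all
qed

lemma star_hom_unitary: assumes "f \<in> unital_star_hom A B" "u \<in> unitaries A" "ucstar A" shows "f u \<in> unitaries B"
proof -
  interpret ucstar A by fact
  note u = unitaryD[OF assms(2)]
  note f = unital_star_homD[OF assms(1)]
  show ?thesis unfolding unitaries_def
    using f(2)[OF u(1)] f(3)[OF u(1)] f(5)[OF u(2,1)] f(5)[OF u(1,2)] f(4) u(3,4) by simp
qed

lemma star_hom_int_pow:
  assumes f: "f \<in> unital_star_hom A B" and u: "u \<in> unitaries A" and A: "ucstar A" and B: "ucstar B"
  shows "f (u [^]\<^bsub>A\<^esub> (k::int)) = f u [^]\<^bsub>B\<^esub> k"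
proof -
  interpret A: ucstar A by fact
  interpret B: ucstar B by fact
  note fu = star_hom_unitary[OF f u A]
  note F = unital_star_homD[OF f]
  note c = A.unitaryD(1,2)[OF u] A.unitaryD(1)[OF A.int_pow_unitary[OF u]]
  show ?thesis
  proof (induction k rule: int_induct[where k=0])
    case base show ?case by (simp add: F(4))
  next
    case (step1 i) then show ?case using c by (simp add: A.int_pow_succ[OF u] B.int_pow_succ[OF fu] F(5))
  next
    case (step2 i) then show ?case using c by (simp add: A.int_pow_pred[OF u] B.int_pow_pred[OF fu] F(3,5))
  qed
qed

lemma ph_star_hom: "f \<in> unital_star_hom A B \<Longrightarrow> ph A u v \<Longrightarrow> v \<in> carrier A \<Longrightarrow> ph B (f u) (f v)"
  unfolding ph_def using unital_star_homD(7) by metis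

text \<open>Each generator goes, up to a phase, to the monomial of a column of M, and monomials
  multiply by adding exponents up to a phase. So on exponents the homomorphism acts as the matrix
  M.\<close>

lemma monomial_hom_W:
  assumes h: "monomial_toric_hom m \<Theta> A U n \<Psi> B V M z \<phi>"
    and A: "torus_unitaries A m \<Theta> U" and B: "torus_unitaries B n \<Psi> V" and x: "x \<in> carrier_vec m"
  shows "ph B (\<phi> (monomial A m U x)) (monomial B n V (M *\<^sub>v x))"
proof -
  interpret A: torus_unitaries A m \<Theta> U by fact
  interpret B: torus_unitaries B n \<Psi> V by fact
  have M: "M \<in> carrier_mat n m" and f: "\<phi> \<in> unital_star_hom A B"
    and z: "\<And>j. j < m \<Longrightarrow> cmod (z $ j) = 1" and fU: "\<And>j. j < m \<Longrightarrow> \<phi> (U j) = (z $ j) \<odot>\<^bsub>B\<^esub> monomial B n V (col M j)"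
    using h by (simp_all add: monomial_toric_hom_def)
  note F = unital_star_homD[OF f]
  note au = A.ucstar_axioms B.ucstar_axioms
  have colM: "col M j \<in> carrier_vec n" for j using M by auto
  \<comment> \<open>The exponent accumulated along a list, namely the combination of the columns of
    M with coefficients \<open>x $ j\<close>; for the full list it is \<open>M x\<close>.\<close>
  define w where "w = rec_list (0\<^sub>v n) (\<lambda>j _ v. x $ j \<cdot>\<^sub>v col M j + v)"
  have w: "w [] = 0\<^sub>v n" "\<And>j js. w (j # js) = x $ j \<cdot>\<^sub>v col M j + w js" by (simp_all add: w_def)
  have wc: "w js \<in> carrier_vec n" for js by (induction js) (use colM in \<open>simp_all add: w\<close>)
  have main: "set js \<subseteq> {..<m} \<Longrightarrow> ph B (\<phi> (A.mon js (\<lambda>j. x $ j))) (B.W (w js))" for js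
  proof (induction js)
    case Nil show ?case by (simp add: F(4) w)
  next
    case (Cons j js)
    then have j: "j < m" and js: "set js \<subseteq> {..<m}" by simp_all
    let ?u = "U j [^]\<^bsub>A\<^esub> (x $ j)"
    have c: "?u \<in> carrier A" "A.mon js (\<lambda>j. x $ j) \<in> carrier A"
      using A.unitaryD(1)[OF A.int_pow_unitary[OF A.U_unitary[OF j]]] A.unitaryD(1)[OF A.mon_unitary[OF js]] by simp_all
    have "ph B (\<phi> (U j)) (B.W (col M j))" unfolding ph_def using z[OF j] fU[OF j] by blast
    then have "ph B (\<phi> (U j) [^]\<^bsub>B\<^esub> (x $ j)) (B.W (col M j) [^]\<^bsub>B\<^esub> (x $ j))"
      by (rule B.ph_int_pow[OF _ star_hom_unitary[OF f A.U_unitary[OF j] au(1)] B.W_unitary])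
    then have "ph B (\<phi> ?u) (B.W (x $ j \<cdot>\<^sub>v col M j))"
      using B.ph_trans[OF _ B.W_int_pow[OF colM] B.W_closed] star_hom_int_pow[OF f A.U_unitary[OF j] au] by simp
    from B.ph_mult[OF this Cons.IH[OF js] B.W_closed B.W_closed]
    have "ph B (\<phi> ?u \<otimes>\<^bsub>B\<^esub> \<phi> (A.mon js (\<lambda>j. x $ j))) (B.W (x $ j \<cdot>\<^sub>v col M j) \<otimes>\<^bsub>B\<^esub> B.W (w js))" .
    moreover have "ph B (B.W (x $ j \<cdot>\<^sub>v col M j) \<otimes>\<^bsub>B\<^esub> B.W (w js)) (B.W (w (j # js)))"
      unfolding w by (rule B.W_mult) (use colM wc in simp_all)
    ultimately show ?case using B.ph_trans[OF _ _ B.W_closed] F(5)[OF c] by simp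
  qed
  have wi: "i < n \<Longrightarrow> w js $ i = (\<Sum>j\<leftarrow>js. x $ j * M $$ (i, j))" if "set js \<subseteq> {..<m}" for i js
    using that
  proof (induction js)
    case (Cons j js)
    then have "w (j # js) $ i = x $ j * col M j $ i + w js $ i"
      using carrier_vecD[OF colM, of j] carrier_vecD[OF wc, of js] Cons.prems unfolding w by simp
    then show ?case using Cons M by simp
  qed (simp add: w)
  have "M *\<^sub>v x = w [0..<m]"
  proof (rule eq_vecI)
    fix i assume "i < dim_vec (w [0..<m])"
    then have i: "i < n" using wc by (metis carrier_vecD)
    have "(M *\<^sub>v x) $ i = (\<Sum>j<m. M $$ (i, j) * x $ j)"
      using i M x by (simp add: scalar_prod_def atLeast0LessThan)
    also have "\<dots> = w [0..<m] $ i" using wi[OF _ i, of "[0..<m]"]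
      by (simp add: interv_sum_list_conv_sum_set_nat atLeast0LessThan mult.commute)
    finally show "(M *\<^sub>v x) $ i = w [0..<m] $ i" .
  qed (use wc[of "[0..<m]"] M in simp)
  then show ?thesis using main[OF A.set_upt_le] unfolding A.W_mon by simp
qed

section \<open>Bounded operators and seminorms\<close>

context cnormed
begin

lemma span_subset: "X \<subseteq> Y \<Longrightarrow> LinearCombinations.submodule class_ring Y V \<Longrightarrow>
    LinearCombinations.module.span class_ring V X \<subseteq> Y"
  by (rule module.span_is_subset[OF mod])

lemma span_submodule: "X \<subseteq> carrier V \<Longrightarrow> LinearCombinations.submodule class_ring (LinearCombinations.module.span class_ring V X) V"
  by (rule module.span_is_submodule[OF mod])

lemma span_base: "X \<subseteq> carrier V \<Longrightarrow> x \<in> X \<Longrightarrow> x \<in> LinearCombinations.module.span class_ring V X"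
  using module.in_own_span[OF mod] by blast

lemma closure_conv_iff:
  "v \<in> met.mtopology closure_of X \<longleftrightarrow> (\<exists>x. conv x v \<and> (\<forall>n. x n \<in> X))"
proof
  assume v: "v \<in> met.mtopology closure_of X"
  have vc: "v \<in> carrier V" using v unfolding closure_iff by blast
  have "\<forall>n. \<exists>x\<in>X. x \<in> carrier V \<and> N (v \<ominus> x) < 1 / Suc n"
    using v unfolding closure_iff by auto
  then obtain x where x: "\<And>n. x n \<in> X \<and> x n \<in> carrier V \<and> N (v \<ominus> x n) < 1 / Suc n" by metis
  have "conv x v"
  proof (rule conv_squeeze)
    show "N (x n \<ominus> v) \<le> inverse (Suc n)" for n
      using x[of n] nrm_minus_commute[of v "x n"] vc by (auto simp: inverse_eq_divide)
  qed (use x vc LIMSEQ_inverse_real_of_nat in auto)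
  then show "\<exists>x. conv x v \<and> (\<forall>n. x n \<in> X)" using x by blast
next
  assume "\<exists>x. conv x v \<and> (\<forall>n. x n \<in> X)"
  then obtain x where x: "conv x v" "\<And>n. x n \<in> X" by blast
  have c: "v \<in> carrier V" "\<And>n. x n \<in> carrier V" and l: "(\<lambda>n. N (x n \<ominus> v)) \<longlonglongrightarrow> 0"
    using x(1) by (simp_all add: conv_def)
  show "v \<in> met.mtopology closure_of X"
    unfolding closure_iff
  proof (intro conjI c(1) allI impI)
    fix e :: real assume e: "e > 0"
    obtain n where "N (x n \<ominus> v) < e"
      using eventually_happens'[OF sequentially_bot order_tendstoD(2)[OF l e]] by blast
    then show "\<exists>y\<in>X. y \<in> carrier V \<and> N (v \<ominus> y) < e"
      using nrm_minus_commute[OF c(2) c(1), of n] x(2)[of n] c(2)[of n] by auto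
  qed
qed

end

lemma bseminorm_compose:
  assumes V: "cnormed V N" and W: "cnormed W N'" and T: "T \<in> linear_maps V W"
    and C: "\<And>v. v \<in> carrier V \<Longrightarrow> N' (T v) \<le> C * N v" and p: "cnormed.bseminorm W N' p"
  shows "cnormed.bseminorm V N (\<lambda>v. p (T v))"
proof -
  interpret V: cnormed V N by (rule V)
  interpret W: cnormed W N' by (rule W)
  note Tl = linear_mapsD[OF T]
  obtain D where D: "\<And>x. x \<in> carrier W \<Longrightarrow> p x \<le> D * N' x" using W.bseminormD(3)[OF p] by blast
  show ?thesis unfolding V.bseminorm_def
  proof (intro conjI ballI allI)
    show "p (T (x \<oplus>\<^bsub>V\<^esub> y)) \<le> p (T x) + p (T y)" if "x \<in> carrier V" "y \<in> carrier V" for x y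
      unfolding Tl(2)[OF that] by (rule W.bseminormD(1)[OF p Tl(1)[OF that(1)] Tl(1)[OF that(2)]])
    show "p (T (c \<odot>\<^bsub>V\<^esub> x)) = cmod c * p (T x)" if "x \<in> carrier V" for x c
      unfolding Tl(3)[OF that] by (rule W.bseminormD(2)[OF p Tl(1)[OF that]])
    show "\<exists>C. \<forall>x\<in>carrier V. p (T x) \<le> C * N x"
    proof (intro exI[of _ "\<bar>D\<bar> * C"] ballI)
      fix x assume x: "x \<in> carrier V"
      have "p (T x) \<le> D * N' (T x)" by (rule D[OF Tl(1)[OF x]])
      also have "\<dots> \<le> \<bar>D\<bar> * N' (T x)" by (rule mult_right_mono[OF abs_ge_self W.nrm_nonneg[OF Tl(1)[OF x]]])
      also have "\<dots> \<le> \<bar>D\<bar> * (C * N x)" by (rule mult_left_mono[OF C[OF x] abs_ge_zero])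
      finally show "p (T x) \<le> \<bar>D\<bar> * C * N x" by (simp add: mult.assoc)
    qed
  qed
qed

text \<open>Its vanishing expresses equality of two operators tested against a vector as well as an
  adjoint relation, which is why two operators, two target spaces and two test vectors are
  allowed.\<close>

lemma bseminorm_inner_diff:
  assumes "hilbert_space H" "hilbert_space K1" "hilbert_space K2"
    and T1: "T1 \<in> bounded_ops H K1" and T2: "T2 \<in> bounded_ops H K2" and u: "u1 \<in> carrier K1" "u2 \<in> carrier K2"
  shows "cnormed.bseminorm H (hnorm H) (\<lambda>v. cmod (inner K1 u1 (T1 v) - inner K2 u2 (T2 v)))"
proof -
  interpret H: hilbert_space H by fact
  interpret K1: hilbert_space K1 by fact
  interpret K2: hilbert_space K2 by fact
  note L1 = linear_mapsD[OF bounded_opsD(1)[OF T1]]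
  note L2 = linear_mapsD[OF bounded_opsD(1)[OF T2]]
  obtain C1 where C1: "\<And>v. v \<in> carrier H \<Longrightarrow> hnorm K1 (T1 v) \<le> C1 * hnorm H v" using bounded_opsD(2)[OF T1] by blast
  obtain C2 where C2: "\<And>v. v \<in> carrier H \<Longrightarrow> hnorm K2 (T2 v) \<le> C2 * hnorm H v" using bounded_opsD(2)[OF T2] by blast
  show ?thesis unfolding H.nrm.bseminorm_def
  proof (intro conjI ballI allI)
    fix x assume x: "x \<in> carrier H"
    show "cmod (inner K1 u1 (T1 (c \<odot>\<^bsub>H\<^esub> x)) - inner K2 u2 (T2 (c \<odot>\<^bsub>H\<^esub> x))) =
      cmod c * cmod (inner K1 u1 (T1 x) - inner K2 u2 (T2 x))" for c
      using x u L1 L2 by (simp add: K1.inner_smult K2.inner_smult norm_mult flip: right_diff_distrib)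
    fix y assume y: "y \<in> carrier H"
    have "inner K1 u1 (T1 (x \<oplus>\<^bsub>H\<^esub> y)) - inner K2 u2 (T2 (x \<oplus>\<^bsub>H\<^esub> y)) =
      (inner K1 u1 (T1 x) - inner K2 u2 (T2 x)) + (inner K1 u1 (T1 y) - inner K2 u2 (T2 y))"
      using x y u L1 L2 by (simp add: K1.inner_add K2.inner_add)
    then show "cmod (inner K1 u1 (T1 (x \<oplus>\<^bsub>H\<^esub> y)) - inner K2 u2 (T2 (x \<oplus>\<^bsub>H\<^esub> y))) \<le>
      cmod (inner K1 u1 (T1 x) - inner K2 u2 (T2 x)) + cmod (inner K1 u1 (T1 y) - inner K2 u2 (T2 y))"
      by (simp only: norm_triangle_ineq)
  next
    show "\<exists>C. \<forall>x\<in>carrier H. cmod (inner K1 u1 (T1 x) - inner K2 u2 (T2 x)) \<le> C * hnorm H x"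
    proof (intro exI[of _ "hnorm K1 u1 * C1 + hnorm K2 u2 * C2"] ballI)
      fix x assume x: "x \<in> carrier H"
      have "cmod (inner K1 u1 (T1 x) - inner K2 u2 (T2 x)) \<le> cmod (inner K1 u1 (T1 x)) + cmod (inner K2 u2 (T2 x))"
        by (rule norm_triangle_ineq4)
      also have "\<dots> \<le> hnorm K1 u1 * hnorm K1 (T1 x) + hnorm K2 u2 * hnorm K2 (T2 x)"
        by (rule add_mono[OF K1.Cauchy_Schwarz[OF u(1) L1(1)[OF x]] K2.Cauchy_Schwarz[OF u(2) L2(1)[OF x]]])
      also have "\<dots> \<le> hnorm K1 u1 * (C1 * hnorm H x) + hnorm K2 u2 * (C2 * hnorm H x)"
        by (intro add_mono mult_left_mono C1 C2 x K1.hnorm_nonneg K2.hnorm_nonneg u)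
      finally show "cmod (inner K1 u1 (T1 x) - inner K2 u2 (T2 x)) \<le> (hnorm K1 u1 * C1 + hnorm K2 u2 * C2) * hnorm H x"
        by (simp add: algebra_simps)
    qed
  qed
qed

lemma bounded_ops_add:
  assumes "hilbert_space H" "hilbert_space K" "S \<in> bounded_ops H K" "T \<in> bounded_ops H K"
  shows "(\<lambda>v. S v \<oplus>\<^bsub>K\<^esub> T v) \<in> bounded_ops H K"
proof -
  interpret H: hilbert_space H by fact
  interpret K: hilbert_space K by fact
  note L1 = linear_mapsD[OF bounded_opsD(1)[OF assms(3)]]
  note L2 = linear_mapsD[OF bounded_opsD(1)[OF assms(4)]]
  obtain C1 where C1: "\<And>v. v \<in> carrier H \<Longrightarrow> hnorm K (S v) \<le> C1 * hnorm H v" using bounded_opsD(2)[OF assms(3)] by blast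
  obtain C2 where C2: "\<And>v. v \<in> carrier H \<Longrightarrow> hnorm K (T v) \<le> C2 * hnorm H v" using bounded_opsD(2)[OF assms(4)] by blast
  show ?thesis
  proof (rule bounded_opsI[OF linear_mapsI])
    show "hnorm K (S v \<oplus>\<^bsub>K\<^esub> T v) \<le> (C1 + C2) * hnorm H v" if v: "v \<in> carrier H" for v
      using K.nrm.nrm_triangle[OF L1(1)[OF v] L2(1)[OF v]] C1[OF v] C2[OF v] by (simp add: distrib_right)
  qed (simp_all add: L1 L2 K.nrm.a_ac K.nrm.sm_radd)
qed

lemma bounded_ops_smult:
  assumes "hilbert_space H" "hilbert_space K" "T \<in> bounded_ops H K"
  shows "(\<lambda>v. c \<odot>\<^bsub>K\<^esub> T v) \<in> bounded_ops H K"
proof -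
  interpret H: hilbert_space H by fact
  interpret K: hilbert_space K by fact
  note L = linear_mapsD[OF bounded_opsD(1)[OF assms(3)]]
  obtain C where C: "\<And>v. v \<in> carrier H \<Longrightarrow> hnorm K (T v) \<le> C * hnorm H v" using bounded_opsD(2)[OF assms(3)] by blast
  show ?thesis
  proof (rule bounded_opsI[OF linear_mapsI])
    show "hnorm K (c \<odot>\<^bsub>K\<^esub> T v) \<le> (cmod c * C) * hnorm H v" if v: "v \<in> carrier H" for v
      using mult_left_mono[OF C[OF v], of "cmod c"] L(1)[OF v] by (simp add: K.hnorm_smult mult.assoc)
  qed (simp_all add: L K.nrm.sm_radd mult.commute)
qed

lemma bounded_ops_compose:
  assumes "hilbert_space H" "hilbert_space K" "hilbert_space K'" "S \<in> bounded_ops H K" "T \<in> bounded_ops K K'"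
  shows "(\<lambda>v. T (S v)) \<in> bounded_ops H K'"
proof -
  interpret H: hilbert_space H by fact
  interpret K: hilbert_space K by fact
  interpret K': hilbert_space K' by fact
  note L1 = linear_mapsD[OF bounded_opsD(1)[OF assms(4)]]
  note L2 = linear_mapsD[OF bounded_opsD(1)[OF assms(5)]]
  obtain C1 where C1: "\<And>v. v \<in> carrier H \<Longrightarrow> hnorm K (S v) \<le> C1 * hnorm H v" using bounded_opsD(2)[OF assms(4)] by blast
  obtain C2 where C2: "0 \<le> C2" "\<And>v. v \<in> carrier K \<Longrightarrow> hnorm K' (T v) \<le> C2 * hnorm K v"
    using least_bound[OF assms(2,3,5)] by metis
  show ?thesis
  proof (rule bounded_opsI[OF linear_mapsI])
    show "hnorm K' (T (S v)) \<le> (C2 * C1) * hnorm H v" if v: "v \<in> carrier H" for v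
    proof -
      have "hnorm K' (T (S v)) \<le> C2 * hnorm K (S v)" by (rule C2(2)[OF L1(1)[OF v]])
      also have "\<dots> \<le> C2 * (C1 * hnorm H v)" by (rule mult_left_mono[OF C1[OF v] C2(1)])
      finally show ?thesis by (simp add: mult.assoc)
    qed
  qed (simp_all add: L1 L2)
qed

lemma bounded_ops_id: "(\<lambda>v. v) \<in> bounded_ops H H"
  by (rule bounded_opsI[OF linear_mapsI, where C=1]) simp_all

text \<open>Taking logarithms and dividing by \<open>2 ^ k\<close> leaves a right-hand side of order
  \<open>k / 2 ^ k\<close>, which tends to zero. Only exponents \<open>2 ^ k\<close> occur because
  those are the powers whose norms the C*-identity computes.\<close>

lemma exponential_below_polynomial:
  fixes t :: real and c m :: nat
  assumes "\<And>k::nat. t ^ (2 ^ k) \<le> (real c * 2 ^ k + 1) ^ m"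
  shows "t \<le> 1"
proof (rule ccontr)
  assume "\<not> t \<le> 1"
  then have t: "t > 1" by simp
  \<comment> \<open>Both constants come from the cruder bound \<open>((c + 1) * 2 ^ k) ^ m\<close>,
    whose logarithm is \<open>a + b * k\<close>.\<close>
  define a where "a = real m * ln (real c + 1)"
  define b where "b = real m * ln 2"
  have le: "ln t \<le> a * (1/2) ^ k + b * (real k * (1/2) ^ k)" for k
  proof -
    have "real c * 2 ^ k + 1 \<le> (real c + 1) * 2 ^ k" by (simp add: distrib_right)
    then have "(real c * 2 ^ k + 1) ^ m \<le> ((real c + 1) * 2 ^ k) ^ m" by (rule power_mono) simp
    then have "t ^ (2 ^ k) \<le> ((real c + 1) * 2 ^ k) ^ m" using assms[of k] by simp
    then have "ln (t ^ (2 ^ k)) \<le> ln (((real c + 1) * 2 ^ k) ^ m)" using t by (subst ln_le_cancel_iff) simp_all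
    then have "2 ^ k * ln t \<le> a + b * real k"
    proof -
      assume 1: "ln (t ^ (2 ^ k)) \<le> ln (((real c + 1) * 2 ^ k) ^ m)"
      have 2: "ln (((real c + 1) * 2 ^ k) ^ m) = real m * (ln (real c + 1) + real k * ln 2)"
        by (simp add: ln_realpow ln_mult)
      show ?thesis using 1 t unfolding 2 a_def b_def by (simp add: ln_realpow algebra_simps)
    qed
    then have "(1/2) ^ k * (2 ^ k * ln t) \<le> (1/2) ^ k * (a + b * real k)" by (rule mult_left_mono) simp
    moreover have "(1/2) ^ k * (2 ^ k * ln t) = ln t" by (simp add: power_one_over)
    moreover have "(1/2) ^ k * (a + b * real k) = a * (1/2) ^ k + b * (real k * (1/2) ^ k)" by (simp only: algebra_simps)
    ultimately show ?thesis by linarith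
  qed
  have "(\<lambda>k. a * (1/2) ^ k + b * (real k * (1/2) ^ k)) \<longlonglongrightarrow> a * 0 + b * 0"
    by (intro tendsto_intros LIMSEQ_power_zero powser_times_n_limit_0) simp_all
  then have "ln t \<le> a * 0 + b * 0" by (rule LIMSEQ_le_const) (use le in blast)
  then show False using t by simp
qed

section \<open>The standard representation of a noncommutative torus\<close>

locale torus_algebra = torus_unitaries A m \<Theta> U for A :: "'a cstar" (structure) and m \<Theta> U +
  fixes \<tau> :: "'a \<Rightarrow> complex"
  assumes gen: "generated_by A (U ` {..<m})"
    and trace: "tracial_state A \<tau>" and nondeg: "nondegenerate m \<Theta>" and \<Theta>_carrier: "\<Theta> \<in> carrier_mat m m"
begin

abbreviation spanA :: "'a set \<Rightarrow> 'a set" where "spanA \<equiv> LinearCombinations.module.span class_ring A"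

definition box :: "nat \<Rightarrow> int Matrix.vec set" where
  "box r = {x \<in> carrier_vec m. \<forall>j<m. \<bar>x $ j\<bar> \<le> int r}"

text \<open>A filtration whose radii add under multiplication, while the number of spanning
  monomials grows only polynomially with the radius. These two facts drive the norm
  comparison.\<close>

definition E :: "nat \<Rightarrow> 'a set" where "E r = spanA (W ` box r)"

definition P :: "'a set" where "P = (\<Union>r. E r)"

lemma box_sub: "W ` box r \<subseteq> carrier A" by auto

lemma E_submodule: "LinearCombinations.submodule class_ring (E r) A"
  unfolding E_def by (rule nrm.span_submodule[OF box_sub])

lemma E_closed: "a \<in> E r \<Longrightarrow> a \<in> carrier A"
  using LinearCombinations.submodule.subset[OF E_submodule] by blast

lemma E_ops: "\<zero> \<in> E r" "a \<in> E r \<Longrightarrow> b \<in> E r \<Longrightarrow> a \<oplus> b \<in> E r" "a \<in> E r \<Longrightarrow> c \<odot>\<^bsub>A\<^esub> a \<in> E r"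
  using LinearCombinations.submodule.zero_closed[OF E_submodule] LinearCombinations.submodule.m_closed[OF E_submodule]
    LinearCombinations.submodule.smult_closed[OF E_submodule] by simp_all

lemma W_in_E: "x \<in> box r \<Longrightarrow> W x \<in> E r"
  unfolding E_def by (rule nrm.span_base[OF box_sub]) simp

lemma ph_in_E: "ph A u (W x) \<Longrightarrow> x \<in> box r \<Longrightarrow> u \<in> E r"
  unfolding ph_def using E_ops(3)[OF W_in_E] by blast

lemma E_induct:
  assumes "a \<in> E r" and N: "LinearCombinations.submodule class_ring N A" and "\<And>x. x \<in> box r \<Longrightarrow> W x \<in> N"
  shows "a \<in> N"
  using nrm.span_subset[OF _ N, of "W ` box r"] assms(1,3) unfolding E_def by blast

lemma box_mono: "r \<le> s \<Longrightarrow> box r \<subseteq> box s"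
  unfolding box_def by fastforce

lemma E_mono: assumes "r \<le> s" shows "E r \<subseteq> E s"
proof
  fix a assume "a \<in> E r"
  then show "a \<in> E s" by (rule E_induct[OF _ E_submodule]) (use box_mono[OF assms] W_in_E in blast)
qed

lemma box_add: assumes "x \<in> box r" "y \<in> box s" shows "x + y \<in> box (r + s)"
proof -
  have "\<bar>x $ j + y $ j\<bar> \<le> int r + int s" if "j < m" for j
    using assms that unfolding box_def by (intro order_trans[OF abs_triangle_ineq] add_mono) auto
  then show ?thesis using assms unfolding box_def by auto
qed

lemma box_uminus: "x \<in> box r \<Longrightarrow> - x \<in> box r"
  unfolding box_def by auto

lemma E_mult: assumes a: "a \<in> E r" and b: "b \<in> E s" shows "a \<otimes> b \<in> E (r + s)"
proof -
  have 1: "a \<otimes> W y \<in> E (r + s)" if y: "y \<in> box s" for y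
  proof -
    have "LinearCombinations.submodule class_ring {a \<in> carrier A. a \<otimes> W y \<in> E (r + s)} A"
      by (rule nrm.submoduleI) (auto simp: E_ops rg.l_distr smult_mult_left)
    from E_induct[OF a this] show ?thesis
    proof -
      have "W x \<otimes> W y \<in> E (r + s)" if x: "x \<in> box r" for x
        by (rule ph_in_E[OF W_mult box_add[OF x y]]) (use x y in \<open>simp_all add: box_def\<close>)
      with E_induct[OF a \<open>LinearCombinations.submodule class_ring {a \<in> carrier A. a \<otimes> W y \<in> E (r + s)} A\<close>]
      show ?thesis by simp
    qed
  qed
  have ac: "a \<in> carrier A" by (rule E_closed[OF a])
  have "LinearCombinations.submodule class_ring {b \<in> carrier A. a \<otimes> b \<in> E (r + s)} A"
    by (rule nrm.submoduleI) (use ac in \<open>auto simp: E_ops rg.r_distr smult_mult_right\<close>)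
  from E_induct[OF b this] show ?thesis using 1 by simp
qed

lemma E_star: assumes a: "a \<in> E r" shows "star A a \<in> E r"
proof -
  have s0: "star A \<zero> = \<zero>" using star_smult[of \<zero> 0] star_closed[of \<zero>] by simp
  have "LinearCombinations.submodule class_ring {a \<in> carrier A. star A a \<in> E r} A"
    by (rule nrm.submoduleI) (auto simp: E_ops star_add star_smult s0)
  from E_induct[OF a this] show ?thesis
    using ph_in_E[OF W_star box_uminus] by (simp add: box_def)
qed

lemma P_I: "a \<in> E r \<Longrightarrow> a \<in> P" unfolding P_def by blast

lemma P_E: assumes "a \<in> P" obtains r where "a \<in> E r" using assms unfolding P_def by blast

lemma P_E2: assumes "a \<in> P" "b \<in> P" obtains r where "a \<in> E r" "b \<in> E r"
proof -
  obtain r s where "a \<in> E r" "b \<in> E s" using assms unfolding P_def by blast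
  then have "a \<in> E (max r s)" "b \<in> E (max r s)" using E_mono[of r "max r s"] E_mono[of s "max r s"] by auto
  then show thesis by (rule that)
qed

lemma P_closed: "a \<in> P \<Longrightarrow> a \<in> carrier A" unfolding P_def using E_closed by blast

lemma P_ops: "\<zero> \<in> P" "a \<in> P \<Longrightarrow> b \<in> P \<Longrightarrow> a \<oplus> b \<in> P" "a \<in> P \<Longrightarrow> c \<odot>\<^bsub>A\<^esub> a \<in> P"
  "a \<in> P \<Longrightarrow> b \<in> P \<Longrightarrow> a \<otimes> b \<in> P" "a \<in> P \<Longrightarrow> star A a \<in> P"
proof -
  show "\<zero> \<in> P" by (rule P_I[OF E_ops(1)])
  show "a \<oplus> b \<in> P" if "a \<in> P" "b \<in> P" by (rule P_E2[OF that]) (rule P_I[OF E_ops(2)])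
  show "c \<odot>\<^bsub>A\<^esub> a \<in> P" if "a \<in> P" by (rule P_E[OF that]) (rule P_I[OF E_ops(3)])
  show "a \<otimes> b \<in> P" if "a \<in> P" "b \<in> P" by (rule P_E2[OF that]) (rule P_I[OF E_mult])
  show "star A a \<in> P" if "a \<in> P" by (rule P_E[OF that]) (rule P_I[OF E_star])
qed

lemma W_in_P: assumes "x \<in> carrier_vec m" shows "W x \<in> P"
proof -
  define r where "r = (\<Sum>j<m. nat \<bar>x $ j\<bar>)"
  have "nat \<bar>x $ j\<bar> \<le> r" if "j < m" for j
    unfolding r_def by (rule member_le_sum) (use that in auto)
  then have "\<bar>x $ j\<bar> \<le> int r" if "j < m" for j using that by fastforce
  then show ?thesis using assms by (intro P_I[of _ r] W_in_E) (simp add: box_def)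
qed

lemma P_induct:
  assumes "a \<in> P" and N: "LinearCombinations.submodule class_ring N A" and "\<And>x. x \<in> carrier_vec m \<Longrightarrow> W x \<in> N"
  shows "a \<in> N"
proof (rule P_E[OF assms(1)])
  fix r assume "a \<in> E r"
  then show "a \<in> N" by (rule E_induct[OF _ N]) (use assms(3) in \<open>simp add: box_def\<close>)
qed

lemma one_in_P: "\<one> \<in> P"
  using W_in_P[of "0\<^sub>v m"] by simp

lemma U_in_P: assumes "j < m" shows "U j \<in> P"
proof -
  have u1: "U j [^] (1::int) = U j"
    using int_pow_succ[OF U_unitary[OF assms], of 0] unitaryD(1)[OF U_unitary[OF assms]] by simp
  have "set js \<subseteq> {..<m} \<Longrightarrow> distinct js \<Longrightarrow> mon js (\<lambda>i. unit_vec m j $ i) = (if j \<in> set js then U j else \<one>)" for js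
  proof (induction js)
    case (Cons i js)
    then have i: "i < m" by simp
    have "unit_vec m j $ i = (if i = j then 1 else 0 :: int)" using i assms by (simp add: unit_vec_def)
    then show ?case using Cons u1 unitaryD(1)[OF U_unitary[OF assms]] by (auto simp del: index_unit_vec)
  qed simp
  from this[OF set_upt_le distinct_upt] have "W (unit_vec m j) = U j" using assms unfolding W_mon by simp
  then show ?thesis using W_in_P[of "unit_vec m j"] by simp
qed

text \<open>The closure of P is a closed unital star subalgebra containing the generators, so the
  generation hypothesis identifies it with the whole algebra.\<close>

lemma P_dense: "nrm.met.mtopology closure_of P = carrier A"
proof -
  let ?B = "nrm.met.mtopology closure_of P"
  have sub: "P \<subseteq> ?B" by (rule closure_of_subset) (use P_closed in auto)
  have Bc: "?B \<subseteq> carrier A" using closure_of_subset_topspace[of nrm.met.mtopology P] by simp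
  have "LinearCombinations.submodule class_ring ?B A"
  proof (rule nrm.submoduleI[OF Bc])
    show "\<zero> \<in> ?B" using sub P_ops(1) by blast
    show "a \<oplus> b \<in> ?B" if ab: "a \<in> ?B" "b \<in> ?B" for a b
    proof -
      obtain x y where "nrm.conv x a" "\<forall>n. x n \<in> P" "nrm.conv y b" "\<forall>n. y n \<in> P"
        using ab unfolding nrm.closure_conv_iff by blast
      then show ?thesis unfolding nrm.closure_conv_iff by (intro exI[of _ "\<lambda>n. x n \<oplus> y n"]) (simp add: nrm.conv_add P_ops)
    qed
    show "c \<odot>\<^bsub>A\<^esub> a \<in> ?B" if a: "a \<in> ?B" for a c
    proof -
      obtain x where "nrm.conv x a" "\<forall>n. x n \<in> P" using a unfolding nrm.closure_conv_iff by blast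
      then show ?thesis unfolding nrm.closure_conv_iff by (intro exI[of _ "\<lambda>n. c \<odot>\<^bsub>A\<^esub> x n"]) (simp add: nrm.conv_smult P_ops)
    qed
  qed
  then have f1: "VectorSpace.subspace class_ring ?B A" using vectorspace by (rule VectorSpace.subspace.intro[rotated])
  have f2: "star A a \<in> ?B" if a: "a \<in> ?B" for a
  proof -
    obtain x where "nrm.conv x a" "\<forall>n. x n \<in> P" using a unfolding nrm.closure_conv_iff by blast
    then show ?thesis unfolding nrm.closure_conv_iff by (intro exI[of _ "\<lambda>n. star A (x n)"]) (simp add: conv_star P_ops)
  qed
  have f3: "a \<otimes> b \<in> ?B" if ab: "a \<in> ?B" "b \<in> ?B" for a b
  proof -
    obtain x y where "nrm.conv x a" "\<forall>n. x n \<in> P" "nrm.conv y b" "\<forall>n. y n \<in> P"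
      using ab unfolding nrm.closure_conv_iff by blast
    then show ?thesis unfolding nrm.closure_conv_iff by (intro exI[of _ "\<lambda>n. x n \<otimes> y n"]) (simp add: conv_mult P_ops)
  qed
  have f4: "U ` {..<m} \<subseteq> ?B" "\<one> \<in> ?B" using sub U_in_P one_in_P by auto
  have f5: "closedin (ctop A) ?B" by (simp add: ctop_eq)
  show ?thesis
    by (rule gen[unfolded generated_by_def, THEN spec, THEN mp]) (intro conjI ballI f1 f2 f3 f4 f5)
qed

lemma traceD:
  "a \<in> carrier A \<Longrightarrow> \<tau> (c \<odot>\<^bsub>A\<^esub> a) = c * \<tau> a" "a \<in> carrier A \<Longrightarrow> cmod (\<tau> a) \<le> cnorm A a" "\<tau> \<one> = 1"
  using trace unfolding tracial_state_def by blast+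

lemma trace_W: "x \<in> carrier_vec m \<Longrightarrow> y \<in> carrier_vec m \<Longrightarrow> \<tau> (star A (W x) \<otimes> W y) = (if x = y then 1 else 0)"
proof (cases "x = y")
  case True
  then show ?thesis using unitaryD(3)[OF W_unitary] traceD(3) by simp
next
  case False
  assume xy: "x \<in> carrier_vec m" "y \<in> carrier_vec m"
  have "y - x \<noteq> 0\<^sub>v m"
  proof
    assume "y - x = 0\<^sub>v m"
    then have "(y - x) $ i = 0" if "i < m" for i using that by simp
    then have "x = y" using xy by (intro eq_vecI) auto
    then show False using False by simp
  qed
  then have "\<tau> (W (y - x)) = 0" using xy by (intro trace_W_zero[OF trace nondeg \<Theta>_carrier]) simp_all
  moreover obtain c where "star A (W x) \<otimes> W y = c \<odot>\<^bsub>A\<^esub> W (y - x)" using W_star_mult[OF xy] unfolding ph_def by blast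
  ultimately show ?thesis using False traceD(1)[OF W_closed] by simp
qed

lemma finite_box: "finite (box r)" "card (box r) \<le> (2 * r + 1) ^ m"
proof -
  let ?F = "{..<m} \<rightarrow>\<^sub>E {- int r..int r}"
  let ?f = "\<lambda>x. \<lambda>j\<in>{..<m}. x $ j"
  have inj: "inj_on ?f (box r)"
  proof (rule inj_onI)
    fix x y :: "int Matrix.vec" assume xy: "x \<in> box r" "y \<in> box r" "?f x = ?f y"
    have d: "dim_vec x = m" "dim_vec y = m" using xy carrier_vecD unfolding box_def by blast+
    show "x = y"
    proof (rule eq_vecI)
      fix i assume "i < dim_vec y"
      then show "x $ i = y $ i" using fun_cong[OF xy(3), of i] d by simp
    qed (use d in simp)
  qed
  have im: "?f ` box r \<subseteq> ?F"
    by (rule image_subsetI, unfold restrict_PiE_iff) (auto simp: box_def abs_le_iff)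
  have fin: "finite ?F" by (intro finite_PiE) simp_all
  show "finite (box r)" using inj_on_finite[OF inj im fin] .
  have "card (box r) \<le> card ?F" by (rule card_inj_on_le[OF inj im fin])
  also have "card ?F = card {- int r..int r} ^ m" by (simp add: card_PiE)
  also have "card {- int r..int r} = 2 * r + 1" unfolding card_atLeastAtMost_int by linarith
  finally show "card (box r) \<le> (2 * r + 1) ^ m" .
qed

end

section \<open>The amplified GNS representation and its isometry\<close>

locale torus_stage = torus_algebra A m \<Theta> U \<tau> + L: hilbert_space L + S: hilbert_space S + H: hilbert_space H
  for A :: "'a cstar" (structure) and m \<Theta> U \<tau> and L :: "'l hilbert" and S :: "'s hilbert" and H :: "'h hilbert" +
  fixes \<Lambda> :: "'a \<Rightarrow> 'l" and tens :: "'l \<Rightarrow> 's \<Rightarrow> 'h" and \<pi> :: "'a \<Rightarrow> 'h \<Rightarrow> 'h"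
  assumes gns: "gns_space A \<tau> L \<Lambda>" and tensor: "hilbert_tensor L S H tens"
    and \<pi>_bounded: "a \<in> carrier A \<Longrightarrow> \<pi> a \<in> bounded_ops H H"
    and \<pi>_tens: "a \<in> carrier A \<Longrightarrow> b \<in> carrier A \<Longrightarrow> \<xi> \<in> carrier S \<Longrightarrow> \<pi> a (tens (\<Lambda> b) \<xi>) = tens (\<Lambda> (a \<otimes> b)) \<xi>"
    and S_nontrivial: "carrier S \<noteq> {\<zero>\<^bsub>S\<^esub>}"
begin

lemma \<Lambda>_linear: "\<Lambda> \<in> linear_maps A L"
  and \<Lambda>_inner: "a \<in> carrier A \<Longrightarrow> b \<in> carrier A \<Longrightarrow> inner L (\<Lambda> a) (\<Lambda> b) = \<tau> (star A a \<otimes> b)"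
  and \<Lambda>_dense: "L.nrm.met.mtopology closure_of (\<Lambda> ` carrier A) = carrier L"
  using gns unfolding gns_space_def L.htop_eq by simp_all

lemma \<Lambda>_closed [simp]: "a \<in> carrier A \<Longrightarrow> \<Lambda> a \<in> carrier L"
  by (rule linear_mapsD(1)[OF \<Lambda>_linear])

lemma tens_linear_left: "s \<in> carrier S \<Longrightarrow> (\<lambda>l. tens l s) \<in> linear_maps L H"
  and tens_linear_right: "l \<in> carrier L \<Longrightarrow> tens l \<in> linear_maps S H"
  and tens_inner: "l \<in> carrier L \<Longrightarrow> l' \<in> carrier L \<Longrightarrow> s \<in> carrier S \<Longrightarrow> s' \<in> carrier S \<Longrightarrow>
      inner H (tens l s) (tens l' s') = inner L l l' * inner S s s'"
  and tens_dense: "H.nrm.met.mtopology closure_of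
      LinearCombinations.module.span class_ring H {tens l s | l s. l \<in> carrier L \<and> s \<in> carrier S} = carrier H"
  using tensor unfolding hilbert_tensor_def H.htop_eq by simp_all

lemma tens_closed [simp]: "l \<in> carrier L \<Longrightarrow> s \<in> carrier S \<Longrightarrow> tens l s \<in> carrier H"
  by (rule linear_mapsD(1)[OF tens_linear_right])

lemma tens_norm: assumes "l \<in> carrier L" "s \<in> carrier S" shows "hnorm H (tens l s) = hnorm L l * hnorm S s"
proof -
  have "inner H (tens l s) (tens l s) = complex_of_real ((hnorm L l)\<^sup>2 * (hnorm S s)\<^sup>2)"
    using assms by (simp add: tens_inner L.inner_self S.inner_self)
  then have "(hnorm H (tens l s))\<^sup>2 = (hnorm L l * hnorm S s)\<^sup>2"
    using H.hnorm_sq[OF tens_closed[OF assms]] by (simp add: power_mult_distrib)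
  then show ?thesis
    using H.hnorm_nonneg[OF tens_closed[OF assms]] L.hnorm_nonneg[OF assms(1)] S.hnorm_nonneg[OF assms(2)]
    by (simp add: power2_eq_iff_nonneg)
qed

lemma \<Lambda>_norm_le: assumes "a \<in> carrier A" shows "hnorm L (\<Lambda> a) \<le> cnorm A a"
proof (rule power2_le_imp_le[OF _ norm_nonneg[OF assms]])
  have "(hnorm L (\<Lambda> a))\<^sup>2 = Re (\<tau> (star A a \<otimes> a))" using L.hnorm_sq[of "\<Lambda> a"] assms by (simp add: \<Lambda>_inner)
  also have "\<dots> \<le> cmod (\<tau> (star A a \<otimes> a))" by (rule complex_Re_le_cmod)
  also have "\<dots> \<le> cnorm A (star A a \<otimes> a)" by (rule traceD(2)) (use assms star_closed in simp)
  also have "\<dots> = (cnorm A a)\<^sup>2" by (rule cstar_identity[OF assms])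
  finally show "(hnorm L (\<Lambda> a))\<^sup>2 \<le> (cnorm A a)\<^sup>2" .
qed

definition \<delta> :: "int Matrix.vec \<Rightarrow> 's \<Rightarrow> 'h" where "\<delta> x \<xi> = tens (\<Lambda> (W x)) \<xi>"

lemma \<delta>_closed [simp]: "\<xi> \<in> carrier S \<Longrightarrow> \<delta> x \<xi> \<in> carrier H"
  by (simp add: \<delta>_def)

lemma \<delta>_linear: "\<delta> x \<in> linear_maps S H"
  unfolding \<delta>_def by (rule tens_linear_right) simp

lemma \<delta>_inner: "x \<in> carrier_vec m \<Longrightarrow> y \<in> carrier_vec m \<Longrightarrow> \<xi> \<in> carrier S \<Longrightarrow> \<eta> \<in> carrier S \<Longrightarrow>
   inner H (\<delta> x \<xi>) (\<delta> y \<eta>) = (if x = y then inner S \<xi> \<eta> else 0)"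
  unfolding \<delta>_def by (simp add: tens_inner \<Lambda>_inner trace_W)

text \<open>Three density statements are composed by pulling the seminorm back: P is dense in the
  algebra, the image of \<open>\<Lambda>\<close> in L, and the span of elementary tensors in
  H.\<close>

lemma \<delta>_seminorm_zero:
  assumes p: "H.nrm.bseminorm p" and z: "\<And>x \<xi>. x \<in> carrier_vec m \<Longrightarrow> \<xi> \<in> carrier S \<Longrightarrow> p (\<delta> x \<xi>) = 0"
    and v: "v \<in> carrier H"
  shows "p v = 0"
proof (rule H.nrm.bseminorm_zero[OF p _ _ tens_dense v])
  fix h assume "h \<in> {tens l s | l s. l \<in> carrier L \<and> s \<in> carrier S}"
  then obtain l s where h: "h = tens l s" and l: "l \<in> carrier L" and s: "s \<in> carrier S" by blast
  have pL: "L.nrm.bseminorm (\<lambda>l. p (tens l s))"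
    by (rule bseminorm_compose[OF L.nrm.cnormed_axioms H.nrm.cnormed_axioms tens_linear_left[OF s] _ p, where C="hnorm S s"])
       (simp add: tens_norm s mult.commute)
  have pA: "nrm.bseminorm (\<lambda>a. p (tens (\<Lambda> a) s))"
    by (rule bseminorm_compose[OF nrm.cnormed_axioms L.nrm.cnormed_axioms \<Lambda>_linear _ pL, where C=1]) (simp add: \<Lambda>_norm_le)
  have "p (tens (\<Lambda> a) s) = 0" if a: "a \<in> carrier A" for a
  proof (rule nrm.bseminorm_zero_closure[OF pA])
    show "a \<in> nrm.met.mtopology closure_of P" using a P_dense by simp
    fix b assume "b \<in> P"
    then have "b \<in> {b \<in> carrier A. p (tens (\<Lambda> b) s) = 0}"
      by (rule P_induct[OF _ nrm.bseminorm_kernel[OF pA]]) (use z s in \<open>simp add: \<delta>_def\<close>)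
    then show "p (tens (\<Lambda> b) s) = 0" by simp
  qed
  then have z: "p (tens x s) = 0" if "x \<in> \<Lambda> ` carrier A" for x using that by auto
  have "l \<in> L.nrm.met.mtopology closure_of (\<Lambda> ` carrier A)" using \<Lambda>_dense l by simp
  from L.nrm.bseminorm_zero_closure[OF pL z this] have "p (tens l s) = 0" .
  then show "p h = 0" using h by simp
qed auto

lemma bounded_eq_on_tens:
  assumes K: "hilbert_space K" and T: "T \<in> bounded_ops H K" and T': "T' \<in> bounded_ops H K"
    and eq: "\<And>b \<xi>. b \<in> carrier A \<Longrightarrow> \<xi> \<in> carrier S \<Longrightarrow> T (tens (\<Lambda> b) \<xi>) = T' (tens (\<Lambda> b) \<xi>)" and v: "v \<in> carrier H"
  shows "T v = T' v"
proof -
  interpret K: hilbert_space K by (rule K)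
  have c: "T v \<in> carrier K" "T' v \<in> carrier K" using linear_mapsD(1)[OF bounded_opsD(1)[OF T] v] linear_mapsD(1)[OF bounded_opsD(1)[OF T'] v] by simp_all
  show ?thesis
  proof (rule K.inner_eqI[OF c])
    fix w assume w: "w \<in> carrier K"
    have "cmod (inner K w (T v) - inner K w (T' v)) = 0"
      by (rule \<delta>_seminorm_zero[OF bseminorm_inner_diff[OF H.hilbert_space_axioms K K T T' w w] _ v])
         (simp add: \<delta>_def eq)
    then show "inner K w (T v) = inner K w (T' v)" by simp
  qed
qed

lemma \<pi>_closed [simp]: "a \<in> carrier A \<Longrightarrow> v \<in> carrier H \<Longrightarrow> \<pi> a v \<in> carrier H"
  using linear_mapsD(1)[OF bounded_opsD(1)[OF \<pi>_bounded]] by blast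

lemma \<pi>_adjoint_tens:
  assumes a: "a \<in> carrier A" and b: "b \<in> carrier A" "\<xi> \<in> carrier S" and c: "c \<in> carrier A" "\<eta> \<in> carrier S"
  shows "inner H (\<pi> (star A a) (tens (\<Lambda> b) \<xi>)) (tens (\<Lambda> c) \<eta>) = inner H (tens (\<Lambda> b) \<xi>) (\<pi> a (tens (\<Lambda> c) \<eta>))"
proof -
  have "star A (star A a \<otimes> b) \<otimes> c = star A b \<otimes> (a \<otimes> c)"
    using a b(1) c(1) star_closed by (simp add: star_mult star_star rg.m_assoc)
  then show ?thesis using a b c star_closed[OF a] by (simp add: \<pi>_tens tens_inner \<Lambda>_inner)
qed

text \<open>The identity extends from elementary tensors one argument at a time. Inner products are
  linear only in the second argument, so the extension in v is made with the two sides
  interchanged.\<close>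

lemma \<pi>_adjoint:
  assumes a: "a \<in> carrier A" and v: "v \<in> carrier H" and w: "w \<in> carrier H"
  shows "inner H (\<pi> (star A a) v) w = inner H v (\<pi> a w)"
proof -
  note hs = H.hilbert_space_axioms
  have sa: "star A a \<in> carrier A" using star_closed[OF a] .
  have 1: "inner H v (\<pi> a (tens (\<Lambda> c) \<eta>)) = inner H (\<pi> (star A a) v) (tens (\<Lambda> c) \<eta>)"
    if c: "c \<in> carrier A" "\<eta> \<in> carrier S" for c \<eta>
  proof -
    let ?w = "tens (\<Lambda> c) \<eta>"
    have w: "?w \<in> carrier H" "\<pi> a ?w \<in> carrier H" using c a by simp_all
    have "cmod (inner H ?w (\<pi> (star A a) v) - inner H (\<pi> a ?w) v) = 0"
    proof (rule \<delta>_seminorm_zero[OF bseminorm_inner_diff[OF hs hs hs \<pi>_bounded[OF sa] bounded_ops_id w] _ v])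
      fix x :: "int Matrix.vec" and \<xi> assume x: "x \<in> carrier_vec m" "\<xi> \<in> carrier S"
      have "inner H (\<pi> (star A a) (\<delta> x \<xi>)) ?w = inner H (\<delta> x \<xi>) (\<pi> a ?w)"
        unfolding \<delta>_def using \<pi>_adjoint_tens[OF a W_closed x(2) c] .
      then have "inner H ?w (\<pi> (star A a) (\<delta> x \<xi>)) = inner H (\<pi> a ?w) (\<delta> x \<xi>)"
        using H.inner_commute[of ?w "\<pi> (star A a) (\<delta> x \<xi>)"] H.inner_commute[of "\<pi> a ?w" "\<delta> x \<xi>"] w x sa by simp
      then show "cmod (inner H ?w (\<pi> (star A a) (\<delta> x \<xi>)) - inner H (\<pi> a ?w) (\<delta> x \<xi>)) = 0" by simp
    qed
    then show ?thesis using H.inner_commute[of v "\<pi> a ?w"] H.inner_commute[of "\<pi> (star A a) v" ?w] w v sa by simp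
  qed
  have "cmod (inner H (\<pi> (star A a) v) w - inner H v (\<pi> a w)) = 0"
    by (rule \<delta>_seminorm_zero[OF bseminorm_inner_diff[OF hs hs hs bounded_ops_id \<pi>_bounded[OF a] _ v] _ w])
       (simp_all add: sa v 1 \<delta>_def)
  then show ?thesis by simp
qed

text \<open>The operators are given as bounded maps prescribed on elementary tensors. There the
  algebraic laws are those of left multiplication, and density carries them over.\<close>

lemma \<pi>_representation: "unital_representation A H \<pi>"
  unfolding unital_representation_def
proof (intro conjI ballI allI)
  note hs = H.hilbert_space_axioms
  fix v assume v: "v \<in> carrier H"
  show "\<pi> \<one> v = v"
    by (rule bounded_eq_on_tens[OF hs \<pi>_bounded bounded_ops_id _ v]) (simp_all add: \<pi>_tens)
  fix a assume a: "a \<in> carrier A"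
  show "\<pi> (c \<odot>\<^bsub>A\<^esub> a) v = c \<odot>\<^bsub>H\<^esub> \<pi> a v" for c
    by (rule bounded_eq_on_tens[OF hs \<pi>_bounded bounded_ops_smult[OF hs hs \<pi>_bounded] _ v])
       (simp_all add: a \<pi>_tens smult_mult_left linear_mapsD(3)[OF \<Lambda>_linear] linear_mapsD(3)[OF tens_linear_left])
  show "inner H (\<pi> (star A a) v) w = inner H v (\<pi> a w)" if "w \<in> carrier H" for w
    by (rule \<pi>_adjoint[OF a v that])
  fix b assume b: "b \<in> carrier A"
  show "\<pi> (a \<oplus> b) v = \<pi> a v \<oplus>\<^bsub>H\<^esub> \<pi> b v"
    by (rule bounded_eq_on_tens[OF hs \<pi>_bounded bounded_ops_add[OF hs hs \<pi>_bounded \<pi>_bounded] _ v])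
       (simp_all add: a b \<pi>_tens rg.l_distr linear_mapsD(2)[OF \<Lambda>_linear] linear_mapsD(2)[OF tens_linear_left])
  show "\<pi> (a \<otimes> b) v = \<pi> a (\<pi> b v)"
    by (rule bounded_eq_on_tens[OF hs \<pi>_bounded bounded_ops_compose[OF hs hs hs \<pi>_bounded \<pi>_bounded] _ v])
       (simp_all add: a b \<pi>_tens rg.m_assoc)
qed (rule \<pi>_bounded)

lemma \<pi>_contractive: "a \<in> carrier A \<Longrightarrow> v \<in> carrier H \<Longrightarrow> hnorm H (\<pi> a v) \<le> cnorm A a * hnorm H v"
  by (rule representation_contractive[OF unital_cstar_algebra_axioms H.hilbert_space_axioms \<pi>_representation])

text \<open>The coefficients of a are inner products with orthonormal vectors, hence at most the
  norm of \<open>\<Lambda> a\<close>. Monomials are unitary, so the triangle inequality costs only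
  the number of terms.\<close>

lemma E_norm_le: assumes a: "a \<in> E r" shows "cnorm A a \<le> real ((2 * r + 1) ^ m) * hnorm L (\<Lambda> a)"
proof -
  let ?T = "W ` box r"
  have fT: "finite ?T" using finite_box(1) by simp
  have Tc: "v \<in> carrier A" if "v \<in> ?T" for v using that by auto
  have "a \<in> {module.lincomb A c ?T | c. c \<in> ?T \<rightarrow> carrier class_ring}"
    using a module.finite_span[OF nrm.mod fT box_sub] unfolding E_def by blast
  then obtain c where c: "a = finsum A (\<lambda>v. c v \<odot>\<^bsub>A\<^esub> v) ?T" unfolding module.lincomb_def[OF nrm.mod] by blast
  \<comment> \<open>The sum runs over the set of monomials rather than over exponents, so
    orthonormality is stated for elements of that set.\<close>
  have ort: "inner L (\<Lambda> u) (\<Lambda> v) = (if u = v then 1 else 0)" if "u \<in> ?T" "v \<in> ?T" for u v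
  proof -
    obtain x y where x: "u = W x" "x \<in> carrier_vec m" and y: "v = W y" "y \<in> carrier_vec m" using \<open>u \<in> ?T\<close> \<open>v \<in> ?T\<close> unfolding box_def by blast
    have e: "inner L (\<Lambda> u) (\<Lambda> v) = (if x = y then 1 else 0)" unfolding x(1) y(1) using x(2) y(2) by (simp add: \<Lambda>_inner trace_W)
    have "inner L (\<Lambda> u) (\<Lambda> u) = 1" unfolding x(1) using x(2) by (simp add: \<Lambda>_inner trace_W)
    then show ?thesis using e x(1) y(1) by (cases "x = y") auto
  qed
  have "\<Lambda> a = finsum L (\<lambda>v. \<Lambda> (c v \<odot>\<^bsub>A\<^esub> v)) ?T"
    unfolding c by (rule linear_finsum[OF nrm.cnormed_axioms L.nrm.cnormed_axioms \<Lambda>_linear fT]) (use Tc in simp)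
  then have \<Lambda>a: "inner L u (\<Lambda> a) = (\<Sum>v\<in>?T. inner L u (\<Lambda> (c v \<odot>\<^bsub>A\<^esub> v)))" if "u \<in> carrier L" for u
    using L.inner_finsum[OF fT that, of "\<lambda>v. \<Lambda> (c v \<odot>\<^bsub>A\<^esub> v)"] Tc by simp
  have ac: "a \<in> carrier A" by (rule E_closed[OF a])
  have coeff: "cmod (c v) \<le> hnorm L (\<Lambda> a)" if v: "v \<in> ?T" for v
  proof -
    have "inner L (\<Lambda> v) (\<Lambda> a) = (\<Sum>w\<in>?T. c w * inner L (\<Lambda> v) (\<Lambda> w))"
      unfolding \<Lambda>a[OF \<Lambda>_closed[OF Tc[OF v]]] using Tc v
      by (intro sum.cong refl) (simp add: linear_mapsD(3)[OF \<Lambda>_linear] L.inner_smult)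
    also have "\<dots> = (\<Sum>w\<in>?T. if v = w then c w else 0)" using ort[OF v] by (intro sum.cong refl) simp
    also have "\<dots> = c v" using fT v by simp
    finally have "cmod (c v) = cmod (inner L (\<Lambda> v) (\<Lambda> a))" by simp
    also have "\<dots> \<le> hnorm L (\<Lambda> v) * hnorm L (\<Lambda> a)" by (rule L.Cauchy_Schwarz) (use Tc[OF v] ac in simp_all)
    also have "hnorm L (\<Lambda> v) = 1" using ort[OF v v] by (simp add: hnorm_def)
    finally show ?thesis by simp
  qed
  have "cnorm A a \<le> (\<Sum>v\<in>?T. cnorm A (c v \<odot>\<^bsub>A\<^esub> v))"
    unfolding c by (rule nrm.nrm_finsum_le[OF fT]) (use Tc in simp)
  also have "\<dots> \<le> (\<Sum>v\<in>?T. hnorm L (\<Lambda> a))"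
  proof (rule sum_mono)
    fix v assume v: "v \<in> ?T"
    then have "cnorm A v = 1" using norm_unitary[OF unital_cstar_algebra_axioms W_unitary] by auto
    then show "cnorm A (c v \<odot>\<^bsub>A\<^esub> v) \<le> hnorm L (\<Lambda> a)" using coeff[OF v] Tc[OF v] by (simp add: norm_smult)
  qed
  also have "\<dots> = real (card ?T) * hnorm L (\<Lambda> a)" by simp
  also have "\<dots> \<le> real ((2 * r + 1) ^ m) * hnorm L (\<Lambda> a)"
    using card_image_le[OF finite_box(1), of W r] finite_box(2)[of r] L.hnorm_nonneg[OF \<Lambda>_closed[OF ac]]
    by (intro mult_right_mono of_nat_mono) simp_all
  finally show ?thesis .
qed

text \<open>Polynomial growth of the box forces the C*-norm of a to be the operator norm of \<open>\<pi> a\<close>: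
  apply the preceding estimate to the powers \<open>(a\<^sup>* a)\<close> to the exponent \<open>2\<^sup>k\<close> and take roots.\<close>

lemma P_norm_le:
  assumes aP: "a \<in> P" and C: "0 \<le> C" "\<And>v. v \<in> carrier H \<Longrightarrow> hnorm H (\<pi> a v) \<le> C * hnorm H v"
  shows "cnorm A a \<le> C"
proof -
  note R = unital_representationD[OF \<pi>_representation]
  obtain r where aE: "a \<in> E r" by (rule P_E[OF aP])
  have a: "a \<in> carrier A" by (rule P_closed[OF aP])
  have sa: "star A a \<in> carrier A" by (rule star_closed[OF a])
  define h where "h = star A a \<otimes> a"
  have h: "h \<in> carrier A" "star A h = h" using a sa by (simp_all add: h_def star_mult star_star)
  have hE: "h \<in> E (r + r)" unfolding h_def by (rule E_mult[OF E_star[OF aE] aE])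
  have hpE: "h [^] n \<in> E (n * (r + r))" for n :: nat
  proof (induction n)
    case 0
    have "W (0\<^sub>v m) \<in> E 0" by (rule W_in_E) (simp add: box_def)
    then show ?case by simp
  next
    case (Suc n)
    from E_mult[OF Suc hE] show ?case by (simp add: add.commute)
  qed
  \<comment> \<open>The adjoint obeys the same operator bound, which makes \<open>C^2\<close> a
    bound for \<open>h\<close>.\<close>
  have Cs: "hnorm H (\<pi> (star A a) v) \<le> C * hnorm H v" if v: "v \<in> carrier H" for v
  proof -
    let ?w = "\<pi> (star A a) v"
    have w: "?w \<in> carrier H" using v sa by simp
    have "(hnorm H ?w)\<^sup>2 = Re (inner H v (\<pi> a ?w))" using H.hnorm_sq[OF w] R(6)[OF a v w] by simp
    also have "\<dots> \<le> cmod (inner H v (\<pi> a ?w))" by (rule complex_Re_le_cmod)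
    also have "\<dots> \<le> hnorm H v * hnorm H (\<pi> a ?w)" by (rule H.Cauchy_Schwarz[OF v]) (use a w in simp)
    also have "\<dots> \<le> hnorm H v * (C * hnorm H ?w)" by (rule mult_left_mono[OF C(2)[OF w] H.hnorm_nonneg[OF v]])
    finally have "hnorm H ?w * hnorm H ?w \<le> (C * hnorm H v) * hnorm H ?w" by (simp add: power2_eq_square mult.commute mult.left_commute)
    then show ?thesis using H.hnorm_nonneg[OF w] C(1) H.hnorm_nonneg[OF v] by (cases "hnorm H ?w = 0") simp_all
  qed
  have hb: "hnorm H (\<pi> h v) \<le> C\<^sup>2 * hnorm H v" if v: "v \<in> carrier H" for v
  proof -
    have "hnorm H (\<pi> h v) \<le> C * hnorm H (\<pi> a v)" unfolding h_def R(4)[OF sa a v] by (rule Cs) (use a v in simp)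
    also have "\<dots> \<le> C * (C * hnorm H v)" by (rule mult_left_mono[OF C(2)[OF v] C(1)])
    finally show ?thesis by (simp add: power2_eq_square)
  qed
  have hnb: "hnorm H (\<pi> (h [^] n) v) \<le> (C\<^sup>2) ^ n * hnorm H v" if v: "v \<in> carrier H" for n :: nat and v
    using v
  proof (induction n arbitrary: v)
    case 0 then show ?case using R(2) by simp
  next
    case (Suc n)
    have "\<pi> (h [^] Suc n) v = \<pi> (h [^] n) (\<pi> h v)" using R(4)[OF _ h(1) Suc.prems, of "h [^] n"] h(1) by simp
    then have "hnorm H (\<pi> (h [^] Suc n) v) \<le> (C\<^sup>2) ^ n * hnorm H (\<pi> h v)" using Suc.IH[of "\<pi> h v"] h(1) Suc.prems by simp
    also have "\<dots> \<le> (C\<^sup>2) ^ n * (C\<^sup>2 * hnorm H v)" by (rule mult_left_mono[OF hb[OF Suc.prems]]) simp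
    finally show ?case by (simp add: mult_ac)
  qed
  \<comment> \<open>A nonzero vector of S makes the \<open>L\<close>-norm visible in H: acting on
    the tensor of \<open>\<Lambda> 1\<close> and \<open>\<xi>\<close>, the operator of
    \<open>h ^ n\<close> produces \<open>\<Lambda> (h ^ n)\<close> in the first factor.\<close>
  obtain \<xi> where \<xi>: "\<xi> \<in> carrier S" "\<xi> \<noteq> \<zero>\<^bsub>S\<^esub>" using S_nontrivial S.nrm.zero_closed by blast
  have \<xi>n: "hnorm S \<xi> > 0" using \<xi> S.nrm.nrm_definite[OF \<xi>(1)] S.hnorm_nonneg[OF \<xi>(1)] by fastforce
  have \<Lambda>1: "hnorm L (\<Lambda> \<one>) = 1" using traceD(3) by (simp add: hnorm_def \<Lambda>_inner star_one)
  have \<Lambda>h: "hnorm L (\<Lambda> (h [^] n)) \<le> (C\<^sup>2) ^ n" for n :: nat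
  proof -
    have "hnorm L (\<Lambda> (h [^] n)) * hnorm S \<xi> = hnorm H (\<pi> (h [^] n) (tens (\<Lambda> \<one>) \<xi>))"
      using h(1) \<xi>(1) by (simp add: \<pi>_tens tens_norm)
    also have "\<dots> \<le> (C\<^sup>2) ^ n * (hnorm L (\<Lambda> \<one>) * hnorm S \<xi>)"
      using hnb[of "tens (\<Lambda> \<one>) \<xi>" n] \<xi>(1) by (simp add: tens_norm)
    finally have "hnorm L (\<Lambda> (h [^] n)) * hnorm S \<xi> \<le> (C\<^sup>2) ^ n * hnorm S \<xi>" using \<Lambda>1 by simp
    then show ?thesis using \<xi>n by simp
  qed
  let ?q = "cnorm A a"
  \<comment> \<open>If a lies in the box of radius r, then h lies in radius \<open>2 * r\<close> and
    its power in radius \<open>2 ^ k * 2 * r\<close>; twice this radius plus one is the base on the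
    right.\<close>
  have main: "(?q\<^sup>2) ^ (2 ^ k) \<le> (real (4 * r) * 2 ^ k + 1) ^ m * (C\<^sup>2) ^ (2 ^ k)" for k :: nat
  proof -
    have "(?q\<^sup>2) ^ (2 ^ k) = cnorm A (h [^] (2 ^ k :: nat))"
      using norm_selfadjoint_power[OF h, of k] cstar_identity[OF a] by (simp add: h_def)
    also have "\<dots> \<le> real ((2 * (2 ^ k * (r + r)) + 1) ^ m) * hnorm L (\<Lambda> (h [^] (2 ^ k :: nat)))"
      by (rule E_norm_le[OF hpE])
    also have "\<dots> \<le> real ((2 * (2 ^ k * (r + r)) + 1) ^ m) * (C\<^sup>2) ^ (2 ^ k)" by (rule mult_left_mono[OF \<Lambda>h]) simp
    also have "real ((2 * (2 ^ k * (r + r)) + 1) ^ m) = (real (4 * r) * 2 ^ k + 1) ^ m"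
      by (simp add: algebra_simps)
    finally show ?thesis .
  qed
  show ?thesis
  proof (cases "C = 0")
    \<comment> \<open>Division by \<open>C^2\<close> is impossible here, but \<open>main\<close> at
      \<open>k = 0\<close> already gives zero.\<close>
    case True
    from main[of 0] True have "?q\<^sup>2 \<le> 0" by simp
    then show ?thesis using True by simp
  next
    case False
    then have Cp: "C\<^sup>2 > 0" by simp
    have "?q\<^sup>2 / C\<^sup>2 \<le> 1"
    proof (rule exponential_below_polynomial)
      fix k :: nat
      show "(?q\<^sup>2 / C\<^sup>2) ^ (2 ^ k) \<le> (real (4 * r) * 2 ^ k + 1) ^ m"
        unfolding power_divide[of "?q\<^sup>2"] using main[of k] Cp by (subst pos_divide_le_eq) simp_all
    qed
    then have "?q\<^sup>2 \<le> C\<^sup>2" using Cp by (simp add: pos_divide_le_eq)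
    then show ?thesis by (rule power2_le_imp_le[OF _ C(1)])
  qed
qed

text \<open>A nearby polynomial b satisfies the operator bound \<open>C + \<epsilon> / 2\<close>
  because representations are contractive, so the estimate for P applies to b and passes to
  a.\<close>

lemma norm_le_of_operator_bound:
  assumes a: "a \<in> carrier A" and C: "0 \<le> C" "\<And>v. v \<in> carrier H \<Longrightarrow> hnorm H (\<pi> a v) \<le> C * hnorm H v"
  shows "cnorm A a \<le> C"
proof (rule field_le_epsilon)
  note R = unital_representationD[OF \<pi>_representation]
  fix \<epsilon> :: real assume e: "\<epsilon> > 0"
  have "a \<in> nrm.met.mtopology closure_of P" using a P_dense by simp
  then obtain b where b: "b \<in> P" "b \<in> carrier A" "cnorm A (a \<ominus> b) < \<epsilon> / 2"
    unfolding nrm.closure_iff using e half_gt_zero by blast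
  have "cnorm A b \<le> C + \<epsilon> / 2"
  proof (rule P_norm_le[OF b(1)])
    fix v assume v: "v \<in> carrier H"
    have "\<pi> b v = \<pi> a v \<oplus>\<^bsub>H\<^esub> \<pi> (b \<ominus> a) v"
      using R(3)[OF a _ v, of "b \<ominus> a"] a b(2) by (simp add: nrm.add_diff)
    then have "hnorm H (\<pi> b v) \<le> hnorm H (\<pi> a v) + hnorm H (\<pi> (b \<ominus> a) v)"
      using H.nrm.nrm_triangle[of "\<pi> a v" "\<pi> (b \<ominus> a) v"] a b(2) v by simp
    also have "\<dots> \<le> C * hnorm H v + cnorm A (b \<ominus> a) * hnorm H v"
      by (intro add_mono C(2) \<pi>_contractive v) (use a b in simp)
    also have "\<dots> \<le> C * hnorm H v + \<epsilon> / 2 * hnorm H v"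
      using b(3) nrm.nrm_minus_commute[OF a b(2)] H.hnorm_nonneg[OF v] by (intro add_mono mult_right_mono) simp_all
    finally show "hnorm H (\<pi> b v) \<le> (C + \<epsilon> / 2) * hnorm H v" by (simp add: distrib_right)
  qed (use C e in simp)
  then show "cnorm A a \<le> C + \<epsilon>" using nrm.nrm_le_diff[OF a b(2)] b(3) by simp
qed

end

section \<open>Inductive limits\<close>

lemma chain_append: "chain f n (k + l) x = chain f (n + k) l (chain f n k x)"
  by (induction l) (simp_all add: add.assoc)

text \<open>The i-th term is taken from the i-th set, so that sequences for an algebra element and
  for a vector can later be multiplied stage by stage.\<close>

lemma (in cnormed) dense_increasing_union:
  assumes X: "\<And>i. X i \<subseteq> X (Suc i)" and d: "met.mtopology closure_of (\<Union>i. X i) = carrier V" and Xc: "\<And>i. X i \<subseteq> carrier V"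
    and ne: "\<And>i. X i \<noteq> {}" and v: "v \<in> carrier V"
  obtains x where "\<And>i :: nat. x i \<in> X i" "conv x v"
proof -
  \<comment> \<open>The distance from v to \<open>X i\<close>. It decreases with i, so almost
    optimal choices in each set converge to v.\<close>
  define r where "r i = Inf ((\<lambda>x. N (v \<ominus> x)) ` X i)" for i
  have bdd: "bdd_below ((\<lambda>x. N (v \<ominus> x)) ` X i)" for i
    by (rule bdd_belowI[of _ 0]) (use nrm_nonneg[OF minus_closed[OF v]] Xc in blast)
  have "\<exists>x. x \<in> X i \<and> N (v \<ominus> x) < r i + 1 / Suc i" for i
  proof -
    have "Inf ((\<lambda>x. N (v \<ominus> x)) ` X i) < r i + 1 / Suc i" by (simp add: r_def)
    from cInf_lessD[OF _ this] ne show ?thesis by auto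
  qed
  then obtain x where x: "\<And>i. x i \<in> X i" "\<And>i. N (v \<ominus> x i) < r i + 1 / Suc i" by metis
  have xc: "x i \<in> carrier V" for i using x(1) Xc by blast
  have mono: "X i \<subseteq> X j" if "i \<le> j" for i j using lift_Suc_mono_le[of X, OF X that] .
  have "conv x v"
    unfolding conv_def
  proof (intro conjI v allI xc)
    show "(\<lambda>n. N (x n \<ominus> v)) \<longlonglongrightarrow> 0"
    proof (rule LIMSEQ_I)
      fix e :: real assume e: "e > 0"
      have "v \<in> met.mtopology closure_of (\<Union>i. X i)" using d v by simp
      then obtain n y where y: "y \<in> X n" "N (v \<ominus> y) < e / 2" unfolding closure_iff using half_gt_zero[OF e] by blast
      obtain k where k: "1 / Suc k < e / 2" using nat_approx_posE[of "e / 2"] e by auto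
      show "\<exists>no. \<forall>i\<ge>no. norm (N (x i \<ominus> v) - 0) < e"
      proof (intro exI[of _ "max n k"] allI impI)
        fix i assume i: "max n k \<le> i"
        have "r i \<le> N (v \<ominus> y)" unfolding r_def by (rule cInf_lower[OF _ bdd]) (use mono[of n i] i y in auto)
        moreover have "1 / Suc i \<le> 1 / Suc k" using i by (simp add: frac_le)
        ultimately have "N (v \<ominus> x i) < e" using x(2)[of i] y k by linarith
        then show "norm (N (x i \<ominus> v) - 0) < e" using nrm_minus_commute[OF v xc] nrm_nonneg[of "x i \<ominus> v"] xc v by simp
      qed
    qed
  qed
  with x(1) show thesis by (rule that)
qed

lemma (in cnormed) conv_bounded: assumes "conv x l" obtains B where "\<And>n. N (x n) \<le> B" "B > 0"
proof -
  have "Bseq (\<lambda>n. N (x n))" using conv_nrm[OF assms] convergent_imp_Bseq convergentI by blast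
  then obtain B where "B > 0" "\<And>n. norm (N (x n)) \<le> B" unfolding Bseq_def by blast
  moreover have "N (x n) \<le> norm (N (x n))" for n by simp
  ultimately show thesis using that[of B] order_trans by metis
qed

lemma (in cnormed) conv_dist_null: assumes "conv x l" "conv y l" shows "(\<lambda>n. N (x n \<ominus> y n)) \<longlonglongrightarrow> 0"
proof -
  have "l \<in> carrier V" using assms(1) by (simp add: conv_def)
  then show ?thesis using conv_nrm[OF conv_minus[OF assms]] by simp
qed

lemma (in cnormed) conv_of_null: assumes "conv x l" "\<And>n. y n \<in> carrier V" "(\<lambda>n. N (x n \<ominus> y n)) \<longlonglongrightarrow> 0" shows "conv y l"
proof (rule conv_squeeze)
  have c: "l \<in> carrier V" "\<And>n. x n \<in> carrier V" and lim: "(\<lambda>n. N (x n \<ominus> l)) \<longlonglongrightarrow> 0"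
    using assms(1) by (simp_all add: conv_def)
  show "l \<in> carrier V" by (rule c(1))
  show "N (y n \<ominus> l) \<le> N (x n \<ominus> y n) + N (x n \<ominus> l)" for n
    using nrm_diff_triangle[of "y n" "x n" l] c assms(2) nrm_minus_commute[of "y n" "x n"] by simp
  show "(\<lambda>n. N (x n \<ominus> y n) + N (x n \<ominus> l)) \<longlonglongrightarrow> 0" using tendsto_add[OF assms(3) lim] by simp
qed (rule assms(2))

lemma (in cnormed) conv_eventually_const:
  assumes "l \<in> carrier V" "\<And>i. x i \<in> carrier V" "\<And>i. i \<ge> (n :: nat) \<Longrightarrow> x i = l" shows "conv x l"
  unfolding conv_def
proof (intro conjI allI assms)
  have "\<forall>\<^sub>F i in sequentially. N (x i \<ominus> l) = 0"
    unfolding eventually_sequentially by (intro exI[of _ n]) (simp add: assms)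
  then show "(\<lambda>i. N (x i \<ominus> l)) \<longlonglongrightarrow> 0" by (rule tendsto_eventually)
qed

lemma (in hilbert_space) conv_inner2:
  assumes "nrm.conv x u" "nrm.conv y v" shows "(\<lambda>n. inner H (x n) (y n)) \<longlonglongrightarrow> inner H u v"
proof -
  have c: "u \<in> carrier H" "v \<in> carrier H" "\<And>n. x n \<in> carrier H" "\<And>n. y n \<in> carrier H"
    and l: "(\<lambda>n. hnorm H (x n \<ominus> u)) \<longlonglongrightarrow> 0"
    using assms by (simp_all add: nrm.conv_def)
  have "(\<lambda>n. hnorm H (x n \<ominus> u) * hnorm H (y n)) \<longlonglongrightarrow> 0 * hnorm H v"
    by (intro tendsto_mult l nrm.conv_nrm[OF assms(2)])
  then have l2: "(\<lambda>n. hnorm H (x n \<ominus> u) * hnorm H (y n)) \<longlonglongrightarrow> 0" by simp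
  have "(\<lambda>n. inner H (x n) (y n) - inner H u (y n)) \<longlonglongrightarrow> 0"
  proof (rule Lim_null_comparison[OF _ l2])
    show "\<forall>\<^sub>F n in sequentially. norm (inner H (x n) (y n) - inner H u (y n)) \<le> hnorm H (x n \<ominus> u) * hnorm H (y n)"
      using Cauchy_Schwarz[OF nrm.minus_closed[OF c(3,1)] c(4)] c
      by (intro always_eventually allI) (simp add: inner_minus_left)
  qed
  from tendsto_add[OF this conv_inner[OF assms(2) c(1)]] show ?thesis by simp
qed

text \<open>Polarization: the norm of a sum determines real parts of inner products, and replacing v
  by \<open>i v\<close> gives the imaginary parts.\<close>

lemma isometry_inner:
  assumes "hilbert_space H" "hilbert_space K" "T \<in> isometries H K" "u \<in> carrier H" "v \<in> carrier H"
  shows "inner K (T u) (T v) = inner H u v"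
proof -
  interpret H: hilbert_space H by fact
  interpret K: hilbert_space K by fact
  have Tl: "T \<in> linear_maps H K" and Tn: "\<And>v. v \<in> carrier H \<Longrightarrow> hnorm K (T v) = hnorm H v"
    using assms(3) by (simp_all add: isometries_def)
  note T = linear_mapsD[OF Tl]
  have re: "Re (inner K (T u) (T w)) = Re (inner H u w)" if w: "w \<in> carrier H" for w
    using K.hnorm_add_sq[OF T(1)[OF assms(4)] T(1)[OF w]] H.hnorm_add_sq[OF assms(4) w]
      Tn[OF H.H_closed(1)[OF assms(4) w]] Tn[OF assms(4)] Tn[OF w] T(2)[OF assms(4) w] by simp
  have "Re (inner K (T u) (T (\<i> \<odot>\<^bsub>H\<^esub> v))) = Re (inner H u (\<i> \<odot>\<^bsub>H\<^esub> v))" by (rule re) (use assms(5) in simp)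
  then have "Im (inner K (T u) (T v)) = Im (inner H u v)"
    using T assms(4,5) by (simp add: K.inner_smult H.inner_smult)
  then show ?thesis using re[OF assms(5)] by (simp add: complex_eq_iff)
qed

section \<open>The limit algebra acting on the limit Hilbert space\<close>

locale toric_system =
  fixes m :: "nat \<Rightarrow> nat" and \<Theta> :: "nat \<Rightarrow> real mat"
    and A :: "nat \<Rightarrow> 'a cstar" and U :: "nat \<Rightarrow> nat \<Rightarrow> 'a" and \<tau> :: "nat \<Rightarrow> 'a \<Rightarrow> complex"
    and M :: "nat \<Rightarrow> int mat" and z :: "nat \<Rightarrow> complex Matrix.vec" and \<phi> :: "nat \<Rightarrow> 'a \<Rightarrow> 'a"
    and L :: "nat \<Rightarrow> 'l hilbert" and \<Lambda> :: "nat \<Rightarrow> 'a \<Rightarrow> 'l"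
    and H :: "nat \<Rightarrow> 'h hilbert" and tens :: "nat \<Rightarrow> 'l \<Rightarrow> 's \<Rightarrow> 'h"
    and \<pi> :: "nat \<Rightarrow> 'a \<Rightarrow> 'h \<Rightarrow> 'h" and I :: "nat \<Rightarrow> 'h \<Rightarrow> 'h" and S :: "'s hilbert"
    and B :: "'b cstar" and \<mu> :: "nat \<Rightarrow> 'a \<Rightarrow> 'b"
    and K :: "'k hilbert" and J :: "nat \<Rightarrow> 'h \<Rightarrow> 'k"
  assumes stage: "torus_stage (A n) (m n) (\<Theta> n) (U n) (\<tau> n) (L n) S (H n) (\<Lambda> n) (tens n) (\<pi> n)"
    and toric: "monomial_toric_hom (m n) (\<Theta> n) (A n) (U n)
        (m (Suc n)) (\<Theta> (Suc n)) (A (Suc n)) (U (Suc n)) (M n) (z n) (\<phi> n)"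
    and I_bounded: "I n \<in> bounded_ops (H n) (H (Suc n))"
    and I_tens: "a \<in> carrier (A n) \<Longrightarrow> \<xi> \<in> carrier S \<Longrightarrow>
          I n (tens n (\<Lambda> n a) \<xi>) = tens (Suc n) (\<Lambda> (Suc n) (\<phi> n a)) \<xi>"
    and climit: "cstar_inductive_limit A \<phi> B \<mu>"
    and hlimit: "hilbert_inductive_limit H I K J"
begin

sublocale st: torus_stage "A n" "m n" "\<Theta> n" "U n" "\<tau> n" "L n" S "H n" "\<Lambda> n" "tens n" "\<pi> n" for n
  by (rule stage)

sublocale B: ucstar B
  using climit unfolding cstar_inductive_limit_def ucstar_def by simp

sublocale K: hilbert_space K
  using hlimit unfolding hilbert_inductive_limit_def by simp

lemma \<phi>_hom: "\<phi> n \<in> unital_star_hom (A n) (A (Suc n))"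
  using toric by (simp add: monomial_toric_hom_def)

lemma \<mu>_hom: "\<mu> n \<in> unital_star_hom (A n) B"
  and \<mu>_\<phi>: "a \<in> carrier (A n) \<Longrightarrow> \<mu> (Suc n) (\<phi> n a) = \<mu> n a"
  and \<mu>_norm: "a \<in> carrier (A n) \<Longrightarrow> (\<lambda>k. cnorm (A (n + k)) (chain \<phi> n k a)) \<longlonglongrightarrow> cnorm B (\<mu> n a)"
  and \<mu>_dense: "B.nrm.met.mtopology closure_of (\<Union>n. \<mu> n ` carrier (A n)) = carrier B"
  using climit unfolding cstar_inductive_limit_def B.ctop_eq by simp_all

lemma J_iso: "J n \<in> isometries (H n) K"
  and J_I: "v \<in> carrier (H n) \<Longrightarrow> J (Suc n) (I n v) = J n v"
  and J_dense: "K.nrm.met.mtopology closure_of (\<Union>n. J n ` carrier (H n)) = carrier K"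
  using hlimit unfolding hilbert_inductive_limit_def K.htop_eq by simp_all

lemma \<mu>_closed [simp]: "a \<in> carrier (A n) \<Longrightarrow> \<mu> n a \<in> carrier B"
  by (rule unital_star_homD(2)[OF \<mu>_hom])

lemma \<phi>_closed [simp]: "a \<in> carrier (A n) \<Longrightarrow> \<phi> n a \<in> carrier (A (Suc n))"
  by (rule unital_star_homD(2)[OF \<phi>_hom])

lemma J_linear: "J n \<in> linear_maps (H n) K"
  and J_norm: "v \<in> carrier (H n) \<Longrightarrow> hnorm K (J n v) = hnorm (H n) v"
  using J_iso by (simp_all add: isometries_def)

lemma J_closed [simp]: "v \<in> carrier (H n) \<Longrightarrow> J n v \<in> carrier K"
  by (rule linear_mapsD(1)[OF J_linear])

lemma I_closed [simp]: "v \<in> carrier (H n) \<Longrightarrow> I n v \<in> carrier (H (Suc n))"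
  by (rule linear_mapsD(1)[OF bounded_opsD(1)[OF I_bounded]])

lemma J_inner: "u \<in> carrier (H n) \<Longrightarrow> v \<in> carrier (H n) \<Longrightarrow> inner K (J n u) (J n v) = inner (H n) u v"
  by (rule isometry_inner[OF st.H.hilbert_space_axioms K.hilbert_space_axioms J_iso])

lemma J_minus: "u \<in> carrier (H n) \<Longrightarrow> v \<in> carrier (H n) \<Longrightarrow> J n (u \<ominus>\<^bsub>H n\<^esub> v) = J n u \<ominus>\<^bsub>K\<^esub> J n v"
  by (rule linear_maps_minus[OF st.H.nrm.cnormed_axioms K.nrm.cnormed_axioms J_linear])

lemma \<mu>_minus: "a \<in> carrier (A n) \<Longrightarrow> b \<in> carrier (A n) \<Longrightarrow> \<mu> n (a \<ominus>\<^bsub>A n\<^esub> b) = \<mu> n a \<ominus>\<^bsub>B\<^esub> \<mu> n b"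
  by (rule linear_maps_minus[OF st.nrm.cnormed_axioms B.nrm.cnormed_axioms unital_star_homD(1)[OF \<mu>_hom]])

lemma I_\<pi>:
  assumes a: "a \<in> carrier (A n)" and v: "v \<in> carrier (H n)"
  shows "I n (\<pi> n a v) = \<pi> (Suc n) (\<phi> n a) (I n v)"
proof (rule st.bounded_eq_on_tens[OF st.H.hilbert_space_axioms _ _ _ v])
  note hs = st.H.hilbert_space_axioms
  show "(\<lambda>v. I n (\<pi> n a v)) \<in> bounded_ops (H n) (H (Suc n))"
    by (rule bounded_ops_compose[OF hs hs hs st.\<pi>_bounded[OF a] I_bounded])
  show "(\<lambda>v. \<pi> (Suc n) (\<phi> n a) (I n v)) \<in> bounded_ops (H n) (H (Suc n))"
    by (rule bounded_ops_compose[OF hs hs hs I_bounded st.\<pi>_bounded[OF \<phi>_closed[OF a]]])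
  show "I n (\<pi> n a (tens n (\<Lambda> n b) \<xi>)) = \<pi> (Suc n) (\<phi> n a) (I n (tens n (\<Lambda> n b) \<xi>))"
    if "b \<in> carrier (A n)" "\<xi> \<in> carrier S" for b \<xi>
    using a that by (simp add: st.\<pi>_tens I_tens unital_star_homD(5)[OF \<phi>_hom])
qed

text \<open>Composing with the next stage's representation gives a representation of
  \<open>A n\<close>, hence contractive operators; the operator bound at the next stage then
  controls the C*-norm there.\<close>

lemma \<phi>_contractive: assumes a: "a \<in> carrier (A n)" shows "cnorm (A (Suc n)) (\<phi> n a) \<le> cnorm (A n) a"
proof (rule st.norm_le_of_operator_bound[OF \<phi>_closed[OF a] st.norm_nonneg[OF a]])
  note R = unital_representationD[OF st.\<pi>_representation]
  have rep: "unital_representation (A n) (H (Suc n)) (\<lambda>a. \<pi> (Suc n) (\<phi> n a))"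
    unfolding unital_representation_def
    by (intro conjI ballI allI)
       (simp_all add: unital_star_homD(3,4,5,6,7)[OF \<phi>_hom] R(2,3,4,5,6) st.\<pi>_bounded)
  show "hnorm (H (Suc n)) (\<pi> (Suc n) (\<phi> n a) v) \<le> cnorm (A n) a * hnorm (H (Suc n)) v" if "v \<in> carrier (H (Suc n))" for v
    by (rule representation_contractive[OF st.unital_cstar_algebra_axioms st.H.hilbert_space_axioms rep a that])
qed

lemma chain_\<phi>_closed: "a \<in> carrier (A n) \<Longrightarrow> chain \<phi> n k a \<in> carrier (A (n + k))"
  by (induction k) simp_all

lemma chain_\<phi>_norm: "a \<in> carrier (A n) \<Longrightarrow> cnorm (A (n + k)) (chain \<phi> n k a) \<le> cnorm (A n) a"
proof (induction k)
  case (Suc k)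
  then show ?case using \<phi>_contractive[OF chain_\<phi>_closed[OF Suc.prems, of k]] by simp
qed simp

lemma \<mu>_chain: "a \<in> carrier (A n) \<Longrightarrow> \<mu> (n + k) (chain \<phi> n k a) = \<mu> n a"
  by (induction k) (simp_all add: \<mu>_\<phi> chain_\<phi>_closed)

lemma \<mu>_contractive: "a \<in> carrier (A n) \<Longrightarrow> cnorm B (\<mu> n a) \<le> cnorm (A n) a"
  by (rule LIMSEQ_le_const2[OF \<mu>_norm]) (auto intro: chain_\<phi>_norm)

lemma chain_I_closed: "v \<in> carrier (H n) \<Longrightarrow> chain I n k v \<in> carrier (H (n + k))"
  by (induction k) simp_all

lemma J_chain: "v \<in> carrier (H n) \<Longrightarrow> J (n + k) (chain I n k v) = J n v"
  by (induction k) (simp_all add: J_I chain_I_closed)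

lemma chain_I_\<pi>: "a \<in> carrier (A n) \<Longrightarrow> v \<in> carrier (H n) \<Longrightarrow>
   chain I n k (\<pi> n a v) = \<pi> (n + k) (chain \<phi> n k a) (chain I n k v)"
  by (induction k) (simp_all add: I_\<pi> chain_I_closed chain_\<phi>_closed)

lemma J_\<pi>_chain: "a \<in> carrier (A n) \<Longrightarrow> v \<in> carrier (H n) \<Longrightarrow>
   J (n + k) (\<pi> (n + k) (chain \<phi> n k a) (chain I n k v)) = J n (\<pi> n a v)"
  using J_chain[of "\<pi> n a v" n k] by (simp add: chain_I_\<pi>)

text \<open>The bound involves the limit norm rather than the norm at stage n. Moving a and v to
  stage \<open>n + k\<close> preserves the vectors in K, and the stage norms tend to the limit norm;
  so the action depends only on the image in the limit algebra.\<close>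

lemma \<pi>_norm_\<mu>:
  assumes a: "a \<in> carrier (A n)" and v: "v \<in> carrier (H n)"
  shows "hnorm (H n) (\<pi> n a v) \<le> cnorm B (\<mu> n a) * hnorm (H n) v"
proof (rule LIMSEQ_le_const)
  show "(\<lambda>k. cnorm (A (n + k)) (chain \<phi> n k a) * hnorm (H n) v) \<longlonglongrightarrow> cnorm B (\<mu> n a) * hnorm (H n) v"
    by (intro tendsto_mult \<mu>_norm a tendsto_const)
  have "hnorm (H n) (\<pi> n a v) \<le> cnorm (A (n + k)) (chain \<phi> n k a) * hnorm (H n) v" for k
  proof -
    have c: "chain \<phi> n k a \<in> carrier (A (n + k))" "chain I n k v \<in> carrier (H (n + k))"
      using a v by (simp_all add: chain_\<phi>_closed chain_I_closed)
    have "hnorm (H n) (\<pi> n a v) = hnorm K (J (n + k) (\<pi> (n + k) (chain \<phi> n k a) (chain I n k v)))"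
      using J_\<pi>_chain[OF a v] J_norm[of "\<pi> n a v" n] a v by simp
    also have "\<dots> = hnorm (H (n + k)) (\<pi> (n + k) (chain \<phi> n k a) (chain I n k v))" using c by (intro J_norm) simp
    also have "\<dots> \<le> cnorm (A (n + k)) (chain \<phi> n k a) * hnorm (H (n + k)) (chain I n k v)" by (rule st.\<pi>_contractive[OF c])
    also have "hnorm (H (n + k)) (chain I n k v) = hnorm (H n) v"
      using J_norm[OF c(2)] J_norm[OF v] J_chain[OF v] by simp
    finally show ?thesis .
  qed
  then show "\<exists>N. \<forall>k\<ge>N. hnorm (H n) (\<pi> n a v) \<le> cnorm (A (n + k)) (chain \<phi> n k a) * hnorm (H n) v" by blast
qed

text \<open>The converse estimate: an operator bound valid at all later stages bounds the limit
  norm. This is where isometry of the stage representations becomes faithfulness of the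
  limit.\<close>

lemma \<mu>_norm_le_of_bound:
  assumes a: "a \<in> carrier (A n)" and C: "0 \<le> C"
    and b: "\<And>k v. v \<in> carrier (H (n + k)) \<Longrightarrow> hnorm (H (n + k)) (\<pi> (n + k) (chain \<phi> n k a) v) \<le> C * hnorm (H (n + k)) v"
  shows "cnorm B (\<mu> n a) \<le> C"
  by (rule LIMSEQ_le_const2[OF \<mu>_norm[OF a]])
     (use st.norm_le_of_operator_bound[OF chain_\<phi>_closed[OF a] C b] in blast)

lemma same_stage_estimate:
  assumes a: "a \<in> carrier (A n)" "a' \<in> carrier (A n)" and v: "v \<in> carrier (H n)" "v' \<in> carrier (H n)"
  shows "hnorm K (J n (\<pi> n a v) \<ominus>\<^bsub>K\<^esub> J n (\<pi> n a' v'))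
    \<le> cnorm B (\<mu> n a \<ominus>\<^bsub>B\<^esub> \<mu> n a') * hnorm K (J n v) + cnorm B (\<mu> n a') * hnorm K (J n v \<ominus>\<^bsub>K\<^esub> J n v')"
proof -
  note R = unital_representationD[OF st.\<pi>_representation]
  let ?d = "a \<ominus>\<^bsub>A n\<^esub> a'" and ?w = "v \<ominus>\<^bsub>H n\<^esub> v'"
  have c: "?d \<in> carrier (A n)" "?w \<in> carrier (H n)" using a v by simp_all
  have "\<pi> n a v \<ominus>\<^bsub>H n\<^esub> \<pi> n a' v' = (\<pi> n a v \<ominus>\<^bsub>H n\<^esub> \<pi> n a' v) \<oplus>\<^bsub>H n\<^esub> (\<pi> n a' v \<ominus>\<^bsub>H n\<^esub> \<pi> n a' v')"
    by (rule st.H.nrm.diff_trans) (use a v in simp_all)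
  also have "\<pi> n a v \<ominus>\<^bsub>H n\<^esub> \<pi> n a' v = \<pi> n ?d v"
    using a v by (simp add: st.nrm.minus_sm st.H.nrm.minus_sm R(3,5))
  also have "\<pi> n a' v \<ominus>\<^bsub>H n\<^esub> \<pi> n a' v' = \<pi> n a' ?w"
    using linear_maps_minus[OF st.H.nrm.cnormed_axioms st.H.nrm.cnormed_axioms bounded_opsD(1)[OF st.\<pi>_bounded[OF a(2)]] v] by simp
  finally have e: "\<pi> n a v \<ominus>\<^bsub>H n\<^esub> \<pi> n a' v' = \<pi> n ?d v \<oplus>\<^bsub>H n\<^esub> \<pi> n a' ?w" .
  have "hnorm K (J n (\<pi> n a v) \<ominus>\<^bsub>K\<^esub> J n (\<pi> n a' v')) = hnorm (H n) (\<pi> n a v \<ominus>\<^bsub>H n\<^esub> \<pi> n a' v')"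
    using a v by (simp flip: J_minus add: J_norm)
  also have "\<dots> \<le> hnorm (H n) (\<pi> n ?d v) + hnorm (H n) (\<pi> n a' ?w)"
    unfolding e by (rule st.H.nrm.nrm_triangle) (use a v c in simp_all)
  also have "\<dots> \<le> cnorm B (\<mu> n ?d) * hnorm (H n) v + cnorm B (\<mu> n a') * hnorm (H n) ?w"
    by (intro add_mono \<pi>_norm_\<mu> c v a)
  finally show ?thesis using a v by (simp add: \<mu>_minus J_norm flip: J_minus)
qed

text \<open>Moving both pairs to stage \<open>max n n'\<close> changes neither the images of the
  algebra elements nor the vectors in K, so the estimate for a single stage applies.\<close>

lemma two_stage_estimate:
  assumes a: "a \<in> carrier (A n)" "a' \<in> carrier (A n')" and v: "v \<in> carrier (H n)" "v' \<in> carrier (H n')"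
  shows "hnorm K (J n (\<pi> n a v) \<ominus>\<^bsub>K\<^esub> J n' (\<pi> n' a' v'))
    \<le> cnorm B (\<mu> n a \<ominus>\<^bsub>B\<^esub> \<mu> n' a') * hnorm K (J n v) + cnorm B (\<mu> n' a') * hnorm K (J n v \<ominus>\<^bsub>K\<^esub> J n' v')"
proof -
  have push: "\<exists>b w. b \<in> carrier (A N) \<and> w \<in> carrier (H N) \<and> \<mu> N b = \<mu> n a \<and> J N w = J n v \<and> J N (\<pi> N b w) = J n (\<pi> n a v)"
    if "n \<le> N" "a \<in> carrier (A n)" "v \<in> carrier (H n)" for n N a v
  proof -
    obtain k where N: "N = n + k" using \<open>n \<le> N\<close> le_Suc_ex by blast
    show ?thesis unfolding N using that
      by (intro exI[of _ "chain \<phi> n k a"] exI[of _ "chain I n k v"])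
         (simp add: chain_\<phi>_closed chain_I_closed \<mu>_chain J_chain J_\<pi>_chain)
  qed
  obtain b w where b: "b \<in> carrier (A (max n n'))" "w \<in> carrier (H (max n n'))" "\<mu> (max n n') b = \<mu> n a" "J (max n n') w = J n v"
    "J (max n n') (\<pi> (max n n') b w) = J n (\<pi> n a v)"
    using push[of n "max n n'", OF _ a(1) v(1)] by auto
  obtain b' w' where b': "b' \<in> carrier (A (max n n'))" "w' \<in> carrier (H (max n n'))" "\<mu> (max n n') b' = \<mu> n' a'" "J (max n n') w' = J n' v'"
    "J (max n n') (\<pi> (max n n') b' w') = J n' (\<pi> n' a' v')"
    using push[of n' "max n n'", OF _ a(2) v(2)] by auto
  show ?thesis using same_stage_estimate[OF b(1) b'(1) b(2) b'(2)] unfolding b(3-5) b'(3-5) .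
qed

definition approxA :: "'b \<Rightarrow> (nat \<Rightarrow> 'a) \<Rightarrow> bool" where
  "approxA b a \<longleftrightarrow> (\<forall>i. a i \<in> carrier (A i)) \<and> B.nrm.conv (\<lambda>i. \<mu> i (a i)) b"

definition approxH :: "'k \<Rightarrow> (nat \<Rightarrow> 'h) \<Rightarrow> bool" where
  "approxH v x \<longleftrightarrow> (\<forall>i. x i \<in> carrier (H i)) \<and> K.nrm.conv (\<lambda>i. J i (x i)) v"

lemma approxA_exists: assumes b: "b \<in> carrier B" shows "\<exists>a. approxA b a"
proof -
  obtain x where x: "\<And>i. x i \<in> \<mu> i ` carrier (A i)" "B.nrm.conv x b"
  proof (rule B.nrm.dense_increasing_union[OF _ \<mu>_dense _ _ b])
    show "\<mu> i ` carrier (A i) \<subseteq> \<mu> (Suc i) ` carrier (A (Suc i))" for i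
    proof
      fix x assume "x \<in> \<mu> i ` carrier (A i)"
      then obtain a where a: "a \<in> carrier (A i)" "x = \<mu> i a" by blast
      show "x \<in> \<mu> (Suc i) ` carrier (A (Suc i))" by (rule image_eqI[of _ _ "\<phi> i a"]) (simp_all add: a \<mu>_\<phi>)
    qed
    show "\<mu> i ` carrier (A i) \<subseteq> carrier B" "\<mu> i ` carrier (A i) \<noteq> {}" for i using st.rg.zero_closed by auto
  qed (rule that)
  from x(1) have "\<forall>i. \<exists>a. a \<in> carrier (A i) \<and> x i = \<mu> i a" by blast
  then obtain a where a: "\<And>i. a i \<in> carrier (A i)" "\<And>i. x i = \<mu> i (a i)" by metis
  have "x = (\<lambda>i. \<mu> i (a i))" using a(2) by (rule ext)
  then show ?thesis using x(2) a(1) unfolding approxA_def by auto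
qed

lemma approxH_exists: assumes v: "v \<in> carrier K" shows "\<exists>x. approxH v x"
proof -
  obtain x where x: "\<And>i. x i \<in> J i ` carrier (H i)" "K.nrm.conv x v"
  proof (rule K.nrm.dense_increasing_union[OF _ J_dense _ _ v])
    show "J i ` carrier (H i) \<subseteq> J (Suc i) ` carrier (H (Suc i))" for i
    proof
      fix x assume "x \<in> J i ` carrier (H i)"
      then obtain a where a: "a \<in> carrier (H i)" "x = J i a" by blast
      show "x \<in> J (Suc i) ` carrier (H (Suc i))" by (rule image_eqI[of _ _ "I i a"]) (simp_all add: a J_I)
    qed
    show "J i ` carrier (H i) \<subseteq> carrier K" "J i ` carrier (H i) \<noteq> {}" for i using st.H.nrm.zero_closed by auto
  qed (rule that)
  from x(1) have "\<forall>i. \<exists>a. a \<in> carrier (H i) \<and> x i = J i a" by blast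
  then obtain a where a: "\<And>i. a i \<in> carrier (H i)" "\<And>i. x i = J i (a i)" by metis
  have "x = (\<lambda>i. J i (a i))" using a(2) by (rule ext)
  then show ?thesis using x(2) a(1) unfolding approxH_def by auto
qed

lemma approx_converges: assumes a: "approxA b a" and x: "approxH v x" shows "\<exists>w. K.nrm.conv (\<lambda>i. J i (\<pi> i (a i) (x i))) w"
proof -
  have ac: "\<And>i. a i \<in> carrier (A i)" and xc: "\<And>i. x i \<in> carrier (H i)"
    and ca: "B.nrm.conv (\<lambda>i. \<mu> i (a i)) b" and cx: "K.nrm.conv (\<lambda>i. J i (x i)) v"
    using a x by (simp_all add: approxA_def approxH_def)
  have bc: "b \<in> carrier B" and la: "(\<lambda>n. cnorm B (\<mu> n (a n) \<ominus>\<^bsub>B\<^esub> b)) \<longlonglongrightarrow> 0" using ca by (simp_all add: B.nrm.conv_def)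
  have vc: "v \<in> carrier K" and lx: "(\<lambda>n. hnorm K (J n (x n) \<ominus>\<^bsub>K\<^esub> v)) \<longlonglongrightarrow> 0" using cx by (simp_all add: K.nrm.conv_def)
  obtain P where P: "\<And>n. cnorm B (\<mu> n (a n)) \<le> P" "P > 0" using B.nrm.conv_bounded[OF ca] by blast
  obtain Q where Q: "\<And>n. hnorm K (J n (x n)) \<le> Q" "Q > 0" using K.nrm.conv_bounded[OF cx] by blast
  obtain w where "K.nrm.conv (\<lambda>i. J i (\<pi> i (a i) (x i))) w"
  proof (rule K.nrm.complete_conv[OF K.mcompl])
    show "J n (\<pi> n (a n) (x n)) \<in> carrier K" for n using ac xc by simp
    fix e :: real assume e: "e > 0"
    \<comment> \<open>Comparing two terms through the limit doubles the error, and each of the two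
      products in \<open>two_stage_estimate\<close> may use half of e.\<close>
    have d: "e / (4 * Q) > 0" "e / (4 * P) > 0" using e P(2) Q(2) by simp_all
    obtain N1 where N1: "\<And>n. n \<ge> N1 \<Longrightarrow> cnorm B (\<mu> n (a n) \<ominus>\<^bsub>B\<^esub> b) < e / (4 * Q)"
      using order_tendstoD(2)[OF la d(1)] unfolding eventually_sequentially by blast
    obtain N2 where N2: "\<And>n. n \<ge> N2 \<Longrightarrow> hnorm K (J n (x n) \<ominus>\<^bsub>K\<^esub> v) < e / (4 * P)"
      using order_tendstoD(2)[OF lx d(2)] unfolding eventually_sequentially by blast
    show "\<exists>N. \<forall>i\<ge>N. \<forall>j\<ge>N. hnorm K (J i (\<pi> i (a i) (x i)) \<ominus>\<^bsub>K\<^esub> J j (\<pi> j (a j) (x j))) < e"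
    proof (intro exI[of _ "max N1 N2"] allI impI)
      fix i j assume ij: "max N1 N2 \<le> i" "max N1 N2 \<le> j"
      have 1: "cnorm B (\<mu> i (a i) \<ominus>\<^bsub>B\<^esub> \<mu> j (a j)) < e / (2 * Q)"
        using B.nrm.nrm_diff_triangle[of "\<mu> i (a i)" b "\<mu> j (a j)"] B.nrm.nrm_minus_commute[of b "\<mu> j (a j)"]
          N1[of i] N1[of j] ij ac bc by simp
      have 2: "hnorm K (J i (x i) \<ominus>\<^bsub>K\<^esub> J j (x j)) < e / (2 * P)"
        using K.nrm.nrm_diff_triangle[of "J i (x i)" v "J j (x j)"] K.nrm.nrm_minus_commute[of v "J j (x j)"]
          N2[of i] N2[of j] ij xc vc by simp
      have "hnorm K (J i (\<pi> i (a i) (x i)) \<ominus>\<^bsub>K\<^esub> J j (\<pi> j (a j) (x j)))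
        \<le> cnorm B (\<mu> i (a i) \<ominus>\<^bsub>B\<^esub> \<mu> j (a j)) * hnorm K (J i (x i)) + cnorm B (\<mu> j (a j)) * hnorm K (J i (x i) \<ominus>\<^bsub>K\<^esub> J j (x j))"
        by (rule two_stage_estimate[OF ac ac xc xc])
      also have "\<dots> \<le> cnorm B (\<mu> i (a i) \<ominus>\<^bsub>B\<^esub> \<mu> j (a j)) * Q + P * hnorm K (J i (x i) \<ominus>\<^bsub>K\<^esub> J j (x j))"
        using ac xc by (intro add_mono mult_left_mono mult_right_mono P Q B.norm_nonneg K.hnorm_nonneg) simp_all
      also have "\<dots> < e / (2 * Q) * Q + P * (e / (2 * P))"
        using 1 2 P(2) Q(2) by (intro add_strict_mono mult_strict_right_mono mult_strict_left_mono)
      also have "\<dots> = e" using P(2) Q(2) by simp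
      finally show "hnorm K (J i (\<pi> i (a i) (x i)) \<ominus>\<^bsub>K\<^esub> J j (\<pi> j (a j) (x j))) < e" .
    qed
  qed (rule that)
  then show ?thesis by blast
qed

lemma approx_unique:
  assumes a: "approxA b a" "approxA b a'" and x: "approxH v x" "approxH v x'"
    and w: "K.nrm.conv (\<lambda>i. J i (\<pi> i (a i) (x i))) w"
  shows "K.nrm.conv (\<lambda>i. J i (\<pi> i (a' i) (x' i))) w"
proof (rule K.nrm.conv_of_null[OF w])
  have ac: "\<And>i. a i \<in> carrier (A i)" "\<And>i. a' i \<in> carrier (A i)" and xc: "\<And>i. x i \<in> carrier (H i)" "\<And>i. x' i \<in> carrier (H i)"
    and ca: "B.nrm.conv (\<lambda>i. \<mu> i (a i)) b" "B.nrm.conv (\<lambda>i. \<mu> i (a' i)) b"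
    and cx: "K.nrm.conv (\<lambda>i. J i (x i)) v" "K.nrm.conv (\<lambda>i. J i (x' i)) v"
    using a x by (simp_all add: approxA_def approxH_def)
  show "J n (\<pi> n (a' n) (x' n)) \<in> carrier K" for n using ac xc by simp
  have "(\<lambda>i. cnorm B (\<mu> i (a i) \<ominus>\<^bsub>B\<^esub> \<mu> i (a' i)) * hnorm K (J i (x i)) + cnorm B (\<mu> i (a' i)) * hnorm K (J i (x i) \<ominus>\<^bsub>K\<^esub> J i (x' i)))
    \<longlonglongrightarrow> 0 * hnorm K v + cnorm B b * 0"
    by (intro tendsto_add tendsto_mult B.nrm.conv_dist_null[OF ca] K.nrm.conv_dist_null[OF cx] K.nrm.conv_nrm[OF cx(1)] B.nrm.conv_nrm[OF ca(2)])
  then have l: "(\<lambda>i. cnorm B (\<mu> i (a i) \<ominus>\<^bsub>B\<^esub> \<mu> i (a' i)) * hnorm K (J i (x i)) + cnorm B (\<mu> i (a' i)) * hnorm K (J i (x i) \<ominus>\<^bsub>K\<^esub> J i (x' i)))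
    \<longlonglongrightarrow> 0" by simp
  show "(\<lambda>i. hnorm K (J i (\<pi> i (a i) (x i)) \<ominus>\<^bsub>K\<^esub> J i (\<pi> i (a' i) (x' i)))) \<longlonglongrightarrow> 0"
  proof (rule tendsto_sandwich[OF _ _ tendsto_const l])
    show "\<forall>\<^sub>F i in sequentially. 0 \<le> hnorm K (J i (\<pi> i (a i) (x i)) \<ominus>\<^bsub>K\<^esub> J i (\<pi> i (a' i) (x' i)))"
      using ac xc by (intro always_eventually allI K.hnorm_nonneg) simp
    show "\<forall>\<^sub>F i in sequentially. hnorm K (J i (\<pi> i (a i) (x i)) \<ominus>\<^bsub>K\<^esub> J i (\<pi> i (a' i) (x' i))) \<le>
       cnorm B (\<mu> i (a i) \<ominus>\<^bsub>B\<^esub> \<mu> i (a' i)) * hnorm K (J i (x i)) + cnorm B (\<mu> i (a' i)) * hnorm K (J i (x i) \<ominus>\<^bsub>K\<^esub> J i (x' i))"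
      by (intro always_eventually allI same_stage_estimate ac xc)
  qed
qed

text \<open>The value is characterized by all approximating sequences simultaneously;
  \<open>approx_unique\<close> makes this satisfiable, and each law of a representation is then
  proved with the sequences that suit it.\<close>

definition \<rho> :: "'b \<Rightarrow> 'k \<Rightarrow> 'k" where
  "\<rho> b v = (SOME w. \<forall>a x. approxA b a \<longrightarrow> approxH v x \<longrightarrow> K.nrm.conv (\<lambda>i. J i (\<pi> i (a i) (x i))) w)"

lemma \<rho>_conv:
  assumes a: "approxA b a" and x: "approxH v x" shows "K.nrm.conv (\<lambda>i. J i (\<pi> i (a i) (x i))) (\<rho> b v)"
proof -
  obtain w where w: "K.nrm.conv (\<lambda>i. J i (\<pi> i (a i) (x i))) w" using approx_converges[OF a x] by blast
  have "\<forall>a x. approxA b a \<longrightarrow> approxH v x \<longrightarrow> K.nrm.conv (\<lambda>i. J i (\<pi> i (a i) (x i))) w"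
    using approx_unique[OF a _ x _ w] by blast
  then have "\<forall>a x. approxA b a \<longrightarrow> approxH v x \<longrightarrow> K.nrm.conv (\<lambda>i. J i (\<pi> i (a i) (x i))) (\<rho> b v)"
    unfolding \<rho>_def by (rule someI)
  then show ?thesis using a x by blast
qed

lemma approxD: "approxA b a \<Longrightarrow> a i \<in> carrier (A i)" "approxA b a \<Longrightarrow> B.nrm.conv (\<lambda>i. \<mu> i (a i)) b"
  "approxH v x \<Longrightarrow> x i \<in> carrier (H i)" "approxH v x \<Longrightarrow> K.nrm.conv (\<lambda>i. J i (x i)) v"
  by (simp_all add: approxA_def approxH_def)

lemma approxA_add: "approxA b a \<Longrightarrow> approxA b' a' \<Longrightarrow> approxA (b \<oplus>\<^bsub>B\<^esub> b') (\<lambda>i. a i \<oplus>\<^bsub>A i\<^esub> a' i)"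
  using B.nrm.conv_add unfolding approxA_def by (simp add: unital_star_homD(6)[OF \<mu>_hom])

lemma approxA_mult: "approxA b a \<Longrightarrow> approxA b' a' \<Longrightarrow> approxA (b \<otimes>\<^bsub>B\<^esub> b') (\<lambda>i. a i \<otimes>\<^bsub>A i\<^esub> a' i)"
  using B.conv_mult unfolding approxA_def by (simp add: unital_star_homD(5)[OF \<mu>_hom])

lemma approxA_smult: "approxA b a \<Longrightarrow> approxA (c \<odot>\<^bsub>B\<^esub> b) (\<lambda>i. c \<odot>\<^bsub>A i\<^esub> a i)"
  using B.nrm.conv_smult unfolding approxA_def by (simp add: unital_star_homD(7)[OF \<mu>_hom])

lemma approxA_star: "approxA b a \<Longrightarrow> approxA (star B b) (\<lambda>i. star (A i) (a i))"
  using B.conv_star unfolding approxA_def by (simp add: unital_star_homD(3)[OF \<mu>_hom] st.star_closed)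

lemma approxA_one: "approxA \<one>\<^bsub>B\<^esub> (\<lambda>i. \<one>\<^bsub>A i\<^esub>)"
  unfolding approxA_def by (simp add: unital_star_homD(4)[OF \<mu>_hom] B.nrm.conv_const)

lemma approxH_add: "approxH v x \<Longrightarrow> approxH w y \<Longrightarrow> approxH (v \<oplus>\<^bsub>K\<^esub> w) (\<lambda>i. x i \<oplus>\<^bsub>H i\<^esub> y i)"
  using K.nrm.conv_add unfolding approxH_def by (simp add: linear_mapsD(2)[OF J_linear])

lemma approxH_smult: "approxH v x \<Longrightarrow> approxH (c \<odot>\<^bsub>K\<^esub> v) (\<lambda>i. c \<odot>\<^bsub>H i\<^esub> x i)"
  using K.nrm.conv_smult unfolding approxH_def by (simp add: linear_mapsD(3)[OF J_linear])

lemma approxH_\<pi>: "approxA b a \<Longrightarrow> approxH v x \<Longrightarrow> approxH (\<rho> b v) (\<lambda>i. \<pi> i (a i) (x i))"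
  using \<rho>_conv unfolding approxH_def by (simp add: approxD)

lemma \<rho>_eqI: assumes "approxA b a" "approxH v x" "K.nrm.conv (\<lambda>i. J i (\<pi> i (a i) (x i))) w" shows "\<rho> b v = w"
  by (rule K.nrm.conv_unique[OF \<rho>_conv[OF assms(1,2)] assms(3)])

lemma \<rho>_closed: assumes "b \<in> carrier B" "v \<in> carrier K" shows "\<rho> b v \<in> carrier K"
proof -
  obtain a x where "approxA b a" "approxH v x" using approxA_exists[OF assms(1)] approxH_exists[OF assms(2)] by blast
  from \<rho>_conv[OF this] show ?thesis by (simp add: K.nrm.conv_def)
qed

lemma \<rho>_bounded: assumes b: "b \<in> carrier B" shows "\<rho> b \<in> bounded_ops K K"
proof (rule bounded_opsI[OF linear_mapsI])
  obtain a where a: "approxA b a" using approxA_exists[OF b] by blast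
  note pl = linear_mapsD[OF bounded_opsD(1)[OF st.\<pi>_bounded[OF approxD(1)[OF a]]]]
  show "\<rho> b v \<in> carrier K" if "v \<in> carrier K" for v by (rule \<rho>_closed[OF b that])
  show "\<rho> b (v \<oplus>\<^bsub>K\<^esub> w) = \<rho> b v \<oplus>\<^bsub>K\<^esub> \<rho> b w" if vw: "v \<in> carrier K" "w \<in> carrier K" for v w
  proof -
    obtain x y where x: "approxH v x" and y: "approxH w y" using approxH_exists vw by blast
    show ?thesis
      by (rule \<rho>_eqI[OF a approxH_add[OF x y]])
         (use K.nrm.conv_add[OF \<rho>_conv[OF a x] \<rho>_conv[OF a y]] in \<open>simp add: pl approxD(1)[OF a] approxD(3)[OF x] approxD(3)[OF y] linear_mapsD(2)[OF J_linear]\<close>)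
  qed
  show "\<rho> b (c \<odot>\<^bsub>K\<^esub> v) = c \<odot>\<^bsub>K\<^esub> \<rho> b v" if v: "v \<in> carrier K" for c v
  proof -
    obtain x where x: "approxH v x" using approxH_exists v by blast
    show ?thesis
      by (rule \<rho>_eqI[OF a approxH_smult[OF x]])
         (use K.nrm.conv_smult[OF \<rho>_conv[OF a x], of c] in \<open>simp add: pl approxD(1)[OF a] approxD(3)[OF x] linear_mapsD(3)[OF J_linear]\<close>)
  qed
  show "hnorm K (\<rho> b v) \<le> cnorm B b * hnorm K v" if v: "v \<in> carrier K" for v
  proof -
    obtain x where x: "approxH v x" using approxH_exists v by blast
    show ?thesis
    proof (rule K.nrm.conv_limit_le[OF \<rho>_conv[OF a x]])
      show "hnorm K (J n (\<pi> n (a n) (x n))) \<le> cnorm B (\<mu> n (a n)) * hnorm K (J n (x n))" for n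
        using \<pi>_norm_\<mu>[OF approxD(1)[OF a] approxD(3)[OF x], of n] approxD(1)[OF a] approxD(3)[OF x] by (simp add: J_norm)
      show "(\<lambda>n. cnorm B (\<mu> n (a n)) * hnorm K (J n (x n))) \<longlonglongrightarrow> cnorm B b * hnorm K v"
        by (intro tendsto_mult B.nrm.conv_nrm[OF approxD(2)[OF a]] K.nrm.conv_nrm[OF approxD(4)[OF x]])
    qed
  qed
qed

lemma \<rho>_induced: "induced_representation A H \<pi> B \<mu> K J \<rho>"
  unfolding induced_representation_def unital_representation_def
proof (intro conjI ballI allI)
  note R = unital_representationD[OF st.\<pi>_representation]
  show "\<rho> b \<in> bounded_ops K K" if "b \<in> carrier B" for b by (rule \<rho>_bounded[OF that])
  fix v assume v: "v \<in> carrier K"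
  obtain x where x: "approxH v x" using approxH_exists v by blast
  note xc = approxD(3)[OF x]
  show "\<rho> \<one>\<^bsub>B\<^esub> v = v"
    by (rule \<rho>_eqI[OF approxA_one x]) (use approxD(4)[OF x] in \<open>simp add: R(2) xc\<close>)
  fix a assume a: "a \<in> carrier B"
  obtain a' where a': "approxA a a'" using approxA_exists a by blast
  note ac = approxD(1)[OF a']
  show "\<rho> (c \<odot>\<^bsub>B\<^esub> a) v = c \<odot>\<^bsub>K\<^esub> \<rho> a v" for c
    by (rule \<rho>_eqI[OF approxA_smult[OF a'] x])
       (use K.nrm.conv_smult[OF \<rho>_conv[OF a' x], of c] in \<open>simp add: R(5) ac xc linear_mapsD(3)[OF J_linear]\<close>)
  show "inner K (\<rho> (star B a) v) w = inner K v (\<rho> a w)" if w: "w \<in> carrier K" for w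
  proof -
    obtain y where y: "approxH w y" using approxH_exists w by blast
    note yc = approxD(3)[OF y]
    have 1: "(\<lambda>i. inner K (J i (\<pi> i (star (A i) (a' i)) (x i))) (J i (y i))) \<longlonglongrightarrow> inner K (\<rho> (star B a) v) w"
      by (rule K.conv_inner2[OF \<rho>_conv[OF approxA_star[OF a'] x] approxD(4)[OF y]])
    have 2: "(\<lambda>i. inner K (J i (x i)) (J i (\<pi> i (a' i) (y i)))) \<longlonglongrightarrow> inner K v (\<rho> a w)"
      by (rule K.conv_inner2[OF approxD(4)[OF x] \<rho>_conv[OF a' y]])
    have "inner K (J i (\<pi> i (star (A i) (a' i)) (x i))) (J i (y i)) = inner K (J i (x i)) (J i (\<pi> i (a' i) (y i)))" for i
      using ac xc yc by (simp add: J_inner R(6) st.star_closed)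
    then show ?thesis using LIMSEQ_unique[OF 1] 2 by simp
  qed
  fix b assume b: "b \<in> carrier B"
  obtain b' where b': "approxA b b'" using approxA_exists b by blast
  note bc = approxD(1)[OF b']
  show "\<rho> (a \<oplus>\<^bsub>B\<^esub> b) v = \<rho> a v \<oplus>\<^bsub>K\<^esub> \<rho> b v"
    by (rule \<rho>_eqI[OF approxA_add[OF a' b'] x])
       (use K.nrm.conv_add[OF \<rho>_conv[OF a' x] \<rho>_conv[OF b' x]] in \<open>simp add: R(3) ac bc xc linear_mapsD(2)[OF J_linear]\<close>)
  show "\<rho> (a \<otimes>\<^bsub>B\<^esub> b) v = \<rho> a (\<rho> b v)"
    by (rule \<rho>_eqI[OF approxA_mult[OF a' b'] x])
       (use \<rho>_conv[OF a' approxH_\<pi>[OF b' x]] in \<open>simp add: R(4) ac bc xc\<close>)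
next
  fix n a v assume a: "a \<in> carrier (A n)" and v: "v \<in> carrier (H n)"
  \<comment> \<open>Stage elements are approximated by their own images from stage n on. The zeros
    before stage n are fillers that do not affect the limit.\<close>
  define a' where "a' i = (if n \<le> i then chain \<phi> n (i - n) a else \<zero>\<^bsub>A i\<^esub>)" for i
  define x where "x i = (if n \<le> i then chain I n (i - n) v else \<zero>\<^bsub>H i\<^esub>)" for i
  have ac: "a' i \<in> carrier (A i)" for i using chain_\<phi>_closed[OF a, of "i - n"] by (cases "n \<le> i") (simp_all add: a'_def)
  have xc: "x i \<in> carrier (H i)" for i using chain_I_closed[OF v, of "i - n"] by (cases "n \<le> i") (simp_all add: x_def)
  have e: "\<mu> i (a' i) = \<mu> n a" "J i (x i) = J n v" "J i (\<pi> i (a' i) (x i)) = J n (\<pi> n a v)" if "n \<le> i" for i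
    using \<mu>_chain[OF a, of "i - n"] J_chain[OF v, of "i - n"] J_\<pi>_chain[OF a v, of "i - n"] that by (simp_all add: a'_def x_def)
  have 1: "approxA (\<mu> n a) a'" unfolding approxA_def
    by (intro conjI allI ac B.nrm.conv_eventually_const[where n=n]) (simp_all add: a ac e)
  have 2: "approxH (J n v) x" unfolding approxH_def
    by (intro conjI allI xc K.nrm.conv_eventually_const[where n=n]) (simp_all add: v xc e)
  show "\<rho> (\<mu> n a) (J n v) = J n (\<pi> n a v)"
    by (rule \<rho>_eqI[OF 1 2 K.nrm.conv_eventually_const[where n=n]]) (simp_all add: a v ac xc e)
qed

text \<open>If b acts as zero and \<open>\<mu> n a\<close> is close to b, then
  \<open>\<mu> n a\<close> acts with small norm, hence so do the images of a at all later stages,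
  and isometry there makes \<open>\<mu> n a\<close> small.\<close>

lemma induced_faithful: assumes ind: "induced_representation A H \<pi> B \<mu> K J \<rho>'" shows "faithful B K \<rho>'"
  unfolding faithful_def
proof (intro ballI impI)
  have rep: "unital_representation B K \<rho>'" and comp: "\<And>n a v. a \<in> carrier (A n) \<Longrightarrow> v \<in> carrier (H n) \<Longrightarrow> \<rho>' (\<mu> n a) (J n v) = J n (\<pi> n a v)"
    using ind by (simp_all add: induced_representation_def)
  note R = unital_representationD[OF rep]
  fix b assume b: "b \<in> carrier B" and z: "\<forall>v\<in>carrier K. \<rho>' b v = \<zero>\<^bsub>K\<^esub>"
  have "cnorm B b \<le> 0"
  proof (rule field_le_epsilon)
    fix e :: real assume e: "e > 0"
    have "b \<in> B.nrm.met.mtopology closure_of (\<Union>n. \<mu> n ` carrier (A n))" using \<mu>_dense b by simp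
    then obtain n a where a: "a \<in> carrier (A n)" "cnorm B (b \<ominus>\<^bsub>B\<^esub> \<mu> n a) < e / 2"
      unfolding B.nrm.closure_iff using half_gt_zero[OF e] by blast
    have "cnorm B (\<mu> n a) \<le> e / 2"
    proof (rule \<mu>_norm_le_of_bound[OF a(1)])
      fix k v assume v: "v \<in> carrier (H (n + k))"
      let ?c = "chain \<phi> n k a"
      have c: "?c \<in> carrier (A (n + k))" using chain_\<phi>_closed[OF a(1)] .
      have "hnorm (H (n + k)) (\<pi> (n + k) ?c v) = hnorm K (\<rho>' (\<mu> n a) (J (n + k) v))"
        using comp[OF c v] \<mu>_chain[OF a(1)] J_norm[of "\<pi> (n + k) ?c v" "n + k"] c v by simp
      also have "\<rho>' (\<mu> n a) (J (n + k) v) = \<rho>' (\<mu> n a \<ominus>\<^bsub>B\<^esub> b) (J (n + k) v)"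
        using R(3)[OF \<mu>_closed[OF a(1)], of "(-1) \<odot>\<^bsub>B\<^esub> b" "J (n + k) v"] R(5)[OF b, of "J (n + k) v" "-1"] z b v a(1) R(7)[of "\<mu> n a" "J (n + k) v"]
        by (simp add: B.nrm.minus_sm)
      also have "hnorm K \<dots> \<le> cnorm B (\<mu> n a \<ominus>\<^bsub>B\<^esub> b) * hnorm K (J (n + k) v)"
        by (rule representation_contractive[OF B.unital_cstar_algebra_axioms K.hilbert_space_axioms rep]) (use a b v in simp_all)
      also have "\<dots> \<le> e / 2 * hnorm (H (n + k)) v"
        unfolding J_norm[OF v]
        by (rule mult_right_mono) (use a(2) B.nrm.nrm_minus_commute[OF b \<mu>_closed[OF a(1)]] st.H.hnorm_nonneg[OF v] in simp_all)
      finally show "hnorm (H (n + k)) (\<pi> (n + k) ?c v) \<le> e / 2 * hnorm (H (n + k)) v" .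
    qed (use e in simp)
    then show "cnorm B b \<le> 0 + e" using B.nrm.nrm_le_diff[OF b \<mu>_closed[OF a(1)]] a(2) by simp
  qed
  then show "b = \<zero>\<^bsub>B\<^esub>" using B.norm_nonneg[OF b] B.norm_definite[OF b] by simp
qed

text \<open>Elements that preserve the domain of D and have bounded commutators form a linear space.
  If it contains the images of the monomials, then it contains those of all polynomials, which are
  dense.\<close>

lemma smooth_dense:
  assumes ind: "induced_representation A H \<pi> B \<mu> K J \<rho>'"
    and sv: "single_valued D" and dd: "htop K closure_of Domain D = carrier K" and Dc: "D \<subseteq> carrier K \<times> carrier K"
    and Dadd: "\<And>v w v' w'. (v, w) \<in> D \<Longrightarrow> (v', w') \<in> D \<Longrightarrow> (v \<oplus>\<^bsub>K\<^esub> v', w \<oplus>\<^bsub>K\<^esub> w') \<in> D"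
    and Dsm: "\<And>v w c. (v, w) \<in> D \<Longrightarrow> (c \<odot>\<^bsub>K\<^esub> v, c \<odot>\<^bsub>K\<^esub> w) \<in> D"
    and D0: "(\<zero>\<^bsub>K\<^esub>, \<zero>\<^bsub>K\<^esub>) \<in> D"
    and W: "\<And>n x. x \<in> carrier_vec (m n) \<Longrightarrow>
      \<exists>Q\<in>bounded_ops K K. \<forall>(v, w)\<in>D. (\<rho>' (\<mu> n (st.W n x)) v, Q v \<oplus>\<^bsub>K\<^esub> \<rho>' (\<mu> n (st.W n x)) w) \<in> D"
  shows "ctop B closure_of smooth_part B K \<rho>' D = carrier B"
proof -
  have rep: "unital_representation B K \<rho>'" using ind by (simp add: induced_representation_def)
  note R = unital_representationD[OF rep]
  note hs = K.hilbert_space_axioms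
  \<comment> \<open>Stronger than membership in \<open>smooth_part\<close>: the whole domain of D is
    preserved. Hence the commutator with a sum is again defined on all of it and the bounded
    extensions simply add.\<close>
  define nice where "nice b \<longleftrightarrow> (\<exists>Q\<in>bounded_ops K K. \<forall>(v, w)\<in>D. (\<rho>' b v, Q v \<oplus>\<^bsub>K\<^esub> \<rho>' b w) \<in> D)" for b
  have Dcar: "v \<in> carrier K" "w \<in> carrier K" if "(v, w) \<in> D" for v w using that Dc by auto
  have niceI: "nice b" if "Q \<in> bounded_ops K K" "\<And>v w. (v, w) \<in> D \<Longrightarrow> (\<rho>' b v, Q v \<oplus>\<^bsub>K\<^esub> \<rho>' b w) \<in> D" for b Q
    using that unfolding nice_def by blast
  have Qc: "Q v \<in> carrier K" if "Q \<in> bounded_ops K K" "v \<in> carrier K" for Q v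
    using linear_mapsD(1)[OF bounded_opsD(1)[OF that(1)] that(2)] .
  have nice_add: "nice (b \<oplus>\<^bsub>B\<^esub> b')" if bb: "b \<in> carrier B" "b' \<in> carrier B" "nice b" "nice b'" for b b'
  proof -
    obtain Q where Q: "Q \<in> bounded_ops K K" "\<And>v w. (v, w) \<in> D \<Longrightarrow> (\<rho>' b v, Q v \<oplus>\<^bsub>K\<^esub> \<rho>' b w) \<in> D" using bb(3) unfolding nice_def by blast
    obtain Q' where Q': "Q' \<in> bounded_ops K K" "\<And>v w. (v, w) \<in> D \<Longrightarrow> (\<rho>' b' v, Q' v \<oplus>\<^bsub>K\<^esub> \<rho>' b' w) \<in> D" using bb(4) unfolding nice_def by blast
    show ?thesis
    proof (rule niceI[OF bounded_ops_add[OF hs hs Q(1) Q'(1)]])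
      fix v w assume vw: "(v, w) \<in> D"
      note c = Dcar[OF vw]
      have "(\<rho>' b v \<oplus>\<^bsub>K\<^esub> \<rho>' b' v, (Q v \<oplus>\<^bsub>K\<^esub> \<rho>' b w) \<oplus>\<^bsub>K\<^esub> (Q' v \<oplus>\<^bsub>K\<^esub> \<rho>' b' w)) \<in> D" by (rule Dadd[OF Q(2)[OF vw] Q'(2)[OF vw]])
      moreover have "(Q v \<oplus>\<^bsub>K\<^esub> \<rho>' b w) \<oplus>\<^bsub>K\<^esub> (Q' v \<oplus>\<^bsub>K\<^esub> \<rho>' b' w) = (Q v \<oplus>\<^bsub>K\<^esub> Q' v) \<oplus>\<^bsub>K\<^esub> (\<rho>' b w \<oplus>\<^bsub>K\<^esub> \<rho>' b' w)"
        using c Qc[OF Q(1) c(1)] Qc[OF Q'(1) c(1)] R(7)[OF bb(1) c(2)] R(7)[OF bb(2) c(2)] by (simp add: K.nrm.a_ac)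
      ultimately show "(\<rho>' (b \<oplus>\<^bsub>B\<^esub> b') v, (Q v \<oplus>\<^bsub>K\<^esub> Q' v) \<oplus>\<^bsub>K\<^esub> \<rho>' (b \<oplus>\<^bsub>B\<^esub> b') w) \<in> D"
        using R(3)[OF bb(1,2)] c by simp
    qed
  qed
  have nice_smult: "nice (c \<odot>\<^bsub>B\<^esub> b)" if bb: "b \<in> carrier B" "nice b" for b c
  proof -
    obtain Q where Q: "Q \<in> bounded_ops K K" "\<And>v w. (v, w) \<in> D \<Longrightarrow> (\<rho>' b v, Q v \<oplus>\<^bsub>K\<^esub> \<rho>' b w) \<in> D" using bb(2) unfolding nice_def by blast
    show ?thesis
    proof (rule niceI[OF bounded_ops_smult[OF hs hs Q(1)]])
      fix v w assume vw: "(v, w) \<in> D"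
      note cc = Dcar[OF vw]
      show "(\<rho>' (c \<odot>\<^bsub>B\<^esub> b) v, c \<odot>\<^bsub>K\<^esub> Q v \<oplus>\<^bsub>K\<^esub> \<rho>' (c \<odot>\<^bsub>B\<^esub> b) w) \<in> D"
        using Dsm[OF Q(2)[OF vw], of c] R(5)[OF bb(1)] cc Qc[OF Q(1) cc(1)] R(7)[OF bb(1) cc(2)] by (simp add: K.nrm.sm_radd)
    qed
  qed
  have smooth: "b \<in> smooth_part B K \<rho>' D" if b: "b \<in> carrier B" "nice b" for b
  proof -
    obtain Q where Q: "Q \<in> bounded_ops K K" "\<And>v w. (v, w) \<in> D \<Longrightarrow> (\<rho>' b v, Q v \<oplus>\<^bsub>K\<^esub> \<rho>' b w) \<in> D" using b(2) unfolding nice_def by blast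
    have dom: "Domain (commutator_graph K D (\<rho>' b)) = Domain D"
    proof
      show "Domain (commutator_graph K D (\<rho>' b)) \<subseteq> Domain D" unfolding commutator_graph_def by blast
      show "Domain D \<subseteq> Domain (commutator_graph K D (\<rho>' b))"
      proof
        fix v assume "v \<in> Domain D"
        then obtain w where vw: "(v, w) \<in> D" by blast
        then have "(v, (Q v \<oplus>\<^bsub>K\<^esub> \<rho>' b w) \<ominus>\<^bsub>K\<^esub> \<rho>' b w) \<in> commutator_graph K D (\<rho>' b)"
          unfolding commutator_graph_def using Q(2)[OF vw] by blast
        then show "v \<in> Domain (commutator_graph K D (\<rho>' b))" by blast
      qed
    qed
    have "Q v = w" if vw: "(v, w) \<in> commutator_graph K D (\<rho>' b)" for v w
    proof -
      obtain y y' where y: "(v, y) \<in> D" "(\<rho>' b v, y') \<in> D" "w = y' \<ominus>\<^bsub>K\<^esub> \<rho>' b y" using vw unfolding commutator_graph_def by blast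
      have e: "y' = Q v \<oplus>\<^bsub>K\<^esub> \<rho>' b y" using single_valuedD[OF sv y(2) Q(2)[OF y(1)]] .
      note c = Dcar[OF y(1)]
      have qc: "Q v \<in> carrier K" "\<rho>' b y \<in> carrier K" using Qc[OF Q(1) c(1)] R(7)[OF b(1) c(2)] by simp_all
      show ?thesis unfolding y(3) e using qc by (subst K.nrm.a_comm) (simp_all add: K.nrm.add_diff2)
    qed
    then show ?thesis unfolding smooth_part_def using b(1) dom dd Q(1) by auto
  qed
  have niceP: "nice (\<mu> n a)" if a: "a \<in> st.P n" for n a
  proof -
    have "LinearCombinations.submodule class_ring {a \<in> carrier (A n). nice (\<mu> n a)} (A n)"
    proof (rule st.nrm.submoduleI)
      \<comment> \<open>Zero is reached as the multiple by 0 of the unit, which is the monomial with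
        exponent zero.\<close>
      have z: "\<mu> n \<zero>\<^bsub>A n\<^esub> = 0 \<odot>\<^bsub>B\<^esub> \<mu> n \<one>\<^bsub>A n\<^esub>"
        using unital_star_homD(7)[OF \<mu>_hom, of "\<one>\<^bsub>A n\<^esub>" n 0] by simp
      have "nice (\<mu> n (st.W n (0\<^sub>v (m n))))" unfolding nice_def by (rule W) simp
      then have "nice (0 \<odot>\<^bsub>B\<^esub> \<mu> n \<one>\<^bsub>A n\<^esub>)" by (intro nice_smult) simp_all
      then show "\<zero>\<^bsub>A n\<^esub> \<in> {a \<in> carrier (A n). nice (\<mu> n a)}" using z by simp
    qed (auto simp: unital_star_homD(6,7)[OF \<mu>_hom] nice_add nice_smult)
    from st.P_induct[OF a this] show ?thesis using W unfolding nice_def by simp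
  qed
  show ?thesis
    unfolding B.ctop_eq B.nrm.dense_iff
  proof (intro ballI allI impI)
    fix b and e :: real assume b: "b \<in> carrier B" and e: "e > 0"
    have "b \<in> B.nrm.met.mtopology closure_of (\<Union>n. \<mu> n ` carrier (A n))" using \<mu>_dense b by simp
    then obtain n a where a: "a \<in> carrier (A n)" "cnorm B (b \<ominus>\<^bsub>B\<^esub> \<mu> n a) < e / 2"
      unfolding B.nrm.closure_iff using half_gt_zero[OF e] by blast
    have "a \<in> st.nrm.met.mtopology n closure_of st.P n" using a(1) st.P_dense by simp
    then obtain p where p: "p \<in> st.P n" "p \<in> carrier (A n)" "cnorm (A n) (a \<ominus>\<^bsub>A n\<^esub> p) < e / 2"
      unfolding st.nrm.closure_iff using half_gt_zero[OF e] by blast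
    have "cnorm B (\<mu> n a \<ominus>\<^bsub>B\<^esub> \<mu> n p) < e / 2"
      using \<mu>_contractive[of "a \<ominus>\<^bsub>A n\<^esub> p" n] p a(1) by (simp add: \<mu>_minus)
    then have "cnorm B (b \<ominus>\<^bsub>B\<^esub> \<mu> n p) < e"
      using B.nrm.nrm_diff_triangle[OF b \<mu>_closed[OF a(1)] \<mu>_closed[OF p(2)]] a(2) by simp
    then show "\<exists>x\<in>smooth_part B K \<rho>' D. x \<in> carrier B \<and> cnorm B (b \<ominus>\<^bsub>B\<^esub> x) < e"
      using smooth[OF \<mu>_closed[OF p(2)] niceP[OF p(1)]] p(2) by (intro bexI[of _ "\<mu> n p"]) simp_all
  qed
qed

end

section \<open>The limit lattice\<close>

locale lattice_system =
  fixes m :: "nat \<Rightarrow> nat" and M :: "nat \<Rightarrow> int mat"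
  assumes M_carrier: "M n \<in> carrier_mat (m (Suc n)) (m n)"
begin

text \<open>Indexed by the target stage instead of the number of steps. For \<open>l < n\<close> the
  truncated difference makes it the identity, hence the side conditions \<open>n \<le> l\<close>
  below.\<close>

definition push :: "nat \<Rightarrow> nat \<Rightarrow> int Matrix.vec \<Rightarrow> int Matrix.vec" where
  "push n l x = chain (\<lambda>i v. M i *\<^sub>v v) n (l - n) x"

abbreviation cls :: "nat \<Rightarrow> int Matrix.vec \<Rightarrow> (nat \<times> int Matrix.vec) set" where
  "cls \<equiv> lattice_class m M"

abbreviation Lim :: "(nat \<times> int Matrix.vec) set set" where "Lim \<equiv> lattice_limit m M"

abbreviation ladd where "ladd \<equiv> lattice_add m M"

lemma chain_closed: "x \<in> carrier_vec (m n) \<Longrightarrow> chain (\<lambda>i v. M i *\<^sub>v v) n k x \<in> carrier_vec (m (n + k))"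
  by (induction k) (auto intro: mult_mat_vec_carrier[OF M_carrier])

lemma chain_add: "x \<in> carrier_vec (m n) \<Longrightarrow> y \<in> carrier_vec (m n) \<Longrightarrow>
  chain (\<lambda>i v. M i *\<^sub>v v) n k (x + y) = chain (\<lambda>i v. M i *\<^sub>v v) n k x + chain (\<lambda>i v. M i *\<^sub>v v) n k y"
  by (induction k) (simp_all add: mult_add_distrib_mat_vec[OF M_carrier] chain_closed)

lemma push_closed: assumes "n \<le> l" "x \<in> carrier_vec (m n)" shows "push n l x \<in> carrier_vec (m l)"
  using chain_closed[OF assms(2), of "l - n"] assms(1) by (simp add: push_def)

lemma push_add: "x \<in> carrier_vec (m n) \<Longrightarrow> y \<in> carrier_vec (m n) \<Longrightarrow> push n l (x + y) = push n l x + push n l y"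
  by (simp add: push_def chain_add)

lemma push_refl [simp]: "push n n x = x"
  by (simp add: push_def)

lemma push_Suc: "n \<le> l \<Longrightarrow> push n (Suc l) x = M l *\<^sub>v push n l x"
  by (simp add: push_def Suc_diff_le)

lemma push_push: assumes "n \<le> k" "k \<le> l" shows "push k l (push n k x) = push n l x"
  using chain_append[of "\<lambda>i v. M i *\<^sub>v v" n "k - n" "l - k" x] assms by (simp add: push_def)

lemma rel_iff: "((n, x), (k, y)) \<in> lattice_rel m M \<longleftrightarrow>
  x \<in> carrier_vec (m n) \<and> y \<in> carrier_vec (m k) \<and> (\<exists>l. n \<le> l \<and> k \<le> l \<and> push n l x = push k l y)"
  by (auto simp: lattice_rel_def lattice_pairs_def push_def)

lemma rel_equiv: "equiv (lattice_pairs m) (lattice_rel m M)"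
proof (rule equivI)
  show "lattice_rel m M \<subseteq> lattice_pairs m \<times> lattice_pairs m" by (auto simp: lattice_rel_def)
  show "refl_on (lattice_pairs m) (lattice_rel m M)"
    by (auto simp: refl_on_def rel_iff lattice_pairs_def)
  show "sym (lattice_rel m M)"
  proof (rule symI, clarify)
    fix n x k y assume "((n, x), (k, y)) \<in> lattice_rel m M"
    then show "((k, y), (n, x)) \<in> lattice_rel m M" unfolding rel_iff by metis
  qed
  show "trans (lattice_rel m M)"
  proof (rule transI, clarify)
    fix n x k y j w assume 1: "((n, x), (k, y)) \<in> lattice_rel m M" and 2: "((k, y), (j, w)) \<in> lattice_rel m M"
    obtain l where l: "n \<le> l" "k \<le> l" "push n l x = push k l y" using 1 unfolding rel_iff by blast
    obtain l' where l': "k \<le> l'" "j \<le> l'" "push k l' y = push j l' w" using 2 unfolding rel_iff by blast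
    have "push n (max l l') x = push j (max l l') w"
      using push_push[OF l(1), of "max l l'" x] push_push[OF l(2), of "max l l'" y]
        push_push[OF l'(1), of "max l l'" y] push_push[OF l'(2), of "max l l'" w] l(3) l'(3) by simp
    then show "((n, x), (j, w)) \<in> lattice_rel m M"
      using 1 2 l l' unfolding rel_iff by (intro conjI exI[of _ "max l l'"]) auto
  qed
qed

lemma cls_eq_iff:
  assumes "x \<in> carrier_vec (m n)" "y \<in> carrier_vec (m k)"
  shows "cls n x = cls k y \<longleftrightarrow> (\<exists>l. n \<le> l \<and> k \<le> l \<and> push n l x = push k l y)"
  using eq_equiv_class_iff[OF rel_equiv, of "(n, x)" "(k, y)"] assms
  by (simp add: lattice_class_def lattice_pairs_def rel_iff)

lemma cls_push: assumes "n \<le> l" "x \<in> carrier_vec (m n)" shows "cls l (push n l x) = cls n x"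
  using assms push_closed[OF assms] by (subst cls_eq_iff) auto

lemma cls_in: "x \<in> carrier_vec (m n) \<Longrightarrow> cls n x \<in> Lim"
  unfolding lattice_class_def lattice_limit_def by (rule quotientI) (simp add: lattice_pairs_def)

lemma Lim_cases: assumes "g \<in> Lim" obtains n x where "x \<in> carrier_vec (m n)" "g = cls n x"
  using assms unfolding lattice_limit_def lattice_class_def lattice_pairs_def by (auto elim!: quotientE)

lemma mem_cls_iff: "y \<in> carrier_vec (m k) \<Longrightarrow> (n, x) \<in> cls k y \<longleftrightarrow> x \<in> carrier_vec (m n) \<and> cls n x = cls k y"
  using cls_eq_iff[of y k x n] by (auto simp: lattice_class_def rel_iff)

text \<open>Directedness of the system. It reduces addition of classes to a single stage and brings
  every finite truncation into the image of one stage operator.\<close>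

lemma common_stage:
  assumes "finite X" "X \<subseteq> Lim"
  obtains N f where "\<And>g. g \<in> X \<Longrightarrow> f g \<in> carrier_vec (m N)" "\<And>g. g \<in> X \<Longrightarrow> cls N (f g) = g"
proof -
  have "\<forall>g\<in>X. \<exists>p. snd p \<in> carrier_vec (m (fst p)) \<and> g = cls (fst p) (snd p)"
  proof
    fix g assume "g \<in> X"
    then obtain n x where "x \<in> carrier_vec (m n)" "g = cls n x" using assms(2) Lim_cases by blast
    then show "\<exists>p. snd p \<in> carrier_vec (m (fst p)) \<and> g = cls (fst p) (snd p)" by (intro exI[of _ "(n, x)"]) simp
  qed
  then obtain p where p: "\<And>g. g \<in> X \<Longrightarrow> snd (p g) \<in> carrier_vec (m (fst (p g)))" "\<And>g. g \<in> X \<Longrightarrow> g = cls (fst (p g)) (snd (p g))"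
    by metis
  let ?N = "Max (insert 0 (fst ` p ` X))"
  have le: "fst (p g) \<le> ?N" if "g \<in> X" for g using assms(1) that by (intro Max_ge) auto
  show thesis
  proof (rule that)
    show "push (fst (p g)) ?N (snd (p g)) \<in> carrier_vec (m ?N)" if "g \<in> X" for g
      by (rule push_closed[OF le[OF that] p(1)[OF that]])
    show "cls ?N (push (fst (p g)) ?N (snd (p g))) = g" if "g \<in> X" for g
      using cls_push[OF le[OF that] p(1)[OF that]] p(2)[OF that] by simp
  qed
qed

text \<open>Any two pairs of representatives agree after being pushed far enough, and pushing is
  additive, so the union in \<open>lattice_add\<close> runs over copies of one class.\<close>

lemma ladd_cls:
  assumes x: "x \<in> carrier_vec (m n)" and y: "y \<in> carrier_vec (m n)"
  shows "ladd (cls n x) (cls n y) = cls n (x + y)"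
proof -
  have "cls k (x' + y') = cls n (x + y)" if "(k, x') \<in> cls n x" "(k, y') \<in> cls n y" for k x' y'
  proof -
    have c: "x' \<in> carrier_vec (m k)" "y' \<in> carrier_vec (m k)" "cls k x' = cls n x" "cls k y' = cls n y"
      using that x y by (simp_all add: mem_cls_iff)
    obtain l where l: "k \<le> l" "n \<le> l" "push k l x' = push n l x" using c(3) cls_eq_iff[OF c(1) x] by blast
    obtain l' where l': "k \<le> l'" "n \<le> l'" "push k l' y' = push n l' y" using c(4) cls_eq_iff[OF c(2) y] by blast
    let ?l = "max l l'"
    have "push k ?l (x' + y') = push n ?l (x + y)"
      using push_push[OF l(1), of ?l x'] push_push[OF l(2), of ?l x]
        push_push[OF l'(1), of ?l y'] push_push[OF l'(2), of ?l y] l(3) l'(3) by (simp add: push_add x y c(1,2))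
    then show ?thesis
      using l(1,2) x y c(1,2) by (subst cls_eq_iff) (auto intro!: exI[of _ ?l])
  qed
  moreover have "(n, x) \<in> cls n x" "(n, y) \<in> cls n y" using x y by (simp_all add: mem_cls_iff)
  ultimately have "{cls k (x' + y') | k x' y'. (k, x') \<in> cls n x \<and> (k, y') \<in> cls n y} = {cls n (x + y)}" by blast
  then show ?thesis unfolding lattice_add_def by simp
qed

lemma Lim_cases2: assumes "g \<in> Lim" "h \<in> Lim"
  obtains n x y where "x \<in> carrier_vec (m n)" "y \<in> carrier_vec (m n)" "g = cls n x" "h = cls n y"
proof -
  have "finite {g, h}" "{g, h} \<subseteq> Lim" using assms by simp_all
  then obtain N f where "\<And>k. k \<in> {g, h} \<Longrightarrow> f k \<in> carrier_vec (m N)" "\<And>k. k \<in> {g, h} \<Longrightarrow> cls N (f k) = k"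
    by (rule common_stage) blast
  then show thesis using that[of "f g" N "f h"] by simp
qed

lemma ladd_closed: assumes "g \<in> Lim" "h \<in> Lim" shows "ladd g h \<in> Lim"
proof -
  obtain n x y where "x \<in> carrier_vec (m n)" "y \<in> carrier_vec (m n)" "g = cls n x" "h = cls n y" using Lim_cases2[OF assms] .
  then show ?thesis by (simp add: ladd_cls cls_in)
qed

text \<open>Connecting maps may fail to be injective, so equality of the sums holds only at some
  later stage; the common summand is cancelled there.\<close>

lemma ladd_inj: assumes h: "h \<in> Lim" shows "inj_on (\<lambda>g. ladd g h) Lim"
proof (rule inj_onI)
  fix g g' assume g: "g \<in> Lim" "g' \<in> Lim" and eq: "ladd g h = ladd g' h"
  have "finite {g, g', h}" "{g, g', h} \<subseteq> Lim" using g h by simp_all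
  then obtain n f where "\<And>k. k \<in> {g, g', h} \<Longrightarrow> f k \<in> carrier_vec (m n)" "\<And>k. k \<in> {g, g', h} \<Longrightarrow> cls n (f k) = k"
    by (rule common_stage) blast
  then obtain x x' y where c: "x \<in> carrier_vec (m n)" "x' \<in> carrier_vec (m n)" "y \<in> carrier_vec (m n)"
    and e: "g = cls n x" "g' = cls n x'" "h = cls n y" by (metis insertCI)
  have "cls n (x + y) = cls n (x' + y)" using eq c by (simp add: e ladd_cls)
  then obtain l where l: "n \<le> l" "push n l (x + y) = push n l (x' + y)" using c by (subst (asm) cls_eq_iff) auto
  have "push n l x = push n l x'"
  proof -
    have p: "push n l x \<in> carrier_vec (m l)" "push n l x' \<in> carrier_vec (m l)" "push n l y \<in> carrier_vec (m l)"
      using push_closed[OF l(1)] c by simp_all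
    have s: "push n l x + push n l y = push n l x' + push n l y" using l(2) c by (simp add: push_add)
    show ?thesis
    proof (rule eq_vecI)
      fix i assume i: "i < dim_vec (push n l x')"
      have "(push n l x + push n l y) $ i = (push n l x' + push n l y) $ i" using s by simp
      then show "push n l x $ i = push n l x' $ i" using i p by simp
    qed (use p in simp)
  qed
  then show "g = g'" unfolding e using c l(1) by (subst cls_eq_iff) auto
qed

text \<open>Iterated compatibility makes \<open>F n x\<close> depend only on the class of x.
  Uniqueness is equality of functions and rests on extensionality outside the limit lattice.\<close>

lemma limit_multiplier_exists:
  assumes F: "\<And>n x. x \<in> carrier_vec (m n) \<Longrightarrow> F n x \<in> End_sa S"
    and comp: "\<And>n x. x \<in> carrier_vec (m n) \<Longrightarrow> F (Suc n) (M n *\<^sub>v x) = F n x"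
  shows "\<exists>!Finf. is_limit_multiplier m M F S Finf"
proof -
  have Fp: "F l (push n l x) = F n x" if "n \<le> l" "x \<in> carrier_vec (m n)" for n l x
    using that(1)
  proof (induction l rule: dec_induct)
    case (step l)
    show ?case using comp[OF push_closed[OF step(1) that(2)]] step by (simp add: push_Suc)
  qed simp
  have wd: "F n x = F k y" if "x \<in> carrier_vec (m n)" "y \<in> carrier_vec (m k)" "cls n x = cls k y" for n x k y
    using that Fp[OF _ that(1)] Fp[OF _ that(2)] cls_eq_iff[OF that(1,2)] by metis
  define Finf where "Finf = (\<lambda>g\<in>Lim. let p = (SOME p. snd p \<in> carrier_vec (m (fst p)) \<and> g = cls (fst p) (snd p)) in F (fst p) (snd p))"
  have Finf: "Finf (cls n x) = F n x" if x: "x \<in> carrier_vec (m n)" for n x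
  proof -
    let ?P = "\<lambda>p. snd p \<in> carrier_vec (m (fst p)) \<and> cls n x = cls (fst p) (snd p)"
    have "?P (n, x)" using x by simp
    then have "?P (SOME p. ?P p)" by (rule someI)
    then show ?thesis using wd[OF x, of "snd (SOME p. ?P p)" "fst (SOME p. ?P p)"] cls_in[OF x] by (simp add: Finf_def Let_def)
  qed
  have "Finf g \<in> End_sa S" if g: "g \<in> Lim" for g
  proof -
    obtain n x where "x \<in> carrier_vec (m n)" "g = cls n x" using Lim_cases[OF g] .
    then show ?thesis using F by (simp add: Finf)
  qed
  then have "is_limit_multiplier m M F S Finf"
    unfolding is_limit_multiplier_def using Finf by (auto simp: PiE_iff) (auto simp: Finf_def)
  moreover have "f = Finf" if "is_limit_multiplier m M F S f" for f
  proof (rule PiE_ext)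
    show "f \<in> Lim \<rightarrow>\<^sub>E End_sa S" "Finf \<in> Lim \<rightarrow>\<^sub>E End_sa S"
      using that calculation unfolding is_limit_multiplier_def by blast+
    fix g assume "g \<in> Lim"
    then obtain n x where "x \<in> carrier_vec (m n)" "g = cls n x" by (rule Lim_cases)
    then show "f g = Finf g" using that Finf unfolding is_limit_multiplier_def by simp
  qed
  ultimately show ?thesis by blast
qed

end

section \<open>Finite-dimensional direct sums and the operator norm\<close>

lemma (in hilbert_space) direct_power_vectorspace: "vectorspace class_ring (direct_power X H)"
proof -
  define P where "P = direct_power X H"
  have car: "f \<in> carrier P \<longleftrightarrow> f \<in> X \<rightarrow>\<^sub>E carrier H \<and> finite {x \<in> X. f x \<noteq> \<zero>}" for f
    by (simp add: P_def direct_power_def)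
  have at: "(f \<oplus>\<^bsub>P\<^esub> g) x = f x \<oplus> g x" "(c \<odot>\<^bsub>P\<^esub> f) x = c \<odot>\<^bsub>H\<^esub> f x" "\<zero>\<^bsub>P\<^esub> x = \<zero>" if "x \<in> X" for f g c x
    using that by (simp_all add: P_def direct_power_def)
  have undef: "(f \<oplus>\<^bsub>P\<^esub> g) x = undefined" "(c \<odot>\<^bsub>P\<^esub> f) x = undefined" "\<zero>\<^bsub>P\<^esub> x = undefined" if "x \<notin> X" for f g c x
    using that by (simp_all add: P_def direct_power_def)
  have val: "f x \<in> carrier H" if "f \<in> carrier P" "x \<in> X" for f x using that car by blast
  have add_c: "f \<oplus>\<^bsub>P\<^esub> g \<in> carrier P" if "f \<in> carrier P" "g \<in> carrier P" for f g
  proof -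
    have "{x \<in> X. (f \<oplus>\<^bsub>P\<^esub> g) x \<noteq> \<zero>} \<subseteq> {x \<in> X. f x \<noteq> \<zero>} \<union> {x \<in> X. g x \<noteq> \<zero>}" by (auto simp: at)
    from finite_subset[OF this] show ?thesis
      using that by (auto simp: car PiE_iff extensional_def at undef)
  qed
  have smult_c: "c \<odot>\<^bsub>P\<^esub> f \<in> carrier P" if "f \<in> carrier P" for f c
  proof -
    have "{x \<in> X. (c \<odot>\<^bsub>P\<^esub> f) x \<noteq> \<zero>} \<subseteq> {x \<in> X. f x \<noteq> \<zero>}" by (auto simp: at)
    from finite_subset[OF this] show ?thesis
      using that by (auto simp: car PiE_iff extensional_def at undef)
  qed
  have z: "{x \<in> X. \<zero>\<^bsub>P\<^esub> x \<noteq> \<zero>} = {}" by (auto simp: at)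
  have zero_c: "\<zero>\<^bsub>P\<^esub> \<in> carrier P" by (auto simp: car z PiE_iff extensional_def at undef)
  have ext: "f = g" if "f \<in> carrier P" "g \<in> carrier P" "\<And>x. x \<in> X \<Longrightarrow> f x = g x" for f g
    using that PiE_ext[of f X "\<lambda>_. carrier H" g] by (simp add: car)
  have ag: "abelian_group P"
  proof (rule abelian_groupI)
    fix f assume f: "f \<in> carrier P"
    show "\<zero>\<^bsub>P\<^esub> \<oplus>\<^bsub>P\<^esub> f = f" by (rule ext[OF add_c[OF zero_c f] f]) (simp add: at val[OF f])
    show "\<exists>g\<in>carrier P. g \<oplus>\<^bsub>P\<^esub> f = \<zero>\<^bsub>P\<^esub>"
    proof (rule bexI[of _ "(-1) \<odot>\<^bsub>P\<^esub> f"])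
      show "(-1) \<odot>\<^bsub>P\<^esub> f \<oplus>\<^bsub>P\<^esub> f = \<zero>\<^bsub>P\<^esub>"
      proof (rule ext[OF add_c[OF smult_c[OF f] f] zero_c])
        fix x assume x: "x \<in> X"
        show "((-1) \<odot>\<^bsub>P\<^esub> f \<oplus>\<^bsub>P\<^esub> f) x = \<zero>\<^bsub>P\<^esub> x"
          using val[OF f x] nrm.sm_ladd[of "f x" "-1" 1] x by (simp add: at)
      qed
    qed (rule smult_c[OF f])
    fix g assume g: "g \<in> carrier P"
    show "f \<oplus>\<^bsub>P\<^esub> g \<in> carrier P" by (rule add_c[OF f g])
    show "f \<oplus>\<^bsub>P\<^esub> g = g \<oplus>\<^bsub>P\<^esub> f"
      by (rule ext[OF add_c[OF f g] add_c[OF g f]]) (simp add: at val[OF f] val[OF g] nrm.a_comm)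
    fix h assume h: "h \<in> carrier P"
    show "(f \<oplus>\<^bsub>P\<^esub> g) \<oplus>\<^bsub>P\<^esub> h = f \<oplus>\<^bsub>P\<^esub> (g \<oplus>\<^bsub>P\<^esub> h)"
      by (rule ext[OF add_c[OF add_c[OF f g] h] add_c[OF f add_c[OF g h]]])
         (simp add: at val[OF f] val[OF g] val[OF h] nrm.a_assoc)
  qed (rule zero_c)
  have "Module.module (class_ring :: complex ring) P"
  proof (rule moduleI[OF Module.module.axioms(1)[OF nrm.mod] ag])
    fix c :: complex and f assume f: "f \<in> carrier P"
    show "c \<odot>\<^bsub>P\<^esub> f \<in> carrier P" by (rule smult_c[OF f])
    show "(c \<oplus>\<^bsub>class_ring\<^esub> d) \<odot>\<^bsub>P\<^esub> f = c \<odot>\<^bsub>P\<^esub> f \<oplus>\<^bsub>P\<^esub> d \<odot>\<^bsub>P\<^esub> f" for d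
      by (rule ext[OF smult_c[OF f] add_c[OF smult_c[OF f] smult_c[OF f]]]) (simp add: at val[OF f] nrm.sm_ladd)
    show "(c \<otimes>\<^bsub>class_ring\<^esub> d) \<odot>\<^bsub>P\<^esub> f = c \<odot>\<^bsub>P\<^esub> (d \<odot>\<^bsub>P\<^esub> f)" for d
      by (rule ext[OF smult_c[OF f] smult_c[OF smult_c[OF f]]]) (simp add: at val[OF f])
    show "\<one>\<^bsub>class_ring\<^esub> \<odot>\<^bsub>P\<^esub> f = f"
      by (rule ext[OF smult_c[OF f] f]) (simp add: at val[OF f])
    fix g assume g: "g \<in> carrier P"
    show "c \<odot>\<^bsub>P\<^esub> (f \<oplus>\<^bsub>P\<^esub> g) = c \<odot>\<^bsub>P\<^esub> f \<oplus>\<^bsub>P\<^esub> c \<odot>\<^bsub>P\<^esub> g"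
      by (rule ext[OF smult_c[OF add_c[OF f g]] add_c[OF smult_c[OF f] smult_c[OF g]]])
         (simp add: at val[OF f] val[OF g] nrm.sm_radd)
  qed
  then show ?thesis using vectorspace unfolding vectorspace_def P_def by simp
qed

text \<open>A finite spanning set has finite total support. At an index outside this support every
  element of the span would vanish, yet a nonzero vector of the space can be placed there.\<close>

lemma (in hilbert_space) direct_power_finite:
  assumes fd: "vectorspace.fin_dim class_ring (direct_power X H)" and nz: "carrier H \<noteq> {\<zero>}"
  shows "finite X"
proof -
  let ?D = "direct_power X H"
  note vs = direct_power_vectorspace[of X]
  have md: "Module.module (class_ring :: complex ring) ?D" using vs by (simp add: vectorspace_def)
  note am = abelian_group.axioms(1)[OF Module.module.axioms(2)[OF md]]
  obtain Y where Y: "finite Y" "Y \<subseteq> carrier ?D" "LinearCombinations.module.span class_ring ?D Y = carrier ?D"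
    using fd unfolding vectorspace.fin_dim_def[OF vs] by blast
  obtain s where s: "s \<in> carrier H" "s \<noteq> \<zero>" using nz nrm.zero_closed by blast
  have "X \<subseteq> (\<Union>f\<in>Y. {x \<in> X. f x \<noteq> \<zero>})"
  proof
    fix x assume x: "x \<in> X"
    show "x \<in> (\<Union>f\<in>Y. {x \<in> X. f x \<noteq> \<zero>})"
    proof (rule ccontr)
      have at: "(f \<oplus>\<^bsub>?D\<^esub> g) x = f x \<oplus> g x" "(c \<odot>\<^bsub>?D\<^esub> f) x = c \<odot>\<^bsub>H\<^esub> f x" "\<zero>\<^bsub>?D\<^esub> x = \<zero>" for f g c
        using x by (simp_all add: direct_power_def)
      assume n: "x \<notin> (\<Union>f\<in>Y. {x \<in> X. f x \<noteq> \<zero>})"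
      have "LinearCombinations.submodule class_ring {f \<in> carrier ?D. f x = \<zero>} ?D"
      proof (rule LinearCombinations.submodule.intro[OF md])
        show "\<zero>\<^bsub>?D\<^esub> \<in> {f \<in> carrier ?D. f x = \<zero>}"
          using x abelian_monoid.zero_closed[OF am] by (simp add: at)
        show "f \<oplus>\<^bsub>?D\<^esub> g \<in> {f \<in> carrier ?D. f x = \<zero>}"
          if "f \<in> {f \<in> carrier ?D. f x = \<zero>}" "g \<in> {f \<in> carrier ?D. f x = \<zero>}" for f g
          using that abelian_monoid.a_closed[OF am, of f g] by (simp add: at)
        show "c \<odot>\<^bsub>?D\<^esub> f \<in> {f \<in> carrier ?D. f x = \<zero>}" if "f \<in> {f \<in> carrier ?D. f x = \<zero>}" for c f
          using that Module.module.smult_closed[OF md, of c f] by (simp add: at)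
      qed auto
      from module.span_is_subset[OF md _ this, of Y] have a: "f x = \<zero>" if "f \<in> carrier ?D" for f
        using Y n x that by blast
      let ?f = "\<lambda>y\<in>X. if y = x then s else \<zero>"
      have "{y \<in> X. ?f y \<noteq> \<zero>} \<subseteq> {x}" by auto
      then have "finite {y \<in> X. ?f y \<noteq> \<zero>}" by (rule finite_subset) simp
      then have "?f \<in> carrier ?D" using s by (simp add: direct_power_def)
      from a[OF this] show False using s x by simp
    qed
  qed
  moreover have "finite (\<Union>f\<in>Y. {x \<in> X. f x \<noteq> \<zero>})" using Y by (auto simp: direct_power_def)
  ultimately show ?thesis by (rule finite_subset)
qed

lemma (in hilbert_space) opnorm_bound:
  assumes T: "T \<in> bounded_ops H H" and v: "v \<in> carrier H"
  shows "hnorm H (T v) \<le> opnorm H T * hnorm H v"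
proof (cases "hnorm H v = 0")
  case True
  obtain C where "\<And>v. v \<in> carrier H \<Longrightarrow> hnorm H (T v) \<le> C * hnorm H v" using bounded_opsD(2)[OF T] by blast
  from this[OF v] show ?thesis using True by simp
next
  case False
  then have pos: "hnorm H v > 0" using hnorm_nonneg[OF v] by simp
  note Tl = linear_mapsD[OF bounded_opsD(1)[OF T]]
  obtain C where C: "\<And>v. v \<in> carrier H \<Longrightarrow> hnorm H (T v) \<le> C * hnorm H v" using bounded_opsD(2)[OF T] by blast
  let ?c = "complex_of_real (1 / hnorm H v)" and ?X = "{v \<in> carrier H. hnorm H v \<le> 1}"
  have bd: "bdd_above ((\<lambda>v. hnorm H (T v)) ` ?X)"
  proof (rule bdd_aboveI2)
    fix u assume u: "u \<in> ?X"
    then have "hnorm H (T u) \<le> C * hnorm H u" using C by simp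
    also have "\<dots> \<le> \<bar>C\<bar> * 1" using u hnorm_nonneg[of u] by (intro mult_mono) auto
    finally show "hnorm H (T u) \<le> \<bar>C\<bar>" by simp
  qed
  have "hnorm H (?c \<odot>\<^bsub>H\<^esub> v) = 1" using pos v by (simp add: hnorm_smult norm_divide)
  then have "?c \<odot>\<^bsub>H\<^esub> v \<in> ?X" using v by simp
  from cSUP_upper[OF this bd] have "hnorm H (T (?c \<odot>\<^bsub>H\<^esub> v)) \<le> opnorm H T" by (simp add: opnorm_def)
  moreover have "hnorm H (T (?c \<odot>\<^bsub>H\<^esub> v)) = 1 / hnorm H v * hnorm H (T v)"
    using pos v Tl(1)[OF v] by (simp add: Tl(3)[OF v] hnorm_smult norm_divide)
  ultimately have "1 / hnorm H v * hnorm H (T v) \<le> opnorm H T" by simp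
  then show ?thesis using pos by (simp add: field_simps)
qed

section \<open>The spectral triple\<close>

locale toric_multiplier = toric_system m \<Theta> A U \<tau> M z \<phi> L \<Lambda> H tens \<pi> I S B \<mu> K J
  for m :: "nat \<Rightarrow> nat" and \<Theta> :: "nat \<Rightarrow> real mat"
    and A :: "nat \<Rightarrow> 'a cstar" and U :: "nat \<Rightarrow> nat \<Rightarrow> 'a" and \<tau> :: "nat \<Rightarrow> 'a \<Rightarrow> complex"
    and M :: "nat \<Rightarrow> int mat" and z :: "nat \<Rightarrow> complex Matrix.vec" and \<phi> :: "nat \<Rightarrow> 'a \<Rightarrow> 'a"
    and L :: "nat \<Rightarrow> 'l hilbert" and \<Lambda> :: "nat \<Rightarrow> 'a \<Rightarrow> 'l"
    and H :: "nat \<Rightarrow> 'h hilbert" and tens :: "nat \<Rightarrow> 'l \<Rightarrow> 's \<Rightarrow> 'h"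
    and \<pi> :: "nat \<Rightarrow> 'a \<Rightarrow> 'h \<Rightarrow> 'h" and I :: "nat \<Rightarrow> 'h \<Rightarrow> 'h" and S :: "'s hilbert"
    and B :: "'b cstar" and \<mu> :: "nat \<Rightarrow> 'a \<Rightarrow> 'b"
    and K :: "'k hilbert" and J :: "nat \<Rightarrow> 'h \<Rightarrow> 'k" +
  fixes F :: "nat \<Rightarrow> int Matrix.vec \<Rightarrow> 's \<Rightarrow> 's" and Finf :: "(nat \<times> int Matrix.vec) set \<Rightarrow> 's \<Rightarrow> 's"
    and X :: "'s set"
  assumes onb: "hilbert_space.onb S X"
    and F_sa: "x \<in> carrier_vec (m n) \<Longrightarrow> F n x \<in> End_sa S"
    and Finf: "is_limit_multiplier m M F S Finf"
begin

sublocale lat: lattice_system m M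
  using toric by unfold_locales (simp add: monomial_toric_hom_def)

lemma Finf_sa: "g \<in> lat.Lim \<Longrightarrow> Finf g \<in> End_sa S"
  and Finf_cls: "x \<in> carrier_vec (m n) \<Longrightarrow> Finf (lat.cls n x) = F n x"
  using Finf by (auto simp: is_limit_multiplier_def)

text \<open>One phase must serve all \<open>\<xi>\<close>: only then do the two embeddings of S
  differ by a scalar that commutes with the endomorphisms \<open>F n x\<close>.\<close>

definition same_phase :: "('s \<Rightarrow> 'k) \<Rightarrow> ('s \<Rightarrow> 'k) \<Rightarrow> bool" where
  "same_phase u v \<longleftrightarrow> (\<exists>c. cmod c = 1 \<and> (\<forall>\<xi>\<in>carrier S. v \<xi> \<in> carrier K \<and> u \<xi> = c \<odot>\<^bsub>K\<^esub> v \<xi>))"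

lemma same_phase_refl: "(\<And>\<xi>. \<xi> \<in> carrier S \<Longrightarrow> u \<xi> \<in> carrier K) \<Longrightarrow> same_phase u u"
  unfolding same_phase_def by (intro exI[of _ 1]) simp

lemma same_phase_trans: assumes "same_phase u v" "same_phase v w" shows "same_phase u w"
proof -
  obtain c where c: "cmod c = 1" "\<forall>\<xi>\<in>carrier S. v \<xi> \<in> carrier K \<and> u \<xi> = c \<odot>\<^bsub>K\<^esub> v \<xi>" using assms(1) unfolding same_phase_def by blast
  obtain d where d: "cmod d = 1" "\<forall>\<xi>\<in>carrier S. w \<xi> \<in> carrier K \<and> v \<xi> = d \<odot>\<^bsub>K\<^esub> w \<xi>" using assms(2) unfolding same_phase_def by blast
  show ?thesis unfolding same_phase_def using c d by (intro exI[of _ "c * d"]) (simp add: Real_Vector_Spaces.norm_mult)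
qed

lemma same_phase_sym: assumes "same_phase u v" shows "same_phase v u"
proof -
  obtain c where c: "cmod c = 1" "\<forall>\<xi>\<in>carrier S. v \<xi> \<in> carrier K \<and> u \<xi> = c \<odot>\<^bsub>K\<^esub> v \<xi>" using assms unfolding same_phase_def by blast
  have "c \<noteq> 0" using c(1) by auto
  then show ?thesis unfolding same_phase_def using c by (intro exI[of _ "inverse c"]) (simp add: norm_inverse)
qed

lemma J_\<delta>_step:
  assumes x: "x \<in> carrier_vec (m n)"
  shows "same_phase (\<lambda>\<xi>. J n (st.\<delta> n x \<xi>)) (\<lambda>\<xi>. J (Suc n) (st.\<delta> (Suc n) (M n *\<^sub>v x) \<xi>))"
proof -
  obtain c where c: "cmod c = 1" "\<phi> n (st.W n x) = c \<odot>\<^bsub>A (Suc n)\<^esub> st.W (Suc n) (M n *\<^sub>v x)"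
    using monomial_hom_W[OF toric st.torus_unitaries_axioms st.torus_unitaries_axioms x] unfolding ph_def by blast
  have "J n (st.\<delta> n x \<xi>) = c \<odot>\<^bsub>K\<^esub> J (Suc n) (st.\<delta> (Suc n) (M n *\<^sub>v x) \<xi>)" if \<xi>: "\<xi> \<in> carrier S" for \<xi>
  proof -
    have "I n (st.\<delta> n x \<xi>) = tens (Suc n) (\<Lambda> (Suc n) (\<phi> n (st.W n x))) \<xi>"
      unfolding st.\<delta>_def by (rule I_tens[OF st.W_closed \<xi>])
    also have "\<dots> = c \<odot>\<^bsub>H (Suc n)\<^esub> st.\<delta> (Suc n) (M n *\<^sub>v x) \<xi>"
      unfolding c(2) st.\<delta>_def by (simp add: linear_mapsD(3)[OF st.\<Lambda>_linear] linear_mapsD(3)[OF st.tens_linear_left[OF \<xi>]])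
    finally show ?thesis using J_I[of "st.\<delta> n x \<xi>" n] \<xi> by (simp add: linear_mapsD(3)[OF J_linear])
  qed
  then show ?thesis unfolding same_phase_def using c(1) by (intro exI[of _ c]) simp
qed

lemma J_\<delta>_push:
  assumes "n \<le> l" and x: "x \<in> carrier_vec (m n)"
  shows "same_phase (\<lambda>\<xi>. J n (st.\<delta> n x \<xi>)) (\<lambda>\<xi>. J l (st.\<delta> l (lat.push n l x) \<xi>))"
  using assms(1)
proof (induction l rule: dec_induct)
  case base show ?case by (simp add: same_phase_refl)
next
  case (step l)
  show ?case using same_phase_trans[OF step(3) J_\<delta>_step[OF lat.push_closed[OF step(1) x]]] step(1) by (simp add: lat.push_Suc)
qed

lemma J_\<delta>_cls:
  assumes "x \<in> carrier_vec (m n)" "y \<in> carrier_vec (m k)" "lat.cls n x = lat.cls k y"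
  shows "same_phase (\<lambda>\<xi>. J n (st.\<delta> n x \<xi>)) (\<lambda>\<xi>. J k (st.\<delta> k y \<xi>))"
proof -
  obtain l where l: "n \<le> l" "k \<le> l" "lat.push n l x = lat.push k l y" using assms lat.cls_eq_iff by blast
  show ?thesis
    using same_phase_trans[OF J_\<delta>_push[OF l(1) assms(1)] ] same_phase_sym[OF J_\<delta>_push[OF l(2) assms(2)]] l(3) by simp
qed

definition rep :: "(nat \<times> int Matrix.vec) set \<Rightarrow> nat \<times> int Matrix.vec" where
  "rep g = (SOME p. snd p \<in> carrier_vec (m (fst p)) \<and> g = lat.cls (fst p) (snd p))"

text \<open>Another choice of representatives changes \<open>e g\<close> by a phase only.\<close>

definition e :: "(nat \<times> int Matrix.vec) set \<Rightarrow> 's \<Rightarrow> 'k" where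
  "e g \<xi> = J (fst (rep g)) (st.\<delta> (fst (rep g)) (snd (rep g)) \<xi>)"

lemma rep: assumes "g \<in> lat.Lim" shows "snd (rep g) \<in> carrier_vec (m (fst (rep g)))" "lat.cls (fst (rep g)) (snd (rep g)) = g"
proof -
  obtain n x where "x \<in> carrier_vec (m n)" "g = lat.cls n x" using lat.Lim_cases[OF assms] .
  then have "snd (n, x) \<in> carrier_vec (m (fst (n, x))) \<and> g = lat.cls (fst (n, x)) (snd (n, x))" by simp
  from someI[of "\<lambda>p. snd p \<in> carrier_vec (m (fst p)) \<and> g = lat.cls (fst p) (snd p)", OF this]
  show "snd (rep g) \<in> carrier_vec (m (fst (rep g)))" "lat.cls (fst (rep g)) (snd (rep g)) = g"
    unfolding rep_def by simp_all
qed

lemma e_cls: assumes x: "x \<in> carrier_vec (m n)" shows "same_phase (e (lat.cls n x)) (\<lambda>\<xi>. J n (st.\<delta> n x \<xi>))"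
  using J_\<delta>_cls[OF rep(1) x rep(2)] lat.cls_in[OF x] by (simp add: e_def[abs_def])

lemma e_cls_obtain: assumes x: "x \<in> carrier_vec (m n)"
  obtains c where "cmod c = 1" "\<And>\<xi>. \<xi> \<in> carrier S \<Longrightarrow> e (lat.cls n x) \<xi> = c \<odot>\<^bsub>K\<^esub> J n (st.\<delta> n x \<xi>)"
  using e_cls[OF x] unfolding same_phase_def by blast

lemma block: "block_multiplier K S lat.Lim e X Finf"
proof (intro block_multiplier.intro block_space.intro block_space_axioms.intro block_multiplier_axioms.intro)
  show "hilbert_space K" by (rule K.hilbert_space_axioms)
  show "hilbert_space S" by (rule st.S.hilbert_space_axioms)
  show "hilbert_space.onb S X" by (rule onb)
  fix g assume g: "g \<in> lat.Lim"
  show "Finf g \<in> End_sa S" by (rule Finf_sa[OF g])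
  show "e g \<in> linear_maps S K"
    by (rule linear_mapsI) (simp_all add: e_def linear_mapsD[OF st.\<delta>_linear] linear_mapsD[OF J_linear])
  fix h s t assume h: "h \<in> lat.Lim" and s: "s \<in> carrier S" and t: "t \<in> carrier S"
  show "inner K (e g s) (e h t) = (if g = h then inner S s t else 0)"
  proof (cases "g = h")
    case True
    then show ?thesis using rep(1)[OF g] s t by (simp add: e_def J_inner st.\<delta>_inner)
  next
    case False
    \<comment> \<open>Distinct classes have distinct representatives at a common stage, and there
      orthogonality is that of the monomials under the trace.\<close>
    obtain n x y where n: "x \<in> carrier_vec (m n)" "y \<in> carrier_vec (m n)" "g = lat.cls n x" "h = lat.cls n y" using lat.Lim_cases2[OF g h] .
    obtain c where c: "\<And>\<xi>. \<xi> \<in> carrier S \<Longrightarrow> e g \<xi> = c \<odot>\<^bsub>K\<^esub> J n (st.\<delta> n x \<xi>)" using e_cls_obtain[OF n(1)] n(3) by metis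
    obtain d where d: "\<And>\<xi>. \<xi> \<in> carrier S \<Longrightarrow> e h \<xi> = d \<odot>\<^bsub>K\<^esub> J n (st.\<delta> n y \<xi>)" using e_cls_obtain[OF n(2)] n(4) by metis
    have "x \<noteq> y" using False n by blast
    then show ?thesis using False s t n(1,2) by (simp add: c d K.inner_smult K.inner_smult_left J_inner st.\<delta>_inner)
  qed
next
  fix v assume v: "v \<in> carrier K" and o: "\<And>g s. g \<in> lat.Lim \<Longrightarrow> s \<in> carrier S \<Longrightarrow> inner K (e g s) v = 0"
  \<comment> \<open>The seminorm vanishes on all standard vectors of all stages, hence on K, and in
    particular at v itself.\<close>
  let ?p = "\<lambda>u. cmod (inner K v u)"
  have p: "K.nrm.bseminorm ?p" by (rule K.bseminorm_inner[OF v])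
  have "?p (J n u) = 0" if u: "u \<in> carrier (H n)" for n u
  proof (rule st.\<delta>_seminorm_zero[OF _ _ u])
    show "st.H.nrm.bseminorm n (\<lambda>u. ?p (J n u))"
      by (rule bseminorm_compose[OF st.H.nrm.cnormed_axioms K.nrm.cnormed_axioms J_linear _ p, of n 1]) (simp add: J_norm)
    fix x :: "int Matrix.vec" and \<xi> assume x: "x \<in> carrier_vec (m n)" and \<xi>: "\<xi> \<in> carrier S"
    obtain c where c: "cmod c = 1" "J n (st.\<delta> n x \<xi>) = c \<odot>\<^bsub>K\<^esub> e (lat.cls n x) \<xi>"
      using same_phase_sym[OF e_cls[OF x]] \<xi> unfolding same_phase_def by blast
    have ec: "e (lat.cls n x) \<xi> \<in> carrier K" using \<xi> by (simp add: e_def)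
    have "inner K v (e (lat.cls n x) \<xi>) = 0"
      using o[OF lat.cls_in[OF x] \<xi>] K.inner_commute[OF v ec] by simp
    then show "?p (J n (st.\<delta> n x \<xi>)) = 0" unfolding c(2) using v ec by (simp add: K.inner_smult)
  qed
  then have "?p v = 0" using K.nrm.bseminorm_zero_closure[OF p, of "\<Union>n. J n ` carrier (H n)" v] J_dense v by auto
  then show "v = \<zero>\<^bsub>K\<^esub>" using K.inner_definite[OF v] by simp
qed

sublocale bm: block_multiplier K S lat.Lim e X Finf
  by (rule block)

section \<open>Identification of the limit Dirac operator\<close>

definition D :: "nat \<Rightarrow> ('h \<times> 'h) set" where
  "D n = multiplier_op (carrier_vec (m n)) (F n) S (H n) (\<lambda>x. tens n (\<Lambda> n (st.W n x)))"

lemma D_iff: "(v, w) \<in> D n \<longleftrightarrow> v \<in> carrier (H n) \<and> w \<in> carrier (H n) \<and> (\<forall>x\<in>carrier_vec (m n). \<exists>s\<in>carrier S.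
      (\<forall>\<xi>\<in>carrier S. inner (H n) (st.\<delta> n x \<xi>) v = inner S \<xi> s) \<and>
      (\<forall>\<xi>\<in>carrier S. inner (H n) (st.\<delta> n x \<xi>) w = inner S \<xi> (F n x s)))"
  by (auto simp: D_def multiplier_op_def st.\<delta>_def)

lemma F_linear: "x \<in> carrier_vec (m n) \<Longrightarrow> F n x \<in> linear_maps S S"
  by (rule End_saD(1)[OF F_sa])

lemma F_zero: "x \<in> carrier_vec (m n) \<Longrightarrow> F n x \<zero>\<^bsub>S\<^esub> = \<zero>\<^bsub>S\<^esub>"
  by (rule linear_maps_zero[OF st.S.nrm.cnormed_axioms st.S.nrm.cnormed_axioms F_linear])

lemma D_zero: "(\<zero>\<^bsub>H n\<^esub>, \<zero>\<^bsub>H n\<^esub>) \<in> D n"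
  unfolding D_iff by (auto intro!: bexI[of _ "\<zero>\<^bsub>S\<^esub>"] simp: F_zero)

lemma D_add: assumes "(v, w) \<in> D n" "(v', w') \<in> D n" shows "(v \<oplus>\<^bsub>H n\<^esub> v', w \<oplus>\<^bsub>H n\<^esub> w') \<in> D n"
  unfolding D_iff
proof (intro conjI ballI)
  have c: "v \<in> carrier (H n)" "w \<in> carrier (H n)" "v' \<in> carrier (H n)" "w' \<in> carrier (H n)" using assms by (auto simp: D_iff)
  then show "v \<oplus>\<^bsub>H n\<^esub> v' \<in> carrier (H n)" "w \<oplus>\<^bsub>H n\<^esub> w' \<in> carrier (H n)" by simp_all
  fix x :: "int Matrix.vec" assume x: "x \<in> carrier_vec (m n)"
  obtain s where s: "s \<in> carrier S" "\<forall>\<xi>\<in>carrier S. inner (H n) (st.\<delta> n x \<xi>) v = inner S \<xi> s"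
    "\<forall>\<xi>\<in>carrier S. inner (H n) (st.\<delta> n x \<xi>) w = inner S \<xi> (F n x s)" using assms(1) x unfolding D_iff by meson
  obtain s' where s': "s' \<in> carrier S" "\<forall>\<xi>\<in>carrier S. inner (H n) (st.\<delta> n x \<xi>) v' = inner S \<xi> s'"
    "\<forall>\<xi>\<in>carrier S. inner (H n) (st.\<delta> n x \<xi>) w' = inner S \<xi> (F n x s')" using assms(2) x unfolding D_iff by meson
  note Fx = linear_mapsD[OF F_linear[OF x]]
  show "\<exists>s\<in>carrier S. (\<forall>\<xi>\<in>carrier S. inner (H n) (st.\<delta> n x \<xi>) (v \<oplus>\<^bsub>H n\<^esub> v') = inner S \<xi> s) \<and>
      (\<forall>\<xi>\<in>carrier S. inner (H n) (st.\<delta> n x \<xi>) (w \<oplus>\<^bsub>H n\<^esub> w') = inner S \<xi> (F n x s))"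
    by (rule bexI[of _ "s \<oplus>\<^bsub>S\<^esub> s'"]) (use s s' c in \<open>simp_all add: st.H.inner_add st.S.inner_add Fx\<close>)
qed

lemma D_\<delta>: assumes x: "x \<in> carrier_vec (m n)" and s: "s \<in> carrier S" shows "(st.\<delta> n x s, st.\<delta> n x (F n x s)) \<in> D n"
  unfolding D_iff
proof (intro conjI ballI)
  note Fx = linear_mapsD[OF F_linear]
  show "st.\<delta> n x s \<in> carrier (H n)" "st.\<delta> n x (F n x s) \<in> carrier (H n)" using s Fx(1)[OF x] by simp_all
  fix y :: "int Matrix.vec" assume y: "y \<in> carrier_vec (m n)"
  show "\<exists>t\<in>carrier S. (\<forall>\<xi>\<in>carrier S. inner (H n) (st.\<delta> n y \<xi>) (st.\<delta> n x s) = inner S \<xi> t) \<and>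
      (\<forall>\<xi>\<in>carrier S. inner (H n) (st.\<delta> n y \<xi>) (st.\<delta> n x (F n x s)) = inner S \<xi> (F n y t))"
    by (rule bexI[of _ "if y = x then s else \<zero>\<^bsub>S\<^esub>"])
       (use x y s in \<open>simp_all add: st.\<delta>_inner Fx(1)[OF x] F_zero\<close>)
qed

definition core :: "nat \<Rightarrow> ('k \<times> 'k) set" where
  "core n = {(J n v, J n w) | v w. (v, w) \<in> D n}"

lemma core_add: assumes "(v, w) \<in> core n" "(v', w') \<in> core n" shows "(v \<oplus>\<^bsub>K\<^esub> v', w \<oplus>\<^bsub>K\<^esub> w') \<in> core n"
proof -
  obtain a b where ab: "(a, b) \<in> D n" "v = J n a" "w = J n b" using assms(1) unfolding core_def by blast
  obtain a' b' where ab': "(a', b') \<in> D n" "v' = J n a'" "w' = J n b'" using assms(2) unfolding core_def by blast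
  have c: "a \<in> carrier (H n)" "b \<in> carrier (H n)" "a' \<in> carrier (H n)" "b' \<in> carrier (H n)" using ab(1) ab'(1) by (auto simp: D_iff)
  show ?thesis unfolding core_def ab(2,3) ab'(2,3) using D_add[OF ab(1) ab'(1)] c
    by (simp flip: linear_mapsD(2)[OF J_linear]) blast
qed

lemma core_zero: "(\<zero>\<^bsub>K\<^esub>, \<zero>\<^bsub>K\<^esub>) \<in> core n"
  unfolding core_def using D_zero[of n] linear_maps_zero[OF st.H.nrm.cnormed_axioms K.nrm.cnormed_axioms J_linear, of n] by force

text \<open>The phase between \<open>e\<close> and the standard vector is absorbed into the vector
  of S, where it commutes with \<open>F n x\<close> by linearity.\<close>

lemma core_e: assumes x: "x \<in> carrier_vec (m n)" and s: "s \<in> carrier S"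
  shows "(e (lat.cls n x) s, e (lat.cls n x) (Finf (lat.cls n x) s)) \<in> core n"
proof -
  obtain c where c: "\<And>\<xi>. \<xi> \<in> carrier S \<Longrightarrow> e (lat.cls n x) \<xi> = c \<odot>\<^bsub>K\<^esub> J n (st.\<delta> n x \<xi>)" using e_cls_obtain[OF x] by metis
  note Fx = linear_mapsD[OF F_linear[OF x]]
  have "e (lat.cls n x) \<xi> = J n (st.\<delta> n x (c \<odot>\<^bsub>S\<^esub> \<xi>))" if "\<xi> \<in> carrier S" for \<xi>
    using c[OF that] that by (simp add: linear_mapsD(3)[OF J_linear] linear_mapsD(3)[OF st.\<delta>_linear])
  from this[OF s] this[OF Fx(1)[OF s]] show ?thesis
    using D_\<delta>[OF x, of "c \<odot>\<^bsub>S\<^esub> s"] s unfolding core_def by (auto simp: Finf_cls[OF x] Fx(3))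
qed

lemma comp_J:
  assumes x: "x \<in> carrier_vec (m n)" and c: "\<And>\<xi>. \<xi> \<in> carrier S \<Longrightarrow> e (lat.cls n x) \<xi> = c \<odot>\<^bsub>K\<^esub> J n (st.\<delta> n x \<xi>)"
    and v: "v \<in> carrier (H n)" and s: "s \<in> carrier S" "\<And>\<xi>. \<xi> \<in> carrier S \<Longrightarrow> inner (H n) (st.\<delta> n x \<xi>) v = inner S \<xi> s"
  shows "bm.comp (lat.cls n x) (J n v) = cnj c \<odot>\<^bsub>S\<^esub> s"
  by (rule bm.comp_unique[OF lat.cls_in[OF x]])
     (use v s in \<open>simp_all add: c K.inner_smult_left st.S.inner_smult J_inner\<close>)

text \<open>Blocks of classes without a representative at stage n are orthogonal to the whole image
  of \<open>H n\<close>.\<close>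

lemma comp_J_other:
  assumes g: "g \<in> lat.Lim" and ng: "\<And>x. x \<in> carrier_vec (m n) \<Longrightarrow> g \<noteq> lat.cls n x" and v: "v \<in> carrier (H n)"
  shows "bm.comp g (J n v) = \<zero>\<^bsub>S\<^esub>"
proof (rule bm.comp_unique[OF g J_closed[OF v]])
  fix s assume s: "s \<in> carrier S"
  let ?p = "\<lambda>u. cmod (inner K (e g s) u)"
  have p: "K.nrm.bseminorm ?p" by (rule K.bseminorm_inner[OF bm.e_closed[OF g s]])
  have "?p (J n v) = 0"
  proof (rule st.\<delta>_seminorm_zero[OF _ _ v])
    show "st.H.nrm.bseminorm n (\<lambda>u. ?p (J n u))"
      by (rule bseminorm_compose[OF st.H.nrm.cnormed_axioms K.nrm.cnormed_axioms J_linear _ p, of n 1]) (simp add: J_norm)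
    fix x :: "int Matrix.vec" and \<xi> assume x: "x \<in> carrier_vec (m n)" and \<xi>: "\<xi> \<in> carrier S"
    obtain c where c: "J n (st.\<delta> n x \<xi>) = c \<odot>\<^bsub>K\<^esub> e (lat.cls n x) \<xi>"
      using same_phase_sym[OF e_cls[OF x]] \<xi> unfolding same_phase_def by blast
    show "?p (J n (st.\<delta> n x \<xi>)) = 0" unfolding c
      using bm.e_inner[OF g lat.cls_in[OF x] s \<xi>] ng[OF x] bm.e_closed[OF g s] bm.e_closed[OF lat.cls_in[OF x] \<xi>] by (simp add: K.inner_smult)
  qed
  then show "inner K (e g s) (J n v) = inner S s \<zero>\<^bsub>S\<^esub>" using s by simp
qed simp

text \<open>At a class coming from stage n the components of both entries carry the same conjugated
  phase, which the linear map \<open>F n x\<close> lets through; at all other classes both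
  components are zero.\<close>

lemma core_mop: "core n \<subseteq> bm.mop"
proof (clarsimp simp: core_def)
  fix v w assume vw: "(v, w) \<in> D n"
  then have c: "v \<in> carrier (H n)" "w \<in> carrier (H n)" by (auto simp: D_iff)
  show "(J n v, J n w) \<in> bm.mop"
  proof (rule bm.mopI)
    fix g assume g: "g \<in> lat.Lim"
    show "bm.comp g (J n w) = Finf g (bm.comp g (J n v))"
    proof (cases "\<exists>x. x \<in> carrier_vec (m n) \<and> g = lat.cls n x")
      case True
      then obtain x where x: "x \<in> carrier_vec (m n)" "g = lat.cls n x" by blast
      obtain c' where c': "\<And>\<xi>. \<xi> \<in> carrier S \<Longrightarrow> e (lat.cls n x) \<xi> = c' \<odot>\<^bsub>K\<^esub> J n (st.\<delta> n x \<xi>)" using e_cls_obtain[OF x(1)] by metis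
      obtain s where s: "s \<in> carrier S" "\<forall>\<xi>\<in>carrier S. inner (H n) (st.\<delta> n x \<xi>) v = inner S \<xi> s"
        "\<forall>\<xi>\<in>carrier S. inner (H n) (st.\<delta> n x \<xi>) w = inner S \<xi> (F n x s)" using vw x(1) unfolding D_iff by meson
      note Fx = linear_mapsD[OF F_linear[OF x(1)]]
      have "bm.comp g (J n v) = cnj c' \<odot>\<^bsub>S\<^esub> s"
        unfolding x(2) by (rule comp_J[OF x(1) c' c(1) s(1)]) (use s(2) in simp_all)
      moreover have "bm.comp g (J n w) = cnj c' \<odot>\<^bsub>S\<^esub> F n x s"
        unfolding x(2) by (rule comp_J[OF x(1) c' c(2) Fx(1)[OF s(1)]]) (use s(3) in simp_all)
      ultimately show ?thesis using s(1) by (simp add: x(2) Finf_cls[OF x(1)] Fx(3))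
    next
      case False
      then have "\<And>x. x \<in> carrier_vec (m n) \<Longrightarrow> g \<noteq> lat.cls n x" by blast
      from comp_J_other[OF g this c(1)] comp_J_other[OF g this c(2)] show ?thesis using bm.F_zero[OF g] by simp
    qed
  qed (use c in simp_all)
qed

text \<open>All classes in Y have representatives at one stage n, the block vectors there lie in
  \<open>core n\<close>, and this set is closed under addition. The stage depends on Y, so the core
  is the union over all stages.\<close>

lemma proj_core:
  assumes vw: "(v, w) \<in> bm.mop" and Y: "finite Y" "Y \<subseteq> lat.Lim"
  obtains n where "(bm.proj Y v, bm.proj Y w) \<in> core n"
proof -
  obtain n f where f: "\<And>g. g \<in> Y \<Longrightarrow> f g \<in> carrier_vec (m n)" "\<And>g. g \<in> Y \<Longrightarrow> lat.cls n (f g) = g"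
    by (rule lat.common_stage[OF Y]) blast
  have "Z \<subseteq> Y \<longrightarrow> (bm.proj Z v, bm.proj Z w) \<in> core n" if "finite Z" for Z
    using that
  proof induction
    case empty show ?case using core_zero by (simp add: bm.proj_def bm.blk_def)
  next
    case (insert g Z)
    show ?case
    proof
      assume sub: "insert g Z \<subseteq> Y"
      then have g: "g \<in> Y" "g \<in> lat.Lim" "Z \<subseteq> lat.Lim" using Y by auto
      have ins: "bm.proj (insert g Z) u = e g (bm.comp g u) \<oplus>\<^bsub>K\<^esub> bm.proj Z u" for u
        unfolding bm.proj_def bm.blk_def using insert(1,2) g by (intro K.nrm.finsum_insert) auto
      have "(e g (bm.comp g v), e g (bm.comp g w)) \<in> core n"
        using core_e[OF f(1)[OF g(1)], of "bm.comp g v"] f(2)[OF g(1)] bm.mopD(3)[OF vw g(2)] by simp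
      then show "(bm.proj (insert g Z) v, bm.proj (insert g Z) w) \<in> core n"
        unfolding ins using insert.IH sub by (intro core_add) auto
    qed
  qed
  from this[OF Y(1)] show thesis using that by blast
qed

lemma inductive_dirac: "inductive_dirac D K J = bm.mop"
  unfolding inductive_dirac_def core_def[symmetric]
proof (rule bm.mop_core)
  show "(\<Union>n. core n) \<subseteq> bm.mop" using core_mop by blast
  show "(bm.proj Y v, bm.proj Y w) \<in> (\<Union>n. core n)" if "(v, w) \<in> bm.mop" "finite Y" "Y \<subseteq> lat.Lim" for v w Y
    by (rule proj_core[OF that]) (rule UN_I[OF UNIV_I])
qed

section \<open>Monomials as translations of blocks\<close>

lemma \<mu>_W_push:
  assumes "n \<le> l" and a: "a \<in> carrier_vec (m n)"
  shows "ph B (\<mu> n (st.W n a)) (\<mu> l (st.W l (lat.push n l a)))"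
  using assms(1)
proof (induction l rule: dec_induct)
  case base show ?case by simp
next
  case (step l)
  note p = lat.push_closed[OF step(1) a]
  have "ph (A (Suc l)) (\<phi> l (st.W l (lat.push n l a))) (st.W (Suc l) (M l *\<^sub>v lat.push n l a))"
    by (rule monomial_hom_W[OF toric st.torus_unitaries_axioms st.torus_unitaries_axioms p])
  from ph_star_hom[OF \<mu>_hom this]
  have "ph B (\<mu> l (st.W l (lat.push n l a))) (\<mu> (Suc l) (st.W (Suc l) (M l *\<^sub>v lat.push n l a)))"
    by (simp add: \<mu>_\<phi>)
  from B.ph_trans[OF step(3) this] show ?case using step(1) by (simp add: lat.push_Suc)
qed

text \<open>Both the monomial and the block are moved to a common stage. Four phases arise: from
  moving the monomial, from expressing \<open>e g\<close> at that stage, from multiplying monomials,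
  and from returning to the chosen representative of the sum.\<close>

lemma shift:
  assumes ind: "induced_representation A H \<pi> B \<mu> K J \<rho>'" and a: "a \<in> carrier_vec (m n)" and g: "g \<in> lat.Lim"
  shows "\<exists>c. cmod c = 1 \<and> (\<forall>s\<in>carrier S. \<rho>' (\<mu> n (st.W n a)) (e g s) = c \<odot>\<^bsub>K\<^esub> e (lat.ladd g (lat.cls n a)) s)"
proof -
  have rep: "unital_representation B K \<rho>'" and comp: "\<And>n a v. a \<in> carrier (A n) \<Longrightarrow> v \<in> carrier (H n) \<Longrightarrow> \<rho>' (\<mu> n a) (J n v) = J n (\<pi> n a v)"
    using ind by (simp_all add: induced_representation_def)
  note R = unital_representationD[OF rep]
  obtain k x where x: "x \<in> carrier_vec (m k)" "g = lat.cls k x" using lat.Lim_cases[OF g] .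
  let ?l = "max n k" let ?y = "lat.push k ?l x" and ?b = "lat.push n ?l a"
  have y: "?y \<in> carrier_vec (m ?l)" "lat.cls ?l ?y = g" using lat.push_closed[of k ?l x] lat.cls_push[of k ?l x] x by simp_all
  have b: "?b \<in> carrier_vec (m ?l)" "lat.cls ?l ?b = lat.cls n a" using lat.push_closed[of n ?l a] lat.cls_push[of n ?l a] a by simp_all
  have sum: "lat.ladd g (lat.cls n a) = lat.cls ?l (?b + ?y)"
    using lat.ladd_cls[OF y(1) b(1)] comm_add_vec[OF y(1) b(1)] by (simp add: y(2) b(2))
  obtain c1 where c1: "cmod c1 = 1" "\<mu> n (st.W n a) = c1 \<odot>\<^bsub>B\<^esub> \<mu> ?l (st.W ?l ?b)" using \<mu>_W_push[of n ?l a] a unfolding ph_def by auto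
  obtain c2 where c2: "cmod c2 = 1" "\<And>s. s \<in> carrier S \<Longrightarrow> e g s = c2 \<odot>\<^bsub>K\<^esub> J ?l (st.\<delta> ?l ?y s)" using e_cls_obtain[OF y(1)] y(2) by metis
  obtain c3 where c3: "cmod c3 = 1" "st.W ?l ?b \<otimes>\<^bsub>A ?l\<^esub> st.W ?l ?y = c3 \<odot>\<^bsub>A ?l\<^esub> st.W ?l (?b + ?y)"
    using st.W_mult[OF b(1) y(1)] unfolding ph_def by blast
  obtain c4 where c4: "cmod c4 = 1" "\<forall>s\<in>carrier S. J ?l (st.\<delta> ?l (?b + ?y) s) = c4 \<odot>\<^bsub>K\<^esub> e (lat.cls ?l (?b + ?y)) s"
    using same_phase_sym[OF e_cls[of "?b + ?y" ?l]] b(1) y(1) unfolding same_phase_def by auto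
  show ?thesis
  proof (intro exI[of _ "c1 * c2 * c3 * c4"] conjI ballI)
    show "cmod (c1 * c2 * c3 * c4) = 1" using c1 c2 c3 c4 by (simp add: Real_Vector_Spaces.norm_mult)
    fix s assume s: "s \<in> carrier S"
    have e: "e (lat.cls ?l (?b + ?y)) s \<in> carrier K" by (rule bm.e_closed[OF lat.cls_in s]) (use b(1) y(1) in simp)
    have "\<rho>' (\<mu> ?l (st.W ?l ?b)) (J ?l (st.\<delta> ?l ?y s)) = J ?l (tens ?l (\<Lambda> ?l (st.W ?l ?b \<otimes>\<^bsub>A ?l\<^esub> st.W ?l ?y)) s)"
      using s comp[OF st.W_closed st.\<delta>_closed[OF s]] by (simp add: st.\<delta>_def st.\<pi>_tens)
    also have "\<dots> = c3 \<odot>\<^bsub>K\<^esub> J ?l (st.\<delta> ?l (?b + ?y) s)"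
      unfolding c3(2) st.\<delta>_def using s
      by (simp add: linear_mapsD(3)[OF st.\<Lambda>_linear] linear_mapsD(3)[OF st.tens_linear_left[OF s]] linear_mapsD(3)[OF J_linear])
    also have "\<dots> = (c3 * c4) \<odot>\<^bsub>K\<^esub> e (lat.cls ?l (?b + ?y)) s" using c4(2) s e by simp
    finally have 1: "\<rho>' (\<mu> ?l (st.W ?l ?b)) (J ?l (st.\<delta> ?l ?y s)) = (c3 * c4) \<odot>\<^bsub>K\<^esub> e (lat.cls ?l (?b + ?y)) s" .
    have "\<rho>' (\<mu> n (st.W n a)) (e g s) = c1 \<odot>\<^bsub>K\<^esub> \<rho>' (\<mu> ?l (st.W ?l ?b)) (e g s)"
      unfolding c1(2) by (rule R(5)) (use g s in simp_all)
    also have "\<rho>' (\<mu> ?l (st.W ?l ?b)) (e g s) = c2 \<odot>\<^bsub>K\<^esub> \<rho>' (\<mu> ?l (st.W ?l ?b)) (J ?l (st.\<delta> ?l ?y s))"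
      unfolding c2(2)[OF s] using s by (intro linear_mapsD(3)[OF bounded_opsD(1)[OF R(1)]]) simp_all
    finally show "\<rho>' (\<mu> n (st.W n a)) (e g s) = (c1 * c2 * c3 * c4) \<odot>\<^bsub>K\<^esub> e (lat.ladd g (lat.cls n a)) s"
      unfolding 1 sum using e by (simp add: mult.assoc)
  qed
qed

text \<open>The premises \<open>low\<close> and \<open>diff\<close> are the conditions (a) and (b)
  in working form: finiteness of index sets in place of dimensions, and estimates on vectors in
  place of operator norms.\<close>

lemma spectral_triple:
  assumes ind: "induced_representation A H \<pi> B \<mu> K J \<rho>'"
    and low: "\<And>r. r > 0 \<Longrightarrow> finite (low_spectrum_set Finf S lat.Lim r)"
    and diff: "\<And>h. h \<in> lat.Lim \<Longrightarrow>
      \<exists>C. \<forall>g\<in>lat.Lim. \<forall>s\<in>carrier S. hnorm S (Finf (lat.ladd g h) s \<ominus>\<^bsub>S\<^esub> Finf g s) \<le> C * hnorm S s"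
  shows "spectral_triple B K \<rho>' (inductive_dirac D K J)"
proof -
  have rep: "unital_representation B K \<rho>'" using ind by (simp add: induced_representation_def)
  have "ctop B closure_of smooth_part B K \<rho>' bm.mop = carrier B"
  proof (rule smooth_dense[OF ind bm.mop_single_valued bm.mop_domain_dense])
    show "bm.mop \<subseteq> carrier K \<times> carrier K" by (auto simp: bm.mop_def)
    show "(v \<oplus>\<^bsub>K\<^esub> v', w \<oplus>\<^bsub>K\<^esub> w') \<in> bm.mop" if "(v, w) \<in> bm.mop" "(v', w') \<in> bm.mop" for v w v' w'
      by (rule bm.mopI) (use that bm.mopD[OF that(1)] bm.mopD[OF that(2)] in
        \<open>simp_all add: linear_mapsD(2)[OF bm.comp_linear] linear_mapsD(2)[OF bm.F_linear]\<close>)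
    show sm: "(c \<odot>\<^bsub>K\<^esub> v, c \<odot>\<^bsub>K\<^esub> w) \<in> bm.mop" if "(v, w) \<in> bm.mop" for v w c
      by (rule bm.mopI) (use that bm.mopD[OF that] in
        \<open>simp_all add: linear_mapsD(3)[OF bm.comp_linear] linear_mapsD(3)[OF bm.F_linear]\<close>)
    show "(\<zero>\<^bsub>K\<^esub>, \<zero>\<^bsub>K\<^esub>) \<in> bm.mop" using core_zero core_mop by blast
    fix n and x :: "int Matrix.vec" assume x: "x \<in> carrier_vec (m n)"
    let ?h = "lat.cls n x"
    have h: "?h \<in> lat.Lim" by (rule lat.cls_in[OF x])
    have "\<forall>g\<in>lat.Lim. \<exists>c. cmod c = 1 \<and> (\<forall>s\<in>carrier S. \<rho>' (\<mu> n (st.W n x)) (e g s) = c \<odot>\<^bsub>K\<^esub> e (lat.ladd g ?h) s)"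
      using shift[OF ind x] by blast
    then obtain c where c: "\<forall>g\<in>lat.Lim. cmod (c g) = 1 \<and> (\<forall>s\<in>carrier S. \<rho>' (\<mu> n (st.W n x)) (e g s) = c g \<odot>\<^bsub>K\<^esub> e (lat.ladd g ?h) s)"
      by (rule bchoice[THEN exE])
    obtain C where C: "\<forall>g\<in>lat.Lim. \<forall>s\<in>carrier S. hnorm S (Finf (lat.ladd g ?h) s \<ominus>\<^bsub>S\<^esub> Finf g s) \<le> C * hnorm S s"
      using diff[OF h] by blast
    show "\<exists>Q\<in>bounded_ops K K. \<forall>(v, w)\<in>bm.mop. (\<rho>' (\<mu> n (st.W n x)) v, Q v \<oplus>\<^bsub>K\<^esub> \<rho>' (\<mu> n (st.W n x)) w) \<in> bm.mop"
    proof (rule bm.shift_commutator[where \<sigma> = "\<lambda>g. lat.ladd g ?h" and c = c and C = C])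
      show "\<rho>' (\<mu> n (st.W n x)) \<in> bounded_ops K K" by (rule unital_representationD(1)[OF rep]) simp
      show "inj_on (\<lambda>g. lat.ladd g ?h) lat.Lim" by (rule lat.ladd_inj[OF h])
      show "(\<lambda>g. lat.ladd g ?h) ` lat.Lim \<subseteq> lat.Lim" using lat.ladd_closed[OF _ h] by blast
    qed (use c C in blast)+
  qed
  then show ?thesis
    unfolding spectral_triple_def inductive_dirac
    using B.unital_cstar_algebra_axioms K.hilbert_space_axioms rep induced_faithful[OF ind] bm.mop_selfadjoint
      bm.mop_compact_resolvent[OF low] by blast
qed

end

text \<open>The limits are given by arbitrary models, so the existence of an induced representation
  is asserted along with the property of each one. With \<open>S0\<close> the zero space,
  \<open>Hpro\<close> would be zero and could not carry a faithful representation.\<close>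

theorem corollary4p8:
  fixes m :: "nat \<Rightarrow> nat" and \<Theta> :: "nat \<Rightarrow> real mat"
    and A :: "nat \<Rightarrow> 'a cstar" and U :: "nat \<Rightarrow> nat \<Rightarrow> 'a" and \<tau> :: "nat \<Rightarrow> 'a \<Rightarrow> complex"
    and M :: "nat \<Rightarrow> int mat" and z :: "nat \<Rightarrow> complex Matrix.vec" and \<phi> :: "nat \<Rightarrow> 'a \<Rightarrow> 'a"
    and F :: "nat \<Rightarrow> int Matrix.vec \<Rightarrow> 's \<Rightarrow> 's" and S :: "nat \<Rightarrow> 's hilbert" and J :: "nat \<Rightarrow> 's \<Rightarrow> 's"
    and L :: "nat \<Rightarrow> 'l hilbert" and \<Lambda> :: "nat \<Rightarrow> 'a \<Rightarrow> 'l"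
    and H :: "nat \<Rightarrow> 'h hilbert" and tens :: "nat \<Rightarrow> 'l \<Rightarrow> 's \<Rightarrow> 'h"
    and \<pi> :: "nat \<Rightarrow> 'a \<Rightarrow> 'h \<Rightarrow> 'h" and D :: "nat \<Rightarrow> ('h \<times> 'h) set"
    and I :: "nat \<Rightarrow> 'h \<Rightarrow> 'h" and S0 :: "'s hilbert"
    and Apro :: "'b cstar" and \<mu> :: "nat \<Rightarrow> 'a \<Rightarrow> 'b"
    and Hpro :: "'k hilbert" and Iinf :: "nat \<Rightarrow> 'h \<Rightarrow> 'k"
  assumes dim: "\<And>n. m n \<ge> 2"
    and skew: "\<And>n. skew_symmetric (m n) (\<Theta> n)"
    and nondeg: "\<And>n. nondegenerate (m n) (\<Theta> n)"
    and torus: "\<And>n. nc_torus (m n) (\<Theta> n) (A n) (U n)"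
    and trace: "\<And>n. tracial_state (A n) (\<tau> n)"
    and toric: "\<And>n. monomial_toric_hom (m n) (\<Theta> n) (A n) (U n)
        (m (Suc n)) (\<Theta> (Suc n)) (A (Suc n)) (U (Suc n)) (M n) (z n) (\<phi> n)"
    and mult: "compatible_multipliers m M F S J"
    and gns: "\<And>n. gns_space (A n) (\<tau> n) (L n) (\<Lambda> n)"
    and tensor: "\<And>n. hilbert_tensor (L n) (S n) (H n) (tens n)"
    and left_mult: "\<And>n a. a \<in> carrier (A n) \<Longrightarrow> \<pi> n a \<in> bounded_ops (H n) (H n) \<and>
        (\<forall>b\<in>carrier (A n). \<forall>\<xi>\<in>carrier (S n).
          \<pi> n a (tens n (\<Lambda> n b) \<xi>) = tens n (\<Lambda> n (a \<otimes>\<^bsub>A n\<^esub> b)) \<xi>)"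
    and D_def: "\<And>n. D n = multiplier_op (carrier_vec (m n)) (F n) (S n) (H n)
        (\<lambda>x. tens n (\<Lambda> n (monomial (A n) (m n) (U n) x)))"
    and connecting: "\<And>n. I n \<in> bounded_ops (H n) (H (Suc n)) \<and>
        (\<forall>a\<in>carrier (A n). \<forall>\<xi>\<in>carrier (S n).
          I n (tens n (\<Lambda> n a) \<xi>) = tens (Suc n) (\<Lambda> (Suc n) (\<phi> n a)) (J n \<xi>))"
    and smooth: "\<And>n. \<phi> n ` smooth_part (A n) (H n) (\<pi> n) (D n)
        \<subseteq> smooth_part (A (Suc n)) (H (Suc n)) (\<pi> (Suc n)) (D (Suc n))"
    and S_const: "\<And>n. S n = S0"
    and J_id: "\<And>n \<xi>. \<xi> \<in> carrier S0 \<Longrightarrow> J n \<xi> = \<xi>"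
  shows "(\<exists>!Finf. is_limit_multiplier m M F S0 Finf) \<and>
    (\<forall>Finf.
      carrier S0 \<noteq> {\<zero>\<^bsub>S0\<^esub>} \<and>
      is_limit_multiplier m M F S0 Finf \<and>
      (\<forall>R>0. vectorspace.fin_dim class_ring
        (direct_power (low_spectrum_set Finf S0 (lattice_limit m M) R) S0)) \<and>
      (\<forall>h\<in>lattice_limit m M. bdd_above
        ((\<lambda>g. opnorm S0 (\<lambda>v. Finf (lattice_add m M g h) v \<ominus>\<^bsub>S0\<^esub> Finf g v)) ` lattice_limit m M)) \<and>
      cstar_inductive_limit A \<phi> Apro \<mu> \<and> hilbert_inductive_limit H I Hpro Iinf
      \<longrightarrow>
      (\<exists>\<rho>. induced_representation A H \<pi> Apro \<mu> Hpro Iinf \<rho>) \<and>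
      (\<forall>\<rho>. induced_representation A H \<pi> Apro \<mu> Hpro Iinf \<rho> \<longrightarrow>
        spectral_triple Apro Hpro \<rho> (inductive_dirac D Hpro Iinf)))"
proof -
  have M: "M n \<in> carrier_mat (m (Suc n)) (m n)" for n using toric[of n] by (simp add: monomial_toric_hom_def)
  interpret lat: lattice_system m M by unfold_locales (rule M)
  have S: "hilbert_space S0" and fd: "vectorspace.fin_dim class_ring S0"
    using mult S_const unfolding compatible_multipliers_def by metis+
  interpret S: hilbert_space S0 by (rule S)
  have F_sa: "F n x \<in> End_sa S0" if "x \<in> carrier_vec (m n)" for n x
    using mult that S_const unfolding compatible_multipliers_def by metis
  have F_M: "F (Suc n) (M n *\<^sub>v x) = F n x" if x: "x \<in> carrier_vec (m n)" for n x
  \<comment> \<open>The compatibility condition gives equality on the carrier of \<open>S0\<close>;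
    elements of \<open>End_sa\<close> are extensional, which turns it into equality of
    functions.\<close>
  proof (rule extensionalityI)
    show "F (Suc n) (M n *\<^sub>v x) \<in> extensional (carrier S0)"
      by (rule End_saD(4)[OF F_sa[OF mult_mat_vec_carrier[OF M x]]])
    show "F n x \<in> extensional (carrier S0)" by (rule End_saD(4)[OF F_sa[OF x]])
    fix v assume v: "v \<in> carrier S0"
    have "F (Suc n) (M n *\<^sub>v x) (J n v) = J n (F n x v)"
      using mult x v S_const unfolding compatible_multipliers_def by metis
    then show "F (Suc n) (M n *\<^sub>v x) v = F n x v"
      using J_id v End_saD(3)[OF F_sa[OF x] v] by simp
  qed
  have triple: "(\<exists>\<rho>. induced_representation A H \<pi> Apro \<mu> Hpro Iinf \<rho>) \<and>
      (\<forall>\<rho>. induced_representation A H \<pi> Apro \<mu> Hpro Iinf \<rho> \<longrightarrow>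
        spectral_triple Apro Hpro \<rho> (inductive_dirac D Hpro Iinf))"
    if nz: "carrier S0 \<noteq> {\<zero>\<^bsub>S0\<^esub>}" and Finf: "is_limit_multiplier m M F S0 Finf"
      and low: "\<forall>R>0. vectorspace.fin_dim class_ring (direct_power (low_spectrum_set Finf S0 (lattice_limit m M) R) S0)"
      and diff: "\<forall>h\<in>lattice_limit m M. bdd_above
        ((\<lambda>g. opnorm S0 (\<lambda>v. Finf (lattice_add m M g h) v \<ominus>\<^bsub>S0\<^esub> Finf g v)) ` lattice_limit m M)"
      and cl: "cstar_inductive_limit A \<phi> Apro \<mu>" and hl: "hilbert_inductive_limit H I Hpro Iinf" for Finf
  proof -
    obtain X where X: "S.onb X" using S.onb_exists[OF fd] .
    have stage: "torus_stage (A n) (m n) (\<Theta> n) (U n) (\<tau> n) (L n) S0 (H n) (\<Lambda> n) (tens n) (\<pi> n)" for n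
    proof -
      have t: "unital_cstar_algebra (A n)" "torus_relations (m n) (\<Theta> n) (A n) (U n)" "generated_by (A n) (U n ` {..<m n})"
        using torus[of n] by (simp_all add: nc_torus_def)
      have h: "hilbert_space (L n)" "hilbert_space (H n)" using tensor[of n] by (simp_all add: hilbert_tensor_def)
      show ?thesis
      proof (intro torus_stage.intro torus_algebra.intro torus_unitaries.intro ucstar.intro
          torus_unitaries_axioms.intro torus_algebra_axioms.intro torus_stage_axioms.intro)
        show "\<Theta> n \<in> carrier_mat (m n) (m n)" using skew[of n] by (simp add: skew_symmetric_def)
        show "hilbert_tensor (L n) S0 (H n) (tens n)" using tensor[of n] by (simp add: S_const)
        show "\<pi> n a \<in> bounded_ops (H n) (H n)" if "a \<in> carrier (A n)" for a using left_mult[OF that] by simp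
        show "\<pi> n a (tens n (\<Lambda> n b) \<xi>) = tens n (\<Lambda> n (a \<otimes>\<^bsub>A n\<^esub> b)) \<xi>"
          if "a \<in> carrier (A n)" "b \<in> carrier (A n)" "\<xi> \<in> carrier S0" for a b \<xi>
          using left_mult[OF that(1)] that(2,3) by (simp add: S_const)
      qed (use t h S nz trace[of n] nondeg[of n] gns[of n] in simp_all)
    qed
    interpret tm: toric_multiplier m \<Theta> A U \<tau> M z \<phi> L \<Lambda> H tens \<pi> I S0 Apro \<mu> Hpro Iinf F Finf X
    proof (intro toric_multiplier.intro toric_system.intro toric_multiplier_axioms.intro)
      show "I n \<in> bounded_ops (H n) (H (Suc n))" for n using connecting[of n] by simp
      show "I n (tens n (\<Lambda> n a) \<xi>) = tens (Suc n) (\<Lambda> (Suc n) (\<phi> n a)) \<xi>"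
        if "a \<in> carrier (A n)" "\<xi> \<in> carrier S0" for n a \<xi>
        using connecting[of n] that by (simp add: S_const J_id)
    qed (fact stage toric cl hl X F_sa Finf)+
    have D: "tm.D = D" by (rule ext) (simp add: tm.D_def D_def S_const)
    have "spectral_triple Apro Hpro \<rho> (inductive_dirac D Hpro Iinf)"
      if ind: "induced_representation A H \<pi> Apro \<mu> Hpro Iinf \<rho>" for \<rho>
      unfolding D[symmetric]
    proof (rule tm.spectral_triple[OF ind])
      show "finite (low_spectrum_set Finf S0 lat.Lim r)" if "r > 0" for r
        by (rule S.direct_power_finite[OF _ nz]) (use low that in simp)
      fix h assume h: "h \<in> lat.Lim"
      let ?T = "\<lambda>g v. Finf (lat.ladd g h) v \<ominus>\<^bsub>S0\<^esub> Finf g v"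
      obtain C where C: "\<And>g. g \<in> lat.Lim \<Longrightarrow> opnorm S0 (?T g) \<le> C"
        using diff h unfolding bdd_above_def by blast
      have "hnorm S0 (?T g s) \<le> C * hnorm S0 s" if g: "g \<in> lat.Lim" and s: "s \<in> carrier S0" for g s
      proof -
        have "?T g \<in> linear_maps S0 S0"
          by (rule linear_maps_diff[OF S.nrm.cnormed_axioms]) (intro End_saD(1) tm.Finf_sa lat.ladd_closed g h)+
        \<comment> \<open>Boundedness, automatic in finite dimension, makes the supremum defining
          \<open>opnorm\<close> a genuine bound.\<close>
        then have "?T g \<in> bounded_ops S0 S0" by (rule linear_bounded_fin_dim[OF S S X])
        from S.opnorm_bound[OF this s] show ?thesis
          using mult_right_mono[OF C[OF g] S.hnorm_nonneg[OF s]] by simp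
      qed
      then show "\<exists>C. \<forall>g\<in>lat.Lim. \<forall>s\<in>carrier S0. hnorm S0 (?T g s) \<le> C * hnorm S0 s" by blast
    qed
    then show ?thesis using tm.\<rho>_induced by blast
  qed
  have "\<exists>!Finf. is_limit_multiplier m M F S0 Finf"
    by (rule lat.limit_multiplier_exists) (fact F_sa F_M)+
  then show ?thesis
    by - (rule conjI, assumption, intro allI impI, elim conjE, rule triple)
qed

end
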